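(* Let $\Omega\subseteq\mathbb{R}^2$ be an open, bounded, connected polygonal Lipschitz domain, $f\in L^2(\Omega)$ and $0<\varepsilon\le 1$. Let $\mathcal{T}$ be a regular triangulation of $\Omega$ from a shape-regular family. Let $u\in H^2_0(\Omega)$ be the solution of $$\varepsilon^2\int_\Omega D^2u:D^2v\,dx+\int_\Omega\nabla u\cdot\nabla v\,dx=\int_\Omega f v\,dx\qquad\text{for all }v\in H^2_0(\Omega),$$ and let $u_h\in\mathcal{M}_0(\mathcal{T})$ be the solution of the modified Morley discretization $$\varepsilon^2\int_\Omega D^2_{\mathrm{pw}}u_h:D^2_{\mathrm{pw}}v_h\,dx+\int_\Omega\nabla I_hu_h\cdot\nabla I_hv_h\,dx=\int_\Omega f\,I_hv_h\,dx\qquad\text{for all }v_h\in\mathcal{M}_0(\mathcal{T}).$$ Then there is a constant $C>0$, independent of the mesh size and of $\varepsilon$, such that for every $T\in\mathcal{T}$ the local error estimator $\eta(T)$ defined in the context satisfies $$\eta^2(T)\le C\Big(|\!|\!|u-u_h|\!|\!|_{\varepsilon,\mathrm{pw},\omega_T}^2+\|\nabla(u-I_hu_h)\|_{L^2(\omega_T)}^2+\operatorname{osc}_\varepsilon(f,\mathcal{T}(\omega_T))^2\Big).$$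
   Context: Mesh notation: $\mathcal{N}$ and $\mathcal{F}$ are the sets of vertices and faces (edges) of $\mathcal{T}$; $\mathcal{N}(\Omega)$, $\mathcal{F}(\Omega)$ are the interior ones; $\mathcal{F}(T)$ is the set of the three faces of $T\in\mathcal{T}$; $h_T=\operatorname{diam}(T)$ and $h_{\mathcal{T}}$ is the piecewise constant function with $h_{\mathcal{T}}|_T=h_T$. For an interior face $F=T_+\cap T_-$ (with a fixed choice of $T_\pm$) let $\nu_F$ be the unit normal on $F$ pointing out of $T_+$, $[v]_F:=v|_{T_+}-v|_{T_-}$ and $\omega_F:=T_+\cup T_-$; for a boundary face $F\subseteq T_+$, $[v]_F:=v|_{T_+}$ and $\omega_F:=T_+$. The element patch is $\omega_T:=\bigcup_{F\in\mathcal{F}(T)}\omega_F$, and $\mathcal{T}(\omega_T)$ is the set of triangles covering it. $\operatorname{mid}(F)$ is the midpoint of $F$. $D^2_{\mathrm{pw}},\nabla_{\mathrm{pw}}$ are the piecewise Hessian and gradient with respect to $\mathcal{T}$. $P_k(\mathcal{T})$ is the space of piecewise polynomials of degree at most $k$ and $\Pi_0$ the $L^2$ projection onto $P_0(\mathcal{T})$. Morley space: $\mathcal{M}(\mathcal{T})$ is the set of $v_h\in P_2(\mathcal{T})$ that are continuous at all vertices in $\mathcal{N}$ and satisfy $[\nabla v_h(\operatorname{mid}(F))]_F=0$ for all $F\in\mathcal{F}(\Omega)$. $\mathcal{M}_0(\mathcal{T})$ is the set of $v_h\in\mathcal{M}(\mathcal{T})$ with $v_h(z)=0$ for all boundary vertices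 $z$ and $\nabla v_h(\operatorname{mid}(F))=0$ for all boundary faces $F$. $I_h$ is the nodal interpolation operator (from $H^2(\Omega)\cup\mathcal{M}(\mathcal{T})$) onto continuous piecewise affine functions $P_1(\mathcal{T})\cap H^1(\Omega)$, i.e. $(I_hv)(z)=v(z)$ for all $z\in\mathcal{N}$. Local norm: $|\!|\!|v|\!|\!|_{\varepsilon,\mathrm{pw},\omega}^2:=\varepsilon^2\|D^2_{\mathrm{pw}}v\|_{L^2(\omega)}^2+\|\nabla_{\mathrm{pw}}v\|_{L^2(\omega)}^2$. Oscillations: $\operatorname{osc}_\varepsilon(f,\mathcal{T}(\omega_T)):=\|\min\{h_{\mathcal{T}},h_{\mathcal{T}}^2/\varepsilon\}(f-\Pi_0f)\|_{L^2(\omega_T)}$. Estimator: with $\kappa_T:=\min\{1,h_T/\varepsilon\}$, $$\mu_{\mathrm{NC}}^2(T):=\sum_{F\in\mathcal{F}(T)}\frac{\varepsilon}{\kappa_T}\|[\nabla_{\mathrm{pw}}u_h]_F\|_{L^2(F)}^2,\qquad \mu_{I_h}(T):=\|\nabla(u_h-I_hu_h)\|_{L^2(T)},\qquad \eta_f(T):=\|h_T\kappa_Tf\|_{L^2(T)},$$ $$\eta_1^2(T):=\sum_{F\in\mathcal{F}(T)\cap\mathcal{F}(\Omega)}\varepsilon^3\kappa_T\|[D^2_{\mathrm{pw}}u_h\,\nu_F]_F\|_{L^2(F)}^2,\qquad \eta_2^2(T):=\sum_{F\in\mathcal{F}(T)\cap\mathcal{F}(\Omega)}h_T\kappa_T^2\|[\nabla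 I_hu_h\cdot\nu_F]_F\|_{L^2(F)}^2,$$ $$\eta^2(T):=\mu_{\mathrm{NC}}^2(T)+\mu_{I_h}^2(T)+\eta_f^2(T)+\eta_1^2(T)+\eta_2^2(T).$$ The constant $C$ may depend on $\Omega$ and the shape-regularity of the family of triangulations. *)

theory Defs
  imports "HOL-Analysis.Analysis"
begin

section \<open>Lebesgue and Sobolev spaces\<close>

type_synonym point = "real^2"

definition square_integrable :: "point set \<Rightarrow> (point \<Rightarrow> 'b::euclidean_space) \<Rightarrow> bool" where
  "square_integrable A g \<longleftrightarrow>
     g \<in> borel_measurable (lebesgue_on A) \<and> integrable (lebesgue_on A) (\<lambda>x. (norm (g x))\<^sup>2)"

text \<open>For matrix-valued functions, the library's norm and inner product on
  \<^typ>\<open>real^2^2\<close> are the Frobenius norm and the Frobenius product $A:B$.\<close>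

definition L2_norm :: "point set \<Rightarrow> (point \<Rightarrow> 'b::euclidean_space) \<Rightarrow> real" where
  "L2_norm A g = sqrt (LINT x|lebesgue_on A. (norm (g x))\<^sup>2)"

definition pd :: "2 \<Rightarrow> (point \<Rightarrow> real) \<Rightarrow> point \<Rightarrow> real" where
  "pd i \<phi> x = frechet_derivative \<phi> (at x) (axis i 1)"

definition grad :: "(point \<Rightarrow> real) \<Rightarrow> point \<Rightarrow> real^2" where
  "grad \<phi> x = (\<chi> i. pd i \<phi> x)"

definition hess :: "(point \<Rightarrow> real) \<Rightarrow> point \<Rightarrow> real^2^2" where
  "hess \<phi> x = (\<chi> i j. pd j (pd i \<phi>) x)"

definition smooth :: "(point \<Rightarrow> real) \<Rightarrow> bool" where
  "smooth \<phi> \<longleftrightarrow> (\<forall>is x. foldr pd is \<phi> differentiable (at x))"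

definition test_functions :: "point set \<Rightarrow> (point \<Rightarrow> real) set" where
  "test_functions \<Omega> = {\<phi>. smooth \<phi> \<and> compact (closure {x. \<phi> x \<noteq> 0}) \<and> closure {x. \<phi> x \<noteq> 0} \<subseteq> \<Omega>}"

definition locally_integrable :: "point set \<Rightarrow> (point \<Rightarrow> real) \<Rightarrow> bool" where
  "locally_integrable \<Omega> g \<longleftrightarrow> (\<forall>K. compact K \<and> K \<subseteq> \<Omega> \<longrightarrow> integrable (lebesgue_on K) g)"

definition has_weak_pd :: "point set \<Rightarrow> (point \<Rightarrow> real) \<Rightarrow> 2 \<Rightarrow> (point \<Rightarrow> real) \<Rightarrow> bool" where
  "has_weak_pd \<Omega> v i g \<longleftrightarrow>
     locally_integrable \<Omega> v \<and> locally_integrable \<Omega> g \<and>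
     (\<forall>\<phi>\<in>test_functions \<Omega>.
        (LINT x|lebesgue_on \<Omega>. v x * pd i \<phi> x) = - (LINT x|lebesgue_on \<Omega>. g x * \<phi> x))"

definition has_weak_grad :: "point set \<Rightarrow> (point \<Rightarrow> real) \<Rightarrow> (point \<Rightarrow> real^2) \<Rightarrow> bool" where
  "has_weak_grad \<Omega> v G \<longleftrightarrow> (\<forall>i. has_weak_pd \<Omega> v i (\<lambda>x. G x $ i))"

definition has_weak_hess :: "point set \<Rightarrow> (point \<Rightarrow> real) \<Rightarrow> (point \<Rightarrow> real^2^2) \<Rightarrow> bool" where
  "has_weak_hess \<Omega> v H \<longleftrightarrow>
     (\<exists>G. has_weak_grad \<Omega> v G \<and> (\<forall>i j. has_weak_pd \<Omega> (\<lambda>x. G x $ i) j (\<lambda>x. H x $ i $ j)))"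

text \<open>Weak derivatives on an open set are unique up to null sets, so the choice of a
  representative below affects no integral.\<close>

definition weak_grad :: "point set \<Rightarrow> (point \<Rightarrow> real) \<Rightarrow> point \<Rightarrow> real^2" where
  "weak_grad \<Omega> v = (SOME G. has_weak_grad \<Omega> v G)"

definition weak_hess :: "point set \<Rightarrow> (point \<Rightarrow> real) \<Rightarrow> point \<Rightarrow> real^2^2" where
  "weak_hess \<Omega> v = (SOME H. has_weak_hess \<Omega> v H)"

definition H2 :: "point set \<Rightarrow> (point \<Rightarrow> real) set" where
  "H2 \<Omega> = {v. square_integrable \<Omega> v \<and>
     (\<exists>G. has_weak_grad \<Omega> v G \<and> square_integrable \<Omega> G) \<and>
     (\<exists>H. has_weak_hess \<Omega> v H \<and> square_integrable \<Omega> H)}"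

definition H2_norm :: "point set \<Rightarrow> (point \<Rightarrow> real) \<Rightarrow> real" where
  "H2_norm \<Omega> v =
     sqrt ((L2_norm \<Omega> v)\<^sup>2 + (L2_norm \<Omega> (weak_grad \<Omega> v))\<^sup>2 + (L2_norm \<Omega> (weak_hess \<Omega> v))\<^sup>2)"

text \<open>The closure of the test functions in $H^2(\Omega)$.\<close>

definition H2_0 :: "point set \<Rightarrow> (point \<Rightarrow> real) set" where
  "H2_0 \<Omega> = {v \<in> H2 \<Omega>. \<exists>\<phi>. (\<forall>n::nat. \<phi> n \<in> test_functions \<Omega>) \<and>
     (\<lambda>n. H2_norm \<Omega> (\<lambda>x. v x - \<phi> n x)) \<longlonglongrightarrow> 0}"


section \<open>Domains and triangulations\<close>

text \<open>Near each boundary point the domain is, in rotated coordinates, the part of a ball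
  above the graph of a Lipschitz function.\<close>

definition lipschitz_boundary :: "point set \<Rightarrow> bool" where
  "lipschitz_boundary \<Omega> \<longleftrightarrow>
     (\<forall>x\<in>frontier \<Omega>. \<exists>r>0. \<exists>t n. norm t = 1 \<and> norm n = 1 \<and> t \<bullet> n = 0 \<and>
        (\<exists>L g. L-lipschitz_on (UNIV::real set) g \<and>
           (\<forall>z\<in>ball x r. z \<in> \<Omega> \<longleftrightarrow> g (t \<bullet> (z - x)) < n \<bullet> (z - x))))"

definition polygonal_lipschitz_domain :: "point set \<Rightarrow> bool" where
  "polygonal_lipschitz_domain \<Omega> \<longleftrightarrow>
     open \<Omega> \<and> bounded \<Omega> \<and> connected \<Omega> \<and> lipschitz_boundary \<Omega> \<and>
     (\<exists>S. finite S \<and> frontier \<Omega> = (\<Union>(a,b)\<in>S. closed_segment a b))"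

definition regular_triangulation :: "point set \<Rightarrow> point set set \<Rightarrow> bool" where
  "regular_triangulation \<Omega> \<T> \<longleftrightarrow>
     triangulation \<T> \<and> (\<forall>T\<in>\<T>. 2 simplex T) \<and> \<Union>\<T> = closure \<Omega>"

text \<open>Every triangle contains a disc whose radius is at least \<open>1/\<gamma>\<close> times the diameter
  of the triangle.\<close>

definition shape_regular_family :: "real \<Rightarrow> point set \<Rightarrow> point set set set \<Rightarrow> bool" where
  "shape_regular_family \<gamma> \<Omega> \<FF> \<longleftrightarrow>
     (\<forall>\<T>\<in>\<FF>. regular_triangulation \<Omega> \<T> \<and>
        (\<forall>T\<in>\<T>. \<exists>x r. r > 0 \<and> cball x r \<subseteq> T \<and> diameter T \<le> \<gamma> * r))"

definition nodes :: "point set set \<Rightarrow> point set" where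
  "nodes \<T> = {z. \<exists>T\<in>\<T>. z extreme_point_of T}"

definition faces_of :: "point set \<Rightarrow> point set set" where
  "faces_of T = {F. F edge_of T}"

definition faces :: "point set set \<Rightarrow> point set set" where
  "faces \<T> = (\<Union>T\<in>\<T>. faces_of T)"

definition boundary_faces :: "point set \<Rightarrow> point set set \<Rightarrow> point set set" where
  "boundary_faces \<Omega> \<T> = {F \<in> faces \<T>. F \<subseteq> frontier \<Omega>}"

definition interior_faces :: "point set \<Rightarrow> point set set \<Rightarrow> point set set" where
  "interior_faces \<Omega> \<T> = {F \<in> faces \<T>. \<not> F \<subseteq> frontier \<Omega>}"

text \<open>The fixed (arbitrary) choice of the triangles $T_+$ and $T_-$ adjacent to a face;
  \<open>T_minus\<close> is meaningful for interior faces only.\<close>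

definition T_plus :: "point set set \<Rightarrow> point set \<Rightarrow> point set" where
  "T_plus \<T> F = (SOME T. T \<in> \<T> \<and> F edge_of T)"

definition T_minus :: "point set set \<Rightarrow> point set \<Rightarrow> point set" where
  "T_minus \<T> F = (SOME T. T \<in> \<T> \<and> F edge_of T \<and> T \<noteq> T_plus \<T> F)"

definition face_normal :: "point set set \<Rightarrow> point set \<Rightarrow> real^2" where
  "face_normal \<T> F = (THE \<nu>. norm \<nu> = 1 \<and> (\<forall>x\<in>F. \<forall>y\<in>F. \<nu> \<bullet> (y - x) = 0) \<and>
     (\<forall>x\<in>F. \<forall>y\<in>T_plus \<T> F. \<nu> \<bullet> (y - x) \<le> 0))"

definition face_mid :: "point set \<Rightarrow> point" where
  "face_mid F = (THE m. \<exists>a b. F = closed_segment a b \<and> m = midpoint a b)"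

text \<open>The integral along a segment with respect to arc length; it does not depend on the
  order of the two endpoints.\<close>

definition face_integral :: "point set \<Rightarrow> (point \<Rightarrow> real) \<Rightarrow> real" where
  "face_integral F g = (THE I. \<exists>a b. F = closed_segment a b \<and>
     I = dist a b * (LINT t|lebesgue_on {0..1}. g (linepath a b t)))"

definition face_L2_norm :: "point set \<Rightarrow> (point \<Rightarrow> 'b::euclidean_space) \<Rightarrow> real" where
  "face_L2_norm F g = sqrt (face_integral F (\<lambda>x. (norm (g x))\<^sup>2))"

definition face_patch :: "point set \<Rightarrow> point set set \<Rightarrow> point set \<Rightarrow> point set" where
  "face_patch \<Omega> \<T> F =
     (if F \<in> interior_faces \<Omega> \<T> then T_plus \<T> F \<union> T_minus \<T> F else T_plus \<T> F)"

definition patch :: "point set \<Rightarrow> point set set \<Rightarrow> point set \<Rightarrow> point set" where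
  "patch \<Omega> \<T> T = (\<Union>F\<in>faces_of T. face_patch \<Omega> \<T> F)"

definition submesh :: "point set set \<Rightarrow> point set \<Rightarrow> point set set" where
  "submesh \<T> \<omega> = {K \<in> \<T>. K \<subseteq> \<omega>}"


section \<open>Piecewise functions\<close>

text \<open>A function that is defined piecewise with respect to a triangulation is represented by
  the family \<open>v\<close> of its pieces: \<open>v T\<close> is its restriction to the closed triangle \<open>T\<close>, so that
  \<open>v T x\<close> is the one-sided value at a point \<open>x\<close> of the boundary of \<open>T\<close>. A polynomial piece is
  identified with its unique polynomial extension to the plane; hence its derivatives,
  also at boundary points of \<open>T\<close>, are classical ones. The triangles of a triangulation overlap
  in null sets only, so integrals over a union of triangles are sums over the triangles.\<close>

type_synonym 'b pw_fun = "point set \<Rightarrow> point \<Rightarrow> 'b"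

definition pw_integral :: "point set set \<Rightarrow> real pw_fun \<Rightarrow> real" where
  "pw_integral \<S> g = (\<Sum>T\<in>\<S>. LINT x|lebesgue_on T. g T x)"

definition pw_L2_norm :: "point set set \<Rightarrow> ('b::euclidean_space) pw_fun \<Rightarrow> real" where
  "pw_L2_norm \<S> g = sqrt (pw_integral \<S> (\<lambda>T x. (norm (g T x))\<^sup>2))"

definition pw_grad :: "real pw_fun \<Rightarrow> (real^2) pw_fun" where
  "pw_grad v T = grad (v T)"

definition pw_hess :: "real pw_fun \<Rightarrow> (real^2^2) pw_fun" where
  "pw_hess v T = hess (v T)"

definition pw_weak_grad :: "real pw_fun \<Rightarrow> (real^2) pw_fun" where
  "pw_weak_grad v T = weak_grad (interior T) (v T)"

definition pw_weak_hess :: "real pw_fun \<Rightarrow> (real^2^2) pw_fun" where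
  "pw_weak_hess v T = weak_hess (interior T) (v T)"

definition jump :: "point set \<Rightarrow> point set set \<Rightarrow> ('b::real_vector) pw_fun \<Rightarrow> point set \<Rightarrow> point \<Rightarrow> 'b"
  where
  "jump \<Omega> \<T> v F x =
     (if F \<in> interior_faces \<Omega> \<T> then v (T_plus \<T> F) x - v (T_minus \<T> F) x else v (T_plus \<T> F) x)"

definition poly_deg_le :: "nat \<Rightarrow> (point \<Rightarrow> real) \<Rightarrow> bool" where
  "poly_deg_le k p \<longleftrightarrow> (\<exists>c. \<forall>x. p x = (\<Sum>i\<le>k. \<Sum>j\<le>k-i. c i j * x$1 ^ i * x$2 ^ j))"

definition pw_poly :: "nat \<Rightarrow> point set set \<Rightarrow> real pw_fun set" where
  "pw_poly k \<T> = {v. \<forall>T\<in>\<T>. poly_deg_le k (v T)}"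

definition L2_proj0 :: "point set set \<Rightarrow> (point \<Rightarrow> real) \<Rightarrow> real pw_fun" where
  "L2_proj0 \<T> f = (SOME q. q \<in> pw_poly 0 \<T> \<and>
     (\<forall>r\<in>pw_poly 0 \<T>. pw_integral \<T> (\<lambda>T x. (f x - q T x) * r T x) = 0))"

definition morley :: "point set \<Rightarrow> point set set \<Rightarrow> real pw_fun set" where
  "morley \<Omega> \<T> = {v \<in> pw_poly 2 \<T>.
     (\<forall>z\<in>nodes \<T>. \<forall>T\<in>\<T>. \<forall>K\<in>\<T>. z \<in> T \<and> z \<in> K \<longrightarrow> v T z = v K z) \<and>
     (\<forall>F\<in>interior_faces \<Omega> \<T>. jump \<Omega> \<T> (pw_grad v) F (face_mid F) = 0)}"

definition morley0 :: "point set \<Rightarrow> point set set \<Rightarrow> real pw_fun set" where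
  "morley0 \<Omega> \<T> = {v \<in> morley \<Omega> \<T>.
     (\<forall>z\<in>nodes \<T> \<inter> frontier \<Omega>. \<forall>T\<in>\<T>. z \<in> T \<longrightarrow> v T z = 0) \<and>
     (\<forall>F\<in>boundary_faces \<Omega> \<T>. \<forall>T\<in>\<T>. F edge_of T \<longrightarrow> pw_grad v T (face_mid F) = 0)}"

text \<open>The nodal interpolation of a piecewise function that is continuous at the nodes: the
  continuous piecewise affine function with the same nodal values.\<close>

definition nodal_interp :: "point set set \<Rightarrow> real pw_fun \<Rightarrow> real pw_fun" where
  "nodal_interp \<T> v = (SOME w. w \<in> pw_poly 1 \<T> \<and>
     (\<forall>T\<in>\<T>. \<forall>K\<in>\<T>. \<forall>x\<in>T \<inter> K. w T x = w K x) \<and>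
     (\<forall>z\<in>nodes \<T>. \<forall>T\<in>\<T>. z \<in> T \<longrightarrow> w T z = v T z))"


section \<open>The continuous and the discrete problem\<close>

definition weak_solution :: "point set \<Rightarrow> real \<Rightarrow> (point \<Rightarrow> real) \<Rightarrow> (point \<Rightarrow> real) \<Rightarrow> bool" where
  "weak_solution \<Omega> \<epsilon> f u \<longleftrightarrow> u \<in> H2_0 \<Omega> \<and>
     (\<forall>v\<in>H2_0 \<Omega>.
        \<epsilon>\<^sup>2 * (LINT x|lebesgue_on \<Omega>. weak_hess \<Omega> u x \<bullet> weak_hess \<Omega> v x)
        + (LINT x|lebesgue_on \<Omega>. weak_grad \<Omega> u x \<bullet> weak_grad \<Omega> v x)
        = (LINT x|lebesgue_on \<Omega>. f x * v x))"

definition morley_solution ::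
  "point set \<Rightarrow> point set set \<Rightarrow> real \<Rightarrow> (point \<Rightarrow> real) \<Rightarrow> real pw_fun \<Rightarrow> bool" where
  "morley_solution \<Omega> \<T> \<epsilon> f u\<^sub>h \<longleftrightarrow> u\<^sub>h \<in> morley0 \<Omega> \<T> \<and>
     (\<forall>v\<in>morley0 \<Omega> \<T>.
        \<epsilon>\<^sup>2 * pw_integral \<T> (\<lambda>T x. pw_hess u\<^sub>h T x \<bullet> pw_hess v T x)
        + pw_integral \<T> (\<lambda>T x. pw_grad (nodal_interp \<T> u\<^sub>h) T x \<bullet> pw_grad (nodal_interp \<T> v) T x)
        = pw_integral \<T> (\<lambda>T x. f x * nodal_interp \<T> v T x))"


section \<open>Local norm, oscillation and error estimator\<close>

definition energy_norm :: "real \<Rightarrow> point set set \<Rightarrow> point set \<Rightarrow> real pw_fun \<Rightarrow> real" where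
  "energy_norm \<epsilon> \<T> \<omega> v = sqrt (\<epsilon>\<^sup>2 * (pw_L2_norm (submesh \<T> \<omega>) (pw_weak_hess v))\<^sup>2
     + (pw_L2_norm (submesh \<T> \<omega>) (pw_weak_grad v))\<^sup>2)"

definition osc :: "real \<Rightarrow> point set set \<Rightarrow> point set \<Rightarrow> (point \<Rightarrow> real) \<Rightarrow> real" where
  "osc \<epsilon> \<T> \<omega> f = pw_L2_norm (submesh \<T> \<omega>)
     (\<lambda>K x. min (diameter K) ((diameter K)\<^sup>2 / \<epsilon>) * (f x - L2_proj0 \<T> f K x))"

definition kappa :: "real \<Rightarrow> point set \<Rightarrow> real" where
  "kappa \<epsilon> T = min 1 (diameter T / \<epsilon>)"

definition mu_NC_sq :: "point set \<Rightarrow> point set set \<Rightarrow> real \<Rightarrow> real pw_fun \<Rightarrow> point set \<Rightarrow> real" where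
  "mu_NC_sq \<Omega> \<T> \<epsilon> u\<^sub>h T =
     (\<Sum>F\<in>faces_of T. \<epsilon> / kappa \<epsilon> T * (face_L2_norm F (jump \<Omega> \<T> (pw_grad u\<^sub>h) F))\<^sup>2)"

definition mu_interp :: "point set set \<Rightarrow> real pw_fun \<Rightarrow> point set \<Rightarrow> real" where
  "mu_interp \<T> u\<^sub>h T = L2_norm T (pw_grad (\<lambda>K x. u\<^sub>h K x - nodal_interp \<T> u\<^sub>h K x) T)"

definition eta_f :: "real \<Rightarrow> (point \<Rightarrow> real) \<Rightarrow> point set \<Rightarrow> real" where
  "eta_f \<epsilon> f T = L2_norm T (\<lambda>x. diameter T * kappa \<epsilon> T * f x)"

definition eta1_sq :: "point set \<Rightarrow> point set set \<Rightarrow> real \<Rightarrow> real pw_fun \<Rightarrow> point set \<Rightarrow> real" where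
  "eta1_sq \<Omega> \<T> \<epsilon> u\<^sub>h T =
     (\<Sum>F\<in>faces_of T \<inter> interior_faces \<Omega> \<T>. \<epsilon> ^ 3 * kappa \<epsilon> T *
        (face_L2_norm F (jump \<Omega> \<T> (\<lambda>K x. pw_hess u\<^sub>h K x *v face_normal \<T> F) F))\<^sup>2)"

definition eta2_sq :: "point set \<Rightarrow> point set set \<Rightarrow> real \<Rightarrow> real pw_fun \<Rightarrow> point set \<Rightarrow> real" where
  "eta2_sq \<Omega> \<T> \<epsilon> u\<^sub>h T =
     (\<Sum>F\<in>faces_of T \<inter> interior_faces \<Omega> \<T>. diameter T * (kappa \<epsilon> T)\<^sup>2 *
        (face_L2_norm F
          (jump \<Omega> \<T> (\<lambda>K x. pw_grad (nodal_interp \<T> u\<^sub>h) K x \<bullet> face_normal \<T> F) F))\<^sup>2)"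

definition eta_sq ::
  "point set \<Rightarrow> point set set \<Rightarrow> real \<Rightarrow> (point \<Rightarrow> real) \<Rightarrow> real pw_fun \<Rightarrow> point set \<Rightarrow> real" where
  "eta_sq \<Omega> \<T> \<epsilon> f u\<^sub>h T =
     mu_NC_sq \<Omega> \<T> \<epsilon> u\<^sub>h T + (mu_interp \<T> u\<^sub>h T)\<^sup>2 + (eta_f \<epsilon> f T)\<^sup>2
     + eta1_sq \<Omega> \<T> \<epsilon> u\<^sub>h T + eta2_sq \<Omega> \<T> \<epsilon> u\<^sub>h T"

end

(* The discrete functions are polynomials on every triangle, so each contribution to the estimator
   is governed by a few numbers, and each of these numbers is isolated by a test function
   obtained from a fixed smooth bump by affine scaling. On an edge F of length l the test
   functions live in a box over the middle of F of half-width l/8 and half-height delta.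

   The jump of the i-th partial derivative of u_h is affine and vanishes at mid(F), hence only
   its slope q_i along F matters. Integrating the identity between first and second derivatives
   of u - u_h by parts over the two halves of the box expresses q_i by the errors. For
   h <= eps a combination of two test functions with delta ~ l bounds q_i by the error of the
   Hessian alone; for eps <= h the choice delta ~ min(l, eps) gives the balanced bound that
   replaces the multiplicative trace inequality. On a boundary edge, u is approximated by test
   functions, whose first derivatives vanish on F.

   In the weak formulation, a bump that is even in the normal coordinate, with delta ~ l,
   isolates the normal jump of the gradient of I_h u_h, because its second normal derivative has
   mean zero on each half of the box. The product of the normal coordinate and the bump, with
   delta ~ min(l, eps), vanishes on F and isolates the normal-normal component of the jump of the
   Hessian; the tangential component is a combination of the slopes q_i. A bump in an inscribed
   disc bounds the mean value of f. *)

theory Submission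
  imports Defs
begin

section \<open>Partial derivatives and an algebra of smooth functions\<close>

text \<open>No trace of u is ever taken. An edge jump is read off from an integral over the half
  plane on one side of the edge, and there only smooth functions are integrated by parts; the
  derivatives of u enter through integrals over the plane or, at the boundary, through approximating
  test functions.

  The split at h \<le> \<epsilon> is forced by the weight \<epsilon>/\<kappa> of the gradient jump.
  For h \<le> \<epsilon> it equals \<epsilon>^2/h, and a slope bound by the gradient error would
  leave the unbounded factor (\<epsilon>/h)^2; so the gradient error must be eliminated. For
  \<epsilon> \<le> h the weight is \<epsilon>, and a box whose height is of order \<epsilon> gives
  the Hessian error the factor \<epsilon>^2 and the gradient error a bounded one.

  The bump is built from exp(-1/t). Among the integrals of its derivatives over the upper half plane
  some vanish, and of the others only the sign matters, which follows from monotonicity. These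
  numbers, the L2 norms of the derivatives and \<gamma> are the only sources of constants, so the
  constants can be fixed before the mesh, \<epsilon> and the data.\<close>

lemma has_derivative_pd:
  assumes "f differentiable (at x)"
  shows "(f has_derivative (\<lambda>h. pd 1 f x * h$1 + pd 2 f x * h$2)) (at x)"
proof -
  let ?D = "frechet_derivative f (at x)"
  have D: "(f has_derivative ?D) (at x)" using assms frechet_derivative_works by blast
  then interpret linear ?D by (rule has_derivative_linear)
  have "?D h = pd 1 f x * h$1 + pd 2 f x * h$2" for h
  proof -
    have "h = h$1 *\<^sub>R axis 1 1 + h$2 *\<^sub>R axis 2 (1::real)"
      by (simp add: vec_eq_iff forall_2 axis_def)
    then have "?D h = h$1 *\<^sub>R ?D (axis 1 1) + h$2 *\<^sub>R ?D (axis 2 1)"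
      by (metis add scale)
    then show ?thesis by (simp add: pd_def)
  qed
  with D show ?thesis by (metis (no_types, lifting) ext)
qed

lemma pd_eqI:
  assumes "(f has_derivative L) (at x)"
  shows "pd i f x = L (axis i 1)"
  unfolding pd_def using frechet_derivative_at[OF assms] by simp

lemma pd_add:
  assumes "f differentiable (at x)" "g differentiable (at x)"
  shows "pd i (\<lambda>x. f x + g x) x = pd i f x + pd i g x"
  using exhaust_2[of i]
  by (auto simp: pd_eqI[OF has_derivative_add[OF has_derivative_pd[OF assms(1)] has_derivative_pd[OF assms(2)]]] axis_def)

lemma pd_diff:
  assumes "f differentiable (at x)" "g differentiable (at x)"
  shows "pd i (\<lambda>x. f x - g x) x = pd i f x - pd i g x"
  using exhaust_2[of i]
  by (auto simp: pd_eqI[OF has_derivative_diff[OF has_derivative_pd[OF assms(1)] has_derivative_pd[OF assms(2)]]] axis_def)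

lemma pd_mult:
  assumes "f differentiable (at x)" "g differentiable (at x)"
  shows "pd i (\<lambda>x. f x * g x) x = f x * pd i g x + pd i f x * g x"
  using exhaust_2[of i]
  by (auto simp: pd_eqI[OF has_derivative_mult[OF has_derivative_pd[OF assms(1)] has_derivative_pd[OF assms(2)]]] axis_def)

lemma pd_affine: "pd i (\<lambda>x. c + x \<bullet> v) x = v $ i"
proof -
  have "((\<lambda>x. c + x \<bullet> v) has_derivative (\<lambda>h. h \<bullet> v)) (at x)"
    by (auto intro!: derivative_eq_intros)
  from pd_eqI[OF this] show ?thesis by (simp add: inner_axis inner_commute)
qed

lemma smooth_differentiable: "smooth \<phi> \<Longrightarrow> \<phi> differentiable (at x)"
  unfolding smooth_def by (metis foldr.simps(1) id_apply)

lemma smooth_pd: "smooth \<phi> \<Longrightarrow> smooth (pd i \<phi>)"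
  unfolding smooth_def
proof (intro allI)
  fix "is" x assume *: "\<forall>is x. foldr pd is \<phi> differentiable at x"
  have "foldr pd is (pd i \<phi>) = foldr pd (is @ [i]) \<phi>" by simp
  then show "foldr pd is (pd i \<phi>) differentiable at x" using * by metis
qed

lemma smooth_continuous: "smooth \<phi> \<Longrightarrow> continuous_on S \<phi>"
  by (meson continuous_at_imp_continuous_on differentiable_imp_continuous_within smooth_differentiable)

text \<open>Differentiating exp(-1/t) produces inverse powers of t. With these built in, derivatives
  are linear combinations of members of the family, and one first-order formula covers all orders,
  also at 0.\<close>

definition flat :: "nat \<Rightarrow> real \<Rightarrow> real" where
  "flat k t = (if t > 0 then exp (- 1 / t) / t ^ k else 0)"

lemma flat_tendsto_0: "(flat k \<longlongrightarrow> 0) (at 0)"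
proof -
  have "((\<lambda>t::real. exp (- 1 / t) / t ^ k) \<longlongrightarrow> 0) (at_right 0)"
  proof -
    have "((\<lambda>t::real. inverse t ^ k / exp (inverse t)) \<longlongrightarrow> 0) (at_right 0)"
      using filterlim_compose[OF tendsto_power_div_exp_0 filterlim_inverse_at_top_right] .
    then show ?thesis
      by (rule Lim_transform_eventually)
         (auto simp: eventually_at_filter exp_minus inverse_eq_divide power_divide field_simps)
  qed
  then have "(flat k \<longlongrightarrow> 0) (at_right 0)"
    by (rule Lim_transform_eventually) (auto simp: eventually_at_filter flat_def)
  moreover have "(flat k \<longlongrightarrow> 0) (at_left 0)"
    by (rule Lim_transform_eventually[OF tendsto_const]) (auto simp: eventually_at_filter flat_def)
  ultimately show ?thesis by (simp add: filterlim_at_split)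
qed

lemma flat_has_derivative:
  "(flat k has_real_derivative (- real k * flat (Suc k) t + flat (k + 2) t)) (at t)"
proof -
  consider "t > 0" | "t = 0" | "t < 0" by linarith
  then show ?thesis
  proof cases
    case 1
    have "((\<lambda>t. exp (- 1 / t) / t ^ k) has_real_derivative (- real k * flat (Suc k) t + flat (k + 2) t)) (at t)"
    proof (cases k)
      case 0 then show ?thesis using 1
        by (auto intro!: derivative_eq_intros simp: flat_def power2_eq_square)
    next
      case (Suc n)
      have "t ^ n + real n * t ^ (n - Suc 0) * t = (1 + real n) * t ^ n"
        by (cases n) (auto simp: algebra_simps)
      then have "((\<lambda>t. exp (- 1 / t) / t ^ k) has_real_derivative 
        (exp (- 1 / t) * (1 / t^2) * t ^ k - exp (- 1 / t) * (real k * t ^ n)) / (t ^ k * t ^ k)) (at t)"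
        using 1 Suc by (auto intro!: derivative_eq_intros simp: power2_eq_square)
      moreover have "(exp (- 1 / t) * (1 / t^2) * t ^ k - exp (- 1 / t) * (real k * t ^ n)) / (t ^ k * t ^ k)
         = - real k * flat (Suc k) t + flat (k + 2) t"
        using 1 Suc by (simp add: flat_def power2_eq_square field_simps)
      ultimately show ?thesis by simp
    qed
    then show ?thesis
    proof (rule has_field_derivative_transform_within_open)
      show "open {0::real<..}" "t \<in> {0<..}" using 1 by auto
    qed (auto simp: flat_def)
  next
    case 2
    \<comment> \<open>The difference quotient at 0 is \<open>flat (Suc k)\<close> itself, so
      differentiability there is the limit at 0 for the next index.\<close>
    have "((\<lambda>h. flat k h / h) \<longlongrightarrow> 0) (at 0)"
      by (rule Lim_transform_eventually[OF flat_tendsto_0[of "Suc k"]])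
         (auto simp: eventually_at_filter flat_def)
    then show ?thesis using 2 by (simp add: DERIV_def flat_def)
  next
    case 3
    have "((\<lambda>_. 0) has_real_derivative (- real k * flat (Suc k) t + flat (k + 2) t)) (at t)"
      using 3 by (simp add: flat_def)
    then show ?thesis
    proof (rule has_field_derivative_transform_within_open)
      show "open {..<0::real}" "t \<in> {..<0}" using 3 by auto
    qed (auto simp: flat_def)
  qed
qed

text \<open>The class is large enough for polynomials and scaled bumps, and small enough that
  smoothness, stability under affine substitution and symmetry of second derivatives follow by
  induction. The affine forms inside the generators keep it closed under a change of frame.\<close>

inductive elementary :: "(point \<Rightarrow> real) \<Rightarrow> bool" where
  flat: "elementary (\<lambda>x. flat k (c + x \<bullet> v))"
| affine: "elementary (\<lambda>x. c + x \<bullet> v)"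
| add: "elementary f \<Longrightarrow> elementary g \<Longrightarrow> elementary (\<lambda>x. f x + g x)"
| mult: "elementary f \<Longrightarrow> elementary g \<Longrightarrow> elementary (\<lambda>x. f x * g x)"

lemma elementary_const: "elementary (\<lambda>x. c)"
  using elementary.affine[of c 0] by simp

lemma elementary_cmult: "elementary f \<Longrightarrow> elementary (\<lambda>x. c * f x)"
  by (intro elementary.mult elementary_const)

lemma elementary_coord: "elementary (\<lambda>x. x $ i)"
  using elementary.affine[of 0 "axis i 1"] by (simp add: inner_axis)

lemma flat_affine_has_derivative:
  "((\<lambda>x. flat k (c + x \<bullet> v)) has_derivative
     (\<lambda>h. (h \<bullet> v) * (- real k * flat (Suc k) (c + x \<bullet> v) + flat (k + 2) (c + x \<bullet> v)))) (at x)"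
proof -
  have "((\<lambda>x. c + x \<bullet> v) has_derivative (\<lambda>h. h \<bullet> v)) (at x)"
    by (auto intro!: derivative_eq_intros)
  from has_derivative_compose[OF this, of "flat k", OF flat_has_derivative[unfolded has_field_derivative_def]]
  show ?thesis by (simp add: algebra_simps)
qed

lemma pd_flat_affine:
  "pd i (\<lambda>x. flat k (c + x \<bullet> v)) =
     (\<lambda>x. v $ i * (- real k * flat (Suc k) (c + x \<bullet> v) + flat (k + 2) (c + x \<bullet> v)))"
  by (rule ext, subst pd_eqI[OF flat_affine_has_derivative]) (simp add: inner_axis inner_commute)

lemma elementary_differentiable_pd:
  "elementary f \<Longrightarrow> (\<forall>x. f differentiable (at x)) \<and> elementary (pd i f)"
proof (induction rule: elementary.induct)
  case (flat k c v)
  have "elementary (pd i (\<lambda>x. flat k (c + x \<bullet> v)))"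
    unfolding pd_flat_affine by (intro elementary_cmult elementary.add elementary.flat)
  then show ?case using flat_affine_has_derivative differentiable_def by blast
next
  case (affine c v)
  then show ?case by (auto simp: pd_affine[abs_def] elementary_const)
next
  case (add f g)
  then have "pd i (\<lambda>x. f x + g x) = (\<lambda>x. pd i f x + pd i g x)" by (auto simp: pd_add)
  then show ?case using add by (auto intro: elementary.add)
next
  case (mult f g)
  then have "pd i (\<lambda>x. f x * g x) = (\<lambda>x. f x * pd i g x + pd i f x * g x)" by (auto simp: pd_mult)
  then show ?case using mult by (auto intro!: elementary.add elementary.mult)
qed

lemma elementary_pd: "elementary f \<Longrightarrow> elementary (pd i f)"
  and elementary_differentiable: "elementary f \<Longrightarrow> f differentiable (at x)"
  using elementary_differentiable_pd by auto

lemma elementary_smooth: "elementary f \<Longrightarrow> smooth f"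
proof -
  assume "elementary f"
  then have "elementary (foldr pd is f)" for "is" by (induction "is") (auto intro: elementary_pd)
  then show ?thesis unfolding smooth_def by (auto intro: elementary_differentiable)
qed

lemma elementary_affine_comp:
  fixes v :: "2 \<Rightarrow> point"
  shows "elementary f \<Longrightarrow> elementary (\<lambda>x. f (\<chi> i. c i + x \<bullet> v i))"
proof (induction rule: elementary.induct)
  have *: "b + (\<chi> i. c i + x \<bullet> v i) \<bullet> w = (b + c 1 * w$1 + c 2 * w$2) + x \<bullet> (w$1 *\<^sub>R v 1 + w$2 *\<^sub>R v 2)" for b w x
    by (simp add: inner_vec_def sum_2 algebra_simps)
  case (flat k b w) then show ?case unfolding * by (rule elementary.flat)
next
  have *: "b + (\<chi> i. c i + x \<bullet> v i) \<bullet> w = (b + c 1 * w$1 + c 2 * w$2) + x \<bullet> (w$1 *\<^sub>R v 1 + w$2 *\<^sub>R v 2)" for b w x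
    by (simp add: inner_vec_def sum_2 algebra_simps)
  case (affine b w) then show ?case unfolding * by (rule elementary.affine)
qed (auto intro: elementary.add elementary.mult)

text \<open>On the generator \<open>flat\<close> both sides carry the symmetric factor
  \<open>v $ i * v $ j\<close>; sums and products inherit the symmetry from the sum and product
  rules.\<close>

lemma pd_pd_commute_elementary:
  "elementary f \<Longrightarrow> pd i (pd j f) x = pd j (pd i f) x"
proof (induction arbitrary: x rule: elementary.induct)
  case (flat k c v)
  have C: "pd i (\<lambda>x. b) y = 0" for i b y using pd_affine[of i b 0 y] by simp
  have E: "(\<lambda>x. flat k (c + x \<bullet> v)) differentiable (at y)" for k y
    using elementary.flat elementary_differentiable by blast
  have "pd i (\<lambda>x. b * (a * flat (Suc k) (c + x \<bullet> v) + flat (k + 2) (c + x \<bullet> v))) x =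
    b * (a * pd i (\<lambda>x. flat (Suc k) (c + x \<bullet> v)) x + pd i (\<lambda>x. flat (k + 2) (c + x \<bullet> v)) x)" for i a b k
  proof -
    have "pd i (\<lambda>x. a * flat (Suc k) (c + x \<bullet> v)) x = a * pd i (\<lambda>x. flat (Suc k) (c + x \<bullet> v)) x"
      by (subst pd_mult) (auto simp: E C)
    moreover have "pd i (\<lambda>x. b * (a * flat (Suc k) (c + x \<bullet> v) + flat (k + 2) (c + x \<bullet> v))) x =
       b * pd i (\<lambda>x. a * flat (Suc k) (c + x \<bullet> v) + flat (k + 2) (c + x \<bullet> v)) x"
      by (subst pd_mult) (auto intro!: differentiable_add differentiable_mult simp: E C)
    moreover have "pd i (\<lambda>x. a * flat (Suc k) (c + x \<bullet> v) + flat (k + 2) (c + x \<bullet> v)) x =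
       pd i (\<lambda>x. a * flat (Suc k) (c + x \<bullet> v)) x + pd i (\<lambda>x. flat (k + 2) (c + x \<bullet> v)) x"
      by (subst pd_add) (auto intro!: differentiable_mult simp: E)
    ultimately show ?thesis by simp
  qed
  note P = this
  show ?case
    by (subst (1 2) pd_flat_affine) (simp only: P, simp add: pd_flat_affine algebra_simps)
next
  case (affine c v)
  have C: "pd i (\<lambda>x. b) y = 0" for i b y using pd_affine[of i b 0 y] by simp
  show ?case by (simp add: pd_affine[abs_def] C)
next
  case (add f g)
  have "pd i (\<lambda>x. f x + g x) = (\<lambda>x. pd i f x + pd i g x)" for i
    using add elementary_differentiable by (auto simp: pd_add)
  then show ?case using add elementary_differentiable elementary_pd by (auto simp: pd_add)
next
  case (mult f g)
  have "pd i (\<lambda>x. f x * g x) = (\<lambda>x. f x * pd i g x + pd i f x * g x)" for i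
    using mult elementary_differentiable by (auto simp: pd_mult)
  then show ?case using mult elementary_differentiable elementary_pd
    by (auto simp: pd_mult pd_add elementary_pd elementary.mult elementary_differentiable algebra_simps)
qed

section \<open>Integration by parts on the plane and on half planes\<close>

lemma integrable_compact_support:
  fixes f :: "point \<Rightarrow> real"
  assumes "continuous_on UNIV f" "\<And>x. f x \<noteq> 0 \<Longrightarrow> norm x \<le> R"
  shows "integrable lebesgue f"
proof -
  have "continuous_on (cball 0 R) f" using assms(1) continuous_on_subset by blast
  then have "integrable lborel (\<lambda>x. indicator (cball 0 R) x *\<^sub>R f x)"
    by (intro borel_integrable_compact) auto
  moreover have "(\<lambda>x. indicator (cball 0 R) x *\<^sub>R f x) = f"
    using assms(2) by (force simp: indicator_def)
  ultimately show ?thesis by (simp add: integrable_completion)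
qed

lemma has_integral_affine:
  fixes f :: "point \<Rightarrow> real" and A :: "point \<Rightarrow> point"
  assumes A: "linear A" and h: "\<And>x. h (m + A x) = x" "\<And>y. m + A (h y) = y" and ch: "continuous_on UNIV h"
    and D: "\<bar>det (matrix A)\<bar> = d"
  shows "integrable lebesgue (\<lambda>x. d * f (m + A x)) \<and> (LINT x|lebesgue. d * f (m + A x)) = b
     \<longleftrightarrow> integrable lebesgue f \<and> (LINT x|lebesgue. f x) = b"
proof -
  have im: "(\<lambda>x. m + A x) ` UNIV = UNIV" using h(2) by (metis surjI)
  \<comment> \<open>The change of variables formula concerns functions with values in some real^n;
    \<open>vec\<close> wraps the scalar integrand into real^1.\<close>
  have "(\<lambda>x. \<bar>det (matrix A)\<bar> *\<^sub>R (vec (f (m + A x)) :: real^1)) absolutely_integrable_on UNIV \<and> integral UNIV (\<lambda>x. \<bar>det (matrix A)\<bar> *\<^sub>R (vec (f (m + A x)) :: real^1)) = vec b \<longleftrightarrow>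
         (\<lambda>x. vec (f x) :: real^1) absolutely_integrable_on ((\<lambda>x. m + A x) ` UNIV) \<and> integral ((\<lambda>x. m + A x) ` UNIV) (\<lambda>x. vec (f x) :: real^1) = vec b"
    by (rule has_absolute_integral_change_of_variables_invertible[where h=h and g' = "\<lambda>_. A"])
       (use h ch im A in \<open>auto intro!: derivative_eq_intros linear_imp_has_derivative\<close>)
  then have *: "(\<lambda>x. d * f (m + A x)) absolutely_integrable_on UNIV \<and> integral UNIV (\<lambda>x. d * f (m + A x)) = b \<longleftrightarrow>
         f absolutely_integrable_on UNIV \<and> integral UNIV f = b"
    unfolding im D by (simp add: absolutely_integrable_on_1_iff integral_on_1_eq vec_eq_iff)
  have I: "integral UNIV g = (LINT x|lebesgue. g x)" if "g absolutely_integrable_on UNIV" for g :: "point \<Rightarrow> real"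
    using set_lebesgue_integral_eq_integral(2)[OF that] by (simp add: set_lebesgue_integral_def)
  have S: "g absolutely_integrable_on UNIV \<longleftrightarrow> integrable lebesgue g" for g :: "point \<Rightarrow> real"
    by (simp add: set_integrable_def)
  show ?thesis using * I[of f] I[of "\<lambda>x. d * f (m + A x)"] unfolding S by metis
qed

lemma integral_translate:
  fixes f :: "point \<Rightarrow> real"
  shows "integrable lebesgue f \<Longrightarrow> integrable lebesgue (\<lambda>x. f (m + x))"
    "integrable lebesgue f \<Longrightarrow> (LINT x|lebesgue. f (m + x)) = (LINT x|lebesgue. f x)"
proof -
  have "linear (\<lambda>x::point. x)" "\<bar>det (matrix (\<lambda>x::point. x))\<bar> = 1"
    using linear_id matrix_id_mat_1 by (auto simp: id_def)
  from has_integral_affine[OF this(1) _ _ _ this(2), of "\<lambda>x. x - m" m f "LINT x|lebesgue. f x"]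
  show "integrable lebesgue f \<Longrightarrow> integrable lebesgue (\<lambda>x. f (m + x))"
    "integrable lebesgue f \<Longrightarrow> (LINT x|lebesgue. f (m + x)) = (LINT x|lebesgue. f x)"
    by (simp_all add: continuous_intros)
qed

text \<open>By translation invariance every difference quotient has integral zero, and the Lipschitz
  bound with the bounded support dominates the quotients. As the limit is required only almost
  everywhere, the result also covers functions with a kink along a line, such as a product with the
  indicator of a half plane.\<close>

lemma integral_difference_quotient:
  fixes \<Phi> g :: "point \<Rightarrow> real"
  assumes meas: "\<Phi> \<in> borel_measurable lebesgue" "g \<in> borel_measurable lebesgue"
    and int: "integrable lebesgue \<Phi>"
    and supp: "\<And>x. \<Phi> x \<noteq> 0 \<Longrightarrow> norm x \<le> R"
    and L: "\<And>x s. \<bar>\<Phi> (x + s *\<^sub>R v) - \<Phi> x\<bar> \<le> L * \<bar>s\<bar>"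
    and lim: "AE x in lebesgue. ((\<lambda>s. (\<Phi> (x + s *\<^sub>R v) - \<Phi> x) / s) \<longlongrightarrow> g x) (at 0)"
  shows "(LINT x|lebesgue. g x) = 0"
proof -
  define s where "s n = inverse (real (Suc n))" for n
  have s: "s \<longlonglongrightarrow> 0" "s n > 0" "s n \<le> 1" for n
    unfolding s_def using LIMSEQ_inverse_real_of_nat by (auto simp: inverse_eq_divide)
  define F where "F n x = (\<Phi> (x + s n *\<^sub>R v) - \<Phi> x) / s n" for n x
  have tr: "integrable lebesgue (\<lambda>x. \<Phi> (x + s n *\<^sub>R v))" 
     "(LINT x|lebesgue. \<Phi> (x + s n *\<^sub>R v)) = (LINT x|lebesgue. \<Phi> x)" for n
    using integral_translate[OF int, of "s n *\<^sub>R v"] by (simp_all add: add.commute)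
  have F0: "(LINT x|lebesgue. F n x) = 0" for n
    unfolding F_def using tr[of n] int by simp
  have Fm: "F n \<in> borel_measurable lebesgue" for n
    unfolding F_def using tr[of n] int by measurable
  have "(\<lambda>n. LINT x|lebesgue. F n x) \<longlonglongrightarrow> (LINT x|lebesgue. g x)"
  proof (rule integral_dominated_convergence)
    show "g \<in> borel_measurable lebesgue" "\<And>n. F n \<in> borel_measurable lebesgue" by fact+
    \<comment> \<open>The steps satisfy \<open>s n \<le> 1\<close>, so enlarging the radius by
      \<open>norm v\<close> catches the support of the shifted function.\<close>
    show "integrable lebesgue (\<lambda>x. L * indicator (cball 0 (R + norm v)) x :: real)"
      by (intro integrable_mult_right integrable_real_indicator) (use emeasure_lborel_cball_finite[of 0 "R + norm v"] in \<open>auto simp: less_top\<close>)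
    show "AE x in lebesgue. (\<lambda>n. F n x) \<longlonglongrightarrow> g x"
      using lim
    proof eventually_elim
      case (elim x)
      show ?case unfolding F_def
        by (rule filterlim_compose[OF elim]) (use s in \<open>auto simp: filterlim_at intro!: always_eventually less_imp_neq[THEN not_sym]\<close>)
    qed
    show "AE x in lebesgue. norm (F n x) \<le> L * indicator (cball 0 (R + norm v)) x" for n
    proof (rule AE_I2)
      fix x
      show "norm (F n x) \<le> L * indicator (cball 0 (R + norm v)) x"
      proof (cases "x \<in> cball 0 (R + norm v)")
        case True
        have "\<bar>\<Phi> (x + s n *\<^sub>R v) - \<Phi> x\<bar> \<le> L * s n" using L[of x "s n"] s(2)[of n] by simp
        then show ?thesis using True s(2)[of n] by (simp add: F_def field_simps)
      next
        case False
        have "norm x > R + norm v" using False by simp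
        moreover have "norm (x + s n *\<^sub>R v) \<ge> norm x - s n * norm v"
          using norm_triangle_ineq4[of "x + s n *\<^sub>R v" "s n *\<^sub>R v"] s(2)[of n] by simp
        moreover have "s n * norm v \<le> norm v" using s(3)[of n] s(2)[of n] by (simp add: mult_left_le_one_le)
        moreover have "norm v \<ge> 0" by simp
        ultimately have "\<Phi> x = 0" "\<Phi> (x + s n *\<^sub>R v) = 0"
          using supp[of x] supp[of "x + s n *\<^sub>R v"] by linarith+
        then show ?thesis using False by (simp add: F_def)
      qed
    qed
  qed
  then show ?thesis unfolding F0 by (simp add: LIMSEQ_const_iff)
qed

definition C1_fun :: "(point \<Rightarrow> real) \<Rightarrow> bool" where
  "C1_fun f \<longleftrightarrow> (\<forall>x. f differentiable (at x)) \<and> (\<forall>i. continuous_on UNIV (pd i f))"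

lemma C1_fun_continuous: "C1_fun f \<Longrightarrow> continuous_on S f"
  by (meson C1_fun_def continuous_at_imp_continuous_on differentiable_imp_continuous_within)

lemma C1_fun_mult: "C1_fun f \<Longrightarrow> C1_fun g \<Longrightarrow> C1_fun (\<lambda>x. f x * g x)"
  using C1_fun_continuous[of f UNIV] C1_fun_continuous[of g UNIV]
  unfolding C1_fun_def by (auto simp: pd_mult intro!: continuous_intros)

lemma smooth_C1_fun: "smooth f \<Longrightarrow> C1_fun f"
  unfolding C1_fun_def using smooth_differentiable smooth_pd smooth_continuous by blast

lemma pd_outside_support:
  assumes "\<And>x. f x \<noteq> 0 \<Longrightarrow> x \<in> S" "closed S" "pd i f x \<noteq> 0"
  shows "x \<in> S"
proof (rule ccontr)
  assume "x \<notin> S"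
  have "(f has_derivative (\<lambda>_. 0)) (at x)"
    by (rule has_derivative_transform_within_open[of "\<lambda>_. 0" _ _ _ "- S"])
       (use assms \<open>x \<notin> S\<close> in auto)
  from pd_eqI[OF this] assms(3) show False by simp
qed

lemma C1_fun_Lipschitz:
  assumes "C1_fun f" "\<And>x. f x \<noteq> 0 \<Longrightarrow> norm x \<le> R"
  obtains L where "\<And>x y. \<bar>f x - f y\<bar> \<le> L * norm (x - y)" "L \<ge> 0"
proof -
  have "\<exists>b. \<forall>x. \<bar>pd i f x\<bar> \<le> b" for i
  proof -
    have "compact (pd i f ` cball 0 R)"
      using assms(1) unfolding C1_fun_def by (intro compact_continuous_image) (auto intro: continuous_on_subset)
    then have "\<exists>b. \<forall>x\<in>cball 0 R. \<bar>pd i f x\<bar> \<le> b" by (auto dest!: compact_imp_bounded simp: bounded_iff)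
    then obtain b where b: "\<And>x. x \<in> cball 0 R \<Longrightarrow> \<bar>pd i f x\<bar> \<le> b" by blast
    have "\<bar>pd i f x\<bar> \<le> max b 0" for x
      using pd_outside_support[of f "cball 0 R" i x] assms(2) b[of x] by (cases "pd i f x = 0") auto
    then show ?thesis by blast
  qed
  then obtain b where b: "\<bar>pd i f x\<bar> \<le> b i" for i x by metis
  have b0: "b i \<ge> 0" for i using b[of i 0] by linarith
  have "\<bar>f x - f y\<bar> \<le> (b 1 + b 2) * norm (x - y)" for x y
  proof -
    have D: "(f has_derivative (\<lambda>h. pd 1 f x * h$1 + pd 2 f x * h$2)) (at x within UNIV)" for x
      using has_derivative_pd assms(1) C1_fun_def by auto
    have "norm (pd 1 f x * h$1 + pd 2 f x * h$2) \<le> (b 1 + b 2) * norm h" for x and h :: point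
    proof -
      have "norm (pd 1 f x * h$1 + pd 2 f x * h$2) \<le> \<bar>pd 1 f x\<bar> * \<bar>h$1\<bar> + \<bar>pd 2 f x\<bar> * \<bar>h$2\<bar>"
        by (metis abs_mult abs_triangle_ineq real_norm_def)
      also have "\<dots> \<le> b 1 * norm h + b 2 * norm h"
        by (intro add_mono mult_mono b b0 component_le_norm_cart) auto
      finally show ?thesis by (simp add: algebra_simps)
    qed
    then have "onorm (\<lambda>h::point. pd 1 f x * h$1 + pd 2 f x * h$2) \<le> b 1 + b 2" for x
      by (intro onorm_bound) (use b0 in auto)
    from differentiable_bound[OF convex_UNIV D this UNIV_I UNIV_I]
    have "norm (f x - f y) \<le> (b 1 + b 2) * norm (x - y)" .
    then show ?thesis by simp
  qed
  then show ?thesis using that b0 by (metis add_nonneg_nonneg)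
qed

lemma directional_limit:
  assumes "f differentiable (at x)"
  shows "((\<lambda>s. (f (x + s *\<^sub>R v) - f x) / s) \<longlongrightarrow> v$1 * pd 1 f x + v$2 * pd 2 f x) (at 0)"
proof -
  have "((\<lambda>s::real. x + s *\<^sub>R v) has_derivative (\<lambda>s. s *\<^sub>R v)) (at 0)"
    by (auto intro!: derivative_eq_intros)
  from has_derivative_compose[OF this, of f] has_derivative_pd[OF assms]
  have "((\<lambda>s. f (x + s *\<^sub>R v)) has_derivative (\<lambda>s. pd 1 f x * (s *\<^sub>R v)$1 + pd 2 f x * (s *\<^sub>R v)$2)) (at 0)" by fastforce
  then have "((\<lambda>s. f (x + s *\<^sub>R v)) has_real_derivative (v$1 * pd 1 f x + v$2 * pd 2 f x)) (at 0)"
    unfolding has_field_derivative_def by (rule has_derivative_eq_rhs) (auto simp: algebra_simps)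
  then show ?thesis by (simp add: DERIV_def)
qed

abbreviation half_plane :: "point \<Rightarrow> point \<Rightarrow> point set" where
  "half_plane m \<nu> \<equiv> {x. 0 < (x - m) \<bullet> \<nu>}"

lemma open_half_plane: "open (half_plane m \<nu>)"
  by (auto intro!: open_Collect_less continuous_intros)

text \<open>The divergence theorem on a half plane for one direction v. The alternative in the
  hypothesis keeps the cut-off function Lipschitz along v: either moving along v never crosses the
  line, or the function is zero at the crossing.\<close>

lemma integral_half_plane_derivative:
  assumes f: "C1_fun f" and supp: "\<And>x. f x \<noteq> 0 \<Longrightarrow> norm x \<le> R"
    and \<nu>: "\<nu> \<noteq> 0" and zero: "v \<bullet> \<nu> = 0 \<or> (\<forall>x. (x - m) \<bullet> \<nu> = 0 \<longrightarrow> f x = 0)"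
  shows "(LINT x|lebesgue. indicator (half_plane m \<nu>) x * (v$1 * pd 1 f x + v$2 * pd 2 f x)) = 0"
proof -
  let ?P = "half_plane m \<nu>"
  obtain L where L: "\<And>x y. \<bar>f x - f y\<bar> \<le> L * norm (x - y)" "L \<ge> 0"
    using C1_fun_Lipschitz[OF f supp] by blast
  have P[measurable]: "?P \<in> sets lebesgue" using open_half_plane by auto
  have [measurable]: "f \<in> borel_measurable lebesgue" "pd i f \<in> borel_measurable lebesgue" for i
    using f C1_fun_continuous[OF f] unfolding C1_fun_def
    by (auto intro!: measurable_completion borel_measurable_continuous_onI)
  show ?thesis
  proof (rule integral_difference_quotient[of "\<lambda>x. indicator ?P x * f x" _ R v "L * norm v"])
    show "integrable lebesgue (\<lambda>x. indicator ?P x * f x)"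
      using integrable_mult_indicator[OF P integrable_compact_support[OF C1_fun_continuous[OF f] supp]] by simp
    show "norm x \<le> R" if "indicator ?P x * f x \<noteq> 0" for x using that supp by auto
    show "\<bar>indicator ?P (x + s *\<^sub>R v) * f (x + s *\<^sub>R v) - indicator ?P x * f x\<bar> \<le> L * norm v * \<bar>s\<bar>" for x s
    proof (cases "x \<in> ?P \<longleftrightarrow> x + s *\<^sub>R v \<in> ?P")
      case True
      then show ?thesis using L(1)[of "x + s *\<^sub>R v" x] L(2) by (auto simp: indicator_def algebra_simps)
    next
      case False
      let ?d = "\<lambda>t. (x - m) \<bullet> \<nu> + t * (s * (v \<bullet> \<nu>))"
      have d: "(x + (t * s) *\<^sub>R v - m) \<bullet> \<nu> = ?d t" for t by (simp add: algebra_simps inner_simps)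
      have nz: "s * (v \<bullet> \<nu>) \<noteq> 0" using False d[of 1] by auto
      then have zero': "(y - m) \<bullet> \<nu> = 0 \<Longrightarrow> f y = 0" for y using zero by auto
      \<comment> \<open>At time \<open>t\<close> the segment from x to x + s v crosses the line,
        where f vanishes. The value of f at the endpoint inside the half plane is therefore
        controlled by the part of the segment on that side.\<close>
      define t where "t = - ((x - m) \<bullet> \<nu>) / (s * (v \<bullet> \<nu>))"
      have "?d t = 0" using nz by (simp add: t_def)
      then have z: "f (x + (t * s) *\<^sub>R v) = 0" using zero'[of "x + (t * s) *\<^sub>R v"] d[of t] by simp
      have t: "0 \<le> t" "t \<le> 1"
        using False d[of 1] nz unfolding t_def
        by (cases "s * (v \<bullet> \<nu>) > 0"; force simp: field_simps)+
      show ?thesis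
      proof (cases "x \<in> ?P")
        case True
        have "\<bar>f x\<bar> \<le> L * (t * \<bar>s\<bar> * norm v)" using L(1)[of x "x + (t * s) *\<^sub>R v"] z t by (simp add: abs_mult)
        also have "\<dots> \<le> L * (1 * \<bar>s\<bar> * norm v)" using t L(2) by (intro mult_left_mono mult_right_mono) auto
        finally show ?thesis using True False by (simp add: indicator_def algebra_simps)
      next
        case F: False
        have "x + s *\<^sub>R v - (x + (t * s) *\<^sub>R v) = ((1 - t) * s) *\<^sub>R v" by (simp add: algebra_simps)
        then have "\<bar>f (x + s *\<^sub>R v)\<bar> \<le> L * ((1 - t) * \<bar>s\<bar> * norm v)"
          using L(1)[of "x + s *\<^sub>R v" "x + (t * s) *\<^sub>R v"] z t by (simp add: abs_mult)
        also have "\<dots> \<le> L * (1 * \<bar>s\<bar> * norm v)" using t L(2) by (intro mult_left_mono mult_right_mono) auto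
        finally show ?thesis using F False by (simp add: indicator_def algebra_simps)
      qed
    qed
    \<comment> \<open>Off the line the indicator is locally constant, so the quotients converge to
      the classical derivative or to 0; the line is a null set.\<close>
    have "negligible {x. \<nu> \<bullet> x = \<nu> \<bullet> m}" using \<nu> by (intro negligible_hyperplane) auto
    then have "AE x in lebesgue. x \<notin> {x. \<nu> \<bullet> x = \<nu> \<bullet> m}"
      by (intro AE_not_in) (simp add: negligible_iff_null_sets)
    then show "AE x in lebesgue. ((\<lambda>s. (indicator ?P (x + s *\<^sub>R v) * f (x + s *\<^sub>R v) - indicator ?P x * f x) / s)
        \<longlongrightarrow> indicator ?P x * (v$1 * pd 1 f x + v$2 * pd 2 f x)) (at 0)"
    proof eventually_elim
      case (elim x)
      then have ne: "(x - m) \<bullet> \<nu> \<noteq> 0" by (simp add: inner_commute inner_diff_right)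
      have "((\<lambda>s. (x + s *\<^sub>R v - m) \<bullet> \<nu>) \<longlongrightarrow> (x + 0 *\<^sub>R v - m) \<bullet> \<nu>) (at 0)" by (intro tendsto_intros)
      then have tt: "((\<lambda>s. (x + s *\<^sub>R v - m) \<bullet> \<nu>) \<longlongrightarrow> (x - m) \<bullet> \<nu>) (at 0)" by simp
      show ?case
      proof (cases "x \<in> ?P")
        case True
        then have "eventually (\<lambda>s. 0 < (x + s *\<^sub>R v - m) \<bullet> \<nu>) (at 0)" using order_tendstoD(1)[OF tt] by auto
        then have "eventually (\<lambda>s. (f (x + s *\<^sub>R v) - f x) / s = (indicator ?P (x + s *\<^sub>R v) * f (x + s *\<^sub>R v) - indicator ?P x * f x) / s) (at 0)"
          by eventually_elim (use True in simp)
        moreover have "f differentiable (at x)" using f C1_fun_def by auto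
        ultimately show ?thesis using Lim_transform_eventually[OF directional_limit] True by simp
      next
        case False
        then have "eventually (\<lambda>s. (x + s *\<^sub>R v - m) \<bullet> \<nu> < 0) (at 0)" using order_tendstoD(2)[OF tt] ne by auto
        then have "eventually (\<lambda>s. 0 = (indicator ?P (x + s *\<^sub>R v) * f (x + s *\<^sub>R v) - indicator ?P x * f x) / s) (at 0)"
          by eventually_elim (use False in \<open>simp add: indicator_def\<close>)
        from Lim_transform_eventually[OF tendsto_const this] show ?thesis using False by simp
      qed
    qed
  qed measurable
qed

lemma integral_pd_zero:
  assumes f: "C1_fun f" and supp: "\<And>x. f x \<noteq> 0 \<Longrightarrow> norm x \<le> R"
  shows "(LINT x|lebesgue. pd i f x) = 0"
proof -
  obtain L where L: "\<And>x y. \<bar>f x - f y\<bar> \<le> L * norm (x - y)" "L \<ge> 0"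
    using C1_fun_Lipschitz[OF f supp] by blast
  have [measurable]: "f \<in> borel_measurable lebesgue" "pd i f \<in> borel_measurable lebesgue" for i
    using f C1_fun_continuous[OF f] unfolding C1_fun_def
    by (auto intro!: measurable_completion borel_measurable_continuous_onI)
  have e: "axis i 1 $ 1 * pd 1 f x + axis i 1 $ 2 * pd 2 f x = pd i f x" for x
    using exhaust_2[of i] by (auto simp: axis_def)
  have d: "((\<lambda>s. (f (x + s *\<^sub>R axis i 1) - f x) / s) \<longlongrightarrow> pd i f x) (at 0)" for x
    using directional_limit[of f x "axis i 1"] f C1_fun_def e by auto
  show ?thesis
  proof (rule integral_difference_quotient[of f _ R "axis i 1" L])
    show "\<bar>f (x + s *\<^sub>R axis i 1) - f x\<bar> \<le> L * \<bar>s\<bar>" for x s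
      using L(1)[of "x + s *\<^sub>R axis i 1" x] by simp
    show "integrable lebesgue f" using integrable_compact_support C1_fun_continuous f supp by blast
  qed (use d supp in auto)
qed

section \<open>Reference bump functions and orthonormal frames\<close>

lemma Cauchy_Schwarz_integral:
  fixes f g :: "'a \<Rightarrow> real"
  assumes [measurable]: "f \<in> borel_measurable M" "g \<in> borel_measurable M"
    and f: "integrable M (\<lambda>x. (f x)\<^sup>2)" and g: "integrable M (\<lambda>x. (g x)\<^sup>2)"
  shows "integrable M (\<lambda>x. f x * g x)"
    and "\<bar>LINT x|M. f x * g x\<bar> \<le> sqrt (LINT x|M. (f x)\<^sup>2) * sqrt (LINT x|M. (g x)\<^sup>2)"
proof -
  have ab: "\<bar>a * b\<bar> \<le> a\<^sup>2 + b\<^sup>2" for a b :: real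
  proof -
    have "0 \<le> (\<bar>a\<bar> - \<bar>b\<bar>)\<^sup>2" by simp
    then have "2 * (\<bar>a\<bar> * \<bar>b\<bar>) \<le> a\<^sup>2 + b\<^sup>2" by (simp add: power2_diff algebra_simps)
    moreover have "0 \<le> \<bar>a\<bar> * \<bar>b\<bar>" by simp
    ultimately show ?thesis unfolding abs_mult by linarith
  qed
  show fg: "integrable M (\<lambda>x. f x * g x)"
    by (rule Bochner_Integration.integrable_bound[OF Bochner_Integration.integrable_add[OF f g]]) (auto simp: ab)
  define A B I where "A = (LINT x|M. (f x)\<^sup>2)" and "B = (LINT x|M. (g x)\<^sup>2)" and "I = (LINT x|M. f x * g x)"
  have AB: "A \<ge> 0" "B \<ge> 0" unfolding A_def B_def by (auto intro!: integral_nonneg_AE)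
  have q: "0 \<le> A - 2 * t * I + t\<^sup>2 * B" for t
  proof -
    have "0 \<le> (LINT x|M. (f x - t * g x)\<^sup>2)" by (rule integral_nonneg_AE) auto
    also have "\<dots> = (LINT x|M. (f x)\<^sup>2 - 2 * t * (f x * g x) + t\<^sup>2 * (g x)\<^sup>2)"
      by (simp add: power2_diff power_mult_distrib algebra_simps)
    also have "\<dots> = A - 2 * t * I + t\<^sup>2 * B"
      using f g fg by (simp add: A_def B_def I_def)
    finally show ?thesis .
  qed
  \<comment> \<open>The quadratic in \<open>q\<close> is nonnegative for all t. Its minimiser is
    \<open>I / B\<close>; for \<open>B = 0\<close> it is affine, so the slope \<open>I\<close>
    vanishes.\<close>
  have "I\<^sup>2 \<le> A * B"
  proof (cases "B = 0")
    case True
    have "I = 0"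
    proof (rule ccontr)
      assume "I \<noteq> 0"
      then show False using q[of "(A + 1) / (2 * I)"] True by (simp add: field_simps)
    qed
    then show ?thesis using AB by simp
  next
    case False
    then show ?thesis using q[of "I / B"] AB by (simp add: field_simps power2_eq_square)
  qed
  then have "\<bar>I\<bar> \<le> sqrt (A * B)" using real_le_rsqrt[of "\<bar>I\<bar>" "A * B"] by simp
  then show "\<bar>LINT x|M. f x * g x\<bar> \<le> sqrt (LINT x|M. (f x)\<^sup>2) * sqrt (LINT x|M. (g x)\<^sup>2)"
    by (simp add: A_def B_def I_def real_sqrt_mult)
qed

lemma integral_pos_open:
  fixes f :: "point \<Rightarrow> real"
  assumes int: "integrable lebesgue f" and nn: "\<And>x. f x \<ge> 0"
    and U: "open U" "U \<noteq> {}" and pos: "\<And>x. x \<in> U \<Longrightarrow> f x > 0"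
  shows "(LINT x|lebesgue. f x) > 0"
proof (rule ccontr)
  assume "\<not> ?thesis"
  moreover have "(LINT x|lebesgue. f x) \<ge> 0" using nn by (auto intro: integral_nonneg_AE)
  ultimately have "(LINT x|lebesgue. f x) = 0" by simp
  then have "AE x in lebesgue. f x = 0" using integral_nonneg_eq_0_iff_AE[OF int] nn by auto
  then have "AE x in lebesgue. x \<notin> U" by eventually_elim (use pos in force)
  then have "negligible U" using U(1) 
    by (simp add: negligible_iff_null_sets completion.null_sets_iff_AE)
  then show False using open_not_negligible U by blast
qed

section \<open>Functions supported in the reference square, and the bump\<close>

definition ref :: "(point \<Rightarrow> real) \<Rightarrow> bool" where
  "ref f \<longleftrightarrow> elementary f \<and> (\<forall>y. f y \<noteq> 0 \<longrightarrow> \<bar>y$1\<bar> \<le> 1 \<and> \<bar>y$2\<bar> \<le> 1)"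

lemma ref_pd: "ref f \<Longrightarrow> ref (pd i f)"
proof -
  assume f: "ref f"
  have "closed {y::point. \<bar>y$1\<bar> \<le> 1 \<and> \<bar>y$2\<bar> \<le> 1}"
    by (intro closed_Collect_conj closed_Collect_le continuous_intros)
  moreover have "\<And>x. f x \<noteq> 0 \<Longrightarrow> x \<in> {y::point. \<bar>y$1\<bar> \<le> 1 \<and> \<bar>y$2\<bar> \<le> 1}" using f unfolding ref_def by blast
  ultimately have "\<And>x. pd i f x \<noteq> 0 \<Longrightarrow> x \<in> {y::point. \<bar>y$1\<bar> \<le> 1 \<and> \<bar>y$2\<bar> \<le> 1}"
    by (meson pd_outside_support)
  then show ?thesis using f unfolding ref_def by (blast intro: elementary_pd)
qed

lemma ref_mult: "elementary g \<Longrightarrow> ref f \<Longrightarrow> ref (\<lambda>y. g y * f y)"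
  unfolding ref_def by (simp add: elementary.mult)

lemma ref_add: "ref f \<Longrightarrow> ref g \<Longrightarrow> ref (\<lambda>y. f y + g y)"
  unfolding ref_def by (intro conjI elementary.add allI impI) (metis add_0)+

lemma ref_norm: 
  assumes "ref f" "f y \<noteq> 0"
  shows "norm y \<le> 2"
proof -
  have "\<bar>y$1\<bar> \<le> 1" "\<bar>y$2\<bar> \<le> 1" using assms by (auto simp: ref_def)
  then show ?thesis using norm_le_l1_cart[of y] by (simp add: sum_2)
qed

lemma ref_C1: "ref f \<Longrightarrow> C1_fun f"
  by (simp add: ref_def elementary_smooth smooth_C1_fun)

lemma ref_integrable: "ref f \<Longrightarrow> integrable lebesgue f"
  using integrable_compact_support C1_fun_continuous ref_C1 ref_norm by blast

abbreviation upper :: "point set" where "upper \<equiv> {y. 0 < y$2}"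

lemma upper_half_plane: "upper = half_plane 0 (axis 2 1)"
  by (auto simp: inner_axis)

lemma open_upper: "open upper"
  unfolding upper_half_plane by (rule open_half_plane)

lemma ref_integrable_upper: "ref f \<Longrightarrow> integrable lebesgue (\<lambda>y. indicator upper y * f y)"
  using integrable_mult_indicator[OF _ ref_integrable, of upper f] open_upper by auto

lemma axis_12: "axis 1 (1::real) $ (1::2) = 1" "axis 1 (1::real) $ (2::2) = 0"
  "axis 2 (1::real) $ (1::2) = 0" "axis 2 (1::real) $ (2::2) = 1" "axis (2::2) (1::real) \<noteq> 0"
  by (simp_all add: axis_eq_0_iff) (simp_all add: axis_def)

lemma ref_integral_upper_pd1: "ref f \<Longrightarrow> (LINT y|lebesgue. indicator upper y * pd 1 f y) = 0"
  using integral_half_plane_derivative[of f 2 "axis 2 1" "axis 1 1" 0] ref_C1 ref_norm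
  unfolding axis_12 by (simp add: inner_axis axis_12)

lemma ref_integral_upper_pd2:
  "ref f \<Longrightarrow> (\<And>y. y$2 = 0 \<Longrightarrow> f y = 0) \<Longrightarrow> (LINT y|lebesgue. indicator upper y * pd 2 f y) = 0"
  using integral_half_plane_derivative[of f 2 "axis 2 1" "axis 2 1" 0] ref_C1 ref_norm
  unfolding axis_12 by (simp add: inner_axis axis_12)

text \<open>A product of one-dimensional bumps, even in each coordinate. Evenness makes
  \<open>pd 2 bump\<close> vanish on the line \<open>y$2 = 0\<close>.\<close>

definition bump :: "point \<Rightarrow> real" where
  "bump y = (flat 0 (1 - y$1) * flat 0 (1 + y$1)) * (flat 0 (1 - y$2) * flat 0 (1 + y$2))"

lemma flat_nonneg: "flat k t \<ge> 0" by (simp add: flat_def)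

lemma elementary_flat_coord: "elementary (\<lambda>y. flat k (1 - y$i))" "elementary (\<lambda>y. flat k (1 + y$i))"
  using elementary.flat[of k 1 "- axis i 1"] elementary.flat[of k 1 "axis i 1"] by (simp_all add: inner_axis)

lemma ref_bump: "ref bump"
proof -
  have "elementary bump" unfolding bump_def by (intro elementary.mult elementary_flat_coord)
  then show ?thesis by (auto simp: ref_def bump_def flat_def split: if_splits)
qed

lemma pd2_bump: 
  "pd 2 bump y = (flat 0 (1 - y$1) * flat 0 (1 + y$1)) * (flat 0 (1 - y$2) * flat 2 (1 + y$2) - flat 2 (1 - y$2) * flat 0 (1 + y$2))"
proof -
  note d = elementary_differentiable[OF elementary_flat_coord(1)] elementary_differentiable[OF elementary_flat_coord(2)]
  have p: "pd 2 (\<lambda>y. flat 0 (1 - y$i)) y = - axis i 1 $ 2 * flat 2 (1 - y$i)"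
     "pd 2 (\<lambda>y. flat 0 (1 + y$i)) y = axis i 1 $ 2 * flat 2 (1 + y$i)" for i
    using pd_flat_affine[of 2 0 1 "- axis i 1"] pd_flat_affine[of 2 0 1 "axis i 1"]
    by (simp_all add: inner_axis numeral_2_eq_2)
  have D: "(\<lambda>y. flat 0 (1 - y$i) * flat 0 (1 + y$i)) differentiable (at y)" for i and y :: point
    by (intro differentiable_mult d)
  show ?thesis unfolding bump_def[abs_def]
    by (simp add: pd_mult d D p) (simp add: axis_def algebra_simps)
qed

text \<open>The logarithmic derivative of exp(- 1/(1 - t) - 1/(1 + t)) is 1/(1 + t)^2 - 1/(1 - t)^2,
  which is negative for 0 < t < 1.\<close>

lemma pd2_bump_sign:
  shows "y$2 > 0 \<Longrightarrow> pd 2 bump y \<le> 0"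
    and "\<bar>y$1\<bar> < 1 \<Longrightarrow> 0 < y$2 \<Longrightarrow> y$2 < 1 \<Longrightarrow> pd 2 bump y < 0"
proof -
  have key: "flat 0 (1 - t) * flat 2 (1 + t) - flat 2 (1 - t) * flat 0 (1 + t) < 0" if "0 < t" "t < 1" for t :: real
  proof -
    have "1 / (1 + t)\<^sup>2 < 1 / (1 - t)\<^sup>2"
      using that by (intro divide_strict_left_mono power_strict_mono mult_pos_pos) auto
    then have "exp (- 1 / (1 - t)) * exp (- 1 / (1 + t)) * (1 / (1 + t)\<^sup>2) < exp (- 1 / (1 - t)) * exp (- 1 / (1 + t)) * (1 / (1 - t)\<^sup>2)"
      by (intro mult_strict_left_mono) auto
    then show ?thesis using that by (simp add: flat_def)
  qed
  show "y$2 > 0 \<Longrightarrow> pd 2 bump y \<le> 0"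
  proof (cases "y$2 < 1")
    case True
    assume "y$2 > 0"
    then show ?thesis unfolding pd2_bump using key[OF _ True] flat_nonneg
      by (intro mult_nonneg_nonpos mult_nonneg_nonneg) auto
  next
    case False
    then show ?thesis unfolding pd2_bump by (simp add: flat_def)
  qed
  show "\<bar>y$1\<bar> < 1 \<Longrightarrow> 0 < y$2 \<Longrightarrow> y$2 < 1 \<Longrightarrow> pd 2 bump y < 0"
    unfolding pd2_bump using key by (intro mult_pos_neg mult_pos_pos) (auto simp: flat_def)
qed

text \<open>By the fundamental theorem of calculus \<open>c0\<close> is the integral of the bump
  along the edge \<open>y$2 = 0\<close>, and \<open>c1\<close> is the same with the weight
  \<open>(y$1)\<^sup>2\<close>. Written over the half plane, they need no integral on a
  line.\<close>

definition c0 :: real where "c0 = - (LINT y|lebesgue. indicator upper y * pd 2 bump y)"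
definition c1 :: real where "c1 = - (LINT y|lebesgue. indicator upper y * ((y$1)\<^sup>2 * pd 2 bump y))"
definition c2 :: real where "c2 = (LINT y|lebesgue. bump y)"

lemma quarter_box: "open {y::point. 0 < y$1 \<and> y$1 < 1 \<and> 0 < y$2 \<and> y$2 < 1}" "{y::point. 0 < y$1 \<and> y$1 < 1 \<and> 0 < y$2 \<and> y$2 < 1} \<noteq> {}"
proof -
  show "open {y::point. 0 < y$1 \<and> y$1 < 1 \<and> 0 < y$2 \<and> y$2 < 1}"
    by (intro open_Collect_conj open_Collect_less continuous_intros)
  have "vec (1/2) \<in> {y::point. 0 < y$1 \<and> y$1 < 1 \<and> 0 < y$2 \<and> y$2 < 1}" by simp
  then show "{y::point. 0 < y$1 \<and> y$1 < 1 \<and> 0 < y$2 \<and> y$2 < 1} \<noteq> {}" by blast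
qed

lemma ref_y1_bump: "ref (\<lambda>y. y$1 * bump y)" and ref_y2_bump: "ref (\<lambda>y. y$2 * bump y)"
  by (intro ref_mult elementary_coord ref_bump)+

lemma c_pos: "c0 > 0" "c1 > 0" "c2 > 0"
proof -
  have e: "elementary (\<lambda>y. (y$1)\<^sup>2)" unfolding power2_eq_square by (intro elementary.mult elementary_coord)
  have "0 < (LINT y|lebesgue. - (indicator upper y * pd 2 bump y))"
    by (rule integral_pos_open[OF _ _ quarter_box])
       (use pd2_bump_sign ref_integrable_upper[OF ref_pd[OF ref_bump]] in \<open>auto simp: indicator_def\<close>)
  then show "c0 > 0" by (simp add: c0_def)
  have "0 < (LINT y|lebesgue. - (indicator upper y * ((y$1)\<^sup>2 * pd 2 bump y)))"
    by (rule integral_pos_open[OF _ _ quarter_box])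
       (use pd2_bump_sign ref_integrable_upper[OF ref_mult[OF e ref_pd[OF ref_bump]]] in
          \<open>auto simp: indicator_def mult_less_0_iff mult_le_0_iff\<close>)
  then show "c1 > 0" by (simp add: c1_def)
  show "c2 > 0" unfolding c2_def
    by (rule integral_pos_open[OF ref_integrable[OF ref_bump] _ quarter_box])
       (auto simp: bump_def flat_nonneg flat_def intro!: mult_nonneg_nonneg mult_pos_pos)
qed

section \<open>Orthonormal frames and affine scaling\<close>

locale frame =
  fixes m \<tau> \<nu> :: point and \<rho> \<delta> :: real
  assumes norm_\<tau>: "norm \<tau> = 1" and norm_\<nu>: "norm \<nu> = 1" and orth: "\<tau> \<bullet> \<nu> = 0" and \<rho>: "\<rho> > 0" and \<delta>: "\<delta> > 0"
begin

text \<open>\<open>B\<close> carries the box around m with half-widths \<rho>, \<delta> along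
  \<tau>, \<nu> onto the reference square and the half plane of \<nu> onto \<open>upper\<close>.
  Test functions are reference functions composed with \<open>B\<close>, so the geometry of the edge
  enters through powers of \<rho>, \<delta> and the components of \<tau>, \<nu> only.\<close>

definition B :: "point \<Rightarrow> point" where
  "B x = (\<chi> i. if i = 1 then ((x - m) \<bullet> \<tau>) / \<rho> else ((x - m) \<bullet> \<nu>) / \<delta>)"

lemma B1[simp]: "B x $ 1 = ((x - m) \<bullet> \<tau>) / \<rho>" and B2[simp]: "B x $ 2 = ((x - m) \<bullet> \<nu>) / \<delta>"
  by (simp_all add: B_def)

lemma coords: "\<tau>$1 * \<tau>$1 + \<tau>$2 * \<tau>$2 = 1" "\<nu>$1 * \<nu>$1 + \<nu>$2 * \<nu>$2 = 1" "\<tau>$1 * \<nu>$1 + \<tau>$2 * \<nu>$2 = 0"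
  using norm_\<tau> norm_\<nu> orth by (simp_all add: norm_eq_1 inner_vec_def sum_2)

lemma coords_det: "(\<tau>$1 * \<nu>$2 - \<tau>$2 * \<nu>$1)\<^sup>2 = 1"
proof -
  have "(\<tau>$1 * \<nu>$2 - \<tau>$2 * \<nu>$1)\<^sup>2 = (\<tau>$1 * \<tau>$1 + \<tau>$2 * \<tau>$2) * (\<nu>$1 * \<nu>$1 + \<nu>$2 * \<nu>$2) - (\<tau>$1 * \<nu>$1 + \<tau>$2 * \<nu>$2)\<^sup>2"
    by (simp add: power2_eq_square algebra_simps)
  then show ?thesis by (simp add: coords)
qed

text \<open>The defect is orthogonal to both vectors, whose determinant has square 1; hence it
  solves a regular homogeneous system.\<close>

lemma expand: "x = (x \<bullet> \<tau>) *\<^sub>R \<tau> + (x \<bullet> \<nu>) *\<^sub>R \<nu>"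
proof -
  have d: "(\<tau>$1 * \<nu>$2 - \<tau>$2 * \<nu>$1) \<noteq> 0" using coords_det by auto
  define z where "z = x - ((x \<bullet> \<tau>) *\<^sub>R \<tau> + (x \<bullet> \<nu>) *\<^sub>R \<nu>)"
  have "z \<bullet> \<tau> = 0" "z \<bullet> \<nu> = 0"
    using norm_\<tau> norm_\<nu> orth by (simp_all add: z_def inner_simps norm_eq_1 inner_commute)
  then have z: "z$1 * \<tau>$1 + z$2 * \<tau>$2 = 0" "z$1 * \<nu>$1 + z$2 * \<nu>$2 = 0" by (simp_all add: inner_vec_def sum_2)
  have "z$1 * (\<tau>$1 * \<nu>$2 - \<tau>$2 * \<nu>$1) = (z$1 * \<tau>$1 + z$2 * \<tau>$2) * \<nu>$2 - (z$1 * \<nu>$1 + z$2 * \<nu>$2) * \<tau>$2"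
    "z$2 * (\<tau>$1 * \<nu>$2 - \<tau>$2 * \<nu>$1) = (z$1 * \<nu>$1 + z$2 * \<nu>$2) * \<tau>$1 - (z$1 * \<tau>$1 + z$2 * \<tau>$2) * \<nu>$1"
    by (simp_all add: algebra_simps)
  then have "z = 0" using d unfolding z by (simp add: vec_eq_iff forall_2)
  then show ?thesis by (simp add: z_def)
qed

lemma B_inverse: "x = m + (\<rho> * B x $ 1) *\<^sub>R \<tau> + (\<delta> * B x $ 2) *\<^sub>R \<nu>"
proof -
  have "x - m = (\<rho> * B x $ 1) *\<^sub>R \<tau> + (\<delta> * B x $ 2) *\<^sub>R \<nu>"
    using expand[of "x - m"] \<rho> \<delta> by simp
  then show ?thesis by (simp add: algebra_simps del: B1 B2)
qed

lemma B_of: "B (m + (\<rho> * s) *\<^sub>R \<tau> + (\<delta> * t) *\<^sub>R \<nu>) = vector [s, t]"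
  using norm_\<tau> norm_\<nu> orth \<rho> \<delta> 
  by (simp add: B_def vec_eq_iff forall_2 inner_simps norm_eq_1 inner_commute)

lemma B_upper: "B x \<in> upper \<longleftrightarrow> x \<in> half_plane m \<nu>"
  using \<delta> by (simp add: zero_less_divide_iff)

lemma elementary_B: "elementary f \<Longrightarrow> elementary (\<lambda>x. f (B x))"
proof -
  have e: "B x = (\<chi> i. (if i = 1 then - (m \<bullet> \<tau>) / \<rho> else - (m \<bullet> \<nu>) / \<delta>) + x \<bullet> (if i = 1 then \<tau> /\<^sub>R \<rho> else \<nu> /\<^sub>R \<delta>))" for x
    by (simp add: B_def vec_eq_iff inner_diff_left diff_divide_distrib divide_inverse algebra_simps)
  show "elementary f \<Longrightarrow> elementary (\<lambda>x. f (B x))" unfolding e by (rule elementary_affine_comp)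
qed

definition A :: "point \<Rightarrow> point" where
  "A x = (\<chi> i. if i = 1 then (x \<bullet> \<tau>) / \<rho> else (x \<bullet> \<nu>) / \<delta>)"

lemma linear_A: "linear A"
  unfolding A_def by (rule linearI) (auto simp: vec_eq_iff inner_simps add_divide_distrib)

lemma B_eq_A: "B x = B 0 + A x"
  by (simp add: B_def A_def vec_eq_iff inner_diff_left diff_divide_distrib)

lemma has_derivative_B: "(B has_derivative A) (at x)"
proof -
  have "((\<lambda>x. B 0 + A x) has_derivative A) (at x)"
    by (auto intro!: derivative_eq_intros linear_imp_has_derivative linear_A)
  then show ?thesis unfolding B_eq_A[symmetric] by simp
qed

lemma pd_B:
  assumes "\<And>y. f differentiable (at y)"
  shows "pd i (\<lambda>x. f (B x)) = (\<lambda>x. \<tau>$i / \<rho> * pd 1 f (B x) + \<nu>$i / \<delta> * pd 2 f (B x))"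
proof
  fix x
  from has_derivative_compose[OF has_derivative_B has_derivative_pd[OF assms]]
  show "pd i (\<lambda>x. f (B x)) x = \<tau>$i / \<rho> * pd 1 f (B x) + \<nu>$i / \<delta> * pd 2 f (B x)"
    by (subst pd_eqI, assumption) (simp add: A_def inner_commute[of "axis i 1"] inner_axis mult.commute)
qed

lemma integral_B:
  fixes f :: "point \<Rightarrow> real"
  assumes "integrable lebesgue f"
  shows "integrable lebesgue (\<lambda>x. f (B x))" "(LINT x|lebesgue. f (B x)) = \<rho> * \<delta> * (LINT y|lebesgue. f y)"
proof -
  have "det (matrix A) = (\<tau>$1 * \<nu>$2 - \<tau>$2 * \<nu>$1) / (\<rho> * \<delta>)"
    using \<rho> \<delta> by (simp add: det_2 matrix_def A_def inner_axis inner_commute diff_divide_distrib)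
  moreover have "\<bar>\<tau>$1 * \<nu>$2 - \<tau>$2 * \<nu>$1\<bar> = 1" using coords_det by (metis abs_minus_cancel abs_one power2_eq_1_iff)
  ultimately have D: "\<bar>det (matrix A)\<bar> = 1 / (\<rho> * \<delta>)" using \<rho> \<delta> by (simp add: abs_divide)
  define h where "h y = m + (\<rho> * y$1) *\<^sub>R \<tau> + (\<delta> * y$2) *\<^sub>R \<nu>" for y :: point
  have h1: "h (B 0 + A x) = x" for x using B_inverse[of x] by (simp add: h_def B_eq_A[symmetric])
  have h2: "B 0 + A (h y) = y" for y unfolding B_eq_A[symmetric] h_def B_of by (simp add: vec_eq_iff forall_2)
  have ch: "continuous_on UNIV h" unfolding h_def by (intro continuous_intros)
  from has_integral_affine[OF linear_A h1 h2 ch D, of f "LINT y|lebesgue. f y"] assms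
  have "integrable lebesgue (\<lambda>x. 1 / (\<rho> * \<delta>) * f (B x))" "(LINT x|lebesgue. 1 / (\<rho> * \<delta>) * f (B x)) = (LINT y|lebesgue. f y)"
    unfolding B_eq_A[symmetric] by blast+
  note * = this
  show "integrable lebesgue (\<lambda>x. f (B x))" 
    using integrable_mult_right[OF *(1), where c="\<rho> * \<delta>"] \<rho> \<delta> by simp
  show "(LINT x|lebesgue. f (B x)) = \<rho> * \<delta> * (LINT y|lebesgue. f y)"
    using *(2) \<rho> \<delta> by (simp add: field_simps)
qed

lemma indicator_B: "indicator upper (B x) = (indicator (half_plane m \<nu>) x :: real)"
  using B_upper[of x] by (simp add: indicator_def)

lemma integral_half_plane_B:
  assumes "ref f"
  shows "integrable lebesgue (\<lambda>x. indicator (half_plane m \<nu>) x * f (B x))"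
   "(LINT x|lebesgue. indicator (half_plane m \<nu>) x * f (B x)) = \<rho> * \<delta> * (LINT y|lebesgue. indicator upper y * f y)"
  using integral_B[OF ref_integrable_upper[OF assms]] unfolding indicator_B by auto

definition box :: "point set" where "box = {x. \<bar>(x - m) \<bullet> \<tau>\<bar> \<le> \<rho> \<and> \<bar>(x - m) \<bullet> \<nu>\<bar> \<le> \<delta>}"

lemma ref_B_box: "ref f \<Longrightarrow> f (B x) \<noteq> 0 \<Longrightarrow> x \<in> box"
proof -
  assume "ref f" "f (B x) \<noteq> 0"
  then have "\<bar>B x $ 1\<bar> \<le> 1" "\<bar>B x $ 2\<bar> \<le> 1" unfolding ref_def by blast+
  then show ?thesis using \<rho> \<delta> by (simp add: box_def abs_divide divide_le_eq)
qed

lemma box_norm: "x \<in> box \<Longrightarrow> norm x \<le> norm m + \<rho> + \<delta>"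
proof -
  assume x: "x \<in> box"
  have "norm x = norm (m + (((x - m) \<bullet> \<tau>) *\<^sub>R \<tau> + ((x - m) \<bullet> \<nu>) *\<^sub>R \<nu>))" using expand[of "x - m"] by simp
  also have "\<dots> \<le> norm m + (norm (((x - m) \<bullet> \<tau>) *\<^sub>R \<tau>) + norm (((x - m) \<bullet> \<nu>) *\<^sub>R \<nu>))"
    by (meson add_left_mono norm_triangle_ineq order_trans)
  also have "\<dots> \<le> norm m + (\<rho> + \<delta>)" using x norm_\<tau> norm_\<nu> by (auto simp: box_def)
  finally show ?thesis by simp
qed

lemma compact_box: "compact box"
proof -
  have "closed box" unfolding box_def by (intro closed_Collect_conj closed_Collect_le continuous_intros)
  moreover have "bounded box" using box_norm by (auto simp: bounded_iff)
  ultimately show ?thesis by (simp add: compact_eq_bounded_closed)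
qed

lemma ref_B_test_function:
  assumes "ref f" "box \<subseteq> \<Omega>"
  shows "(\<lambda>x. f (B x)) \<in> test_functions \<Omega>"
proof -
  have c: "{x. f (B x) \<noteq> 0} \<subseteq> box" using ref_B_box[OF assms(1)] by auto
  then have "closure {x. f (B x) \<noteq> 0} \<subseteq> box"
    using compact_box by (intro closure_minimal) (auto intro: compact_imp_closed)
  moreover have "smooth (\<lambda>x. f (B x))" using assms(1) ref_def elementary_B elementary_smooth by blast
  ultimately show ?thesis using assms(2) compact_box c unfolding test_functions_def
    by (auto simp: compact_closure intro: bounded_subset[OF compact_imp_bounded])
qed

text \<open>The value does not involve the parameters of the frame, so the same numbers
  \<open>frame.nrm\<close> serve all edges and both box heights.\<close>

definition nrm :: "(point \<Rightarrow> real) \<Rightarrow> real" where "nrm f = sqrt (LINT y|lebesgue. (f y)\<^sup>2)"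

lemma integral_mult_B_le:
  assumes "ref f" "e \<in> borel_measurable lebesgue" "integrable lebesgue (\<lambda>x. (e x)\<^sup>2)"
  shows "integrable lebesgue (\<lambda>x. e x * f (B x))"
    "\<bar>LINT x|lebesgue. e x * f (B x)\<bar> \<le> sqrt (LINT x|lebesgue. (e x)\<^sup>2) * (sqrt (\<rho> * \<delta>) * nrm f)"
proof -
  have f2: "integrable lebesgue (\<lambda>y. (f y)\<^sup>2)"
    using ref_integrable[OF ref_mult[of f f]] assms(1) by (simp add: ref_def power2_eq_square)
  have m: "(\<lambda>x. f (B x)) \<in> borel_measurable lebesgue"
    using integral_B(1)[OF ref_integrable[OF assms(1)]] by auto
  have s: "sqrt (LINT x|lebesgue. (f (B x))\<^sup>2) = sqrt (\<rho> * \<delta>) * nrm f"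
    using integral_B(2)[OF f2] by (simp add: nrm_def real_sqrt_mult)
  show "integrable lebesgue (\<lambda>x. e x * f (B x))"
    "\<bar>LINT x|lebesgue. e x * f (B x)\<bar> \<le> sqrt (LINT x|lebesgue. (e x)\<^sup>2) * (sqrt (\<rho> * \<delta>) * nrm f)"
    using Cauchy_Schwarz_integral[OF assms(2) m assms(3) integral_B(1)[OF f2]] unfolding s by auto
qed

end

section \<open>The fundamental lemma of the calculus of variations\<close>

text \<open>Open boxes are stable under intersection and generate the Borel sets, so the integral
  over every Borel set vanishes; \<open>total\<close> provides the complements. The sets where the
  function is positive or negative then show that it is zero.\<close>

lemma AE_zero_if_box_integrals_zero:
  fixes g :: "point \<Rightarrow> real"
  assumes int: "integrable lebesgue g" and total: "(LINT x|lebesgue. g x) = 0"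
    and zero: "\<And>a b. (LINT x|lebesgue. indicator (box a b) x * g x) = 0"
  shows "AE x in lebesgue. g x = 0"
proof -
  let ?G = "range (\<lambda>(a, b). box a b :: point set)"
  have ii: "integrable lebesgue (\<lambda>x. indicator S x * g x)" if "S \<in> sets lebesgue" for S
    using integrable_mult_indicator[OF that int] by simp
  have P: "(LINT x|lebesgue. indicator S x * g x) = 0" if "S \<in> sets borel" for S
  proof -
    have stable: "Int_stable ?G" unfolding Int_stable_def by (auto simp: box_Int_box)
    have G: "?G \<subseteq> Pow UNIV" by simp
    have S: "S \<in> sigma_sets UNIV ?G" using that unfolding borel_eq_box by simp
    have leb: "A \<in> sets lebesgue" if "A \<in> sigma_sets UNIV ?G" for A
    proof -
      have "A \<in> sets borel" using that unfolding borel_eq_box by simp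
      then show ?thesis by simp
    qed
    show ?thesis
      using stable G S
    proof (induction rule: sigma_sets_induct_disjoint)
      case (compl A)
      have "(LINT x|lebesgue. indicator (UNIV - A) x * g x) = (LINT x|lebesgue. g x - indicator A x * g x)"
        by (intro Bochner_Integration.integral_cong) (auto simp: indicator_def)
      also have "\<dots> = 0" using compl total ii[OF leb[OF compl(1)]] int by simp
      finally show ?case .
    next
      case (union A)
      have A: "A i \<in> sets lebesgue" for i using union leb by auto
      have "(LINT x:(\<Union>i. A i)|lebesgue. g x) = (\<Sum>i. (LINT x:(A i)|lebesgue. g x))"
      proof (rule lebesgue_integral_countable_add[OF A])
        show "A i \<inter> A j = {}" if "i \<noteq> j" for i j using union(1) that by (auto simp: disjoint_family_on_def)
        show "set_integrable lebesgue (\<Union>i. A i) g" using ii[of "\<Union>i. A i"] A by (auto simp: set_integrable_def)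
      qed
      then show ?case using union(3) by (simp add: set_lebesgue_integral_def)
    qed (use zero in auto)
  qed
  \<comment> \<open>\<open>P\<close> applies to Borel sets only, so the sets of positivity are
    formed with a Borel representative of \<open>g\<close>.\<close>
  obtain h where h: "h \<in> borel_measurable lborel" "AE x in lborel. g x = h x"
    using completion_ex_borel_measurable_real[of g lborel] int by auto
  have gh: "AE x in lebesgue. g x = h x" using AE_completion[OF h(2)] .
  have one_sided: "AE x in lebesgue. c * g x \<le> 0" if c: "c = 1 \<or> c = - 1" for c :: real
  proof -
    let ?S = "{x. c * h x > 0}"
    have [measurable]: "h \<in> borel_measurable borel" using h(1) by simp
    have S: "?S \<in> sets borel" by measurable
    have "(LINT x|lebesgue. indicator ?S x * (c * g x)) = c * (LINT x|lebesgue. indicator ?S x * g x)"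
      by (subst integral_mult_right_zero[symmetric]) (auto simp: ac_simps)
    then have z: "(LINT x|lebesgue. indicator ?S x * (c * g x)) = 0" using P[OF S] by simp
    have "integrable lebesgue (\<lambda>x. c * (indicator ?S x * g x))" using S ii by auto
    then have I: "integrable lebesgue (\<lambda>x. indicator ?S x * (c * g x))" by (simp add: ac_simps)
    have nn: "AE x in lebesgue. 0 \<le> indicator ?S x * (c * g x)"
      using gh by eventually_elim (auto simp: indicator_def)
    have "AE x in lebesgue. indicator ?S x * (c * g x) = 0"
      using integral_nonneg_eq_0_iff_AE[OF I nn] z by simp
    with gh show ?thesis
    proof eventually_elim
      case (elim x)
      then show ?case by (cases "x \<in> ?S") auto
    qed
  qed
  show ?thesis
    using one_sided[of 1, simplified] one_sided[of "- 1", simplified] by eventually_elim auto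
qed

section \<open>Test functions, and uniqueness of weak derivatives\<close>

lemma integral_lebesgue_on:
  fixes h :: "point \<Rightarrow> real"
  assumes "A \<in> sets lebesgue" "\<And>x. x \<notin> A \<Longrightarrow> h x = 0"
  shows "(LINT x|lebesgue_on A. h x) = (LINT x|lebesgue. h x)"
    and "integrable (lebesgue_on A) h \<longleftrightarrow> integrable lebesgue h"
proof -
  have "(\<lambda>x. indicator A x *\<^sub>R h x) = h" using assms(2) by (force simp: indicator_def)
  then show "(LINT x|lebesgue_on A. h x) = (LINT x|lebesgue. h x)"
     "integrable (lebesgue_on A) h \<longleftrightarrow> integrable lebesgue h"
    using assms(1) by (simp_all add: integral_restrict_space integrable_restrict_space)
qed

lemma test_function_support:
  assumes "\<phi> \<in> test_functions \<Omega>"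
  obtains K where "compact K" "K \<subseteq> \<Omega>" "\<And>x. \<phi> x \<noteq> 0 \<Longrightarrow> x \<in> K"
  using that[of "closure {x. \<phi> x \<noteq> 0}"] assms closure_subset[of "{x. \<phi> x \<noteq> 0}"]
  unfolding test_functions_def by blast

lemma test_functions_pd: "\<phi> \<in> test_functions \<Omega> \<Longrightarrow> pd i \<phi> \<in> test_functions \<Omega>"
proof -
  assume \<phi>: "\<phi> \<in> test_functions \<Omega>"
  have s: "pd i \<phi> x \<noteq> 0 \<Longrightarrow> x \<in> closure {x. \<phi> x \<noteq> 0}" for x
    by (rule pd_outside_support[of \<phi>]) (use closure_subset[of "{x. \<phi> x \<noteq> 0}"] in auto)
  then have "closure {x. pd i \<phi> x \<noteq> 0} \<subseteq> closure {x. \<phi> x \<noteq> 0}"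
    by (intro closure_minimal) auto
  moreover have "bounded {x. pd i \<phi> x \<noteq> 0}"
    using \<phi> s by (intro bounded_subset[of "closure {x. \<phi> x \<noteq> 0}" "{x. pd i \<phi> x \<noteq> 0}"])
      (auto simp: test_functions_def intro: compact_imp_bounded)
  ultimately show ?thesis using \<phi> by (auto simp: test_functions_def smooth_pd compact_closure)
qed

lemma test_functions_mono: "\<Omega> \<subseteq> \<Omega>' \<Longrightarrow> test_functions \<Omega> \<subseteq> test_functions \<Omega>'"
  by (auto simp: test_functions_def)

lemma integrable_locally_test:
  assumes "locally_integrable \<Omega> g" "\<phi> \<in> test_functions \<Omega>"
  shows "integrable lebesgue (\<lambda>x. g x * \<phi> x)"
proof -
  obtain K where K: "compact K" "K \<subseteq> \<Omega>" "\<And>x. \<phi> x \<noteq> 0 \<Longrightarrow> x \<in> K" using test_function_support[OF assms(2)] by blast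
  have Kl: "K \<in> sets lebesgue" using K(1) by (simp add: lmeasurable_compact fmeasurableD)
  have c: "continuous_on UNIV \<phi>" using assms(2) by (auto simp: test_functions_def intro: smooth_continuous)
  have "compact (\<phi> ` K)" using K(1) c by (intro compact_continuous_image) (auto intro: continuous_on_subset)
  then have "\<exists>b. \<forall>x\<in>K. \<bar>\<phi> x\<bar> \<le> b" by (auto dest!: compact_imp_bounded simp: bounded_iff)
  then obtain b where b: "\<And>x. x \<in> K \<Longrightarrow> \<bar>\<phi> x\<bar> \<le> b" by blast
  have gK: "integrable (lebesgue_on K) g" using assms(1) K by (auto simp: locally_integrable_def)
  have "integrable (lebesgue_on K) (\<lambda>x. g x * \<phi> x)"
  proof (rule Bochner_Integration.integrable_bound[OF integrable_mult_left[OF gK, of b]])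
    have "\<phi> \<in> borel_measurable (lebesgue_on K)"
      using borel_measurable_continuous_onI[OF c] by (intro measurable_restrict_space1 measurable_completion) simp
    then show "(\<lambda>x. g x * \<phi> x) \<in> borel_measurable (lebesgue_on K)" using gK by measurable
    show "AE x in lebesgue_on K. norm (g x * \<phi> x) \<le> norm (g x * b)"
    proof (rule AE_I2)
      fix x assume "x \<in> space (lebesgue_on K)"
      then have "\<bar>\<phi> x\<bar> \<le> \<bar>b\<bar>" using b[of x] by simp
      then show "norm (g x * \<phi> x) \<le> norm (g x * b)" by (simp add: abs_mult mult_left_mono)
    qed
  qed
  moreover have "g x * \<phi> x = 0" if "x \<notin> K" for x using K(3)[of x] that by auto
  ultimately show ?thesis using integral_lebesgue_on(2)[OF Kl, of "\<lambda>x. g x * \<phi> x"] by blast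
qed

lemma test_integral_lebesgue_on:
  assumes "\<Omega> \<in> sets lebesgue" "\<phi> \<in> test_functions \<Omega>"
  shows "(LINT x|lebesgue_on \<Omega>. g x * \<phi> x) = (LINT x|lebesgue. g x * \<phi> x)"
proof -
  obtain K where "K \<subseteq> \<Omega>" "\<And>x. \<phi> x \<noteq> 0 \<Longrightarrow> x \<in> K" using test_function_support[OF assms(2)] by blast
  then have "g x * \<phi> x = 0" if "x \<notin> \<Omega>" for x using that by (metis mult_zero_right subsetD)
  then show ?thesis using assms(1) by (intro integral_lebesgue_on)
qed

lemma fundamental_lemma:
  fixes d :: "point \<Rightarrow> real"
  assumes \<Omega>: "open \<Omega>" and d: "locally_integrable \<Omega> d"
    and zero: "\<And>\<phi>. \<phi> \<in> test_functions \<Omega> \<Longrightarrow> (LINT x|lebesgue. d x * \<phi> x) = 0"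
  shows "AE x in lebesgue. x \<in> \<Omega> \<longrightarrow> d x = 0"
proof -
  have box_zero: "(LINT x|lebesgue. indicator (box a b) x * d x) = 0" if ab: "cbox a b \<subseteq> \<Omega>" for a b
  proof -
    \<comment> \<open>For t > 0 the value exp(- 1/(n t)) tends to 1, otherwise \<open>flat\<close>
      is 0. The products are smooth and converge boundedly to the indicator of the open box.\<close>
    define \<phi> where "\<phi> n x = (flat 0 (real n * (x$1 - a$1)) * flat 0 (real n * (b$1 - x$1))) *
       (flat 0 (real n * (x$2 - a$2)) * flat 0 (real n * (b$2 - x$2)))" for n and x :: point
    have e1: "elementary (\<lambda>x. flat 0 (real n * (x$i - a$i)))" for n i
      using elementary.flat[of 0 "- real n * a$i" "axis i (real n)"] by (simp add: inner_axis algebra_simps)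
    have e2: "elementary (\<lambda>x. flat 0 (real n * (b$i - x$i)))" for n i
      using elementary.flat[of 0 "real n * b$i" "axis i (- real n)"] by (simp add: inner_axis algebra_simps)
    have sup: "x \<in> cbox a b" if "\<phi> n x \<noteq> 0" for n x
      using that by (auto simp: \<phi>_def flat_def mem_box_cart forall_2 zero_less_mult_iff split: if_splits)
    have t: "\<phi> n \<in> test_functions \<Omega>" for n
    proof -
      have "smooth (\<phi> n)" unfolding \<phi>_def by (intro elementary_smooth elementary.mult e1 e2)
      moreover have s: "{x. \<phi> n x \<noteq> 0} \<subseteq> cbox a b" using sup by auto
      then have "closure {x. \<phi> n x \<noteq> 0} \<subseteq> cbox a b" by (intro closure_minimal) auto
      ultimately show ?thesis using ab bounded_subset[OF bounded_cbox s]
        by (auto simp: test_functions_def compact_closure)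
    qed
    have dQ: "integrable lebesgue (\<lambda>x. indicator (cbox a b) x * d x)"
      using d ab integrable_restrict_space[of "cbox a b" lebesgue d] by (simp add: locally_integrable_def)
    have "(\<lambda>n. LINT x|lebesgue. d x * \<phi> n x) \<longlonglongrightarrow> (LINT x|lebesgue. indicator (box a b) x * d x)"
    proof (rule integral_dominated_convergence)
      have "integrable lebesgue (\<lambda>x. indicator (box a b) x * (indicator (cbox a b) x * d x))"
        using integrable_mult_indicator[OF _ dQ, of "box a b"] by simp
      moreover have "(\<lambda>x. indicator (box a b) x * (indicator (cbox a b) x * d x)) = (\<lambda>x. indicator (box a b) x * d x)"
        using box_subset_cbox[of a b] by (auto simp: indicator_def fun_eq_iff)
      ultimately show "(\<lambda>x. indicator (box a b) x * d x) \<in> borel_measurable lebesgue"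
        using borel_measurable_integrable by metis
      show "(\<lambda>x. d x * \<phi> n x) \<in> borel_measurable lebesgue" for n
        using integrable_locally_test[OF d t] by blast
      show "integrable lebesgue (\<lambda>x. norm (indicator (cbox a b) x * d x))" using dQ by (rule integrable_norm)
      show "AE x in lebesgue. norm (d x * \<phi> n x) \<le> norm (indicator (cbox a b) x * d x)" for n
      proof (rule AE_I2)
        fix x
        have f1: "flat 0 t \<le> 1" for t by (simp add: flat_def)
        have "0 \<le> \<phi> n x" "\<phi> n x \<le> 1" unfolding \<phi>_def
          by (intro mult_nonneg_nonneg flat_nonneg) (intro mult_le_one mult_nonneg_nonneg flat_nonneg f1)
        then have "\<bar>d x\<bar> * \<bar>\<phi> n x\<bar> \<le> \<bar>d x\<bar> * 1" by (intro mult_left_mono) auto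
        then show "norm (d x * \<phi> n x) \<le> norm (indicator (cbox a b) x * d x)"
          using sup[of n x] by (cases "\<phi> n x = 0") (auto simp: abs_mult)
      qed
      have f2: "(\<lambda>n. flat 0 (real n * t)) \<longlonglongrightarrow> (if t > 0 then 1 else 0)" for t
      proof (cases "t > 0")
        case True
        have "(\<lambda>n. inverse (real n)) \<longlonglongrightarrow> 0" by (rule lim_inverse_n)
        then have "(\<lambda>n. exp (- (1 / t) * inverse (real n))) \<longlonglongrightarrow> exp (- (1 / t) * 0)" by (intro tendsto_intros)
        then have "(\<lambda>n. exp (- (1 / t) * inverse (real n))) \<longlonglongrightarrow> 1" by simp
        then have "(\<lambda>n. flat 0 (real n * t)) \<longlonglongrightarrow> 1"
          by (rule Lim_transform_eventually)
             (use True in \<open>auto intro!: eventually_mono[OF eventually_gt_at_top[of 0]] simp: flat_def field_simps\<close>)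
        then show ?thesis using True by simp
      next
        case False
        then have "flat 0 (real n * t) = 0" for n by (simp add: flat_def zero_less_mult_iff)
        then show ?thesis using False by simp
      qed
      have "(\<lambda>n. d x * \<phi> n x) \<longlonglongrightarrow> d x * (((if x$1 - a$1 > 0 then 1 else 0) * (if b$1 - x$1 > 0 then 1 else 0)) *
         ((if x$2 - a$2 > 0 then 1 else 0) * (if b$2 - x$2 > 0 then 1 else 0)))" for x
        unfolding \<phi>_def by (intro tendsto_mult tendsto_const f2)
      moreover have "d x * (((if x$1 - a$1 > 0 then 1 else 0) * (if b$1 - x$1 > 0 then 1 else 0)) *
         ((if x$2 - a$2 > 0 then 1 else 0) * (if b$2 - x$2 > 0 then 1 else 0))) = indicator (box a b) x * d x" for x
        by (simp add: indicator_def mem_box_cart forall_2)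
      ultimately show "AE x in lebesgue. (\<lambda>n. d x * \<phi> n x) \<longlonglongrightarrow> indicator (box a b) x * d x"
        by (intro AE_I2) (simp only:)
    qed
    then show ?thesis using zero[OF t] by (simp add: LIMSEQ_const_iff)
  qed
  have cbox_AE: "AE x in lebesgue. x \<in> box a b \<longrightarrow> d x = 0" if ab: "cbox a b \<subseteq> \<Omega>" for a b
  proof -
    let ?g = "\<lambda>x. indicator (box a b) x * d x"
    have "integrable lebesgue (\<lambda>x. indicator (cbox a b) x * d x)"
      using d ab integrable_restrict_space[of "cbox a b" lebesgue d] by (simp add: locally_integrable_def)
    then have "integrable lebesgue (\<lambda>x. indicator (box a b) x * (indicator (cbox a b) x * d x))"
      using integrable_mult_indicator[of "box a b" lebesgue "\<lambda>x. indicator (cbox a b) x * d x"] by simp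
    moreover have "(\<lambda>x. indicator (box a b) x * (indicator (cbox a b) x * d x)) = ?g"
      using box_subset_cbox[of a b] by (auto simp: indicator_def fun_eq_iff)
    ultimately have int: "integrable lebesgue ?g" by simp
    have "AE x in lebesgue. ?g x = 0"
    \<comment> \<open>Cutting off by the box keeps the hypothesis intact: the intersection of two
      boxes is a box whose closure again lies in \<Omega>.\<close>
    proof (rule AE_zero_if_box_integrals_zero[OF int box_zero[OF ab]])
      fix c e
      obtain a' b' where ab': "box c e \<inter> box a b = box a' b'"
        using box_Int_box[of c e a b] by blast
      have "(LINT x|lebesgue. indicator (box c e) x * ?g x) = (LINT x|lebesgue. indicator (box a' b') x * d x)"
        unfolding ab'[symmetric] by (simp add: indicator_inter_arith mult.assoc)
      also have "\<dots> = 0"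
      proof (cases "box a' b' = {}")
        case False
        have "cbox a' b' = closure (box a' b')" using closure_box[OF False] by simp
        also have "\<dots> \<subseteq> closure (box a b)" using ab' by (intro closure_mono) auto
        also have "\<dots> \<subseteq> cbox a b" by (intro closure_minimal box_subset_cbox closed_cbox)
        finally show ?thesis using box_zero ab by blast
      qed simp
      finally show "(LINT x|lebesgue. indicator (box c e) x * ?g x) = 0" .
    qed
    then show ?thesis by eventually_elim (auto simp: indicator_def)
  qed
  \<comment> \<open>Countably many closed boxes exhaust \<Omega>, so their exceptional sets unite to
    a null set; the boundaries of the boxes are null as well.\<close>
  obtain D where D: "countable D" "\<And>X. X \<in> D \<Longrightarrow> \<exists>a b. X = cbox a b" "D \<subseteq> Pow \<Omega>" "\<Union>D = \<Omega>"
    using open_countable_Union_open_cbox[OF \<Omega>] by metis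
  have "AE x in lebesgue. \<forall>X\<in>D. x \<in> X \<longrightarrow> d x = 0"
  proof (subst AE_ball_countable[OF D(1)], intro ballI)
    fix X assume X: "X \<in> D"
    then obtain a b where ab: "X = cbox a b" using D(2) by blast
    have "AE x in lebesgue. x \<notin> cbox a b - box a b"
      by (intro AE_not_in) (simp add: negligible_iff_null_sets[symmetric] negligible_frontier_interval)
    moreover have "AE x in lebesgue. x \<in> box a b \<longrightarrow> d x = 0" using cbox_AE D(3) X ab by blast
    ultimately show "AE x in lebesgue. x \<in> X \<longrightarrow> d x = 0" unfolding ab by eventually_elim auto
  qed
  then show ?thesis by eventually_elim (use D(4) in auto)
qed

lemma has_weak_pd_lebesgue:
  assumes "open \<Omega>"
  shows "has_weak_pd \<Omega> v i g \<longleftrightarrow> locally_integrable \<Omega> v \<and> locally_integrable \<Omega> g \<and>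
     (\<forall>\<phi>\<in>test_functions \<Omega>. (LINT x|lebesgue. v x * pd i \<phi> x) = - (LINT x|lebesgue. g x * \<phi> x))"
proof -
  have \<Omega>: "\<Omega> \<in> sets lebesgue" using assms by auto
  show ?thesis unfolding has_weak_pd_def
    by (simp add: test_integral_lebesgue_on[OF \<Omega>] test_functions_pd)
qed

lemma locally_integrable_diff:
  "locally_integrable \<Omega> f \<Longrightarrow> locally_integrable \<Omega> g \<Longrightarrow> locally_integrable \<Omega> (\<lambda>x. f x - g x)"
  by (auto simp: locally_integrable_def)

lemma has_weak_pd_unique:
  assumes \<Omega>: "open \<Omega>" and v: "AE x in lebesgue. x \<in> \<Omega> \<longrightarrow> v x = v' x"
    and g: "has_weak_pd \<Omega> v i g" and g': "has_weak_pd \<Omega> v' i g'"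
  shows "AE x in lebesgue. x \<in> \<Omega> \<longrightarrow> g x = g' x"
proof -
  have l: "locally_integrable \<Omega> v" "locally_integrable \<Omega> v'" "locally_integrable \<Omega> g" "locally_integrable \<Omega> g'"
    using g g' by (auto simp: has_weak_pd_def)
  have "AE x in lebesgue. x \<in> \<Omega> \<longrightarrow> g x - g' x = 0"
  proof (rule fundamental_lemma[OF \<Omega> locally_integrable_diff[OF l(3,4)]])
    fix \<phi> assume \<phi>: "\<phi> \<in> test_functions \<Omega>"
    have i: "integrable lebesgue (\<lambda>x. g x * \<phi> x)" "integrable lebesgue (\<lambda>x. g' x * \<phi> x)"
      using l integrable_locally_test \<phi> by auto
    have "(LINT x|lebesgue. (g x - g' x) * \<phi> x) = (LINT x|lebesgue. g x * \<phi> x) - (LINT x|lebesgue. g' x * \<phi> x)"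
      using i by (simp add: left_diff_distrib)
    also have "\<dots> = - (LINT x|lebesgue. v x * pd i \<phi> x) + (LINT x|lebesgue. v' x * pd i \<phi> x)"
      using g g' \<phi> unfolding has_weak_pd_lebesgue[OF \<Omega>] by simp
    also have "(LINT x|lebesgue. v x * pd i \<phi> x) = (LINT x|lebesgue. v' x * pd i \<phi> x)"
    proof (rule integral_cong_AE)
      show "AE x in lebesgue. v x * pd i \<phi> x = v' x * pd i \<phi> x"
        using v
      proof eventually_elim
        case (elim x)
        obtain K where "K \<subseteq> \<Omega>" "\<And>x. pd i \<phi> x \<noteq> 0 \<Longrightarrow> x \<in> K"
          using test_function_support[OF test_functions_pd[OF \<phi>]] by metis
        then show ?case using elim by (cases "pd i \<phi> x = 0") auto
      qed
    qed (use l integrable_locally_test test_functions_pd[OF \<phi>] in blast)+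
    finally show "(LINT x|lebesgue. (g x - g' x) * \<phi> x) = 0" by simp
  qed
  then show ?thesis by eventually_elim auto
qed

section \<open>Weak derivatives of functions in the Sobolev space\<close>

text \<open>Completeness of the measure: the preimages under both functions differ by subsets of a
  null set.\<close>

lemma borel_measurable_lebesgue_AE:
  fixes f g :: "point \<Rightarrow> real"
  assumes f: "f \<in> borel_measurable lebesgue" and eq: "AE x in lebesgue. f x = g x"
  shows "g \<in> borel_measurable lebesgue"
proof -
  obtain h where h: "h \<in> borel_measurable lborel" "AE x in lborel. f x = h x"
    using completion_ex_borel_measurable_real[OF f] by blast
  have "AE x in lebesgue. h x = g x"
    using eq AE_completion[OF h(2)] by eventually_elim simp
  then obtain N where N: "N \<in> null_sets lebesgue" "{x. h x \<noteq> g x} \<subseteq> N"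
    by (auto simp: eventually_ae_filter)
  show ?thesis
  proof (rule measurableI)
    fix S :: "real set" assume S: "S \<in> sets borel"
    have "g -` S = (h -` S - N) \<union> (g -` S \<inter> N)"
    proof -
      have "h x = g x" if "x \<notin> N" for x using N(2) that by blast
      then show ?thesis by auto
    qed
    moreover have "h -` S \<in> sets lebesgue"
      using measurable_sets[OF measurable_completion[OF h(1)] S] by simp
    moreover have "g -` S \<inter> N \<in> sets lebesgue"
      using null_sets_completion_subset[OF _ N(1), of "g -` S \<inter> N"] by auto
    moreover have "h -` S - N \<in> sets lebesgue" using calculation(2) null_setsD2[OF N(1)] by (rule sets.Diff)
    ultimately have "g -` S \<in> sets lebesgue" using sets.Un[of "h -` S - N" lebesgue "g -` S \<inter> N"] by simp
    then show "g -` S \<inter> space lebesgue \<in> sets lebesgue" by simp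
  qed auto
qed

lemma integral_lebesgue_AE:
  fixes f g :: "point \<Rightarrow> real"
  assumes f: "f \<in> borel_measurable lebesgue" and eq: "AE x in lebesgue. f x = g x"
  shows "(LINT x|lebesgue. f x) = (LINT x|lebesgue. g x)" "integrable lebesgue f \<longleftrightarrow> integrable lebesgue g"
  by (rule integral_cong_AE[OF f borel_measurable_lebesgue_AE[OF assms] eq],
      rule integrable_cong_AE[OF f borel_measurable_lebesgue_AE[OF assms] eq])

lemma integral_lebesgue_on_indicator:
  fixes h :: "point \<Rightarrow> real"
  assumes "A \<in> sets lebesgue"
  shows "(LINT x|lebesgue_on A. h x) = (LINT x|lebesgue. indicator A x * h x)"
    and "integrable (lebesgue_on A) h \<longleftrightarrow> integrable lebesgue (\<lambda>x. indicator A x * h x)"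
  using integral_restrict_space[of A lebesgue h] integrable_restrict_space[of A lebesgue h] assms by simp_all

text \<open>All functions live on the whole plane and are cut off by indicators, so that
  contributions of neighbouring triangles, of half planes and of \<Omega> can be added in one
  space.\<close>

definition sq_int :: "(point \<Rightarrow> real) \<Rightarrow> bool" where
  "sq_int e \<longleftrightarrow> e \<in> borel_measurable lebesgue \<and> integrable lebesgue (\<lambda>x. (e x)\<^sup>2)"

lemma sq_int_mult: "sq_int e \<Longrightarrow> sq_int f \<Longrightarrow> integrable lebesgue (\<lambda>x. e x * f x)"
  unfolding sq_int_def by (rule Cauchy_Schwarz_integral(1)) simp_all

lemma sq_int_lin:
  assumes "sq_int e" "sq_int f"
  shows "sq_int (\<lambda>x. a * e x + b * f x)"
proof -
  have m: "(\<lambda>x. a * e x + b * f x) \<in> borel_measurable lebesgue" using assms by (auto simp: sq_int_def)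
  have "(\<lambda>x. (a * e x + b * f x)\<^sup>2) = (\<lambda>x. a\<^sup>2 * (e x)\<^sup>2 + (2 * a * b) * (e x * f x) + b\<^sup>2 * (f x)\<^sup>2)"
    by (simp add: power2_sum power_mult_distrib algebra_simps)
  moreover have "integrable lebesgue \<dots>"
    using assms sq_int_mult[OF assms] unfolding sq_int_def by (intro Bochner_Integration.integrable_add integrable_mult_right) auto
  ultimately show ?thesis using m by (simp add: sq_int_def)
qed

lemma sq_int_diff: "sq_int e \<Longrightarrow> sq_int f \<Longrightarrow> sq_int (\<lambda>x. e x - f x)"
  using sq_int_lin[of e f 1 "- 1"] by simp

lemma sq_int_add: "sq_int e \<Longrightarrow> sq_int f \<Longrightarrow> sq_int (\<lambda>x. e x + f x)"
  using sq_int_lin[of e f 1 1] by simp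

lemma sq_int_cmult: "sq_int e \<Longrightarrow> sq_int (\<lambda>x. c * e x)"
  using sq_int_lin[of e e c 0] by simp

lemma sq_int_indicator:
  assumes "sq_int e" "S \<in> sets lebesgue"
  shows "sq_int (\<lambda>x. indicator S x * e x)"
proof -
  have "(\<lambda>x. (indicator S x * e x)\<^sup>2) = (\<lambda>x. indicator S x * (e x)\<^sup>2)"
    by (auto simp: indicator_def fun_eq_iff)
  then show ?thesis using assms integrable_mult_indicator[of S lebesgue "\<lambda>x. (e x)\<^sup>2"]
    unfolding sq_int_def by auto
qed

lemma sq_int_AE: "sq_int e \<Longrightarrow> AE x in lebesgue. e x = f x \<Longrightarrow> sq_int f"
  unfolding sq_int_def
proof safe
  assume e: "e \<in> borel_measurable lebesgue" "integrable lebesgue (\<lambda>x. (e x)\<^sup>2)" "AE x in lebesgue. e x = f x"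
  show "f \<in> borel_measurable lebesgue" using borel_measurable_lebesgue_AE e by blast
  have "AE x in lebesgue. (e x)\<^sup>2 = (f x)\<^sup>2" using e(3) by eventually_elim simp
  from integral_lebesgue_AE(2)[OF _ this] show "integrable lebesgue (\<lambda>x. (f x)\<^sup>2)" using e by auto
qed

lemma sq_int_continuous:
  assumes "continuous_on UNIV f" "\<And>x. f x \<noteq> 0 \<Longrightarrow> norm x \<le> R"
  shows "sq_int f"
  unfolding sq_int_def
proof
  show "f \<in> borel_measurable lebesgue" using integrable_compact_support[OF assms] by auto
  show "integrable lebesgue (\<lambda>x. (f x)\<^sup>2)"
    by (rule integrable_compact_support[where R=R]) (use assms in \<open>auto intro!: continuous_intros\<close>)
qed

lemma test_function_bounded_support:
  assumes "\<phi> \<in> test_functions \<Omega>"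
  obtains R where "\<And>x. \<phi> x \<noteq> 0 \<Longrightarrow> norm x \<le> R"
proof -
  obtain K where K: "compact K" "\<And>x. \<phi> x \<noteq> 0 \<Longrightarrow> x \<in> K" using test_function_support[OF assms] by metis
  obtain R where "\<And>x. x \<in> K \<Longrightarrow> norm x \<le> R" using compact_imp_bounded[OF K(1)] by (auto simp: bounded_iff)
  then show ?thesis using that K(2) by blast
qed

lemma test_function_smooth: "\<phi> \<in> test_functions \<Omega> \<Longrightarrow> smooth \<phi>"
  by (simp add: test_functions_def)

lemma sq_int_test: "\<phi> \<in> test_functions \<Omega> \<Longrightarrow> sq_int \<phi>"
proof -
  assume \<phi>: "\<phi> \<in> test_functions \<Omega>"
  obtain R where "\<And>x. \<phi> x \<noteq> 0 \<Longrightarrow> norm x \<le> R" using test_function_bounded_support[OF \<phi>] by blast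
  with smooth_continuous[OF test_function_smooth[OF \<phi>]] show ?thesis by (rule sq_int_continuous)
qed

lemma locally_integrable_smooth:
  assumes "smooth p"
  shows "locally_integrable U p"
  unfolding locally_integrable_def
proof (intro allI impI)
  fix K assume K: "compact K \<and> K \<subseteq> U"
  then have "integrable lborel (\<lambda>x. indicator K x *\<^sub>R p x)"
    using smooth_continuous[OF assms] by (intro borel_integrable_compact) auto
  then have "integrable lebesgue (\<lambda>x. indicator K x *\<^sub>R p x)" by (simp add: integrable_completion)
  moreover have "K \<in> sets lebesgue" using K by (simp add: lmeasurable_compact fmeasurableD)
  ultimately show "integrable (lebesgue_on K) p" by (simp add: integrable_restrict_space)
qed

lemma locally_integrable_mono: "locally_integrable \<Omega> g \<Longrightarrow> U \<subseteq> \<Omega> \<Longrightarrow> locally_integrable U g"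
  unfolding locally_integrable_def by (meson subset_trans)

lemma locally_integrable_AE:
  assumes g: "locally_integrable \<Omega> g" and eq: "AE x in lebesgue. x \<in> \<Omega> \<longrightarrow> g x = g' x"
  shows "locally_integrable \<Omega> g'"
  unfolding locally_integrable_def
proof (intro allI impI)
  fix K assume K: "compact K \<and> K \<subseteq> \<Omega>"
  then have Kl: "K \<in> sets lebesgue" by (simp add: lmeasurable_compact fmeasurableD)
  have i: "integrable lebesgue (\<lambda>x. indicator K x * g x)"
    using g K integral_lebesgue_on_indicator(2)[OF Kl, of g] by (auto simp: locally_integrable_def)
  have "AE x in lebesgue. indicator K x * g x = indicator K x * g' x"
    using eq by eventually_elim (use K in \<open>auto simp: indicator_def\<close>)
  from integral_lebesgue_AE(2)[OF _ this] i
  have "integrable lebesgue (\<lambda>x. indicator K x * g' x)" by auto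
  then show "integrable (lebesgue_on K) g'" using integral_lebesgue_on_indicator(2)[OF Kl] by simp
qed

lemma has_weak_pd_AE:
  assumes \<Omega>: "open \<Omega>" and v: "has_weak_pd \<Omega> v i g"
    and vv: "AE x in lebesgue. x \<in> \<Omega> \<longrightarrow> v x = v' x" and gg: "AE x in lebesgue. x \<in> \<Omega> \<longrightarrow> g x = g' x"
  shows "has_weak_pd \<Omega> v' i g'"
proof -
  have eq: "(LINT x|lebesgue. w x * \<phi> x) = (LINT x|lebesgue. w' x * \<phi> x)"
    if w: "locally_integrable \<Omega> w" "AE x in lebesgue. x \<in> \<Omega> \<longrightarrow> w x = w' x" and \<phi>: "\<phi> \<in> test_functions \<Omega>" for w w' \<phi>
  proof (rule integral_lebesgue_AE(1))
    show "(\<lambda>x. w x * \<phi> x) \<in> borel_measurable lebesgue" using integrable_locally_test[OF w(1) \<phi>] by blast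
    obtain K where "K \<subseteq> \<Omega>" "\<And>x. \<phi> x \<noteq> 0 \<Longrightarrow> x \<in> K" using test_function_support[OF \<phi>] by metis
    then have "\<phi> x = 0 \<or> x \<in> \<Omega>" for x by blast
    then show "AE x in lebesgue. w x * \<phi> x = w' x * \<phi> x"
      using w(2) by (auto elim: eventually_mono)
  qed
  have l: "locally_integrable \<Omega> v" "locally_integrable \<Omega> g" using v by (auto simp: has_weak_pd_def)
  show ?thesis
    unfolding has_weak_pd_lebesgue[OF \<Omega>]
  proof (intro conjI ballI)
    show "locally_integrable \<Omega> v'" "locally_integrable \<Omega> g'"
      using locally_integrable_AE[OF l(1) vv] locally_integrable_AE[OF l(2) gg] .
    fix \<phi> assume \<phi>: "\<phi> \<in> test_functions \<Omega>"
    show "(LINT x|lebesgue. v' x * pd i \<phi> x) = - (LINT x|lebesgue. g' x * \<phi> x)"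
      using v \<phi> unfolding has_weak_pd_lebesgue[OF \<Omega>]
      by (simp add: eq[OF l(1) vv test_functions_pd[OF \<phi>], symmetric] eq[OF l(2) gg \<phi>, symmetric])
  qed
qed

lemma has_weak_pd_smooth:
  assumes U: "open U" and p: "smooth p"
  shows "has_weak_pd U p i (pd i p)"
  unfolding has_weak_pd_lebesgue[OF U]
proof (intro conjI ballI)
  show "locally_integrable U p" "locally_integrable U (pd i p)"
    using p smooth_pd locally_integrable_smooth by auto
  fix \<phi> assume \<phi>: "\<phi> \<in> test_functions U"
  have d: "p differentiable (at x)" "\<phi> differentiable (at x)" for x
    using p \<phi> smooth_differentiable test_function_smooth by auto
  obtain R where R: "\<And>x. \<phi> x \<noteq> 0 \<Longrightarrow> norm x \<le> R" using test_function_bounded_support[OF \<phi>] by blast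
  have c: "C1_fun (\<lambda>x. p x * \<phi> x)" using p \<phi> by (intro C1_fun_mult smooth_C1_fun test_function_smooth[OF \<phi>])
  have "norm x \<le> R" if "p x * \<phi> x \<noteq> 0" for x using R that by simp
  from integral_pd_zero[OF c this] have "(LINT x|lebesgue. p x * pd i \<phi> x + pd i p x * \<phi> x) = 0" by (simp add: pd_mult d)
  moreover have "integrable lebesgue (\<lambda>x. p x * pd i \<phi> x)" "integrable lebesgue (\<lambda>x. pd i p x * \<phi> x)"
    using integrable_locally_test locally_integrable_smooth smooth_pd p \<phi> test_functions_pd by blast+
  ultimately show "(LINT x|lebesgue. p x * pd i \<phi> x) = - (LINT x|lebesgue. pd i p x * \<phi> x)" by simp
qed

lemma has_weak_pd_diff:
  assumes U: "open U" and "has_weak_pd U v i g" "has_weak_pd U w i h"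
  shows "has_weak_pd U (\<lambda>x. v x - w x) i (\<lambda>x. g x - h x)"
  unfolding has_weak_pd_lebesgue[OF U]
proof (intro conjI ballI)
  have l: "locally_integrable U v" "locally_integrable U w" "locally_integrable U g" "locally_integrable U h"
    using assms by (auto simp: has_weak_pd_def)
  show "locally_integrable U (\<lambda>x. v x - w x)" "locally_integrable U (\<lambda>x. g x - h x)"
    using l locally_integrable_diff by auto
  fix \<phi> assume \<phi>: "\<phi> \<in> test_functions U"
  note i = integrable_locally_test[OF l(1) test_functions_pd[OF \<phi>]] integrable_locally_test[OF l(2) test_functions_pd[OF \<phi>]]
    integrable_locally_test[OF l(3) \<phi>] integrable_locally_test[OF l(4) \<phi>]
  show "(LINT x|lebesgue. (v x - w x) * pd i \<phi> x) = - (LINT x|lebesgue. (g x - h x) * \<phi> x)"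
    using assms(2,3) \<phi> i unfolding has_weak_pd_lebesgue[OF U] by (simp add: left_diff_distrib)
qed

lemma has_weak_pd_mono:
  assumes "open \<Omega>" "open U" "U \<subseteq> \<Omega>" "has_weak_pd \<Omega> v i g"
  shows "has_weak_pd U v i g"
proof -
  have "locally_integrable U v" "locally_integrable U g"
    using assms(4) locally_integrable_mono[OF _ assms(3)] by (simp_all add: has_weak_pd_def)
  moreover have "(LINT x|lebesgue. v x * pd i \<phi> x) = - (LINT x|lebesgue. g x * \<phi> x)" if "\<phi> \<in> test_functions U" for \<phi>
    using assms(4) subsetD[OF test_functions_mono[OF assms(3)] that] unfolding has_weak_pd_lebesgue[OF assms(1)] by blast
  ultimately show ?thesis unfolding has_weak_pd_lebesgue[OF assms(2)] by blast
qed

section \<open>The chosen representatives of weak derivatives\<close>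

lemma vec_AE_eq:
  fixes f g :: "point \<Rightarrow> 'a^2"
  assumes "\<And>i. AE x in lebesgue. P x \<longrightarrow> f x $ i = g x $ i"
  shows "AE x in lebesgue. P x \<longrightarrow> f x = g x"
  using assms[of 1] assms[of 2] by eventually_elim (simp add: vec_eq_iff forall_2)

lemma weak_grad_eq:
  assumes "open U" "has_weak_grad U v G"
  shows "AE x in lebesgue. x \<in> U \<longrightarrow> weak_grad U v x = G x"
proof (rule vec_AE_eq)
  fix i
  have "has_weak_grad U v (weak_grad U v)" unfolding weak_grad_def using assms(2) by (rule someI[of "has_weak_grad U v"])
  then show "AE x in lebesgue. x \<in> U \<longrightarrow> weak_grad U v x $ i = G x $ i"
    using has_weak_pd_unique[OF assms(1), of v v i "\<lambda>x. weak_grad U v x $ i" "\<lambda>x. G x $ i"] assms(2) by (auto simp: has_weak_grad_def)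
qed

lemma weak_hess_eq:
  assumes "open U" "has_weak_hess U v H"
  shows "AE x in lebesgue. x \<in> U \<longrightarrow> weak_hess U v x = H x"
proof (intro vec_AE_eq)
  fix i j
  have W: "has_weak_hess U v (weak_hess U v)" unfolding weak_hess_def using assms(2) by (rule someI[of "has_weak_hess U v"])
  obtain G where G: "has_weak_grad U v G" "\<And>i j. has_weak_pd U (\<lambda>x. G x $ i) j (\<lambda>x. H x $ i $ j)"
    using assms(2) by (auto simp: has_weak_hess_def)
  obtain G' where G': "has_weak_grad U v G'" "\<And>i j. has_weak_pd U (\<lambda>x. G' x $ i) j (\<lambda>x. weak_hess U v x $ i $ j)"
    using W by (auto simp: has_weak_hess_def)
  \<comment> \<open>Each weak Hessian comes with a hidden gradient of its own, so uniqueness is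
    applied twice: first to the gradients, then to their derivatives.\<close>
  have "AE x in lebesgue. x \<in> U \<longrightarrow> G' x $ i = G x $ i"
    using has_weak_pd_unique[OF assms(1), of v v i "\<lambda>x. G' x $ i" "\<lambda>x. G x $ i"] G(1) G'(1) by (auto simp: has_weak_grad_def)
  from has_weak_pd_unique[OF assms(1) this G'(2) G(2)]
  show "AE x in lebesgue. x \<in> U \<longrightarrow> weak_hess U v x $ i $ j = H x $ i $ j" .
qed

lemma has_weak_hess_smooth:
  assumes "open U" "smooth p"
  shows "has_weak_grad U p (grad p)" "has_weak_hess U p (hess p)"
proof -
  show g: "has_weak_grad U p (grad p)"
    using has_weak_pd_smooth[OF assms] by (simp add: has_weak_grad_def grad_def)
  show "has_weak_hess U p (hess p)"
    unfolding has_weak_hess_def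
    by (rule exI[of _ "grad p"]) (use g has_weak_pd_smooth[OF assms(1) smooth_pd[OF assms(2)]] in \<open>simp add: grad_def hess_def\<close>)
qed

lemma has_weak_diff:
  assumes U: "open U" and G: "has_weak_grad U v G" "has_weak_grad U w G'"
    and H: "\<And>i j. has_weak_pd U (\<lambda>x. G x $ i) j (\<lambda>x. H x $ i $ j)" "\<And>i j. has_weak_pd U (\<lambda>x. G' x $ i) j (\<lambda>x. H' x $ i $ j)"
  shows "has_weak_grad U (\<lambda>x. v x - w x) (\<lambda>x. G x - G' x)" "has_weak_hess U (\<lambda>x. v x - w x) (\<lambda>x. H x - H' x)"
proof -
  show g: "has_weak_grad U (\<lambda>x. v x - w x) (\<lambda>x. G x - G' x)"
    using has_weak_pd_diff[OF U] G by (simp add: has_weak_grad_def)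
  show "has_weak_hess U (\<lambda>x. v x - w x) (\<lambda>x. H x - H' x)"
    unfolding has_weak_hess_def
    by (rule exI[of _ "\<lambda>x. G x - G' x"]) (use g has_weak_pd_diff[OF U H] in simp)
qed

lemma norm_vec2: "(norm (v :: real^2))\<^sup>2 = (v$1)\<^sup>2 + (v$2)\<^sup>2"
  unfolding power2_norm_eq_inner by (simp add: inner_vec_def sum_2 power2_eq_square)

lemma norm_mat2: "(norm (M :: real^2^2))\<^sup>2 = (M$1$1)\<^sup>2 + (M$1$2)\<^sup>2 + (M$2$1)\<^sup>2 + (M$2$2)\<^sup>2"
  unfolding power2_norm_eq_inner by (simp add: inner_vec_def sum_2 power2_eq_square)

lemma square_integrable_nth:
  fixes F :: "point \<Rightarrow> real^2"
  assumes A: "A \<in> sets lebesgue" and F: "square_integrable A F"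
  shows "sq_int (\<lambda>x. indicator A x * F x $ i)"
proof -
  have m: "(\<lambda>x. F x $ i) \<in> borel_measurable (lebesgue_on A)"
    using F by (intro measurable_compose[of F _ borel "\<lambda>v. v $ i"] borel_measurable_continuous_onI)
      (auto simp: square_integrable_def intro: continuous_intros)
  have m': "(\<lambda>x. indicator A x * F x $ i) \<in> borel_measurable lebesgue"
    using borel_measurable_restrict_space_iff[of A lebesgue "\<lambda>x. F x $ i"] m A by simp
  have "integrable lebesgue (\<lambda>x. indicator A x * (norm (F x))\<^sup>2)"
    using F integral_lebesgue_on_indicator(2)[OF A] by (auto simp: square_integrable_def)
  then have "integrable lebesgue (\<lambda>x. (indicator A x * F x $ i)\<^sup>2)"
  proof (rule Bochner_Integration.integrable_bound)
    show "(\<lambda>x. (indicator A x * F x $ i)\<^sup>2) \<in> borel_measurable lebesgue" using m' by measurable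
    show "AE x in lebesgue. norm ((indicator A x * F x $ i)\<^sup>2) \<le> norm (indicator A x * (norm (F x))\<^sup>2)"
      by (rule AE_I2) (use component_le_norm_cart in \<open>auto simp: indicator_def abs_le_square_iff[symmetric]\<close>)
  qed
  then show ?thesis using m' by (simp add: sq_int_def)
qed

lemma L2_norm_sq: "(L2_norm A F)\<^sup>2 = (LINT x|lebesgue_on A. (norm (F x))\<^sup>2)"
  unfolding L2_norm_def by (intro real_sqrt_pow2 integral_nonneg_AE) simp

lemma norm_sq_sq_int:
  fixes F :: "point \<Rightarrow> real^2"
  assumes A: "A \<in> sets lebesgue" and s: "\<And>i. sq_int (\<lambda>x. indicator A x * F x $ i)"
    and eq: "AE x in lebesgue. x \<in> A \<longrightarrow> W x = F x"
  shows "(L2_norm A W)\<^sup>2 = (LINT x|lebesgue. (indicator A x * F x $ 1)\<^sup>2) + (LINT x|lebesgue. (indicator A x * F x $ 2)\<^sup>2)"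
proof -
  have i: "integrable lebesgue (\<lambda>x. (indicator A x * F x $ i)\<^sup>2)" for i using s by (simp add: sq_int_def)
  have "AE x in lebesgue. (indicator A x * F x $ 1)\<^sup>2 + (indicator A x * F x $ 2)\<^sup>2 = indicator A x * (norm (W x))\<^sup>2"
    using eq by eventually_elim (auto simp: indicator_def norm_vec2)
  from integral_lebesgue_AE(1)[OF _ this]
  have "(LINT x|lebesgue. (indicator A x * F x $ 1)\<^sup>2 + (indicator A x * F x $ 2)\<^sup>2) = (LINT x|lebesgue. indicator A x * (norm (W x))\<^sup>2)"
    using i by (simp add: borel_measurable_integrable)
  then show ?thesis using i
    by (simp add: L2_norm_sq integral_lebesgue_on_indicator(1)[OF A])
qed

lemma norm_sq_sq_int_mat:
  fixes F :: "point \<Rightarrow> real^2^2"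
  assumes A: "A \<in> sets lebesgue" and s: "\<And>i j. sq_int (\<lambda>x. indicator A x * F x $ i $ j)"
    and eq: "AE x in lebesgue. x \<in> A \<longrightarrow> W x = F x"
  shows "(L2_norm A W)\<^sup>2 = (LINT x|lebesgue. (indicator A x * F x $ 1 $ 1)\<^sup>2) + (LINT x|lebesgue. (indicator A x * F x $ 1 $ 2)\<^sup>2)
    + (LINT x|lebesgue. (indicator A x * F x $ 2 $ 1)\<^sup>2) + (LINT x|lebesgue. (indicator A x * F x $ 2 $ 2)\<^sup>2)"
proof -
  have i: "integrable lebesgue (\<lambda>x. (indicator A x * F x $ i $ j)\<^sup>2)" for i j using s by (simp add: sq_int_def)
  have "AE x in lebesgue. (indicator A x * F x $ 1 $ 1)\<^sup>2 + (indicator A x * F x $ 1 $ 2)\<^sup>2 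
     + (indicator A x * F x $ 2 $ 1)\<^sup>2 + (indicator A x * F x $ 2 $ 2)\<^sup>2 = indicator A x * (norm (W x))\<^sup>2"
    using eq by eventually_elim (auto simp: indicator_def norm_mat2)
  from integral_lebesgue_AE(1)[OF _ this]
  have "(LINT x|lebesgue. (indicator A x * F x $ 1 $ 1)\<^sup>2 + (indicator A x * F x $ 1 $ 2)\<^sup>2 
     + (indicator A x * F x $ 2 $ 1)\<^sup>2 + (indicator A x * F x $ 2 $ 2)\<^sup>2) = (LINT x|lebesgue. indicator A x * (norm (W x))\<^sup>2)"
    using i by (simp add: borel_measurable_integrable)
  then show ?thesis using i
    by (simp add: L2_norm_sq integral_lebesgue_on_indicator(1)[OF A])
qed

lemma square_integrable_nth_nth:
  fixes F :: "point \<Rightarrow> real^2^2"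
  assumes A: "A \<in> sets lebesgue" and F: "square_integrable A F"
  shows "sq_int (\<lambda>x. indicator A x * F x $ i $ j)"
proof -
  have m: "(\<lambda>x. F x $ i $ j) \<in> borel_measurable (lebesgue_on A)"
    using F by (intro measurable_compose[of F _ borel "\<lambda>v. v $ i $ j"] borel_measurable_continuous_onI)
      (auto simp: square_integrable_def intro!: continuous_intros)
  have m': "(\<lambda>x. indicator A x * F x $ i $ j) \<in> borel_measurable lebesgue"
    using borel_measurable_restrict_space_iff[of A lebesgue "\<lambda>x. F x $ i $ j"] m A by simp
  have "integrable lebesgue (\<lambda>x. indicator A x * (norm (F x))\<^sup>2)"
    using F integral_lebesgue_on_indicator(2)[OF A] by (auto simp: square_integrable_def)
  then have "integrable lebesgue (\<lambda>x. (indicator A x * F x $ i $ j)\<^sup>2)"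
  proof (rule Bochner_Integration.integrable_bound)
    show "(\<lambda>x. (indicator A x * F x $ i $ j)\<^sup>2) \<in> borel_measurable lebesgue" using m' by measurable
    have "\<bar>F x $ i $ j\<bar> \<le> norm (F x)" for x
      by (rule order_trans[OF component_le_norm_cart Finite_Cartesian_Product.norm_nth_le])
    then have "(F x $ i $ j)\<^sup>2 \<le> (norm (F x))\<^sup>2" for x by (simp add: abs_le_square_iff[symmetric])
    then show "AE x in lebesgue. norm ((indicator A x * F x $ i $ j)\<^sup>2) \<le> norm (indicator A x * (norm (F x))\<^sup>2)"
      by (intro AE_I2) (auto simp: indicator_def)
  qed
  then show ?thesis using m' by (simp add: sq_int_def)
qed

text \<open>\<open>weak_grad\<close>, \<open>weak_hess\<close> and the witnesses of square
  integrability are chosen independently of each other. Uniqueness up to null sets ties them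
  together, so that \<open>weak_hess\<close> is the derivative of \<open>weak_grad\<close> and both
  are square integrable.\<close>

lemma H2_weak_derivatives:
  assumes \<Omega>: "open \<Omega>" and v: "v \<in> H2 \<Omega>"
  shows "has_weak_grad \<Omega> v (weak_grad \<Omega> v)"
    and "has_weak_pd \<Omega> (\<lambda>x. weak_grad \<Omega> v x $ i) j (\<lambda>x. weak_hess \<Omega> v x $ i $ j)"
    and "sq_int (\<lambda>x. indicator \<Omega> x * weak_grad \<Omega> v x $ i)"
    and "sq_int (\<lambda>x. indicator \<Omega> x * weak_hess \<Omega> v x $ i $ j)"
proof -
  have \<Omega>': "\<Omega> \<in> sets lebesgue" using \<Omega> by auto
  obtain G where G: "has_weak_grad \<Omega> v G" "square_integrable \<Omega> G" using v by (auto simp: H2_def)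
  obtain H where H: "has_weak_hess \<Omega> v H" "square_integrable \<Omega> H" using v by (auto simp: H2_def)
  show g: "has_weak_grad \<Omega> v (weak_grad \<Omega> v)"
    unfolding weak_grad_def using G(1) by (rule someI[of "has_weak_grad \<Omega> v"])
  have W: "has_weak_hess \<Omega> v (weak_hess \<Omega> v)"
    unfolding weak_hess_def using H(1) by (rule someI[of "has_weak_hess \<Omega> v"])
  then obtain G' where G': "has_weak_grad \<Omega> v G'" "\<And>i j. has_weak_pd \<Omega> (\<lambda>x. G' x $ i) j (\<lambda>x. weak_hess \<Omega> v x $ i $ j)"
    by (auto simp: has_weak_hess_def)
  have "AE x in lebesgue. x \<in> \<Omega> \<longrightarrow> weak_grad \<Omega> v x = G' x" using weak_grad_eq[OF \<Omega> G'(1)] .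
  then have "AE x in lebesgue. x \<in> \<Omega> \<longrightarrow> G' x $ i = weak_grad \<Omega> v x $ i" by eventually_elim auto
  from has_weak_pd_AE[OF \<Omega> G'(2) this]
  show "has_weak_pd \<Omega> (\<lambda>x. weak_grad \<Omega> v x $ i) j (\<lambda>x. weak_hess \<Omega> v x $ i $ j)" by simp
  have "AE x in lebesgue. indicator \<Omega> x * G x $ i = indicator \<Omega> x * weak_grad \<Omega> v x $ i"
    using weak_grad_eq[OF \<Omega> G(1)] by eventually_elim (auto simp: indicator_def)
  with square_integrable_nth[OF \<Omega>' G(2)] show "sq_int (\<lambda>x. indicator \<Omega> x * weak_grad \<Omega> v x $ i)" by (rule sq_int_AE)
  have "AE x in lebesgue. indicator \<Omega> x * H x $ i $ j = indicator \<Omega> x * weak_hess \<Omega> v x $ i $ j"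
    using weak_hess_eq[OF \<Omega> H(1)] by eventually_elim (auto simp: indicator_def)
  with square_integrable_nth_nth[OF \<Omega>' H(2)] show "sq_int (\<lambda>x. indicator \<Omega> x * weak_hess \<Omega> v x $ i $ j)" by (rule sq_int_AE)
qed

lemma square_integrable_test:
  fixes F :: "point \<Rightarrow> 'b::euclidean_space"
  assumes \<Omega>: "open \<Omega>" and c: "continuous_on UNIV F" and K: "\<And>x. F x \<noteq> 0 \<Longrightarrow> x \<in> K" "K \<subseteq> \<Omega>" and R: "\<And>x. x \<in> K \<Longrightarrow> norm x \<le> R"
  shows "square_integrable \<Omega> F"
  unfolding square_integrable_def
proof
  have \<Omega>': "\<Omega> \<in> sets lebesgue" using \<Omega> by auto
  show "F \<in> borel_measurable (lebesgue_on \<Omega>)"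
    using borel_measurable_continuous_onI[OF c] by (intro measurable_restrict_space1 measurable_completion) simp
  have "integrable lebesgue (\<lambda>x. (norm (F x))\<^sup>2)"
    by (rule integrable_compact_support[where R=R]) (use K R c in \<open>auto intro!: continuous_intros\<close>)
  then show "integrable (lebesgue_on \<Omega>) (\<lambda>x. (norm (F x))\<^sup>2)"
    by (subst integral_lebesgue_on(2)[OF \<Omega>']) (use K in auto)
qed

lemma test_functions_H2_0:
  assumes \<Omega>: "open \<Omega>" and \<phi>: "\<phi> \<in> test_functions \<Omega>"
  shows "\<phi> \<in> H2_0 \<Omega>"
proof -
  have \<Omega>': "\<Omega> \<in> sets lebesgue" using \<Omega> by auto
  define K where "K = closure {x. \<phi> x \<noteq> 0}"
  have K: "compact K" "K \<subseteq> \<Omega>" "\<And>x. \<phi> x \<noteq> 0 \<Longrightarrow> x \<in> K"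
    using \<phi> closure_subset[of "{x. \<phi> x \<noteq> 0}"] by (auto simp: test_functions_def K_def)
  have K1: "pd i \<phi> x \<noteq> 0 \<Longrightarrow> x \<in> K" for i x by (rule pd_outside_support[OF K(3)]) (auto simp: K_def)
  have K2: "pd j (pd i \<phi>) x \<noteq> 0 \<Longrightarrow> x \<in> K" for i j x by (rule pd_outside_support[OF K1]) (auto simp: K_def)
  obtain R where R: "\<And>x. x \<in> K \<Longrightarrow> norm x \<le> R" using compact_imp_bounded[OF K(1)] by (auto simp: bounded_iff)
  have s: "smooth \<phi>" using \<phi> test_function_smooth by blast
  note w = has_weak_hess_smooth[OF \<Omega> s]
  have g: "square_integrable \<Omega> (grad \<phi>)"
  proof (rule square_integrable_test[OF \<Omega> _ _ K(2) R])
    show "continuous_on UNIV (grad \<phi>)" unfolding grad_def[abs_def]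
      by (intro continuous_on_vec_lambda smooth_continuous smooth_pd s)
    show "x \<in> K" if "grad \<phi> x \<noteq> 0" for x using that K1[of _ x] by (auto simp: grad_def vec_eq_iff)
  qed
  have h: "square_integrable \<Omega> (hess \<phi>)"
  proof (rule square_integrable_test[OF \<Omega> _ _ K(2) R])
    show "continuous_on UNIV (hess \<phi>)" unfolding hess_def[abs_def]
      by (intro continuous_on_vec_lambda smooth_continuous smooth_pd s)
    show "x \<in> K" if "hess \<phi> x \<noteq> 0" for x using that K2[of _ _ x] by (auto simp: hess_def vec_eq_iff)
  qed
  have "square_integrable \<Omega> \<phi>"
    by (rule square_integrable_test[OF \<Omega> smooth_continuous[OF s] K(3,2) R])
  then have H2: "\<phi> \<in> H2 \<Omega>" unfolding H2_def using g h w by blast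
  \<comment> \<open>The constant sequence approximates \<open>\<phi>\<close>. The difference is the
    zero function, whose weak derivatives are chosen representatives and vanish only almost
    everywhere.\<close>
  have z: "smooth (\<lambda>x::point. 0)" by (rule elementary_smooth[OF elementary_const])
  have pd0: "pd i (\<lambda>x. 0) x = 0" for i x using pd_affine[of i 0 0 x] by simp
  have "grad (\<lambda>x. 0) x = 0" "hess (\<lambda>x. 0) x = 0" for x
    by (simp_all add: grad_def hess_def vec_eq_iff pd0 pd0[abs_def])
  then have "AE x in lebesgue. x \<in> \<Omega> \<longrightarrow> weak_grad \<Omega> (\<lambda>x. 0) x = 0" "AE x in lebesgue. x \<in> \<Omega> \<longrightarrow> weak_hess \<Omega> (\<lambda>x. 0) x = 0"
    using weak_grad_eq[OF \<Omega> has_weak_hess_smooth(1)[OF \<Omega> z]] weak_hess_eq[OF \<Omega> has_weak_hess_smooth(2)[OF \<Omega> z]] by simp_all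
  then have "AE x in lebesgue. indicator \<Omega> x * (norm (weak_grad \<Omega> (\<lambda>x. 0) x))\<^sup>2 = 0" "AE x in lebesgue. indicator \<Omega> x * (norm (weak_hess \<Omega> (\<lambda>x. 0) x))\<^sup>2 = 0"
    by (eventually_elim, auto simp: indicator_def)+
  then have "L2_norm \<Omega> (weak_grad \<Omega> (\<lambda>x. 0)) = 0" "L2_norm \<Omega> (weak_hess \<Omega> (\<lambda>x. 0)) = 0"
    unfolding L2_norm_def by (simp_all add: integral_lebesgue_on_indicator(1)[OF \<Omega>'] integral_eq_zero_AE)
  then have "H2_norm \<Omega> (\<lambda>x. \<phi> x - \<phi> x) = 0" by (simp add: H2_norm_def L2_norm_def)
  then show ?thesis unfolding H2_0_def using H2 \<phi> by (auto intro!: exI[of _ "\<lambda>_. \<phi>"])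
qed

text \<open>The approximation by test functions transfers identities that are stable under
  convergence of first and second derivatives, also when the integrals are restricted to a
  measurable set such as a half plane on one side of a boundary face.\<close>

lemma H2_0_limit:
  assumes \<Omega>: "open \<Omega>" and v: "v \<in> H2_0 \<Omega>" and P: "P \<in> sets lebesgue"
    and a: "sq_int a" and b: "sq_int b"
    and zero: "\<And>\<phi>. \<phi> \<in> test_functions \<Omega> \<Longrightarrow> (LINT x|lebesgue. indicator P x * (pd i \<phi> x * a x + pd j (pd i \<phi>) x * b x)) = 0"
  shows "(LINT x|lebesgue. indicator P x * (indicator \<Omega> x * weak_grad \<Omega> v x $ i * a x + indicator \<Omega> x * weak_hess \<Omega> v x $ i $ j * b x)) = 0"
proof -
  have \<Omega>': "\<Omega> \<in> sets lebesgue" using \<Omega> by auto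
  have vH: "v \<in> H2 \<Omega>" using v by (simp add: H2_0_def)
  note W = H2_weak_derivatives[OF \<Omega> vH]
  obtain \<phi> where \<phi>: "\<And>n::nat. \<phi> n \<in> test_functions \<Omega>" "(\<lambda>n. H2_norm \<Omega> (\<lambda>x. v x - \<phi> n x)) \<longlonglongrightarrow> 0"
    using v by (auto simp: H2_0_def)
  define dg where "dg n i = (\<lambda>x. indicator \<Omega> x * weak_grad \<Omega> v x $ i - pd i (\<phi> n) x)" for n i
  define dh where "dh n i j = (\<lambda>x. indicator \<Omega> x * weak_hess \<Omega> v x $ i $ j - pd j (pd i (\<phi> n)) x)" for n i j
  have sg: "sq_int (dg n i)" and sh: "sq_int (dh n i j)" for n i j
    unfolding dg_def dh_def by (intro sq_int_diff W sq_int_test[of _ \<Omega>] test_functions_pd \<phi>)+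
  have out: "\<psi> x = indicator \<Omega> x * \<psi> x" if tt: "\<psi> \<in> test_functions \<Omega>" for \<psi> x
  proof -
    obtain K where "K \<subseteq> \<Omega>" "\<And>x. \<psi> x \<noteq> 0 \<Longrightarrow> x \<in> K" using test_function_support[OF tt] by blast
    then have "\<psi> x \<noteq> 0 \<Longrightarrow> x \<in> \<Omega>" by blast
    then show ?thesis by (cases "\<psi> x = 0") auto
  qed
  have dg': "dg n i x = indicator \<Omega> x * (weak_grad \<Omega> v x - grad (\<phi> n) x) $ i" for n i x
    using out[OF test_functions_pd[OF \<phi>(1)], of i n x] by (auto simp: dg_def grad_def indicator_def split: if_splits)
  have dh': "dh n i j x = indicator \<Omega> x * (weak_hess \<Omega> v x - hess (\<phi> n) x) $ i $ j" for n i j x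
    using out[OF test_functions_pd[OF test_functions_pd[OF \<phi>(1)]], of j i n x] by (auto simp: dh_def hess_def indicator_def split: if_splits)
  have bound: "sqrt (LINT x|lebesgue. (dg n i x)\<^sup>2) \<le> H2_norm \<Omega> (\<lambda>x. v x - \<phi> n x)"
       "sqrt (LINT x|lebesgue. (dh n i j x)\<^sup>2) \<le> H2_norm \<Omega> (\<lambda>x. v x - \<phi> n x)" for n i j
  proof -
    have s: "smooth (\<phi> n)" using \<phi>(1) test_function_smooth by blast
    have pds: "has_weak_pd \<Omega> (\<lambda>x. grad (\<phi> n) x $ i) j (\<lambda>x. hess (\<phi> n) x $ i $ j)" for i j
      using has_weak_pd_smooth[OF \<Omega> smooth_pd[OF s]] by (simp add: grad_def hess_def)
    note D = has_weak_diff[OF \<Omega> W(1) has_weak_hess_smooth(1)[OF \<Omega> s] W(2) pds]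
    have g: "(L2_norm \<Omega> (weak_grad \<Omega> (\<lambda>x. v x - \<phi> n x)))\<^sup>2 = (LINT x|lebesgue. (dg n 1 x)\<^sup>2) + (LINT x|lebesgue. (dg n 2 x)\<^sup>2)"
      unfolding dg' by (rule norm_sq_sq_int[OF \<Omega>' _ weak_grad_eq[OF \<Omega> D(1)]]) (use sg[unfolded dg'[abs_def]] in simp)
    have h: "(L2_norm \<Omega> (weak_hess \<Omega> (\<lambda>x. v x - \<phi> n x)))\<^sup>2 = (LINT x|lebesgue. (dh n 1 1 x)\<^sup>2) + (LINT x|lebesgue. (dh n 1 2 x)\<^sup>2)
       + (LINT x|lebesgue. (dh n 2 1 x)\<^sup>2) + (LINT x|lebesgue. (dh n 2 2 x)\<^sup>2)"
      unfolding dh' by (rule norm_sq_sq_int_mat[OF \<Omega>' _ weak_hess_eq[OF \<Omega> D(2)]]) (use sh[unfolded dh'[abs_def]] in simp)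
    have nn: "0 \<le> (LINT x|lebesgue. (dg n i x)\<^sup>2)" "0 \<le> (LINT x|lebesgue. (dh n i j x)\<^sup>2)" for i j
      by (auto intro: integral_nonneg_AE)
    have nn': "0 \<le> (L2_norm \<Omega> (\<lambda>x. v x - \<phi> n x))\<^sup>2" by simp
    show "sqrt (LINT x|lebesgue. (dg n i x)\<^sup>2) \<le> H2_norm \<Omega> (\<lambda>x. v x - \<phi> n x)"
      unfolding H2_norm_def g h using nn(1)[of 1] nn(1)[of 2] nn(2)[of 1 1] nn(2)[of 1 2] nn(2)[of 2 1] nn(2)[of 2 2] nn' exhaust_2[of i]
      by (intro real_sqrt_le_mono) auto
    show "sqrt (LINT x|lebesgue. (dh n i j x)\<^sup>2) \<le> H2_norm \<Omega> (\<lambda>x. v x - \<phi> n x)"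
      unfolding H2_norm_def g h using nn(1)[of 1] nn(1)[of 2] nn(2)[of 1 1] nn(2)[of 1 2] nn(2)[of 2 1] nn(2)[of 2 2] nn' exhaust_2[of i] exhaust_2[of j]
      by (intro real_sqrt_le_mono) auto
  qed
  let ?I = "LINT x|lebesgue. indicator P x * (indicator \<Omega> x * weak_grad \<Omega> v x $ i * a x + indicator \<Omega> x * weak_hess \<Omega> v x $ i $ j * b x)"
  let ?N = "\<lambda>n. H2_norm \<Omega> (\<lambda>x. v x - \<phi> n x)"
  define A where "A = sqrt (LINT x|lebesgue. (indicator P x * a x)\<^sup>2) + sqrt (LINT x|lebesgue. (indicator P x * b x)\<^sup>2)"
  have Pa: "sq_int (\<lambda>x. indicator P x * a x)" "sq_int (\<lambda>x. indicator P x * b x)"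
    using sq_int_indicator P a b by auto
  \<comment> \<open>After subtraction of the identity for \<open>\<phi> n\<close> only the errors
    \<open>dg\<close> and \<open>dh\<close> remain, paired with fixed square integrable functions;
    Cauchy-Schwarz bounds them by the approximation error.\<close>
  have le: "\<bar>?I\<bar> \<le> ?N n * A" for n
  proof -
    have i1: "integrable lebesgue (\<lambda>x. dg n i x * (indicator P x * a x))" "integrable lebesgue (\<lambda>x. dh n i j x * (indicator P x * b x))"
      using sq_int_mult sg sh Pa by blast+
    have ph: "sq_int (pd i (\<phi> n))" "sq_int (pd j (pd i (\<phi> n)))"
      by (intro sq_int_test[of _ \<Omega>] test_functions_pd \<phi>)+
    have i2: "integrable lebesgue (\<lambda>x. pd i (\<phi> n) x * (indicator P x * a x))" "integrable lebesgue (\<lambda>x. pd j (pd i (\<phi> n)) x * (indicator P x * b x))"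
      using sq_int_mult ph Pa by blast+
    have "?I = (LINT x|lebesgue. (dg n i x * (indicator P x * a x) + dh n i j x * (indicator P x * b x)) + (pd i (\<phi> n) x * (indicator P x * a x) + pd j (pd i (\<phi> n)) x * (indicator P x * b x)))"
      unfolding dg_def dh_def by (intro Bochner_Integration.integral_cong) (auto simp: algebra_simps)
    also have "\<dots> = (LINT x|lebesgue. dg n i x * (indicator P x * a x)) + (LINT x|lebesgue. dh n i j x * (indicator P x * b x))
       + (LINT x|lebesgue. pd i (\<phi> n) x * (indicator P x * a x) + pd j (pd i (\<phi> n)) x * (indicator P x * b x))"
      using i1 i2 by simp
    also have "(LINT x|lebesgue. pd i (\<phi> n) x * (indicator P x * a x) + pd j (pd i (\<phi> n)) x * (indicator P x * b x)) = 0"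
      using zero[OF \<phi>(1)[of n]] by (simp add: algebra_simps)
    finally have e: "?I = (LINT x|lebesgue. dg n i x * (indicator P x * a x)) + (LINT x|lebesgue. dh n i j x * (indicator P x * b x))" by simp
    have "\<bar>LINT x|lebesgue. dg n i x * (indicator P x * a x)\<bar> \<le> sqrt (LINT x|lebesgue. (dg n i x)\<^sup>2) * sqrt (LINT x|lebesgue. (indicator P x * a x)\<^sup>2)"
      by (rule Cauchy_Schwarz_integral(2)) (use sg[of n i] Pa in \<open>auto simp: sq_int_def\<close>)
    also have "\<dots> \<le> ?N n * sqrt (LINT x|lebesgue. (indicator P x * a x)\<^sup>2)"
      by (intro mult_right_mono bound) (auto intro: integral_nonneg_AE)
    finally have 1: "\<bar>LINT x|lebesgue. dg n i x * (indicator P x * a x)\<bar> \<le> ?N n * sqrt (LINT x|lebesgue. (indicator P x * a x)\<^sup>2)" .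
    have "\<bar>LINT x|lebesgue. dh n i j x * (indicator P x * b x)\<bar> \<le> sqrt (LINT x|lebesgue. (dh n i j x)\<^sup>2) * sqrt (LINT x|lebesgue. (indicator P x * b x)\<^sup>2)"
      by (rule Cauchy_Schwarz_integral(2)) (use sh[of n i j] Pa in \<open>auto simp: sq_int_def\<close>)
    also have "\<dots> \<le> ?N n * sqrt (LINT x|lebesgue. (indicator P x * b x)\<^sup>2)"
      by (intro mult_right_mono bound) (auto intro: integral_nonneg_AE)
    finally show ?thesis using 1 unfolding e A_def by (simp add: algebra_simps)
  qed
  have "(\<lambda>n. ?N n * A) \<longlonglongrightarrow> 0 * A" by (intro tendsto_mult tendsto_const \<phi>(2))
  then have "\<bar>?I\<bar> \<le> 0 * A" by (rule LIMSEQ_le_const) (use le in auto)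
  then show ?thesis by simp
qed

text \<open>The norms of the theorem differentiate a piece of the error weakly on one open triangle.
  Restricting the test functions identifies the result with the global derivatives of v minus the
  classical ones of p.\<close>

lemma weak_derivatives_minus_smooth:
  assumes "open \<Omega>" "open U" "U \<subseteq> \<Omega>" "v \<in> H2 \<Omega>" "smooth p"
  shows "AE x in lebesgue. x \<in> U \<longrightarrow> weak_grad U (\<lambda>x. v x - p x) x = weak_grad \<Omega> v x - grad p x"
    and "AE x in lebesgue. x \<in> U \<longrightarrow> weak_hess U (\<lambda>x. v x - p x) x = weak_hess \<Omega> v x - hess p x"
proof -
  note W = H2_weak_derivatives[OF assms(1,4)]
  have g: "has_weak_grad U v (weak_grad \<Omega> v)"
    using W(1) has_weak_pd_mono[OF assms(1-3)] by (auto simp: has_weak_grad_def)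
  have pds: "has_weak_pd U (\<lambda>x. grad p x $ i) j (\<lambda>x. hess p x $ i $ j)" for i j
    using has_weak_pd_smooth[OF assms(2) smooth_pd[OF assms(5)]] by (simp add: grad_def hess_def)
  note D = has_weak_diff[OF assms(2) g has_weak_hess_smooth(1)[OF assms(2,5)] has_weak_pd_mono[OF assms(1-3) W(2)] pds]
  show "AE x in lebesgue. x \<in> U \<longrightarrow> weak_grad U (\<lambda>x. v x - p x) x = weak_grad \<Omega> v x - grad p x"
    "AE x in lebesgue. x \<in> U \<longrightarrow> weak_hess U (\<lambda>x. v x - p x) x = weak_hess \<Omega> v x - hess p x"
    using weak_grad_eq[OF assms(2) D(1)] weak_hess_eq[OF assms(2) D(2)] .
qed

lemma weak_solution_test:
  assumes \<Omega>: "open \<Omega>" and u: "weak_solution \<Omega> \<epsilon> f u" and \<phi>: "\<phi> \<in> test_functions \<Omega>"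
  shows "\<epsilon>\<^sup>2 * (\<Sum>i\<in>UNIV. \<Sum>j\<in>UNIV. LINT x|lebesgue. indicator \<Omega> x * weak_hess \<Omega> u x $ i $ j * pd j (pd i \<phi>) x)
    + (\<Sum>i\<in>UNIV. LINT x|lebesgue. indicator \<Omega> x * weak_grad \<Omega> u x $ i * pd i \<phi> x)
    = (LINT x|lebesgue. indicator \<Omega> x * f x * \<phi> x)"
proof -
  have \<Omega>': "\<Omega> \<in> sets lebesgue" using \<Omega> by auto
  have s: "smooth \<phi>" using \<phi> test_function_smooth by blast
  have uH: "u \<in> H2 \<Omega>" using u by (simp add: weak_solution_def H2_0_def)
  note W = H2_weak_derivatives[OF \<Omega> uH]
  have t: "sq_int (pd i \<phi>)" "sq_int (pd j (pd i \<phi>))" for i j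
    by (intro sq_int_test[of _ \<Omega>] test_functions_pd \<phi>)+
  have i1: "integrable lebesgue (\<lambda>x. indicator \<Omega> x * weak_grad \<Omega> u x $ i * pd i \<phi> x)" 
    "integrable lebesgue (\<lambda>x. indicator \<Omega> x * weak_hess \<Omega> u x $ i $ j * pd j (pd i \<phi>) x)" for i j
    using sq_int_mult W t by blast+
  have g: "(LINT x|lebesgue_on \<Omega>. weak_grad \<Omega> u x \<bullet> weak_grad \<Omega> \<phi> x) = (\<Sum>i\<in>UNIV. LINT x|lebesgue. indicator \<Omega> x * weak_grad \<Omega> u x $ i * pd i \<phi> x)"
  proof -
    have "AE x in lebesgue. (\<Sum>i\<in>UNIV. indicator \<Omega> x * weak_grad \<Omega> u x $ i * pd i \<phi> x) = indicator \<Omega> x * (weak_grad \<Omega> u x \<bullet> weak_grad \<Omega> \<phi> x)"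
      using weak_grad_eq[OF \<Omega> has_weak_hess_smooth(1)[OF \<Omega> s]]
      by eventually_elim (auto simp: indicator_def inner_vec_def grad_def)
    from integral_lebesgue_AE(1)[OF _ this]
    have "(LINT x|lebesgue. (\<Sum>i\<in>UNIV. indicator \<Omega> x * weak_grad \<Omega> u x $ i * pd i \<phi> x)) = (LINT x|lebesgue. indicator \<Omega> x * (weak_grad \<Omega> u x \<bullet> weak_grad \<Omega> \<phi> x))"
      using i1(1) by (simp add: borel_measurable_sum borel_measurable_integrable)
    then show ?thesis using i1(1) by (simp add: integral_lebesgue_on_indicator(1)[OF \<Omega>'])
  qed
  have h: "(LINT x|lebesgue_on \<Omega>. weak_hess \<Omega> u x \<bullet> weak_hess \<Omega> \<phi> x) = (\<Sum>i\<in>UNIV. \<Sum>j\<in>UNIV. LINT x|lebesgue. indicator \<Omega> x * weak_hess \<Omega> u x $ i $ j * pd j (pd i \<phi>) x)"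
  proof -
    have "AE x in lebesgue. (\<Sum>i\<in>UNIV. \<Sum>j\<in>UNIV. indicator \<Omega> x * weak_hess \<Omega> u x $ i $ j * pd j (pd i \<phi>) x) = indicator \<Omega> x * (weak_hess \<Omega> u x \<bullet> weak_hess \<Omega> \<phi> x)"
      using weak_hess_eq[OF \<Omega> has_weak_hess_smooth(2)[OF \<Omega> s]]
      by eventually_elim (auto simp: indicator_def inner_vec_def hess_def)
    from integral_lebesgue_AE(1)[OF _ this]
    have "(LINT x|lebesgue. (\<Sum>i\<in>UNIV. \<Sum>j\<in>UNIV. indicator \<Omega> x * weak_hess \<Omega> u x $ i $ j * pd j (pd i \<phi>) x)) = (LINT x|lebesgue. indicator \<Omega> x * (weak_hess \<Omega> u x \<bullet> weak_hess \<Omega> \<phi> x))"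
      using i1(2) by (simp add: borel_measurable_sum borel_measurable_integrable)
    then show ?thesis using i1(2) by (simp add: integral_lebesgue_on_indicator(1)[OF \<Omega>'] Bochner_Integration.integral_sum)
  qed
  have "(LINT x|lebesgue_on \<Omega>. f x * \<phi> x) = (LINT x|lebesgue. indicator \<Omega> x * f x * \<phi> x)"
    by (simp add: integral_lebesgue_on_indicator(1)[OF \<Omega>'] mult.assoc)
  then show ?thesis using u test_functions_H2_0[OF \<Omega> \<phi>] g h unfolding weak_solution_def by auto
qed

section \<open>Triangles and their edges\<close>

text \<open>Faces of a simplex are hulls of subsets of its vertices, and dimension one leaves
  exactly two vertices.\<close>

lemma edge_of_triangle:
  fixes K :: "point set"
  assumes K: "2 simplex K" and F: "F edge_of K"
  obtains a b c where "K = convex hull {a, b, c}" "\<not> collinear {a, b, c}" "F = closed_segment a b"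
proof -
  obtain C where C: "\<not> affine_dependent C" "card C = 3" "K = convex hull C"
    using K by (auto simp: simplex_def)
  have "F face_of convex hull C" "aff_dim F = 1" using F C by (auto simp: edge_of_def)
  then obtain c where c: "c \<subseteq> C" "F = convex hull c"
    using face_of_convex_hull_affine_independent[OF C(1)] by blast
  have finC: "finite C" using C(2) by (metis card.infinite zero_neq_numeral)
  have "\<not> affine_dependent c" using C(1) c(1) affine_dependent_subset by blast
  then have "aff_dim c = int (card c) - 1" by (simp add: aff_dim_affine_independent)
  then have "card c = 2" using \<open>aff_dim F = 1\<close> c(2) by (simp add: aff_dim_convex_hull)
  then obtain a b where ab: "c = {a, b}" "a \<noteq> b" by (meson card_2_iff)
  have "card (C - c) = 1" using c(1) finC C(2) \<open>card c = 2\<close> by (simp add: card_Diff_subset finite_subset)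
  then obtain d where d: "C - c = {d}" by (meson card_1_singletonE)
  have Ceq: "C = {a, b, d}" using d ab c(1) by auto
  have "a \<noteq> d" "b \<noteq> d" using d ab by auto
  then have "\<not> collinear {a, b, d}" using C(1) ab(2) unfolding Ceq by (simp add: collinear_3_eq_affine_dependent)
  then show ?thesis using that[of a b d] C(3) c(2) ab(1) unfolding Ceq by (simp add: segment_convex_hull)
qed

section \<open>The geometry of one triangle\<close>

definition perp :: "point \<Rightarrow> point" where "perp v = vector [- v$2, v$1]"

lemma perp_props: "norm (perp v) = norm v" "v \<bullet> perp v = 0" "perp v \<bullet> v = 0"
  by (simp_all add: perp_def norm_eq_sqrt_inner inner_vec_def sum_2 algebra_simps)

lemma unit_orthogonal_cases:
  assumes "norm \<tau> = 1" "norm \<nu> = 1" "\<tau> \<bullet> \<nu> = 0" "norm (\<nu>' :: point) = 1" "\<tau> \<bullet> \<nu>' = 0"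
  shows "\<nu>' = \<nu> \<or> \<nu>' = - \<nu>"
proof -
  interpret frame 0 \<tau> \<nu> 1 1 by unfold_locales (use assms in auto)
  have e: "\<nu>' = (\<nu>' \<bullet> \<nu>) *\<^sub>R \<nu>" using expand[of \<nu>'] assms(5) by (simp add: inner_commute)
  then have "norm \<nu>' = \<bar>\<nu>' \<bullet> \<nu>\<bar> * norm \<nu>" by (metis norm_scaleR)
  then have "\<bar>\<nu>' \<bullet> \<nu>\<bar> = 1" using assms by simp
  then have "\<nu>' \<bullet> \<nu> = 1 \<or> \<nu>' \<bullet> \<nu> = - 1" by linarith
  then show ?thesis using e by fastforce
qed

text \<open>The side of an edge on which a triangle lies: the box over the edge is contained in the
  triangle, with a height that is controlled by the shape regularity.\<close>

definition side :: "real \<Rightarrow> point \<Rightarrow> point \<Rightarrow> point set \<Rightarrow> point \<Rightarrow> bool" where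
  "side \<gamma> a b K \<nu> \<longleftrightarrow> a \<noteq> b \<and> 2 \<le> \<gamma> \<and> norm \<nu> = 1 \<and> (b - a) \<bullet> \<nu> = 0 \<and>
     (\<forall>x\<in>K. 0 \<le> (x - midpoint a b) \<bullet> \<nu>) \<and>
     (\<forall>x. \<bar>(x - midpoint a b) \<bullet> ((b - a) /\<^sub>R dist a b)\<bar> \<le> dist a b / 4 \<and> 0 \<le> (x - midpoint a b) \<bullet> \<nu> \<and>
        (x - midpoint a b) \<bullet> \<nu> \<le> dist a b / (\<gamma> * (1 + \<gamma>)) \<longrightarrow> x \<in> K) \<and>
     dist a b \<le> diameter K \<and> diameter K \<le> \<gamma> * dist a b / 2"

text \<open>The inscribed disc is neither wider than the chords parallel to the edge nor higher than
  the triangle, so 2 r is below both l and the height H. Diameter, edge and height are thereby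
  comparable, and 2 r \<le> l \<le> diameter \<le> \<gamma> r forces 2 \<le> \<gamma>.\<close>

lemma triangle_side:
  fixes a b c :: point
  assumes K: "K = convex hull {a, b, c}" and nc: "\<not> collinear {a, b, c}"
    and ball: "cball z r \<subseteq> K" "r > 0" "diameter K \<le> \<gamma> * r"
  obtains \<nu> where "side \<gamma> a b K \<nu>"
proof -
  define l where "l = dist a b"
  define \<tau> where "\<tau> = (b - a) /\<^sub>R l"
  define m where "m = midpoint a b"
  have ab: "a \<noteq> b" using nc by auto
  have l: "l > 0" using ab by (simp add: l_def)
  have n\<tau>: "norm \<tau> = 1" using ab by (simp add: \<tau>_def l_def dist_norm norm_minus_commute)
  have ba: "b - a = l *\<^sub>R \<tau>" using l by (simp add: \<tau>_def)
  define w where "w = (c - a) \<bullet> perp \<tau>"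
  have w0: "w \<noteq> 0"
  proof
    assume "w = 0"
    interpret frame 0 \<tau> "perp \<tau>" 1 1 by unfold_locales (use n\<tau> in \<open>auto simp: perp_props\<close>)
    have ca: "c - a = ((c - a) \<bullet> \<tau>) *\<^sub>R \<tau>" using expand[of "c - a"] \<open>w = 0\<close> by (simp add: w_def)
    have "c - a = (((c - a) \<bullet> \<tau>) / l) *\<^sub>R (b - a)" by (subst ca) (use l ba in simp)
    then have "collinear {0, b - a, c - a}" unfolding collinear_lemma by blast
    then have "collinear {b, a, c}" by (subst collinear_3) auto
    then show False using nc by (simp add: insert_commute)
  qed
  \<comment> \<open>The sign turns \<nu> towards the third vertex, so that its height
    \<open>H\<close> is positive.\<close>
  define \<nu> where "\<nu> = (if w > 0 then perp \<tau> else - perp \<tau>)"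
  have n\<nu>: "norm \<nu> = 1" "\<tau> \<bullet> \<nu> = 0" using n\<tau> by (auto simp: \<nu>_def perp_props)
  interpret frame m \<tau> \<nu> 1 1 by unfold_locales (use n\<tau> n\<nu> in auto)
  define H where "H = (c - m) \<bullet> \<nu>"
  define c1 where "c1 = (c - m) \<bullet> \<tau>"
  have am: "a = m - (l / 2) *\<^sub>R \<tau>" "b = m + (l / 2) *\<^sub>R \<tau>"
    using ba by (simp_all add: m_def midpoint_def scaleR_half_double[symmetric] vec_eq_iff field_simps)
  have tt: "\<tau> \<bullet> \<tau> = 1" "\<nu> \<bullet> \<nu> = 1" "\<nu> \<bullet> \<tau> = 0" using n\<tau> n\<nu> by (simp_all add: norm_eq_1 inner_commute)
  have "H = (c - a) \<bullet> \<nu>" using n\<nu>(2) by (simp add: H_def am(1) inner_simps)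
  then have H: "H > 0" using w0 by (auto simp: \<nu>_def w_def)
  have cm: "c = m + c1 *\<^sub>R \<tau> + H *\<^sub>R \<nu>" using expand[of "c - m"] by (simp add: c1_def H_def algebra_simps)
  let ?t = "\<lambda>x. (x - m) \<bullet> \<nu>" and ?s = "\<lambda>x. (x - m) \<bullet> \<tau>"
  \<comment> \<open>The skewed coordinate is constant along lines parallel to the median from m to
    c. Its bound says that chords parallel to the edge have length at most l.\<close>
  have K1: "0 \<le> ?t x \<and> ?t x \<le> H \<and> \<bar>?s x - ?t x * c1 / H\<bar> \<le> l / 2" if x: "x \<in> K" for x
  proof -
    obtain p q e where p: "0 \<le> p" "0 \<le> q" "0 \<le> e" "p + q + e = 1" "x = p *\<^sub>R a + q *\<^sub>R b + e *\<^sub>R c"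
      using x unfolding K convex_hull_3 by blast
    have "x - m = ((q - p) * l / 2 + e * c1) *\<^sub>R \<tau> + (e * H) *\<^sub>R \<nu>"
    proof -
      have "x = p *\<^sub>R (m - (l / 2) *\<^sub>R \<tau>) + q *\<^sub>R (m + (l / 2) *\<^sub>R \<tau>) + e *\<^sub>R (m + c1 *\<^sub>R \<tau> + H *\<^sub>R \<nu>)"
        using p(5) am cm by simp
      also have "\<dots> = (p + q + e) *\<^sub>R m + (((q - p) * l / 2 + e * c1) *\<^sub>R \<tau> + (e * H) *\<^sub>R \<nu>)"
        by (simp add: vec_eq_iff field_simps)
      finally show ?thesis using p(4) by simp
    qed
    then have st: "?s x = (q - p) * l / 2 + e * c1" "?t x = e * H" by (simp_all add: inner_simps tt n\<nu>)
    have "?s x - ?t x * c1 / H = (q - p) * (l / 2)" using H st by (simp add: field_simps)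
    moreover have "\<bar>(q - p) * (l / 2)\<bar> \<le> 1 * (l / 2)"
      unfolding abs_mult using l p by (intro mult_mono) auto
    moreover have "e * H \<le> 1 * H" using p H by (intro mult_right_mono) auto
    ultimately show ?thesis using st p H by simp
  qed
  have "z + r *\<^sub>R \<nu> \<in> K" "z - r *\<^sub>R \<nu> \<in> K" "z + r *\<^sub>R \<tau> \<in> K" "z - r *\<^sub>R \<tau> \<in> K"
    by (rule subsetD[OF ball(1)]; use n\<tau> n\<nu> ball(2) in \<open>simp add: dist_norm\<close>)+
  note zz = this[THEN K1]
  have rH: "2 * r \<le> H" using zz(1,2) by (simp add: inner_simps tt)
  have rl: "2 * r \<le> l" 
  proof -
    define A where "A = ?s z - ?t z * c1 / H"
    have "?s (z + r *\<^sub>R \<tau>) - ?t (z + r *\<^sub>R \<tau>) * c1 / H = A + r" "?s (z - r *\<^sub>R \<tau>) - ?t (z - r *\<^sub>R \<tau>) * c1 / H = A - r"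
      using n\<nu> by (simp_all add: A_def inner_simps tt)
    then have "\<bar>A + r\<bar> \<le> l / 2" "\<bar>A - r\<bar> \<le> l / 2" using zz(3,4) by simp_all
    then show ?thesis by linarith
  qed
  have cK: "compact K" unfolding K by (intro finite_imp_compact_convex_hull) simp
  have abcK: "a \<in> K" "b \<in> K" "c \<in> K" "m \<in> K"
  proof -
    show a: "a \<in> K" and b: "b \<in> K" and c: "c \<in> K" unfolding K by (auto intro: hull_inc)
    have "convex K" unfolding K by (rule convex_convex_hull)
    then show "m \<in> K" unfolding m_def using a b by (meson closed_segment_subset midpoint_in_closed_segment subsetD)
  qed
  have ld: "l \<le> diameter K" unfolding l_def using diameter_bounded_bound abcK cK compact_imp_bounded by blast
  have c1d: "\<bar>c1\<bar> \<le> diameter K"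
  proof -
    have "\<bar>c1\<bar> \<le> norm (c - m)" using Cauchy_Schwarz_ineq2[of "c - m" \<tau>] n\<tau> by (simp add: c1_def)
    also have "\<dots> \<le> diameter K" using diameter_bounded_bound[OF compact_imp_bounded[OF cK] abcK(3,4)] by (simp add: dist_norm)
    finally show ?thesis .
  qed
  have \<gamma>: "2 \<le> \<gamma>"
  proof -
    have "2 * r \<le> \<gamma> * r" using rl ld ball(3) by linarith
    then show ?thesis using ball(2) by simp
  qed
  have boxK: "x \<in> K" if x: "\<bar>?s x\<bar> \<le> l / 4" "0 \<le> ?t x" "?t x \<le> l / (\<gamma> * (1 + \<gamma>))" for x
  proof -
    \<comment> \<open>\<open>e\<close> is the barycentric coordinate of c, and \<open>p\<close>
      below is the difference of those of b and a, so membership in K amounts to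
      \<open>\<bar>p\<bar> \<le> 1 - e\<close>. Since \<open>\<bar>p\<bar>\<close> is at most 1/2 +
      e \<gamma>, it suffices that e (1 + \<gamma>) \<le> 1/2; this is the origin of the height l /
      (\<gamma> (1 + \<gamma>)).\<close>
    define e where "e = ?t x / H"
    define p where "p = 2 / l * (?s x - e * c1)"
    have "l / (\<gamma> * (1 + \<gamma>)) \<le> \<gamma> * r / (\<gamma> * (1 + \<gamma>))" using ld ball(3) \<gamma> by (intro divide_right_mono) auto
    also have "\<dots> = r / (1 + \<gamma>)" using \<gamma> by simp
    finally have "?t x \<le> r / (1 + \<gamma>)" using x(3) by linarith
    then have "e \<le> (r / (1 + \<gamma>)) / (2 * r)" unfolding e_def using rH ball(2) x(2) \<gamma> by (intro frac_le) auto
    moreover have "(r / (1 + \<gamma>)) / (2 * r) = 1 / (2 * (1 + \<gamma>))" using ball(2) by simp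
    ultimately have "e \<le> 1 / (2 * (1 + \<gamma>))" by simp
    then have e2: "e * (1 + \<gamma>) \<le> 1 / 2" using \<gamma> by (simp add: field_simps)
    have e0: "e \<ge> 0" using x(2) H by (simp add: e_def)
    have "\<bar>2 / l * c1\<bar> \<le> 1 / r * (\<gamma> * r)" unfolding abs_mult
      by (intro mult_mono) (use rl l ball(2,3) c1d in \<open>auto simp: field_simps\<close>)
    then have "e * \<bar>2 / l * c1\<bar> \<le> e * \<gamma>" using e0 ball(2) by (intro mult_left_mono) auto
    moreover have "\<bar>2 / l * ?s x\<bar> \<le> 1 / 2" using x(1) l by (simp add: abs_mult field_simps)
    moreover have "p = 2 / l * ?s x - e * (2 / l * c1)" by (simp add: p_def algebra_simps)
    then have "\<bar>p\<bar> \<le> \<bar>2 / l * ?s x\<bar> + e * \<bar>2 / l * c1\<bar>" using e0 abs_triangle_ineq4[of "2 / l * ?s x" "e * (2 / l * c1)"] by (simp add: abs_mult)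
    ultimately have pe: "\<bar>p\<bar> \<le> 1 - e" using e2 by (simp add: algebra_simps)
    have "x = m + (?s x) *\<^sub>R \<tau> + (?t x) *\<^sub>R \<nu>" using expand[of "x - m"] by (simp add: algebra_simps)
    also have "\<dots> = m + (p * (l / 2) + e * c1) *\<^sub>R \<tau> + (e * H) *\<^sub>R \<nu>"
    proof -
      have "p * (l / 2) = ?s x - e * c1" using l by (simp add: p_def)
      then have "p * (l / 2) + e * c1 = ?s x" by linarith
      moreover have "e * H = ?t x" using H by (simp add: e_def)
      ultimately show ?thesis by (simp only:)
    qed
    also have "\<dots> = ((1 - e - p) / 2) *\<^sub>R a + ((1 - e + p) / 2) *\<^sub>R b + e *\<^sub>R c"
      by (simp only: am cm) (simp add: vec_eq_iff field_simps)
    finally have xx: "x = ((1 - e - p) / 2) *\<^sub>R a + ((1 - e + p) / 2) *\<^sub>R b + e *\<^sub>R c" .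
    have "0 \<le> (1 - e - p) / 2" "0 \<le> (1 - e + p) / 2" "(1 - e - p) / 2 + (1 - e + p) / 2 + e = 1"
      using pe by (auto simp: field_simps)
    then show ?thesis unfolding K convex_hull_3 using xx e0 by blast
  qed
  have "\<gamma> * r \<le> \<gamma> * (l / 2)" using rl \<gamma> by (intro mult_left_mono) auto
  then have "diameter K \<le> \<gamma> * l / 2" using ball(3) by simp
  moreover have "(b - a) \<bullet> \<nu> = 0" using ba n\<nu> by simp
  ultimately have "side \<gamma> a b K \<nu>"
    unfolding side_def l_def[symmetric] \<tau>_def[symmetric] m_def[symmetric] using ab \<gamma> n\<nu> K1 boxK ld by auto
  then show ?thesis by (rule that)
qed

lemma side_swap:
  assumes "side \<gamma> a b K \<nu>"
  shows "side \<gamma> b a K \<nu>"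
proof -
  have e: "(b - a) /\<^sub>R dist a b = - ((a - b) /\<^sub>R dist a b)" by (simp add: scaleR_right_diff_distrib)
  have "(a - b) \<bullet> \<nu> = 0" using assms by (simp add: side_def inner_diff_left)
  then show ?thesis using assms unfolding side_def e by (auto simp: midpoint_sym dist_commute)
qed

lemma side_tau:
  assumes "side \<gamma> a b K \<nu>"
  shows "norm ((b - a) /\<^sub>R dist a b) = 1" "((b - a) /\<^sub>R dist a b) \<bullet> \<nu> = 0" "norm \<nu> = 1" "dist a b > 0"
  using assms by (auto simp: side_def dist_norm norm_minus_commute)

lemma side_frame: "side \<gamma> a b K \<nu> \<Longrightarrow> \<rho> > 0 \<Longrightarrow> \<delta> > 0 \<Longrightarrow> frame ((b - a) /\<^sub>R dist a b) \<nu> \<rho> \<delta>"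
  using side_tau by unfold_locales auto

text \<open>Near a boundary point the set below the graph misses \<Omega>, so no boundary point is
  interior to the closure. This excludes slits, and it turns statements about triangles, which only
  cover the closure, into statements about \<Omega>.\<close>

lemma Lipschitz_interior_closure:
  assumes "open \<Omega>" "lipschitz_boundary \<Omega>"
  shows "interior (closure \<Omega>) = \<Omega>"
proof
  show "\<Omega> \<subseteq> interior (closure \<Omega>)" using assms(1) by (simp add: interior_maximal closure_subset)
  show "interior (closure \<Omega>) \<subseteq> \<Omega>"
  proof
    fix x assume x: "x \<in> interior (closure \<Omega>)"
    show "x \<in> \<Omega>"
    proof (rule ccontr)
      assume nx: "x \<notin> \<Omega>"
      have "x \<in> frontier \<Omega>"
        using x nx interior_subset[of "closure \<Omega>"] assms(1) by (auto simp: frontier_def interior_open)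
      then obtain r t n L g where r: "r > 0" "norm n = 1" "t \<bullet> n = 0" "L-lipschitz_on (UNIV::real set) g"
        "\<And>z. z \<in> ball x r \<Longrightarrow> z \<in> \<Omega> \<longleftrightarrow> g (t \<bullet> (z - x)) < n \<bullet> (z - x)"
        using assms(2) unfolding lipschitz_boundary_def by metis
      have cg: "continuous_on UNIV g" using r(4) lipschitz_on_continuous_on by blast
      have g0: "g 0 \<ge> 0" using r(5)[of x] nx r(1) by simp
      obtain e where e: "e > 0" "ball x e \<subseteq> closure \<Omega>" using x by (meson mem_interior)
      define s where "s = min r e / 2"
      have s: "s > 0" "s < r" "s < e" using r(1) e(1) by (auto simp: s_def min_def)
      \<comment> \<open>Straight below x the argument of \<open>g\<close> is still 0, and
        \<open>g 0 \<ge> 0\<close>, so z lies strictly under the graph although it is close enough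
        to x to belong to the closure.\<close>
      define z where "z = x - s *\<^sub>R n"
      have dz: "dist x z = s" using s r(2) by (simp add: z_def dist_norm)
      have "z \<in> closure \<Omega>" using e(2) dz s by auto
      let ?U = "{w. n \<bullet> (w - x) < g (t \<bullet> (w - x))} \<inter> ball x r"
      have cc: "continuous_on UNIV (\<lambda>w. g (t \<bullet> (w - x)))"
        by (rule continuous_on_compose2[OF cg]) (auto intro!: continuous_intros)
      have "open ?U" by (intro open_Int open_Collect_less cc open_ball continuous_intros)
      moreover have "n \<bullet> n = 1" using r(2) by (simp add: norm_eq_1)
      then have "z \<in> ?U" using s g0 r(3) dz by (simp add: z_def)
      ultimately have "?U \<inter> \<Omega> \<noteq> {}" using \<open>z \<in> closure \<Omega>\<close> open_Int_closure_eq_empty[of ?U \<Omega>] by blast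
      then show False using r(5) by fastforce
    qed
  qed
qed

section \<open>The mesh: sides, neighbours and patches\<close>

locale mesh =
  fixes \<Omega> :: "point set" and \<gamma> :: real and \<T> :: "point set set"
  assumes domain: "polygonal_lipschitz_domain \<Omega>" and regular: "regular_triangulation \<Omega> \<T>"
    and shape: "\<And>T. T \<in> \<T> \<Longrightarrow> \<exists>x r. r > 0 \<and> cball x r \<subseteq> T \<and> diameter T \<le> \<gamma> * r"
begin

lemma open_\<Omega>: "open \<Omega>" and interior_closure: "interior (closure \<Omega>) = \<Omega>"
  using domain Lipschitz_interior_closure by (auto simp: polygonal_lipschitz_domain_def)

lemma finite_\<T>: "finite \<T>" and simplex: "T \<in> \<T> \<Longrightarrow> 2 simplex T" and Union_\<T>: "\<Union>\<T> = closure \<Omega>"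
  and Int_face: "T \<in> \<T> \<Longrightarrow> K \<in> \<T> \<Longrightarrow> (T \<inter> K) face_of T"
  using regular by (auto simp: regular_triangulation_def triangulation_def)

lemma triangle_compact: "T \<in> \<T> \<Longrightarrow> compact T" and triangle_convex: "T \<in> \<T> \<Longrightarrow> convex T"
  using simplex by (auto intro: compact_simplex convex_simplex)

lemma triangle_subset: "T \<in> \<T> \<Longrightarrow> T \<subseteq> closure \<Omega>"
  using Union_\<T> by auto

lemma triangle_interior_subset: "T \<in> \<T> \<Longrightarrow> interior T \<subseteq> \<Omega>"
  using interior_mono[OF triangle_subset] interior_closure by auto

lemma ex_side:
  assumes "T \<in> \<T>" "F edge_of T" "F = closed_segment a b"
  shows "\<exists>\<nu>. side \<gamma> a b T \<nu>"
proof -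
  obtain a' b' c where abc: "T = convex hull {a', b', c}" "\<not> collinear {a', b', c}" "F = closed_segment a' b'"
    using edge_of_triangle[OF simplex[OF assms(1)] assms(2)] by blast
  obtain z r where "r > 0" "cball z r \<subseteq> T" "diameter T \<le> \<gamma> * r" using shape[OF assms(1)] by blast
  then obtain \<nu> where \<nu>: "side \<gamma> a' b' T \<nu>" using triangle_side[OF abc(1,2)] by blast
  have "{a, b} = {a', b'}" using assms(3) abc(3) by simp
  then have "(a = a' \<and> b = b') \<or> (a = b' \<and> b = a')" by (auto simp: doubleton_eq_iff)
  then show ?thesis using \<nu> side_swap by blast
qed

lemma edge_segment:
  assumes "T \<in> \<T>" "F edge_of T"
  obtains a b where "F = closed_segment a b"
  using edge_of_triangle[OF simplex[OF assms(1)] assms(2)] by blast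

lemma aff_dim_triangle: "T \<in> \<T> \<Longrightarrow> aff_dim T = 2"
  using simplex aff_dim_simplex by fastforce

text \<open>The intersection is a face of both triangles. An open subset gives it dimension 2, and a
  proper face has smaller dimension.\<close>

lemma Int_open_imp_eq:
  assumes "T \<in> \<T>" "K \<in> \<T>" "open U" "U \<noteq> {}" "U \<subseteq> T" "U \<subseteq> K"
  shows "T = K"
proof -
  have "aff_dim U = 2" using aff_dim_open[OF assms(3,4)] by simp
  moreover have "aff_dim U \<le> aff_dim (T \<inter> K)" using assms by (intro aff_dim_subset) auto
  ultimately have "\<not> aff_dim (T \<inter> K) < 2" by simp
  then have "T \<inter> K = T" "K \<inter> T = K"
    using face_of_aff_dim_lt[OF triangle_convex Int_face] assms(1,2) aff_dim_triangle by (metis Int_commute)+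
  then show ?thesis by blast
qed

text \<open>Both triangles contain the open box above the middle of the edge.\<close>

lemma same_side_eq:
  assumes "T \<in> \<T>" "K \<in> \<T>" and s: "side \<gamma> a b T \<nu>" "side \<gamma> a b K \<nu>"
  shows "T = K"
proof -
  define l where "l = dist a b"
  define \<tau> where "\<tau> = (b - a) /\<^sub>R l"
  have g: "\<gamma> \<ge> 2" "l > 0" using s(1) by (auto simp: side_def l_def)
  define d where "d = l / (\<gamma> * (1 + \<gamma>))"
  have d: "d > 0" using g by (simp add: d_def)
  interpret frame "midpoint a b" \<tau> \<nu> 1 1
    using side_frame[OF s(1), of 1 1] unfolding \<tau>_def l_def by (simp add: frame_def)
  let ?U = "{x. \<bar>(x - midpoint a b) \<bullet> \<tau>\<bar> < l / 4 \<and> 0 < (x - midpoint a b) \<bullet> \<nu> \<and> (x - midpoint a b) \<bullet> \<nu> < d}"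
  have sub: "?U \<subseteq> S" if "side \<gamma> a b S \<nu>" for S
    using that unfolding side_def \<tau>_def[symmetric] l_def[symmetric] d_def[symmetric] by auto
  have op: "open ?U" by (intro open_Collect_conj open_Collect_less continuous_intros)
  have "midpoint a b + (d / 2) *\<^sub>R \<nu> \<in> ?U"
    using g d norm_\<nu> orth by (simp add: norm_eq_1 inner_commute)
  then have "?U \<noteq> {}" by blast
  then show ?thesis using Int_open_imp_eq[OF assms(1,2) op _ sub[OF s(1)] sub[OF s(2)]] by blast
qed

lemma opposite_side:
  assumes "T \<in> \<T>" "K \<in> \<T>" "T \<noteq> K" and s: "side \<gamma> a b T \<nu>" and K: "F edge_of K" "F = closed_segment a b"
  shows "side \<gamma> a b K (- \<nu>)"
proof -
  obtain \<nu>' where \<nu>': "side \<gamma> a b K \<nu>'" using ex_side[OF assms(2) K] by blast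
  have "\<nu>' = \<nu> \<or> \<nu>' = - \<nu>"
    using unit_orthogonal_cases side_tau[OF s] side_tau[OF \<nu>'] by blast
  moreover have "\<nu>' \<noteq> \<nu>" using same_side_eq[OF assms(1,2) s] \<nu>' assms(3) by blast
  ultimately show ?thesis using \<nu>' by blast
qed

lemma at_most_two:
  assumes "T \<in> \<T>" "K \<in> \<T>" "S \<in> \<T>" "T \<noteq> K" "F edge_of T" "F edge_of K" "F edge_of S"
  shows "S = T \<or> S = K"
proof (rule ccontr)
  assume *: "\<not> ?thesis"
  obtain a b where ab: "F = closed_segment a b" using edge_segment[OF assms(1,5)] by blast
  obtain \<nu> where s: "side \<gamma> a b T \<nu>" using ex_side[OF assms(1,5) ab] by blast
  have "side \<gamma> a b K (- \<nu>)" "side \<gamma> a b S (- \<nu>)"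
    using opposite_side[OF assms(1,2,4) s assms(6) ab] opposite_side[OF assms(1,3) _ s assms(7) ab] * by auto
  then show False using same_side_eq[OF assms(2,3)] * by blast
qed

text \<open>The open box is covered by two triangles on opposite sides, hence lies in the interior
  of the closure, which is \<Omega>. This places the test functions of interior edges inside
  \<Omega>, and it shows that an edge of two triangles is not on the boundary.\<close>

lemma side_box_interior:
  assumes T: "side \<gamma> a b T \<nu>" "T \<subseteq> closure \<Omega>" and K: "side \<gamma> a b K (- \<nu>)" "K \<subseteq> closure \<Omega>"
    and x: "\<bar>(x - midpoint a b) \<bullet> ((b - a) /\<^sub>R dist a b)\<bar> < dist a b / 4"
      "\<bar>(x - midpoint a b) \<bullet> \<nu>\<bar> < dist a b / (\<gamma> * (1 + \<gamma>))"
  shows "x \<in> \<Omega>"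
proof -
  let ?U = "{x. \<bar>(x - midpoint a b) \<bullet> ((b - a) /\<^sub>R dist a b)\<bar> < dist a b / 4 \<and> \<bar>(x - midpoint a b) \<bullet> \<nu>\<bar> < dist a b / (\<gamma> * (1 + \<gamma>))}"
  have "open ?U" by (intro open_Collect_conj open_Collect_less continuous_intros)
  moreover have "y \<in> closure \<Omega>" if "y \<in> ?U" for y
  proof (cases "0 \<le> (y - midpoint a b) \<bullet> \<nu>")
    case True
    then have "y \<in> T" using T(1) that unfolding side_def by auto
    then show ?thesis using T(2) by blast
  next
    case False
    then have "y \<in> K" using K(1) that unfolding side_def by auto
    then show ?thesis using K(2) by blast
  qed
  ultimately have "?U \<subseteq> interior (closure \<Omega>)" by (intro interior_maximal) auto
  then show ?thesis using x interior_closure by auto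
qed

lemma boundary_face_unique:
  assumes "T \<in> \<T>" "K \<in> \<T>" "F edge_of T" "F edge_of K" "F \<subseteq> frontier \<Omega>"
  shows "K = T"
proof (rule ccontr)
  assume "K \<noteq> T"
  obtain a b where ab: "F = closed_segment a b" using edge_segment[OF assms(1,3)] by blast
  obtain \<nu> where s: "side \<gamma> a b T \<nu>" using ex_side[OF assms(1,3) ab] by blast
  have s': "side \<gamma> a b K (- \<nu>)" using opposite_side[OF assms(1,2) _ s assms(4) ab] \<open>K \<noteq> T\<close> by auto
  have "midpoint a b \<in> \<Omega>"
    by (rule side_box_interior[OF s triangle_subset[OF assms(1)] s' triangle_subset[OF assms(2)]])
       (use s in \<open>auto simp: side_def\<close>)
  moreover have "midpoint a b \<in> F" using ab by (simp add: midpoint_in_closed_segment)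
  ultimately show False using assms(5) open_\<Omega> by (auto simp: frontier_def interior_open)
qed

text \<open>Points of \<Omega> tend to a relative interior point of the edge from the side away from
  T. One of the finitely many triangles contains infinitely many of them and hence the limit; its
  common face with T meets the relative interior of F.\<close>

lemma interior_face_neighbour:
  assumes T: "T \<in> \<T>" "F edge_of T" and nF: "\<not> F \<subseteq> frontier \<Omega>"
  obtains K where "K \<in> \<T>" "F edge_of K" "K \<noteq> T"
proof -
  obtain a b where ab: "F = closed_segment a b" using edge_segment[OF T] by blast
  obtain \<nu> where s: "side \<gamma> a b T \<nu>" using ex_side[OF T ab] by blast
  have FT: "F \<subseteq> T" "F face_of T" "aff_dim F = 1" using T(2) by (auto simp: edge_of_def face_of_imp_subset)
  obtain x0 where x0: "x0 \<in> F" "x0 \<in> \<Omega>"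
  proof -
    obtain y where y: "y \<in> F" "y \<notin> frontier \<Omega>" using nF by blast
    then have "y \<in> closure \<Omega>" using FT(1) triangle_subset[OF T(1)] by blast
    then show ?thesis using that y open_\<Omega> by (auto simp: frontier_def interior_open)
  qed
  have anb: "a \<noteq> b" using s by (simp add: side_def)
  have "x0 \<in> closure (open_segment a b)" using x0(1) ab anb by (simp add: closure_open_segment)
  then have "open_segment a b \<inter> \<Omega> \<noteq> {}" using x0(2) open_Int_closure_eq_empty[OF open_\<Omega>, of "open_segment a b"] by blast
  then obtain x where x: "x \<in> open_segment a b" "x \<in> \<Omega>" by blast
  have \<nu>: "norm \<nu> = 1" "(b - a) \<bullet> \<nu> = 0" using s by (auto simp: side_def)
  have x\<nu>: "(x - midpoint a b) \<bullet> \<nu> = 0"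
  proof -
    obtain u where u: "x = (1 - u) *\<^sub>R a + u *\<^sub>R b" using x(1) by (auto simp: in_segment)
    have "(x - midpoint a b) $ i = (u - 1/2) * (b $ i - a $ i)" for i
      unfolding u by (simp add: midpoint_def field_simps)
    then have "x - midpoint a b = (u - 1/2) *\<^sub>R (b - a)" by (simp add: vec_eq_iff)
    then show ?thesis using \<nu> by simp
  qed
  obtain e where e: "e > 0" "ball x e \<subseteq> \<Omega>" using x(2) open_\<Omega> open_contains_ball by blast
  \<comment> \<open>The shift \<open>n + 2\<close> keeps the distance to x strictly below
    \<open>e\<close> already for \<open>n = 0\<close>.\<close>
  define y where "y n = x - (e / real (n + 2)) *\<^sub>R \<nu>" for n
  have yb: "y n \<in> ball x e" for n
  proof -
    have "dist x (y n) = e / real (n + 2)" using e(1) \<nu> by (simp add: y_def dist_norm)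
    also have "\<dots> < e / 1" using e(1) by (intro divide_strict_left_mono) auto
    finally show ?thesis by simp
  qed
  have lim: "y \<longlonglongrightarrow> x"
  proof -
    have "(\<lambda>n. inverse (real (n + 2))) \<longlonglongrightarrow> 0"
      using LIMSEQ_ignore_initial_segment[OF lim_inverse_n, of 2] by simp
    then have "(\<lambda>n. x - (e * inverse (real (n + 2))) *\<^sub>R \<nu>) \<longlonglongrightarrow> x - (e * 0) *\<^sub>R \<nu>" by (intro tendsto_intros)
    then show ?thesis unfolding y_def[abs_def] by (simp add: divide_inverse)
  qed
  have "\<exists>K\<in>\<T>. y n \<in> K" for n using yb[of n] e(2) Union_\<T> closure_subset by blast
  then obtain k where k: "\<And>n. k n \<in> \<T>" "\<And>n. y n \<in> k n" by metis
  have "\<exists>K\<in>\<T>. infinite {n. k n = K}"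
  proof (rule ccontr)
    assume "\<not> ?thesis"
    then have "finite (\<Union>K\<in>\<T>. {n. k n = K})" using finite_\<T> by auto
    moreover have "(\<Union>K\<in>\<T>. {n. k n = K}) = UNIV" using k(1) by auto
    ultimately show False by simp
  qed
  then obtain K where K: "K \<in> \<T>" "infinite {n. k n = K}" by blast
  then obtain n0 where n0: "k n0 = K" 
  proof -
    have "{n. k n = K} \<noteq> {}" using K(2) by (intro notI) simp
    then show ?thesis using that by blast
  qed
  have fr: "frequently (\<lambda>n. y n \<in> K) sequentially"
  proof -
    have "{n. k n = K} \<subseteq> {n. y n \<in> K}" using k(2) by auto
    then have "infinite {n. y n \<in> K}" using K(2) finite_subset by blast
    then show ?thesis unfolding cofinite_eq_sequentially[symmetric] frequently_cofinite .
  qed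
  have xK: "x \<in> K"
  proof (rule ccontr)
    assume "x \<notin> K"
    then have "eventually (\<lambda>n. y n \<in> - K) sequentially"
      using triangle_compact[OF K(1), THEN compact_imp_closed] by (intro topological_tendstoD[OF lim]) auto
    then have "\<not> frequently (\<lambda>n. y n \<in> K) sequentially" by (simp add: frequently_def)
    with fr show False by blast
  qed
  have F0: "y n0 \<in> K" "y n0 \<notin> T"
  proof -
    show "y n0 \<in> K" using k(2) n0 by metis
    have "(y n0 - midpoint a b) \<bullet> \<nu> = - (e / real (n0 + 2))"
      using x\<nu> \<nu>(1) by (simp add: y_def inner_diff_left norm_eq_1)
    also have "\<dots> < 0" using e(1) by simp
    finally show "y n0 \<notin> T" using s by (force simp: side_def)
  qed
  define Z where "Z = T \<inter> K"
  have xr: "x \<in> rel_interior F" using x(1) ab anb by (simp add: rel_interior_closed_segment)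
  have xF: "x \<in> F" using xr rel_interior_subset by blast
  have Z: "Z face_of T" "Z face_of K" using Int_face[OF T(1) K(1)] Int_face[OF K(1) T(1)] by (auto simp: Z_def Int_commute)
  \<comment> \<open>A face that meets the relative interior of a set contained in T contains that
    set. The dimension of \<open>Z\<close> below 2 then leaves only \<open>F = Z\<close>.\<close>
  have "F \<subseteq> Z" by (rule subset_of_face_of[OF Z(1) FT(1)]) (use xr xF xK FT(1) in \<open>auto simp: Z_def\<close>)
  have ne: "K \<noteq> T" using F0 by blast
  have "Z \<noteq> T"
  proof
    assume "Z = T"
    then have "T face_of K" "T \<noteq> K" using Z(2) ne by auto
    then have "aff_dim T < aff_dim K" using face_of_aff_dim_lt triangle_convex K(1) by blast
    then show False using aff_dim_triangle T(1) K(1) by simp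
  qed
  then have "aff_dim Z < 2" using face_of_aff_dim_lt[OF triangle_convex[OF T(1)] Z(1)] aff_dim_triangle[OF T(1)] by simp
  moreover have "F face_of Z" using FT(2) \<open>F \<subseteq> Z\<close> face_of_imp_subset[OF Z(1)] face_of_subset by blast
  moreover have "convex Z" using triangle_convex T(1) K(1) by (simp add: Z_def convex_Int)
  ultimately have "F = Z" using face_of_aff_dim_lt[of Z F] FT(3) by fastforce
  then have "F edge_of K" using Z(2) FT(3) by (simp add: edge_of_def)
  then show ?thesis using that K(1) ne by blast
qed

lemma T_plus:
  assumes "F \<in> faces \<T>"
  shows "T_plus \<T> F \<in> \<T>" "F edge_of T_plus \<T> F"
proof -
  have "\<exists>T. T \<in> \<T> \<and> F edge_of T" using assms by (auto simp: faces_def faces_of_def)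
  then have "T_plus \<T> F \<in> \<T> \<and> F edge_of T_plus \<T> F" unfolding T_plus_def by (rule someI_ex)
  then show "T_plus \<T> F \<in> \<T>" "F edge_of T_plus \<T> F" by auto
qed

lemma T_minus:
  assumes "F \<in> interior_faces \<Omega> \<T>"
  shows "T_minus \<T> F \<in> \<T>" "F edge_of T_minus \<T> F" "T_minus \<T> F \<noteq> T_plus \<T> F"
proof -
  have F: "F \<in> faces \<T>" "\<not> F \<subseteq> frontier \<Omega>" using assms by (auto simp: interior_faces_def)
  obtain K where "K \<in> \<T>" "F edge_of K" "K \<noteq> T_plus \<T> F" using interior_face_neighbour[OF T_plus[OF F(1)] F(2)] by blast
  then have "\<exists>T. T \<in> \<T> \<and> F edge_of T \<and> T \<noteq> T_plus \<T> F" by blast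
  then have "T_minus \<T> F \<in> \<T> \<and> F edge_of T_minus \<T> F \<and> T_minus \<T> F \<noteq> T_plus \<T> F" unfolding T_minus_def by (rule someI_ex)
  then show "T_minus \<T> F \<in> \<T>" "F edge_of T_minus \<T> F" "T_minus \<T> F \<noteq> T_plus \<T> F" by auto
qed

lemma face_cases:
  assumes "T \<in> \<T>" "F edge_of T"
  shows "F \<in> faces \<T>"
    and "F \<in> interior_faces \<Omega> \<T> \<Longrightarrow> T = T_plus \<T> F \<or> T = T_minus \<T> F"
    and "F \<notin> interior_faces \<Omega> \<T> \<Longrightarrow> T = T_plus \<T> F"
proof -
  show F: "F \<in> faces \<T>" using assms by (auto simp: faces_def faces_of_def)
  show "T = T_plus \<T> F \<or> T = T_minus \<T> F" if "F \<in> interior_faces \<Omega> \<T>"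
    using at_most_two[OF T_plus(1)[OF F] T_minus(1)[OF that] assms(1) _ T_plus(2)[OF F] T_minus(2)[OF that] assms(2)] T_minus(3)[OF that] by auto
  show "T = T_plus \<T> F" if "F \<notin> interior_faces \<Omega> \<T>"
    using boundary_face_unique[OF T_plus(1)[OF F] assms(1) T_plus(2)[OF F] assms(2)] that F by (auto simp: interior_faces_def)
qed

lemma patch_subset:
  assumes "T \<in> \<T>" "F \<in> faces_of T"
  shows "T_plus \<T> F \<in> submesh \<T> (patch \<Omega> \<T> T)"
    and "F \<in> interior_faces \<Omega> \<T> \<Longrightarrow> T_minus \<T> F \<in> submesh \<T> (patch \<Omega> \<T> T)"
    and "T \<in> submesh \<T> (patch \<Omega> \<T> T)"
proof -
  have e: "F edge_of T" using assms by (simp add: faces_of_def)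
  note fc = face_cases[OF assms(1) e]
  have sub: "face_patch \<Omega> \<T> F \<subseteq> patch \<Omega> \<T> T" using assms(2) by (auto simp: patch_def)
  have p: "T_plus \<T> F \<subseteq> face_patch \<Omega> \<T> F" by (auto simp: face_patch_def)
  show "T_plus \<T> F \<in> submesh \<T> (patch \<Omega> \<T> T)" using T_plus[OF fc(1)] p sub by (auto simp: submesh_def)
  show "T_minus \<T> F \<in> submesh \<T> (patch \<Omega> \<T> T)" if i: "F \<in> interior_faces \<Omega> \<T>"
    using T_minus[OF i] sub i by (auto simp: submesh_def face_patch_def)
  then show "T \<in> submesh \<T> (patch \<Omega> \<T> T)" using fc(2,3) \<open>T_plus \<T> F \<in> submesh \<T> (patch \<Omega> \<T> T)\<close> by metis
qed

end

section \<open>Piecewise polynomials\<close>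

lemma poly_deg_le_elementary:
  assumes "poly_deg_le k p"
  shows "elementary p"
proof -
  obtain c where c: "\<And>x. p x = (\<Sum>i\<le>k. \<Sum>j\<le>k-i. c i j * x$1 ^ i * x$2 ^ j)" using assms by (auto simp: poly_deg_le_def)
  have pow: "elementary (\<lambda>x. x$i ^ n)" for i n
  proof (induction n)
    case 0 show ?case using elementary_const[of 1] by simp
  next
    case (Suc n) then show ?case by (auto intro: elementary.mult elementary_coord)
  qed
  have sum: "elementary (\<lambda>x. \<Sum>i\<in>A. g i x)" if "finite A" "\<And>i. elementary (g i)" for A :: "nat set" and g
    using that by (induction A rule: finite_induct) (auto intro: elementary_const elementary.add)
  have "elementary (\<lambda>x. \<Sum>i\<le>k. \<Sum>j\<le>k-i. c i j * x$1 ^ i * x$2 ^ j)"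
    by (intro sum elementary.mult pow elementary_const) auto
  moreover have "p = (\<lambda>x. \<Sum>i\<le>k. \<Sum>j\<le>k-i. c i j * x$1 ^ i * x$2 ^ j)" by (rule ext) (rule c)
  ultimately show ?thesis by simp
qed

lemma poly_deg_le_0: "poly_deg_le 0 p \<longleftrightarrow> (\<exists>c. p = (\<lambda>x. c))"
proof
  assume "\<exists>c. p = (\<lambda>x. c)"
  then obtain c where "p = (\<lambda>x. c)" by blast
  then show "poly_deg_le 0 p" unfolding poly_deg_le_def by (intro exI[of _ "\<lambda>_ _. c"]) simp
qed (auto simp: poly_deg_le_def)

lemma poly_deg_le_1: "poly_deg_le 1 p \<longleftrightarrow> (\<exists>c v. p = (\<lambda>x. c + x \<bullet> v))"
proof
  assume "poly_deg_le 1 p"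
  then obtain c where c: "\<And>x. p x = (\<Sum>i\<le>1. \<Sum>j\<le>1-i. c i j * x$1 ^ i * x$2 ^ j)" by (auto simp: poly_deg_le_def)
  have "p x = c 0 0 + x \<bullet> vector [c 1 0, c 0 1]" for x
    unfolding c by (simp add: inner_vec_def sum_2 algebra_simps)
  then show "\<exists>c v. p = (\<lambda>x. c + x \<bullet> v)" by blast
next
  assume "\<exists>c v. p = (\<lambda>x. c + x \<bullet> v)"
  then obtain b v where p: "p = (\<lambda>x. b + x \<bullet> v)" by blast
  show "poly_deg_le 1 p" unfolding poly_deg_le_def p
    by (intro exI[of _ "\<lambda>i j. if i = 0 \<and> j = 0 then b else if i = 1 then v$1 else v$2"]) 
       (simp add: inner_vec_def sum_2 algebra_simps)
qed

lemma poly_deg_le_1_pd: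
  assumes "poly_deg_le 1 p"
  shows "\<exists>g. \<forall>i x. pd i p x = g $ i"
  using assms unfolding poly_deg_le_1 by (auto simp: pd_affine)

text \<open>\<open>D\<close> is the constant Hessian, and the last clause is the exact first-order
  expansion of the gradient. Hence a gradient jump is determined by \<open>D\<close> and its value
  at one point.\<close>

lemma poly_deg_le_2_pd:
  assumes "poly_deg_le 2 p"
  shows "\<exists>D. (\<forall>i j x. pd j (pd i p) x = D i j) \<and> D 1 2 = D 2 1 \<and>
     (\<forall>i x y. pd i p x - pd i p y = D i 1 * (x - y)$1 + D i 2 * (x - y)$2)"
proof -
  obtain c where c: "\<And>x. p x = (\<Sum>i\<le>2. \<Sum>j\<le>2-i. c i j * x$1 ^ i * x$2 ^ j)" using assms by (auto simp: poly_deg_le_def)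
  have p: "p = (\<lambda>x. c 0 0 + c 0 1 * x$2 + c 0 2 * (x$2 * x$2) + c 1 0 * x$1 + c 1 1 * (x$1 * x$2) + c 2 0 * (x$1 * x$1))"
    by (rule ext) (simp add: c numeral_2_eq_2 power2_eq_square algebra_simps)
  have nth: "((\<lambda>x::point. x $ i) has_derivative (\<lambda>h. h $ i)) (at x)" for i x
    by (rule bounded_linear.has_derivative[OF bounded_linear_vec_nth has_derivative_ident])
  have "(p has_derivative (\<lambda>h. (c 1 0 + c 1 1 * x$2 + 2 * c 2 0 * x$1) * h$1 + (c 0 1 + 2 * c 0 2 * x$2 + c 1 1 * x$1) * h$2)) (at x)" for x
    unfolding p by (rule derivative_eq_intros nth refl)+ (simp add: algebra_simps fun_eq_iff)
  then have "pd i p x = (c 1 0 + c 1 1 * x$2 + 2 * c 2 0 * x$1) * axis i 1 $ 1 + (c 0 1 + 2 * c 0 2 * x$2 + c 1 1 * x$1) * axis i 1 $ 2" for i x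
    using pd_eqI by blast
  then have p1: "pd 1 p = (\<lambda>x. c 1 0 + x \<bullet> vector [2 * c 2 0, c 1 1])" and p2: "pd 2 p = (\<lambda>x. c 0 1 + x \<bullet> vector [c 1 1, 2 * c 0 2])"
    by (simp_all add: fun_eq_iff axis_def inner_vec_def sum_2 algebra_simps)
  define D where "D i j = (if i = 1 then vector [2 * c 2 0, c 1 1] $ j else vector [c 1 1, 2 * c 0 2] $ j :: real)" for i j :: 2
  have "\<forall>i j x. pd j (pd i p) x = D i j" unfolding forall_2 p1 p2 by (simp add: pd_affine D_def)
  moreover have "D 1 2 = D 2 1" by (simp add: D_def)
  moreover have "\<forall>i x y. pd i p x - pd i p y = D i 1 * (x - y)$1 + D i 2 * (x - y)$2"
    unfolding forall_2 p1 p2 by (simp add: D_def inner_vec_def sum_2 algebra_simps)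
  ultimately show ?thesis by blast
qed

lemma affine_interpolation:
  fixes a b c :: point
  assumes "\<not> collinear {a, b, c}"
  shows "\<exists>w. poly_deg_le 1 w \<and> w a = p \<and> w b = q \<and> w c = r"
proof -
  define d where "d = (b - a) \<bullet> perp (c - a)"
  have d': "(c - a) \<bullet> perp (b - a) = - d" by (simp add: d_def perp_def inner_vec_def sum_2 algebra_simps)
  have "d \<noteq> 0"
  proof
    assume d0: "d = 0"
    have ac: "c \<noteq> a"
    proof
      assume "c = a"
      then have "{a, b, c} = {a, b}" by auto
      then show False using assms by simp
    qed
    define \<tau> where "\<tau> = (c - a) /\<^sub>R norm (c - a)"
    have n: "norm \<tau> = 1" using ac by (simp add: \<tau>_def)
    interpret frame 0 \<tau> "perp \<tau>" 1 1 by unfold_locales (use n in \<open>auto simp: perp_props\<close>)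
    have "perp \<tau> = perp (c - a) /\<^sub>R norm (c - a)" by (simp add: \<tau>_def perp_def vec_eq_iff forall_2 algebra_simps)
    then have "(b - a) \<bullet> perp \<tau> = 0" using d0 by (simp add: d_def)
    then have "b - a = ((b - a) \<bullet> \<tau>) *\<^sub>R \<tau>" using expand[of "b - a"] by simp
    then have "b - a = ((b - a) \<bullet> \<tau> / norm (c - a)) *\<^sub>R (c - a)" by (subst (asm) (2) \<tau>_def) (simp add: divide_inverse)
    then have "collinear {0, c - a, b - a}" unfolding collinear_lemma by blast
    then have "collinear {c, a, b}" by (subst collinear_3) auto
    then show False using assms by (simp add: insert_commute)
  qed
  \<comment> \<open>Cramer's rule: \<open>d\<close> is twice the area of the triangle up to sign,
    and the quotients by \<open>d\<close> are barycentric coordinates.\<close>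
  let ?w = "\<lambda>x. (p - a \<bullet> (((q - p) / d) *\<^sub>R perp (c - a) - ((r - p) / d) *\<^sub>R perp (b - a)))
     + x \<bullet> (((q - p) / d) *\<^sub>R perp (c - a) - ((r - p) / d) *\<^sub>R perp (b - a))"
  have w: "?w x = p + (q - p) / d * ((x - a) \<bullet> perp (c - a)) - (r - p) / d * ((x - a) \<bullet> perp (b - a))" for x
    by (simp add: inner_simps algebra_simps)
  have "poly_deg_le 1 ?w" unfolding poly_deg_le_1 by blast
  moreover have "?w a = p" unfolding w by simp
  moreover have "?w b = q" unfolding w using \<open>d \<noteq> 0\<close> by (simp add: d_def[symmetric] perp_props)
  moreover have "?w c = r" unfolding w using \<open>d \<noteq> 0\<close> by (simp add: d' perp_props)
  ultimately show ?thesis by blast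
qed

section \<open>Integrals along edges and over triangles\<close>

lemma integral_unit_interval_reflect:
  fixes g :: "real \<Rightarrow> real"
  shows "(LINT t|lebesgue_on {0..1}. g (1 - t)) = (LINT t|lebesgue_on {0..1}. g t)"
proof -
  have "(LINT t|lebesgue. indicator {0..1} t * g t) = \<bar>- 1\<bar> *\<^sub>R (LINT t|lebesgue. indicator {0..1} (1 + (- 1) * t) * g (1 + (- 1) * t))"
    by (rule lebesgue_integral_real_affine) simp
  moreover have "indicator {0..1} (1 + (- 1) * t) = (indicator {0..1} t :: real)" for t :: real by (auto simp: indicator_def)
  ultimately show ?thesis by (simp add: integral_restrict_space)
qed

text \<open>A segment determines its endpoints up to exchange, and reflecting the unit interval
  preserves the integral, so the definite description has a unique candidate.\<close>

lemma face_integral_segment: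
  "face_integral (closed_segment a b) g = dist a b * (LINT t|lebesgue_on {0..1}. g (linepath a b t))"
  unfolding face_integral_def
proof (rule the_equality)
  fix I assume "\<exists>a' b'. closed_segment a b = closed_segment a' b' \<and> I = dist a' b' * (LINT t|lebesgue_on {0..1}. g (linepath a' b' t))"
  then obtain a' b' where *: "{a, b} = {a', b'}" "I = dist a' b' * (LINT t|lebesgue_on {0..1}. g (linepath a' b' t))" by auto
  then have "(a = a' \<and> b = b') \<or> (a = b' \<and> b = a')" by (auto simp: doubleton_eq_iff)
  moreover have "(LINT t|lebesgue_on {0..1}. g (linepath b a t)) = (LINT t|lebesgue_on {0..1}. g (linepath a b t))"
    using integral_unit_interval_reflect[of "\<lambda>t. g (linepath a b t)"] by (simp add: linepath_def algebra_simps)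
  ultimately show "I = dist a b * (LINT t|lebesgue_on {0..1}. g (linepath a b t))" using *(2) by (auto simp: dist_commute)
qed blast

lemma face_L2_norm_le:
  assumes "\<And>x. x \<in> closed_segment a b \<Longrightarrow> (norm (g x))\<^sup>2 \<le> S"
  shows "(face_L2_norm (closed_segment a b) g)\<^sup>2 \<le> dist a b * S"
proof -
  have S: "0 \<le> S" using assms[of a] by (meson ends_in_segment(1) order_trans zero_le_power2)
  let ?g = "\<lambda>t. (norm (g (linepath a b t)))\<^sup>2"
  let ?I = "LINT t|lebesgue_on {0..1}. ?g t"
  have I0: "0 \<le> ?I" by (rule integral_nonneg_AE) simp
  have I1: "?I \<le> S"
  proof (cases "integrable (lebesgue_on {0..1}) ?g")
    case True
    have "?I \<le> (LINT t|lebesgue_on {0..1::real}. S)"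
    proof (rule integral_mono_AE[OF True])
      show "AE t in lebesgue_on {0..1}. ?g t \<le> S"
        by (rule AE_I2) (use assms in \<open>auto simp: linepath_in_path\<close>)
    qed (simp add: integrable_const_ivl)
    also have "\<dots> = S" by (simp add: measure_restrict_space)
    finally show ?thesis .
  next
    \<comment> \<open>By convention the integral of a non-integrable function is 0, which satisfies
      the bound because \<open>S\<close> is nonnegative.\<close>
    case False then show ?thesis using S by (simp add: not_integrable_integral_eq)
  qed
  have "(face_L2_norm (closed_segment a b) g)\<^sup>2 = dist a b * ?I"
    unfolding face_L2_norm_def face_integral_segment using I0 by (intro real_sqrt_pow2) simp
  then show ?thesis using I1 by (simp add: mult_left_mono)
qed

lemma face_mid_segment: "face_mid (closed_segment a b) = midpoint a b"
  unfolding face_mid_def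
proof (rule the_equality)
  fix m assume "\<exists>a' b'. closed_segment a b = closed_segment a' b' \<and> m = midpoint a' b'"
  then obtain a' b' where "{a, b} = {a', b'}" "m = midpoint a' b'" by auto
  then show "m = midpoint a b" by (auto simp: doubleton_eq_iff midpoint_sym)
qed blast

lemma integral_convex_interior:
  fixes h :: "point \<Rightarrow> real"
  assumes K: "compact K" "convex K" and h: "(\<lambda>x. indicator (interior K) x * h x) \<in> borel_measurable lebesgue"
  shows "(LINT x|lebesgue_on K. h x) = (LINT x|lebesgue. indicator (interior K) x * h x)"
    and "integrable (lebesgue_on K) h \<longleftrightarrow> integrable lebesgue (\<lambda>x. indicator (interior K) x * h x)"
proof -
  have Kl: "K \<in> sets lebesgue" using K(1) by (simp add: lmeasurable_compact fmeasurableD)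
  have "negligible (frontier K)" using K(2) by (rule negligible_convex_frontier)
  then have "AE x in lebesgue. x \<notin> frontier K" by (intro AE_not_in) (simp add: negligible_iff_null_sets)
  then have "AE x in lebesgue. indicator (interior K) x * h x = indicator K x * h x"
  proof eventually_elim
    case (elim x)
    have "x \<in> interior K \<longleftrightarrow> x \<in> K"
      using elim interior_subset[of K] compact_imp_closed[OF K(1)] by (auto simp: frontier_def closure_closed)
    then show ?case by (simp add: indicator_def)
  qed
  from integral_lebesgue_AE[OF h this]
  show "(LINT x|lebesgue_on K. h x) = (LINT x|lebesgue. indicator (interior K) x * h x)"
    "integrable (lebesgue_on K) h \<longleftrightarrow> integrable lebesgue (\<lambda>x. indicator (interior K) x * h x)"
    by (simp_all add: integral_lebesgue_on_indicator[OF Kl])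
qed

section \<open>Nodal interpolation and projection onto constants\<close>

context mesh
begin

text \<open>There are no hanging nodes: a vertex of K that lies in T is a face of the common face,
  hence a face of T.\<close>

lemma node_extreme:
  assumes "z \<in> nodes \<T>" "T \<in> \<T>" "z \<in> T"
  shows "z extreme_point_of T"
proof -
  obtain K where K: "K \<in> \<T>" "z extreme_point_of K" using assms(1) by (auto simp: nodes_def)
  have "{z} face_of K" using K(2) by (simp add: face_of_singleton)
  moreover have "z \<in> K" using K(2) by (simp add: extreme_point_of_def)
  ultimately have "{z} face_of (T \<inter> K)" using assms(3) face_of_subset[of "{z}" K "T \<inter> K"] by simp
  then have "{z} face_of T" using Int_face[OF assms(2) K(1)] face_of_trans by blast
  then show ?thesis by (simp add: face_of_singleton)
qed

lemma extreme_node: "T \<in> \<T> \<Longrightarrow> z extreme_point_of T \<Longrightarrow> z \<in> nodes \<T>"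
  by (auto simp: nodes_def)

text \<open>The existence proof behind the choice in \<open>nodal_interp\<close>. Each triangle has
  an affine interpolant of its vertex values; on a common face two of them agree because the set of
  agreement is convex and contains the extreme points, whose hull is the face.\<close>

lemma nodal_interp_poly:
  assumes v: "\<And>z T K. z \<in> nodes \<T> \<Longrightarrow> T \<in> \<T> \<Longrightarrow> K \<in> \<T> \<Longrightarrow> z \<in> T \<Longrightarrow> z \<in> K \<Longrightarrow> v T z = v K z"
  shows "nodal_interp \<T> v \<in> pw_poly 1 \<T>"
proof -
  have "\<exists>w. poly_deg_le 1 w \<and> (\<forall>z. z extreme_point_of T \<longrightarrow> w z = v T z)" if T: "T \<in> \<T>" for T
  proof -
    obtain C where C: "\<not> affine_dependent C" "card C = 3" "T = convex hull C"
      using simplex[OF T] by (auto simp: simplex_def)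
    obtain a b c where abc: "C = {a, b, c}" "a \<noteq> b" "a \<noteq> c" "b \<noteq> c" using C(2) by (auto simp: card_3_iff)
    have "\<not> collinear {a, b, c}" using C(1) abc by (simp add: collinear_3_eq_affine_dependent)
    then obtain w where "poly_deg_le 1 w" "w a = v T a" "w b = v T b" "w c = v T c" using affine_interpolation by blast
    moreover have "z extreme_point_of T \<longleftrightarrow> z \<in> {a, b, c}" for z
      using extreme_point_of_convex_hull_affine_independent[OF C(1)] C(3) abc(1) by simp
    ultimately show ?thesis by auto
  qed
  then obtain w where w: "\<And>T. T \<in> \<T> \<Longrightarrow> poly_deg_le 1 (w T)" "\<And>T z. T \<in> \<T> \<Longrightarrow> z extreme_point_of T \<Longrightarrow> w T z = v T z"
    by metis
  have agree: "w T x = w K x" if T: "T \<in> \<T>" and K: "K \<in> \<T>" and x: "x \<in> T \<inter> K" for T K x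
  proof -
    obtain c1 v1 c2 v2 where aff: "w T = (\<lambda>x. c1 + x \<bullet> v1)" "w K = (\<lambda>x. c2 + x \<bullet> v2)"
      using w(1)[OF T] w(1)[OF K] unfolding poly_deg_le_1 by blast
    have "{x. w T x = w K x} = {x. (v1 - v2) \<bullet> x = c2 - c1}" unfolding aff by (auto simp: inner_diff_left inner_commute algebra_simps)
    then have cv: "convex {x. w T x = w K x}" by (simp add: convex_hyperplane)
    have "T \<inter> K = convex hull {z. z extreme_point_of (T \<inter> K)}"
      using T K triangle_compact triangle_convex by (intro Krein_Milman_Minkowski compact_Int convex_Int)
    also have "\<dots> \<subseteq> {x. w T x = w K x}"
    proof (rule hull_minimal[where S=convex], clarify)
      show "convex {x. w T x = w K x}" by (rule cv)
    next
      fix z assume z: "z extreme_point_of (T \<inter> K)"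
      have zT: "z extreme_point_of T" using extreme_point_of_face[OF Int_face[OF T K]] z by blast
      have zK: "z extreme_point_of K" using extreme_point_of_face[OF Int_face[OF K T]] z by (simp add: Int_commute)
      have "v T z = v K z" using v[OF extreme_node[OF T zT] T K] zT zK by (simp add: extreme_point_of_def)
      then show "w T z = w K z" using w(2) T K zT zK by simp
    qed
    finally show ?thesis using x by blast
  qed
  define P where "P w \<longleftrightarrow> w \<in> pw_poly 1 \<T> \<and> (\<forall>T\<in>\<T>. \<forall>K\<in>\<T>. \<forall>x\<in>T \<inter> K. w T x = w K x) \<and>
     (\<forall>z\<in>nodes \<T>. \<forall>T\<in>\<T>. z \<in> T \<longrightarrow> w T z = v T z)" for w :: "real pw_fun"
  have "P w" unfolding P_def
  proof (intro conjI ballI impI)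
    show "w \<in> pw_poly 1 \<T>" using w(1) by (simp add: pw_poly_def)
    show "w T x = w K x" if "T \<in> \<T>" "K \<in> \<T>" "x \<in> T \<inter> K" for T K x using agree that by blast
    show "w T z = v T z" if "z \<in> nodes \<T>" "T \<in> \<T>" "z \<in> T" for z T using w(2) node_extreme that by blast
  qed
  then have "P (SOME w. P w)" by (rule someI[of P])
  moreover have "nodal_interp \<T> v = (SOME w. P w)" unfolding nodal_interp_def P_def ..
  ultimately have "P (nodal_interp \<T> v)" by simp
  then show ?thesis unfolding P_def by (rule conjunct1)
qed

text \<open>The existence proof behind the choice in \<open>L2_proj0\<close>: the mean values
  satisfy the orthogonality triangle by triangle. They make sense since f is integrable on the
  bounded triangle and the disc inside gives it positive measure.\<close>

lemma L2_proj0_const: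
  assumes f: "square_integrable \<Omega> f" and T: "T \<in> \<T>"
  shows "\<exists>c. L2_proj0 \<T> f T = (\<lambda>x. c)"
proof -
  have \<Omega>': "\<Omega> \<in> sets lebesgue" using open_\<Omega> by auto
  have f2: "sq_int (\<lambda>x. indicator \<Omega> x * f x)"
  proof -
    have "(\<lambda>x. indicator \<Omega> x * f x) \<in> borel_measurable lebesgue"
      using f borel_measurable_restrict_space_iff[of \<Omega> lebesgue f] \<Omega>' by (simp add: square_integrable_def)
    moreover have "integrable lebesgue (\<lambda>x. indicator \<Omega> x * (norm (f x))\<^sup>2)"
      using f integral_lebesgue_on_indicator(2)[OF \<Omega>'] by (auto simp: square_integrable_def)
    moreover have "(\<lambda>x. indicator \<Omega> x * (norm (f x))\<^sup>2) = (\<lambda>x. (indicator \<Omega> x * f x)\<^sup>2)" by (auto simp: indicator_def fun_eq_iff)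
    ultimately show ?thesis by (simp add: sq_int_def)
  qed
  have fK: "integrable (lebesgue_on K) f" if K: "K \<in> \<T>" for K
  proof -
    have Kc: "compact K" "convex K" using triangle_compact triangle_convex K by auto
    have "emeasure lebesgue (interior K) < \<infinity>"
      using bounded_subset[OF compact_imp_bounded[OF Kc(1)] interior_subset, THEN emeasure_bounded_finite] by simp
    then have "sq_int (\<lambda>x. indicator (interior K) x)"
      by (auto simp: sq_int_def power2_eq_square indicator_inter_arith[symmetric] intro!: integrable_real_indicator borel_measurable_indicator)
    from sq_int_mult[OF this f2] have "integrable lebesgue (\<lambda>x. indicator (interior K) x * (indicator \<Omega> x * f x))" .
    moreover have "(\<lambda>x. indicator (interior K) x * (indicator \<Omega> x * f x)) = (\<lambda>x. indicator (interior K) x * f x)"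
      using triangle_interior_subset[OF K] by (auto simp: indicator_def fun_eq_iff)
    ultimately show ?thesis using integral_convex_interior(2)[OF Kc, of f] by auto
  qed
  have pos: "measure lebesgue K > 0" if K: "K \<in> \<T>" for K
  proof -
    obtain z r where "r > 0" "cball z r \<subseteq> K" using shape[OF K] by blast
    then have "ball z r \<subseteq> K" "ball z r \<noteq> {}" using ball_subset_cball[of z r] by auto
    then have "\<not> negligible K" using negligible_subset[of K "ball z r"] open_not_negligible[of "ball z r"] by auto
    moreover have "K \<in> lmeasurable" using triangle_compact[OF K] by (rule lmeasurable_compact)
    ultimately have "measure lebesgue K \<noteq> 0" by (simp add: negligible_iff_measure)
    then show ?thesis by (simp add: less_le)
  qed
  define q where "q K x = (LINT x|lebesgue_on K. f x) / measure lebesgue K" for K :: "point set" and x :: point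
  have "pw_integral \<T> (\<lambda>T x. (f x - q T x) * r T x) = 0" if r: "r \<in> pw_poly 0 \<T>" for r
    unfolding pw_integral_def
  proof (rule sum.neutral, rule ballI)
    fix K assume K: "K \<in> \<T>"
    obtain c where c: "r K = (\<lambda>x. c)" using r K by (auto simp: pw_poly_def poly_deg_le_0)
    have Kl: "K \<in> lmeasurable" using triangle_compact[OF K] by (rule lmeasurable_compact)
    have i: "integrable (lebesgue_on K) (\<lambda>x. b)" for b :: real using finite_measure.integrable_const[OF finite_measure_lebesgue_on[OF Kl]] .
    have m: "measure (lebesgue_on K) (space (lebesgue_on K)) = measure lebesgue K" using Kl by (simp add: measure_restrict_space fmeasurableD)
    have "(LINT x|lebesgue_on K. (f x - q K x) * r K x) = ((LINT x|lebesgue_on K. f x) - (LINT x|lebesgue_on K. q K undefined)) * c"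
      unfolding c using fK[OF K] i by (simp add: q_def)
    also have "(LINT x|lebesgue_on K. q K undefined) = (LINT x|lebesgue_on K. f x)"
      using m pos[OF K] by (simp add: q_def)
    finally show "(LINT x|lebesgue_on K. (f x - q K x) * r K x) = 0" by simp
  qed
  note orth = this
  define P where "P q \<longleftrightarrow> q \<in> pw_poly 0 \<T> \<and> (\<forall>r\<in>pw_poly 0 \<T>. pw_integral \<T> (\<lambda>T x. (f x - q T x) * r T x) = 0)" for q :: "real pw_fun"
  have "P q" unfolding P_def
  proof (intro conjI ballI)
    show "q \<in> pw_poly 0 \<T>" unfolding pw_poly_def poly_deg_le_0 q_def by blast
  qed (rule orth)
  then have "P (SOME q. P q)" by (rule someI[of P])
  moreover have "L2_proj0 \<T> f = (SOME q. P q)" unfolding L2_proj0_def P_def ..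
  ultimately have "P (L2_proj0 \<T> f)" by simp
  then have "L2_proj0 \<T> f \<in> pw_poly 0 \<T>" unfolding P_def by (rule conjunct1)
  then show ?thesis using T by (simp add: pw_poly_def poly_deg_le_0)
qed

end

section \<open>Testing with bump functions\<close>

definition U :: "(point \<Rightarrow> real) \<Rightarrow> real" where "U f = (LINT y|lebesgue. indicator upper y * f y)"

lemma U_add: "ref f \<Longrightarrow> ref g \<Longrightarrow> U (\<lambda>y. f y + g y) = U f + U g"
  unfolding U_def using ref_integrable_upper[of f] ref_integrable_upper[of g] by (simp add: distrib_left)

lemma U_cmult: "U (\<lambda>y. c * f y) = c * U f"
  unfolding U_def by (subst integral_mult_right_zero[symmetric]) (simp add: ac_simps)

lemma ref_differentiable: "ref f \<Longrightarrow> f differentiable (at y)"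
  by (simp add: ref_def elementary_differentiable)

lemma ref_commute: "ref f \<Longrightarrow> pd i (pd j f) = pd j (pd i f)"
  using pd_pd_commute_elementary by (auto simp: ref_def)

lemma pd_coord: "pd i (\<lambda>y::point. y $ j) = (\<lambda>y. if i = j then 1 else 0)"
proof
  fix y :: point
  have "pd i (\<lambda>y. y $ j) y = pd i (\<lambda>y. 0 + y \<bullet> axis j 1) y" by (simp add: inner_axis)
  also have "\<dots> = axis j 1 $ i" by (rule pd_affine)
  finally show "pd i (\<lambda>y. y $ j) y = (if i = j then 1 else 0)" by (simp add: axis_def)
qed

lemma pd_coord_mult: "ref f \<Longrightarrow> pd i (\<lambda>y. y $ j * f y) = (\<lambda>y. y $ j * pd i f y + (if i = j then f y else 0))"
  by (rule ext) (auto simp: pd_mult pd_coord ref_differentiable elementary_differentiable[OF elementary_coord])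

lemma ref_cmult: "ref f \<Longrightarrow> ref (\<lambda>y. c * f y)"
  by (intro ref_mult elementary_const)

lemma ref_coord_mult: "ref f \<Longrightarrow> ref (\<lambda>y. y $ i * f y)"
  by (intro ref_mult elementary_coord)

lemma U_pd1: "ref f \<Longrightarrow> U (pd 1 f) = 0"
  unfolding U_def by (rule ref_integral_upper_pd1)

lemma U_pd2: "ref f \<Longrightarrow> (\<And>y. y$2 = 0 \<Longrightarrow> f y = 0) \<Longrightarrow> U (pd 2 f) = 0"
  unfolding U_def by (rule ref_integral_upper_pd2)

text \<open>Integration by parts against the coordinates. Tangential derivatives have integral zero
  over the half plane, and the factor \<open>y$2\<close> removes the boundary term of the normal
  one.\<close>

lemma U_moments:
  assumes f: "ref f"
  shows "U (\<lambda>y. y$1 * pd 1 f y) = - U f" "U (\<lambda>y. y$2 * pd 1 f y) = 0" "U (\<lambda>y. y$2 * pd 2 f y) = - U f"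
proof -
  note r = ref_coord_mult[OF f] ref_coord_mult[OF ref_pd[OF f]]
  have "U (\<lambda>y. y$1 * pd 1 f y + f y) = 0" using U_pd1[OF r(1)[of 1]] pd_coord_mult[OF f, of 1 1] by simp
  then show "U (\<lambda>y. y$1 * pd 1 f y) = - U f" using U_add[OF r(2) f] by simp
  show "U (\<lambda>y. y$2 * pd 1 f y) = 0" using U_pd1[OF r(1)[of 2]] pd_coord_mult[OF f, of 1 2] by simp
  have "U (\<lambda>y. y$2 * pd 2 f y + f y) = 0" using U_pd2[OF r(1)[of 2]] pd_coord_mult[OF f, of 2 2] by simp
  then show "U (\<lambda>y. y$2 * pd 2 f y) = - U f" using U_add[OF r(2) f] by simp
qed

lemma U_bump: "U (pd 2 bump) = - c0"
  by (simp add: U_def c0_def)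

lemma U_y1_bump: "U (\<lambda>y. y$1 * pd 2 (\<lambda>y. y$1 * bump y) y) = - c1"
  unfolding pd_coord_mult[OF ref_bump] by (simp add: U_def c1_def power2_eq_square mult.assoc)

text \<open>As the bump is even, its normal derivative vanishes on the edge. This makes
  \<open>bump\<close> blind to a jump of the Hessian.\<close>

lemma U_pd2_pd2_bump: "U (pd 2 (pd 2 bump)) = 0"
  by (rule U_pd2[OF ref_pd[OF ref_bump]]) (simp add: pd2_bump)

text \<open>The counterpart: \<open>y$2 * bump y\<close> vanishes on the edge and is blind to a jump
  of the gradient, while its normal derivative there equals the bump, whence
  \<open>c0\<close>.\<close>

lemma U_y2_bump: "U (pd 2 (\<lambda>y. y$2 * bump y)) = 0" "U (pd 2 (pd 2 (\<lambda>y. y$2 * bump y))) = - c0"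
proof -
  show "U (pd 2 (\<lambda>y. y$2 * bump y)) = 0" by (rule U_pd2[OF ref_y2_bump]) simp
  have r: "ref (\<lambda>y. y$2 * pd 2 bump y)" by (intro ref_coord_mult ref_pd ref_bump)
  have "pd 2 (pd 2 (\<lambda>y. y$2 * bump y)) = (\<lambda>y. pd 2 (\<lambda>y. y$2 * pd 2 bump y) y + pd 2 bump y)"
    unfolding pd_coord_mult[OF ref_bump] by (rule ext) (simp add: pd_add ref_differentiable r ref_bump)
  moreover have "U (pd 2 (\<lambda>y. y$2 * pd 2 bump y)) = 0" by (rule U_pd2[OF r]) simp
  ultimately show "U (pd 2 (pd 2 (\<lambda>y. y$2 * bump y))) = - c0"
    using U_add[OF ref_pd[OF r] ref_pd[OF ref_bump]] U_bump by simp
qed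

lemma U_y1_pd1_pd2: "U (\<lambda>y. y$1 * pd 2 (pd 1 bump) y) = c0"
  using U_moments(1)[OF ref_pd[OF ref_bump], of 2] U_bump ref_commute[OF ref_bump, of 2 1] by simp

section \<open>Identities and bounds in a scaled frame\<close>

context frame
begin

lemma half_plane_U:
  assumes "ref f"
  shows "(LINT x|lebesgue. indicator (half_plane m \<nu>) x * f (B x)) = \<rho> * \<delta> * U f"
  using integral_half_plane_B(2)[OF assms] by (simp add: U_def)

lemma pd_ref_B: "ref f \<Longrightarrow> pd i (\<lambda>x. f (B x)) x = \<tau>$i / \<rho> * pd 1 f (B x) + \<nu>$i / \<delta> * pd 2 f (B x)"
  using pd_B[of f i] ref_differentiable by simp

lemma pd_pd_ref_B:
  assumes "ref f"
  shows "pd j (pd i (\<lambda>x. f (B x))) x = \<tau>$i * \<tau>$j / \<rho>\<^sup>2 * pd 1 (pd 1 f) (B x)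
     + (\<tau>$i * \<nu>$j + \<nu>$i * \<tau>$j) / (\<rho> * \<delta>) * pd 1 (pd 2 f) (B x) + \<nu>$i * \<nu>$j / \<delta>\<^sup>2 * pd 2 (pd 2 f) (B x)"
proof -
  let ?g = "\<lambda>y. \<tau>$i / \<rho> * pd 1 f y + \<nu>$i / \<delta> * pd 2 f y"
  have r1: "ref (\<lambda>y. \<tau>$i / \<rho> * pd 1 f y)" and r2: "ref (\<lambda>y. \<nu>$i / \<delta> * pd 2 f y)" 
    by (intro ref_cmult ref_pd assms)+
  have rg: "ref ?g" using ref_add[OF r1 r2] .
  have pc: "pd k (\<lambda>y. c * h y) y = c * pd k h y" if "ref h" for k c h y
    using pd_mult[of "\<lambda>_. c" y h k] ref_differentiable[OF that] pd_affine[of k c 0 y] by simp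
  have g: "pd k ?g y = \<tau>$i / \<rho> * pd k (pd 1 f) y + \<nu>$i / \<delta> * pd k (pd 2 f) y" for k y
    by (simp only: pd_add[OF ref_differentiable[OF r1] ref_differentiable[OF r2]] pc[OF ref_pd[OF assms]])
  have "pd j (pd i (\<lambda>x. f (B x))) x = pd j (\<lambda>x. ?g (B x)) x" using pd_ref_B[OF assms] by presburger
  also have "\<dots> = \<tau>$j / \<rho> * pd 1 ?g (B x) + \<nu>$j / \<delta> * pd 2 ?g (B x)" by (rule pd_ref_B[OF rg])
  finally show ?thesis unfolding g ref_commute[OF assms, of 2 1]
    by (simp add: algebra_simps power2_eq_square add_divide_distrib)
qed

lemma comp_decomp: "(x - m) $ k = \<rho> * B x $ 1 * \<tau> $ k + \<delta> * B x $ 2 * \<nu> $ k"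
  using arg_cong[OF expand[of "x - m"], of "\<lambda>v. v $ k"] \<rho> \<delta> by simp

lemma coord_le_1: "\<bar>\<tau> $ k\<bar> \<le> 1" "\<bar>\<nu> $ k\<bar> \<le> 1"
  using component_le_norm_cart[of \<tau> k] component_le_norm_cart[of \<nu> k] norm_\<tau> norm_\<nu> by simp_all

text \<open>An identity for the error \<open>e\<close> and its derivatives \<open>E\<close>, whose right-hand side comes from
  the jump of an affine function that vanishes at \<open>m\<close> and has the gradient \<open>D\<close>. In the frame
  only the tangential component of \<open>D\<close> survives.\<close>

lemma jump_identity:
  assumes e: "sq_int e" and E: "\<And>j. sq_int (E j)" and f: "ref f"
    and id: "\<And>j. (LINT x|lebesgue. e x * pd j (\<lambda>x. f (B x)) x + E j x * f (B x)) =
      - (LINT x|lebesgue. indicator (half_plane m \<nu>) x * ((D 1 * (x - m)$1 + D 2 * (x - m)$2) * pd j (\<lambda>x. f (B x)) x + D j * f (B x)))"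
  shows "\<tau>$j / \<rho> * (LINT x|lebesgue. e x * pd 1 f (B x)) + \<nu>$j / \<delta> * (LINT x|lebesgue. e x * pd 2 f (B x)) + (LINT x|lebesgue. E j x * f (B x))
     = - \<rho>\<^sup>2 * (D 1 * \<tau>$1 + D 2 * \<tau>$2) * \<nu>$j * U (\<lambda>y. y$1 * pd 2 f y)"
proof -
  define q where "q = D 1 * \<tau>$1 + D 2 * \<tau>$2"
  define p where "p = D 1 * \<nu>$1 + D 2 * \<nu>$2"
  have Dj: "D j = q * \<tau>$j + p * \<nu>$j" for j
  proof -
    have "D j = (vector [D 1, D 2] :: point) $ j" using exhaust_2[of j] by auto
    also have "\<dots> = (vector [D 1, D 2] \<bullet> \<tau>) * \<tau>$j + (vector [D 1, D 2] \<bullet> \<nu>) * \<nu>$j"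
      using arg_cong[OF expand[of "vector [D 1, D 2]"], of "\<lambda>v. v $ j"] by simp
    finally show ?thesis by (simp add: q_def p_def inner_vec_def sum_2)
  qed
  have J: "D 1 * (x - m)$1 + D 2 * (x - m)$2 = q * \<rho> * B x $ 1 + p * \<delta> * B x $ 2" for x
    unfolding comp_decomp[of x] q_def p_def by (simp only: algebra_simps)
  note i = integral_mult_B_le(1)[OF _ e[unfolded sq_int_def, THEN conjunct1] e[unfolded sq_int_def, THEN conjunct2]]
  have iE: "integrable lebesgue (\<lambda>x. E j x * f (B x))" using integral_mult_B_le(1)[OF f] E by (auto simp: sq_int_def)
  have "(LINT x|lebesgue. e x * pd j (\<lambda>x. f (B x)) x + E j x * f (B x)) =
     (LINT x|lebesgue. (\<tau>$j / \<rho> * (e x * pd 1 f (B x)) + \<nu>$j / \<delta> * (e x * pd 2 f (B x))) + E j x * f (B x))"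
    by (intro Bochner_Integration.integral_cong refl) (simp only: pd_ref_B[OF f] algebra_simps)
  also have "\<dots> = \<tau>$j / \<rho> * (LINT x|lebesgue. e x * pd 1 f (B x)) + \<nu>$j / \<delta> * (LINT x|lebesgue. e x * pd 2 f (B x)) + (LINT x|lebesgue. E j x * f (B x))"
    using i[OF ref_pd[OF f]] iE by simp
  finally have L: "(LINT x|lebesgue. e x * pd j (\<lambda>x. f (B x)) x + E j x * f (B x)) = \<dots>" .
  let ?h = "\<lambda>y. (q * \<tau>$j) * (y$1 * pd 1 f y) + (q * \<rho> * \<nu>$j / \<delta>) * (y$1 * pd 2 f y) + (p * \<delta> * \<tau>$j / \<rho>) * (y$2 * pd 1 f y)
     + (p * \<nu>$j) * (y$2 * pd 2 f y) + D j * f y"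
  note r = ref_cmult[OF ref_coord_mult[OF ref_pd[OF f]]] ref_cmult[OF f]
  have rh: "ref ?h" by (intro ref_add r)
  have "U ?h = (q * \<tau>$j) * U (\<lambda>y. y$1 * pd 1 f y) + (q * \<rho> * \<nu>$j / \<delta>) * U (\<lambda>y. y$1 * pd 2 f y) + (p * \<delta> * \<tau>$j / \<rho>) * U (\<lambda>y. y$2 * pd 1 f y)
     + (p * \<nu>$j) * U (\<lambda>y. y$2 * pd 2 f y) + D j * U f"
    by (simp only: U_add U_cmult r ref_add)
  \<comment> \<open>The moments \<open>- U f\<close> with the factors q \<tau>_j and p \<nu>_j
    cancel against \<open>D j * U f\<close>, because \<open>D j\<close> is the sum of these factors;
    one mixed moment is zero, the other one remains.\<close>
  also have "\<dots> = q * \<rho> * \<nu>$j / \<delta> * U (\<lambda>y. y$1 * pd 2 f y)"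
    unfolding U_moments[OF f] Dj by (simp add: algebra_simps)
  finally have Uh: "U ?h = q * \<rho> * \<nu>$j / \<delta> * U (\<lambda>y. y$1 * pd 2 f y)" .
  have "(q * \<rho> * B x $ 1 + p * \<delta> * B x $ 2) * (\<tau>$j / \<rho> * pd 1 f (B x) + \<nu>$j / \<delta> * pd 2 f (B x)) + D j * f (B x) = ?h (B x)" for x
    using \<rho> \<delta> by (simp add: field_simps del: B1 B2)
  then have "(LINT x|lebesgue. indicator (half_plane m \<nu>) x * ((D 1 * (x - m)$1 + D 2 * (x - m)$2) * pd j (\<lambda>x. f (B x)) x + D j * f (B x)))
     = (LINT x|lebesgue. indicator (half_plane m \<nu>) x * ?h (B x))"
    by (intro Bochner_Integration.integral_cong refl) (simp only: J pd_ref_B[OF f])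
  also have "\<dots> = \<rho> * \<delta> * U ?h" by (rule half_plane_U[OF rh])
  also have "\<dots> = \<rho>\<^sup>2 * q * \<nu>$j * U (\<lambda>y. y$1 * pd 2 f y)" unfolding Uh using \<delta> by (simp add: power2_eq_square)
  finally show ?thesis using id[of j] L by (simp add: q_def)
qed

lemma dir_sum: "\<tau>$1 * (\<tau>$1 / \<rho> * a1 + \<nu>$1 / \<delta> * a2 + c1') + \<tau>$2 * (\<tau>$2 / \<rho> * a1 + \<nu>$2 / \<delta> * a2 + c2') = a1 / \<rho> + (\<tau>$1 * c1' + \<tau>$2 * c2')"
  "\<nu>$1 * (\<tau>$1 / \<rho> * a1 + \<nu>$1 / \<delta> * a2 + c1') + \<nu>$2 * (\<tau>$2 / \<rho> * a1 + \<nu>$2 / \<delta> * a2 + c2') = a2 / \<delta> + (\<nu>$1 * c1' + \<nu>$2 * c2')"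
proof -
  have "\<tau>$1 * (\<tau>$1 / \<rho> * a1 + \<nu>$1 / \<delta> * a2 + c1') + \<tau>$2 * (\<tau>$2 / \<rho> * a1 + \<nu>$2 / \<delta> * a2 + c2')
    = (\<tau>$1 * \<tau>$1 + \<tau>$2 * \<tau>$2) * (a1 / \<rho>) + (\<tau>$1 * \<nu>$1 + \<tau>$2 * \<nu>$2) * (a2 / \<delta>) + (\<tau>$1 * c1' + \<tau>$2 * c2')"
    by (simp add: algebra_simps)
  then show "\<tau>$1 * (\<tau>$1 / \<rho> * a1 + \<nu>$1 / \<delta> * a2 + c1') + \<tau>$2 * (\<tau>$2 / \<rho> * a1 + \<nu>$2 / \<delta> * a2 + c2') = a1 / \<rho> + (\<tau>$1 * c1' + \<tau>$2 * c2')"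
    by (simp add: coords)
  have "\<nu>$1 * (\<tau>$1 / \<rho> * a1 + \<nu>$1 / \<delta> * a2 + c1') + \<nu>$2 * (\<tau>$2 / \<rho> * a1 + \<nu>$2 / \<delta> * a2 + c2')
    = (\<tau>$1 * \<nu>$1 + \<tau>$2 * \<nu>$2) * (a1 / \<rho>) + (\<nu>$1 * \<nu>$1 + \<nu>$2 * \<nu>$2) * (a2 / \<delta>) + (\<nu>$1 * c1' + \<nu>$2 * c2')"
    by (simp add: algebra_simps)
  then show "\<nu>$1 * (\<tau>$1 / \<rho> * a1 + \<nu>$1 / \<delta> * a2 + c1') + \<nu>$2 * (\<tau>$2 / \<rho> * a1 + \<nu>$2 / \<delta> * a2 + c2') = a2 / \<delta> + (\<nu>$1 * c1' + \<nu>$2 * c2')"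
    by (simp add: coords)
qed

lemma test_bound:
  assumes "ref f" "sq_int e" "sqrt (LINT x|lebesgue. (e x)\<^sup>2) \<le> N"
  shows "\<bar>LINT x|lebesgue. e x * f (B x)\<bar> \<le> N * (sqrt (\<rho> * \<delta>) * nrm f)"
proof -
  have "0 \<le> nrm f" unfolding nrm_def by (intro real_sqrt_ge_zero integral_nonneg_AE) simp
  then have "sqrt (LINT x|lebesgue. (e x)\<^sup>2) * (sqrt (\<rho> * \<delta>) * nrm f) \<le> N * (sqrt (\<rho> * \<delta>) * nrm f)"
    using assms(3) \<rho> \<delta> by (intro mult_right_mono) auto
  then show ?thesis using integral_mult_B_le(2)[OF assms(1), of e] assms(2) by (auto simp: sq_int_def)
qed

lemma nrm_nonneg: "0 \<le> nrm f"
  unfolding nrm_def by (intro real_sqrt_ge_zero integral_nonneg_AE) simp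

lemma dir_bound:
  assumes "\<bar>v1\<bar> \<le> 1" "\<bar>v2\<bar> \<le> 1" "\<bar>a1\<bar> \<le> N" "\<bar>a2\<bar> \<le> (N::real)"
  shows "\<bar>v1 * a1 + v2 * a2\<bar> \<le> 2 * N"
proof -
  have "\<bar>v1 * a1\<bar> \<le> 1 * N" "\<bar>v2 * a2\<bar> \<le> 1 * N" unfolding abs_mult using assms by (intro mult_mono; simp)+
  then show ?thesis by linarith
qed

text \<open>Contraction of the identity with \<nu> isolates the slope but retains the gradient error
  paired with \<open>pd 2 f\<close>. The first bound removes this term by means of the contraction
  with \<tau>, which has no jump term; the second keeps it, at the price 1 / \<delta>.\<close>

lemma tangential_jump_bound:
  assumes e: "sq_int e" and E: "\<And>j. sq_int (E j)"
    and NE: "\<And>j. sqrt (LINT x|lebesgue. (E j x)\<^sup>2) \<le> NE" and Ne: "sqrt (LINT x|lebesgue. (e x)\<^sup>2) \<le> Ne"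
    and id: "\<And>f j. ref f \<Longrightarrow> (LINT x|lebesgue. e x * pd j (\<lambda>x. f (B x)) x + E j x * f (B x)) =
      - (LINT x|lebesgue. indicator (half_plane m \<nu>) x * ((D 1 * (x - m)$1 + D 2 * (x - m)$2) * pd j (\<lambda>x. f (B x)) x + D j * f (B x)))"
  shows "\<bar>D 1 * \<tau>$1 + D 2 * \<tau>$2\<bar> * \<rho>\<^sup>2 * c0 \<le> 2 * NE * sqrt (\<rho> * \<delta>) * (nrm (pd 1 bump) + \<rho> / \<delta> * nrm (pd 2 bump))"
    and "\<bar>D 1 * \<tau>$1 + D 2 * \<tau>$2\<bar> * \<rho>\<^sup>2 * c1 \<le> sqrt (\<rho> * \<delta>) * (Ne / \<delta> * nrm (pd 2 (\<lambda>y. y$1 * bump y)) + 2 * NE * nrm (\<lambda>y. y$1 * bump y))"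
proof -
  define q where "q = D 1 * \<tau>$1 + D 2 * \<tau>$2"
  note J = jump_identity[OF e E _ id]
  define I where "I f = (LINT x|lebesgue. e x * f (B x))" for f
  define IE where "IE j f = (LINT x|lebesgue. E j x * f (B x))" for j f
  have nv: "\<nu>$1 * (a * \<nu>$1 * b) + \<nu>$2 * (a * \<nu>$2 * b) = a * b" "\<tau>$1 * (a * \<nu>$1 * b) + \<tau>$2 * (a * \<nu>$2 * b) = 0" for a b :: real
  proof -
    have "\<nu>$1 * (a * \<nu>$1 * b) + \<nu>$2 * (a * \<nu>$2 * b) = a * b * (\<nu>$1 * \<nu>$1 + \<nu>$2 * \<nu>$2)"
      "\<tau>$1 * (a * \<nu>$1 * b) + \<tau>$2 * (a * \<nu>$2 * b) = a * b * (\<tau>$1 * \<nu>$1 + \<tau>$2 * \<nu>$2)"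
      by (simp_all add: algebra_simps)
    then show "\<nu>$1 * (a * \<nu>$1 * b) + \<nu>$2 * (a * \<nu>$2 * b) = a * b" "\<tau>$1 * (a * \<nu>$1 * b) + \<tau>$2 * (a * \<nu>$2 * b) = 0" by (simp_all add: coords)
  qed
  have J': "\<tau>$j / \<rho> * I (pd 1 f) + \<nu>$j / \<delta> * I (pd 2 f) + IE j f = - \<rho>\<^sup>2 * q * \<nu>$j * U (\<lambda>y. y$1 * pd 2 f y)" if "ref f" for f j
    using J[OF that] that by (simp add: I_def IE_def q_def)
  have DT: "I (pd 1 f) / \<rho> + (\<tau>$1 * IE 1 f + \<tau>$2 * IE 2 f) = 0" if "ref f" for f
    using dir_sum(1)[of "I (pd 1 f)" "I (pd 2 f)" "IE 1 f" "IE 2 f"] nv(2)[of "- \<rho>\<^sup>2 * q" "U (\<lambda>y. y$1 * pd 2 f y)"]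
    unfolding J'[OF that] by simp
  have DN: "I (pd 2 f) / \<delta> + (\<nu>$1 * IE 1 f + \<nu>$2 * IE 2 f) = - \<rho>\<^sup>2 * q * U (\<lambda>y. y$1 * pd 2 f y)" if "ref f" for f
    using dir_sum(2)[of "I (pd 1 f)" "I (pd 2 f)" "IE 1 f" "IE 2 f"] nv(1)[of "- \<rho>\<^sup>2 * q" "U (\<lambda>y. y$1 * pd 2 f y)"]
    unfolding J'[OF that] by simp
  have bE: "\<bar>IE j f\<bar> \<le> NE * (sqrt (\<rho> * \<delta>) * nrm f)" if "ref f" for f j
    unfolding IE_def by (rule test_bound[OF that E NE])
  note r1 = ref_pd[OF ref_bump, of 1] and r2 = ref_pd[OF ref_bump, of 2]
  \<comment> \<open>The tangential contraction for \<open>pd 2 bump\<close> and the normal one for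
    \<open>pd 1 bump\<close> contain the same mixed second derivative of the bump, so the former
    expresses the gradient error of the latter by Hessian errors.\<close>
  have "I (pd 2 (pd 1 bump)) / \<delta> = - (\<rho> / \<delta>) * (\<tau>$1 * IE 1 (pd 2 bump) + \<tau>$2 * IE 2 (pd 2 bump))"
    using DT[OF r2] \<rho> \<delta> unfolding ref_commute[OF ref_bump, of 2 1] by (simp add: field_simps add_eq_0_iff)
  then have "\<rho>\<^sup>2 * q * c0 = (\<rho> / \<delta>) * (\<tau>$1 * IE 1 (pd 2 bump) + \<tau>$2 * IE 2 (pd 2 bump)) - (\<nu>$1 * IE 1 (pd 1 bump) + \<nu>$2 * IE 2 (pd 1 bump))"
    using DN[OF r1] unfolding U_y1_pd1_pd2 by simp
  then have "\<bar>\<rho>\<^sup>2 * q * c0\<bar> \<le> (\<rho> / \<delta>) * \<bar>\<tau>$1 * IE 1 (pd 2 bump) + \<tau>$2 * IE 2 (pd 2 bump)\<bar> + \<bar>\<nu>$1 * IE 1 (pd 1 bump) + \<nu>$2 * IE 2 (pd 1 bump)\<bar>"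
    using \<rho> \<delta> abs_triangle_ineq4[of "(\<rho> / \<delta>) * (\<tau>$1 * IE 1 (pd 2 bump) + \<tau>$2 * IE 2 (pd 2 bump))" "\<nu>$1 * IE 1 (pd 1 bump) + \<nu>$2 * IE 2 (pd 1 bump)"]
    by (simp only: abs_mult) (simp add: abs_mult)
  also have "\<dots> \<le> (\<rho> / \<delta>) * (2 * (NE * (sqrt (\<rho> * \<delta>) * nrm (pd 2 bump)))) + 2 * (NE * (sqrt (\<rho> * \<delta>) * nrm (pd 1 bump)))"
    using \<rho> \<delta> by (intro add_mono mult_left_mono dir_bound coord_le_1 bE r1 r2) auto
  finally show "\<bar>D 1 * \<tau>$1 + D 2 * \<tau>$2\<bar> * \<rho>\<^sup>2 * c0 \<le> 2 * NE * sqrt (\<rho> * \<delta>) * (nrm (pd 1 bump) + \<rho> / \<delta> * nrm (pd 2 bump))"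
    unfolding q_def[symmetric] using c_pos(1) by (simp add: abs_mult algebra_simps)
  note ry = ref_y1_bump
  have "\<rho>\<^sup>2 * q * c1 = I (pd 2 (\<lambda>y. y$1 * bump y)) / \<delta> + (\<nu>$1 * IE 1 (\<lambda>y. y$1 * bump y) + \<nu>$2 * IE 2 (\<lambda>y. y$1 * bump y))"
    using DN[OF ry] unfolding U_y1_bump by simp
  then have "\<bar>\<rho>\<^sup>2 * q * c1\<bar> \<le> \<bar>I (pd 2 (\<lambda>y. y$1 * bump y))\<bar> / \<delta> + \<bar>\<nu>$1 * IE 1 (\<lambda>y. y$1 * bump y) + \<nu>$2 * IE 2 (\<lambda>y. y$1 * bump y)\<bar>"
    using \<delta> abs_triangle_ineq[of "I (pd 2 (\<lambda>y. y$1 * bump y)) / \<delta>" "\<nu>$1 * IE 1 (\<lambda>y. y$1 * bump y) + \<nu>$2 * IE 2 (\<lambda>y. y$1 * bump y)"]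
    by simp
  also have "\<dots> \<le> (Ne * (sqrt (\<rho> * \<delta>) * nrm (pd 2 (\<lambda>y. y$1 * bump y)))) / \<delta> + 2 * (NE * (sqrt (\<rho> * \<delta>) * nrm (\<lambda>y. y$1 * bump y)))"
    using \<rho> \<delta> by (intro add_mono divide_right_mono dir_bound coord_le_1 bE ry) (auto simp: I_def intro!: test_bound e Ne ref_pd ry)
  finally show "\<bar>D 1 * \<tau>$1 + D 2 * \<tau>$2\<bar> * \<rho>\<^sup>2 * c1 \<le> sqrt (\<rho> * \<delta>) * (Ne / \<delta> * nrm (pd 2 (\<lambda>y. y$1 * bump y)) + 2 * NE * nrm (\<lambda>y. y$1 * bump y))"
    unfolding q_def[symmetric] using c_pos(2) by (simp add: abs_mult algebra_simps)
qed

end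

text \<open>One number for all test estimates. The mixed derivative counts twice since it enters
  with the factor \<open>\<tau>$i * \<nu>$j + \<nu>$i * \<tau>$j\<close>.\<close>

definition bump_size :: "(point \<Rightarrow> real) \<Rightarrow> real" where
  "bump_size f = frame.nrm f + 2 * (frame.nrm (pd 1 f) + frame.nrm (pd 2 f)) +
     (frame.nrm (pd 1 (pd 1 f)) + 2 * frame.nrm (pd 1 (pd 2 f)) + frame.nrm (pd 2 (pd 2 f)))"

context frame
begin

lemma integral_test_pd:
  assumes f: "ref f" and e: "sq_int e"
  shows "(LINT x|lebesgue. e x * pd i (\<lambda>x. f (B x)) x) = \<tau>$i / \<rho> * (LINT x|lebesgue. e x * pd 1 f (B x)) + \<nu>$i / \<delta> * (LINT x|lebesgue. e x * pd 2 f (B x))"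
proof -
  note I = integral_mult_B_le(1)[OF ref_pd[OF f] e[unfolded sq_int_def, THEN conjunct1] e[unfolded sq_int_def, THEN conjunct2]]
  have "(LINT x|lebesgue. e x * pd i (\<lambda>x. f (B x)) x) = (LINT x|lebesgue. \<tau>$i / \<rho> * (e x * pd 1 f (B x)) + \<nu>$i / \<delta> * (e x * pd 2 f (B x)))"
    by (intro Bochner_Integration.integral_cong refl) (simp only: pd_ref_B[OF f] algebra_simps)
  then show ?thesis using I by simp
qed

lemma integral_test_pd_pd:
  assumes f: "ref f" and e: "sq_int e"
  shows "(LINT x|lebesgue. e x * pd j (pd i (\<lambda>x. f (B x))) x) = \<tau>$i * \<tau>$j / \<rho>\<^sup>2 * (LINT x|lebesgue. e x * pd 1 (pd 1 f) (B x))
     + (\<tau>$i * \<nu>$j + \<nu>$i * \<tau>$j) / (\<rho> * \<delta>) * (LINT x|lebesgue. e x * pd 1 (pd 2 f) (B x)) + \<nu>$i * \<nu>$j / \<delta>\<^sup>2 * (LINT x|lebesgue. e x * pd 2 (pd 2 f) (B x))"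
proof -
  note I = integral_mult_B_le(1)[OF ref_pd[OF ref_pd[OF f]] e[unfolded sq_int_def, THEN conjunct1] e[unfolded sq_int_def, THEN conjunct2]]
  have "(LINT x|lebesgue. e x * pd j (pd i (\<lambda>x. f (B x))) x) = (LINT x|lebesgue. \<tau>$i * \<tau>$j / \<rho>\<^sup>2 * (e x * pd 1 (pd 1 f) (B x))
     + (\<tau>$i * \<nu>$j + \<nu>$i * \<tau>$j) / (\<rho> * \<delta>) * (e x * pd 1 (pd 2 f) (B x)) + \<nu>$i * \<nu>$j / \<delta>\<^sup>2 * (e x * pd 2 (pd 2 f) (B x)))"
    by (intro Bochner_Integration.integral_cong refl) (simp only: pd_pd_ref_B[OF f] algebra_simps)
  then show ?thesis using I by simp
qed

text \<open>Because \<delta> \<le> \<rho>, each derivative of a scaled test function costs at most 1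
  / \<delta> in either direction.\<close>

lemma residual_bound:
  assumes f: "ref f" and E: "\<And>i j. sq_int (E i j)" and d: "\<And>i. sq_int (d i)" and F: "sq_int F" and \<delta>\<rho>: "\<delta> \<le> \<rho>"
    and NE: "\<And>i j. sqrt (LINT x|lebesgue. (E i j x)\<^sup>2) \<le> NE" and Nd: "\<And>i. sqrt (LINT x|lebesgue. (d i x)\<^sup>2) \<le> Nd"
    and NF: "sqrt (LINT x|lebesgue. (F x)\<^sup>2) \<le> NF"
  shows "\<bar>\<epsilon>\<^sup>2 * (\<Sum>i\<in>UNIV. \<Sum>j\<in>UNIV. LINT x|lebesgue. E i j x * pd j (pd i (\<lambda>x. f (B x))) x)
     + (\<Sum>i\<in>UNIV. LINT x|lebesgue. d i x * pd i (\<lambda>x. f (B x)) x) - (LINT x|lebesgue. F x * f (B x))\<bar>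
     \<le> sqrt (\<rho> * \<delta>) * bump_size f * (4 * \<epsilon>\<^sup>2 * NE / \<delta>\<^sup>2 + 2 * Nd / \<delta> + NF)"
proof -
  let ?s = "sqrt (\<rho> * \<delta>)" and ?S = "bump_size f"
  have n0: "0 \<le> nrm g" for g by (rule nrm_nonneg)
  have N0: "0 \<le> NE" "0 \<le> Nd" "0 \<le> NF"
    by (rule order_trans[OF _ NE[of 1 1]] order_trans[OF _ Nd[of 1]] order_trans[OF _ NF]; intro real_sqrt_ge_zero integral_nonneg_AE; simp)+
  have s0: "0 \<le> ?s" using \<rho> \<delta> by simp
  have inv: "1 / \<rho>\<^sup>2 \<le> 1 / \<delta>\<^sup>2" "1 / (\<rho> * \<delta>) \<le> 1 / \<delta>\<^sup>2" "1 / \<rho> \<le> 1 / \<delta>"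
    using \<rho> \<delta> \<delta>\<rho> by (auto intro!: divide_left_mono power_mono mult_pos_pos simp: power2_eq_square mult_right_mono mult_mono)
  have tb: "\<bar>c * I\<bar> \<le> k * X" if "\<bar>c\<bar> \<le> k" "\<bar>I\<bar> \<le> X" for c I k X :: real
    unfolding abs_mult using that by (intro mult_mono) auto
  have cc: "\<bar>x * y\<bar> \<le> 1" if "\<bar>x\<bar> \<le> 1" "\<bar>y\<bar> \<le> 1" for x y :: real
    using tb[OF that] by simp
  have "\<bar>LINT x|lebesgue. E i j x * pd j (pd i (\<lambda>x. f (B x))) x\<bar> \<le> NE / \<delta>\<^sup>2 * (?s * ?S)" for i j
  proof -
    let ?I = "\<lambda>g. LINT x|lebesgue. E i j x * g (B x)"
    note b = test_bound[OF _ E NE]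
    have c1: "\<bar>\<tau>$i * \<tau>$j / \<rho>\<^sup>2\<bar> \<le> 1 / \<delta>\<^sup>2"
    proof -
      have "\<bar>\<tau>$i * \<tau>$j / \<rho>\<^sup>2\<bar> \<le> 1 / \<rho>\<^sup>2" using cc[OF coord_le_1(1) coord_le_1(1), of i j] by (simp add: divide_right_mono)
      then show ?thesis using inv by linarith
    qed
    have c2: "\<bar>(\<tau>$i * \<nu>$j + \<nu>$i * \<tau>$j) / (\<rho> * \<delta>)\<bar> \<le> 2 * (1 / \<delta>\<^sup>2)"
    proof -
      have "\<bar>\<tau>$i * \<nu>$j + \<nu>$i * \<tau>$j\<bar> \<le> 2" using cc[OF coord_le_1(1)[of i] coord_le_1(2)[of j]] cc[OF coord_le_1(2)[of i] coord_le_1(1)[of j]] by linarith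
      then have "\<bar>(\<tau>$i * \<nu>$j + \<nu>$i * \<tau>$j) / (\<rho> * \<delta>)\<bar> \<le> 2 * (1 / (\<rho> * \<delta>))" using \<rho> \<delta> by (simp add: abs_mult divide_right_mono)
      then show ?thesis using inv by linarith
    qed
    have c3: "\<bar>\<nu>$i * \<nu>$j / \<delta>\<^sup>2\<bar> \<le> 1 / \<delta>\<^sup>2" using cc[OF coord_le_1(2) coord_le_1(2), of i j] by (simp add: divide_right_mono)
    have t1: "\<bar>\<tau>$i * \<tau>$j / \<rho>\<^sup>2 * ?I (pd 1 (pd 1 f))\<bar> \<le> 1 / \<delta>\<^sup>2 * (NE * (?s * nrm (pd 1 (pd 1 f))))"
      by (rule tb[OF c1 b[OF ref_pd[OF ref_pd[OF f]]]])
    have t2: "\<bar>(\<tau>$i * \<nu>$j + \<nu>$i * \<tau>$j) / (\<rho> * \<delta>) * ?I (pd 1 (pd 2 f))\<bar> \<le> 2 * (1 / \<delta>\<^sup>2) * (NE * (?s * nrm (pd 1 (pd 2 f))))"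
      by (rule tb[OF c2 b[OF ref_pd[OF ref_pd[OF f]]]])
    have t3: "\<bar>\<nu>$i * \<nu>$j / \<delta>\<^sup>2 * ?I (pd 2 (pd 2 f))\<bar> \<le> 1 / \<delta>\<^sup>2 * (NE * (?s * nrm (pd 2 (pd 2 f))))"
      by (rule tb[OF c3 b[OF ref_pd[OF ref_pd[OF f]]]])
    have "\<bar>\<tau>$i * \<tau>$j / \<rho>\<^sup>2 * ?I (pd 1 (pd 1 f)) + (\<tau>$i * \<nu>$j + \<nu>$i * \<tau>$j) / (\<rho> * \<delta>) * ?I (pd 1 (pd 2 f)) + \<nu>$i * \<nu>$j / \<delta>\<^sup>2 * ?I (pd 2 (pd 2 f))\<bar>
      \<le> 1 / \<delta>\<^sup>2 * (NE * (?s * nrm (pd 1 (pd 1 f)))) + 2 * (1 / \<delta>\<^sup>2) * (NE * (?s * nrm (pd 1 (pd 2 f)))) + 1 / \<delta>\<^sup>2 * (NE * (?s * nrm (pd 2 (pd 2 f))))"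
      using t1 t2 t3 by linarith
    also have "\<dots> = NE / \<delta>\<^sup>2 * (?s * (nrm (pd 1 (pd 1 f)) + 2 * nrm (pd 1 (pd 2 f)) + nrm (pd 2 (pd 2 f))))" by (simp add: algebra_simps add_divide_distrib)
    also have "\<dots> \<le> NE / \<delta>\<^sup>2 * (?s * ?S)"
      using N0 s0 n0 unfolding bump_size_def by (intro mult_left_mono) auto
    finally show ?thesis unfolding integral_test_pd_pd[OF f E] .
  qed
  note bE = this
  have bd: "\<bar>LINT x|lebesgue. d i x * pd i (\<lambda>x. f (B x)) x\<bar> \<le> Nd / \<delta> * (?s * ?S)" for i
  proof -
    let ?I = "\<lambda>g. LINT x|lebesgue. d i x * g (B x)"
    note b = test_bound[OF _ d Nd]
    have "\<bar>\<tau>$i / \<rho>\<bar> \<le> 1 / \<rho>" "\<bar>\<nu>$i / \<delta>\<bar> \<le> 1 / \<delta>" using coord_le_1[of i] \<rho> \<delta> by (auto simp: divide_right_mono)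
    then have c: "\<bar>\<tau>$i / \<rho>\<bar> \<le> 1 / \<delta>" "\<bar>\<nu>$i / \<delta>\<bar> \<le> 1 / \<delta>" using inv by linarith+
    have t1: "\<bar>\<tau>$i / \<rho> * ?I (pd 1 f)\<bar> \<le> 1 / \<delta> * (Nd * (?s * nrm (pd 1 f)))" by (rule tb[OF c(1) b[OF ref_pd[OF f]]])
    have t2: "\<bar>\<nu>$i / \<delta> * ?I (pd 2 f)\<bar> \<le> 1 / \<delta> * (Nd * (?s * nrm (pd 2 f)))" by (rule tb[OF c(2) b[OF ref_pd[OF f]]])
    have "\<bar>\<tau>$i / \<rho> * ?I (pd 1 f) + \<nu>$i / \<delta> * ?I (pd 2 f)\<bar> \<le> 1 / \<delta> * (Nd * (?s * nrm (pd 1 f))) + 1 / \<delta> * (Nd * (?s * nrm (pd 2 f)))"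
      using t1 t2 by linarith
    also have "\<dots> = Nd / \<delta> * (?s * (nrm (pd 1 f) + nrm (pd 2 f)))" by (simp add: algebra_simps add_divide_distrib)
    also have "\<dots> \<le> Nd / \<delta> * (?s * ?S)"
      using N0 s0 \<delta> n0[of f] n0[of "pd 1 f"] n0[of "pd 2 f"] n0[of "pd 1 (pd 1 f)"] n0[of "pd 1 (pd 2 f)"] n0[of "pd 2 (pd 2 f)"] 
      unfolding bump_size_def by (intro mult_left_mono) auto
    finally show ?thesis unfolding integral_test_pd[OF f d] .
  qed
  have bF: "\<bar>LINT x|lebesgue. F x * f (B x)\<bar> \<le> NF * (?s * ?S)"
  proof -
    have "NF * (?s * nrm f) \<le> NF * (?s * ?S)"
      using N0 s0 n0 unfolding bump_size_def by (intro mult_left_mono) auto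
    then show ?thesis using test_bound[OF f F NF] by linarith
  qed
  have "\<bar>\<Sum>i\<in>UNIV. \<Sum>j\<in>UNIV. LINT x|lebesgue. E i j x * pd j (pd i (\<lambda>x. f (B x))) x\<bar> \<le> 4 * (NE / \<delta>\<^sup>2 * (?s * ?S))"
    unfolding sum_2 using bE[of 1 1] bE[of 1 2] bE[of 2 1] bE[of 2 2] by linarith
  then have "\<bar>\<epsilon>\<^sup>2 * (\<Sum>i\<in>UNIV. \<Sum>j\<in>UNIV. LINT x|lebesgue. E i j x * pd j (pd i (\<lambda>x. f (B x))) x)\<bar> \<le> \<epsilon>\<^sup>2 * (4 * (NE / \<delta>\<^sup>2 * (?s * ?S)))"
    unfolding abs_mult[of "\<epsilon>\<^sup>2"] abs_power2 by (rule mult_left_mono) simp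
  moreover have "\<bar>\<Sum>i\<in>UNIV. LINT x|lebesgue. d i x * pd i (\<lambda>x. f (B x)) x\<bar> \<le> 2 * (Nd / \<delta> * (?s * ?S))"
    unfolding sum_2 using bd[of 1] bd[of 2] by linarith
  ultimately have "\<bar>\<epsilon>\<^sup>2 * (\<Sum>i\<in>UNIV. \<Sum>j\<in>UNIV. LINT x|lebesgue. E i j x * pd j (pd i (\<lambda>x. f (B x))) x)
     + (\<Sum>i\<in>UNIV. LINT x|lebesgue. d i x * pd i (\<lambda>x. f (B x)) x) - (LINT x|lebesgue. F x * f (B x))\<bar>
     \<le> \<epsilon>\<^sup>2 * (4 * (NE / \<delta>\<^sup>2 * (?s * ?S))) + 2 * (Nd / \<delta> * (?s * ?S)) + NF * (?s * ?S)"
    using bF by linarith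
  also have "\<dots> = ?s * ?S * (4 * \<epsilon>\<^sup>2 * NE / \<delta>\<^sup>2 + 2 * Nd / \<delta> + NF)" by (simp add: algebra_simps)
  finally show ?thesis .
qed

text \<open>Every term with a tangential derivative integrates to zero over the half plane. Hence
  the weak form sees the normal component of a gradient jump and the normal-normal component of a
  Hessian jump only.\<close>

lemma jump_integral:
  assumes f: "ref f"
  shows "(LINT x|lebesgue. indicator (half_plane m \<nu>) x * (a * pd j (pd i (\<lambda>x. f (B x))) x)) = a * (\<nu>$i * \<nu>$j) * (\<rho> / \<delta>) * U (pd 2 (pd 2 f))"
    and "(LINT x|lebesgue. indicator (half_plane m \<nu>) x * (a * pd i (\<lambda>x. f (B x)) x)) = a * \<nu>$i * \<rho> * U (pd 2 f)"
    and "integrable lebesgue (\<lambda>x. indicator (half_plane m \<nu>) x * (a * pd j (pd i (\<lambda>x. f (B x))) x))"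
    and "integrable lebesgue (\<lambda>x. indicator (half_plane m \<nu>) x * (a * pd i (\<lambda>x. f (B x)) x))"
proof -
  let ?h = "\<lambda>y. a * (\<tau>$i * \<tau>$j / \<rho>\<^sup>2) * pd 1 (pd 1 f) y + a * ((\<tau>$i * \<nu>$j + \<nu>$i * \<tau>$j) / (\<rho> * \<delta>)) * pd 1 (pd 2 f) y + a * (\<nu>$i * \<nu>$j / \<delta>\<^sup>2) * pd 2 (pd 2 f) y"
  let ?k = "\<lambda>y. a * (\<tau>$i / \<rho>) * pd 1 f y + a * (\<nu>$i / \<delta>) * pd 2 f y"
  note r = ref_cmult[OF ref_pd[OF ref_pd[OF f]]] ref_cmult[OF ref_pd[OF f]]
  have rh: "ref ?h" by (intro ref_add r)
  have rk: "ref ?k" by (intro ref_add r)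
  have h: "a * pd j (pd i (\<lambda>x. f (B x))) x = ?h (B x)" for x unfolding pd_pd_ref_B[OF f] by (simp only: algebra_simps)
  have k: "a * pd i (\<lambda>x. f (B x)) x = ?k (B x)" for x unfolding pd_ref_B[OF f] by (simp only: algebra_simps)
  have Uh: "U ?h = a * (\<nu>$i * \<nu>$j / \<delta>\<^sup>2) * U (pd 2 (pd 2 f))"
    by (simp only: U_add U_cmult r ref_add U_pd1[OF ref_pd[OF f]])
  have Uk: "U ?k = a * (\<nu>$i / \<delta>) * U (pd 2 f)"
    by (simp only: U_add U_cmult r ref_add U_pd1[OF f])
  show "(LINT x|lebesgue. indicator (half_plane m \<nu>) x * (a * pd j (pd i (\<lambda>x. f (B x))) x)) = a * (\<nu>$i * \<nu>$j) * (\<rho> / \<delta>) * U (pd 2 (pd 2 f))"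
    unfolding h half_plane_U[OF rh] Uh using \<delta> by (simp add: power2_eq_square)
  show "(LINT x|lebesgue. indicator (half_plane m \<nu>) x * (a * pd i (\<lambda>x. f (B x)) x)) = a * \<nu>$i * \<rho> * U (pd 2 f)"
    unfolding k half_plane_U[OF rk] Uk using \<delta> by simp
  show "integrable lebesgue (\<lambda>x. indicator (half_plane m \<nu>) x * (a * pd j (pd i (\<lambda>x. f (B x))) x))"
    unfolding h by (rule integral_half_plane_B(1)[OF rh])
  show "integrable lebesgue (\<lambda>x. indicator (half_plane m \<nu>) x * (a * pd i (\<lambda>x. f (B x)) x))"
    unfolding k by (rule integral_half_plane_B(1)[OF rk])
qed

end

section \<open>Scaling\<close>

lemma square_add_le: "(a + b)\<^sup>2 \<le> 2 * a\<^sup>2 + 2 * (b::real)\<^sup>2"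
proof -
  have "0 \<le> (a - b)\<^sup>2" by simp
  then show ?thesis by (simp add: power2_diff power2_sum)
qed

lemma square_add3_le: "(a + b + c)\<^sup>2 \<le> 3 * a\<^sup>2 + 3 * b\<^sup>2 + 3 * (c::real)\<^sup>2"
proof -
  have "0 \<le> (a - b)\<^sup>2" "0 \<le> (b - c)\<^sup>2" "0 \<le> (a - c)\<^sup>2" by simp_all
  then show ?thesis by (simp add: power2_diff power2_eq_square algebra_simps)
qed

text \<open>An affine jump with slope q that vanishes at the midpoint of an edge of length l has a
  squared norm of order l^3 q^2. The two hypotheses on q are the two bounds of
  \<open>tangential_jump_bound\<close>, for boxes of different heights.\<close>

lemma scaling_NC:
  fixes \<gamma> :: real and n1 n2 n3 n4 c0 c1 :: real
  assumes \<gamma>: "2 \<le> \<gamma>" and c: "c0 > 0" "c1 > 0" and k: "k > 0" and n: "n1 \<ge> 0" "n2 \<ge> 0" "n3 \<ge> 0" "n4 \<ge> 0"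
  shows "\<exists>C>0. \<forall>\<epsilon> l h q Ne NE. 0 < \<epsilon> \<and> 0 < l \<and> l \<le> h \<and> h \<le> \<gamma> * l / 2 \<and> 0 \<le> Ne \<and> 0 \<le> NE \<and>
     \<bar>q\<bar> * (l / 8)\<^sup>2 * c0 \<le> 2 * NE * sqrt (l / 8 * (k * l)) * (n1 + (l / 8) / (k * l) * n2) \<and>
     \<bar>q\<bar> * (l / 8)\<^sup>2 * c1 \<le> sqrt (l / 8 * (k * min l \<epsilon>)) * (Ne / (k * min l \<epsilon>) * n3 + 2 * NE * n4)
     \<longrightarrow> \<epsilon> / min 1 (h / \<epsilon>) * (l ^ 3 * q\<^sup>2) \<le> C * (\<epsilon>\<^sup>2 * NE\<^sup>2 + Ne\<^sup>2)"
proof -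
  define A where "A = (64 / c0) * (2 * sqrt (k / 8) * (n1 + n2 / (8 * k)))"
  define B where "B = (64 / c1) * (sqrt (k / 8) * (n3 / k + 2 * n4))"
  have A0: "A \<ge> 0" and B0: "B \<ge> 0" using c k n by (auto simp: A_def B_def)
  have "\<epsilon> / min 1 (h / \<epsilon>) * (l ^ 3 * q\<^sup>2) \<le> (A\<^sup>2 + \<gamma> * B\<^sup>2 + 1) * (\<epsilon>\<^sup>2 * NE\<^sup>2 + Ne\<^sup>2)"
    if H: "0 < \<epsilon>" "0 < l" "l \<le> h" "h \<le> \<gamma> * l / 2" "0 \<le> Ne" "0 \<le> NE"
      and a: "\<bar>q\<bar> * (l / 8)\<^sup>2 * c0 \<le> 2 * NE * sqrt (l / 8 * (k * l)) * (n1 + (l / 8) / (k * l) * n2)"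
      and b: "\<bar>q\<bar> * (l / 8)\<^sup>2 * c1 \<le> sqrt (l / 8 * (k * min l \<epsilon>)) * (Ne / (k * min l \<epsilon>) * n3 + 2 * NE * n4)"
    for \<epsilon> l h q Ne NE
  proof -
    have tot: "0 \<le> \<epsilon>\<^sup>2 * NE\<^sup>2 + Ne\<^sup>2" by simp
    show ?thesis
    proof (cases "\<epsilon> \<le> h")
      \<comment> \<open>Here \<kappa> is h / \<epsilon> and the weight is \<epsilon>^2 / h. The
        bound by the Hessian error reads \<open>\<bar>q\<bar> * l \<le> A * NE\<close>, and l \<le>
        h removes the remaining quotient.\<close>
      case False
      have sq: "sqrt (l / 8 * (k * l)) = l * sqrt (k / 8)"
        using H(2) real_sqrt_mult[of "l\<^sup>2" "k / 8"] by (simp add: power2_eq_square ac_simps)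
      have "\<bar>q\<bar> * (l / 8)\<^sup>2 * c0 \<le> 2 * NE * (l * sqrt (k / 8)) * (n1 + n2 / (8 * k))"
        using a H(2) unfolding sq by simp
      also have "\<dots> = (l * A * NE) * c0 / 64" using c by (simp add: A_def)
      finally have "(\<bar>q\<bar> * l) * l \<le> (A * NE) * l" using c by (simp add: power2_eq_square field_simps)
      then have "\<bar>q\<bar> * l \<le> A * NE" using H(2) by (simp add: mult_le_cancel_right)
      then have "(\<bar>q\<bar> * l)\<^sup>2 \<le> (A * NE)\<^sup>2" using H(2) by (intro power_mono) auto
      then have ql: "q\<^sup>2 * l\<^sup>2 \<le> A\<^sup>2 * NE\<^sup>2" by (simp add: power_mult_distrib)
      have "\<epsilon> / min 1 (h / \<epsilon>) * (l ^ 3 * q\<^sup>2) = \<epsilon>\<^sup>2 * (l / h) * (q\<^sup>2 * l\<^sup>2)"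
        using False H by (simp add: min_def power2_eq_square power3_eq_cube field_simps)
      also have "\<dots> \<le> \<epsilon>\<^sup>2 * 1 * (A\<^sup>2 * NE\<^sup>2)" using H ql by (intro mult_mono[of "\<epsilon>\<^sup>2 * (l / h)" "\<epsilon>\<^sup>2 * 1" "q\<^sup>2 * l\<^sup>2"] mult_left_mono) auto
      also have "\<dots> \<le> A\<^sup>2 * (\<epsilon>\<^sup>2 * NE\<^sup>2 + Ne\<^sup>2)" by (simp add: algebra_simps)
      also have "\<dots> \<le> (A\<^sup>2 + \<gamma> * B\<^sup>2 + 1) * (\<epsilon>\<^sup>2 * NE\<^sup>2 + Ne\<^sup>2)" using \<gamma> tot by (intro mult_right_mono) auto
      finally show ?thesis .
    next
      \<comment> \<open>Here \<kappa> is 1, and \<epsilon> \<le> h \<le> \<gamma> l / 2 makes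
        \<open>s\<close> comparable to \<epsilon>. The height balances the errors: \<epsilon> s (Ne
        / s + NE)^2 is bounded by multiples of Ne^2 and \<epsilon>^2 NE^2.\<close>
      case True
      define s where "s = min l \<epsilon>"
      have s: "s > 0" "s \<le> \<epsilon>" using H by (auto simp: s_def)
      have \<epsilon>s: "\<epsilon> \<le> \<gamma> / 2 * s"
      proof -
        have "\<epsilon> \<le> \<gamma> / 2 * l" using True H by simp
        moreover have "1 * \<epsilon> \<le> \<gamma> / 2 * \<epsilon>" using \<gamma> H by (intro mult_right_mono) auto
        ultimately show ?thesis by (simp add: s_def min_def)
      qed
      have "sqrt (l / 8 * (k * s)) = sqrt (l * s) * sqrt (k / 8)"
        by (simp add: real_sqrt_mult[symmetric] ac_simps)
      then have "\<bar>q\<bar> * (l / 8)\<^sup>2 * c1 \<le> (sqrt (l * s) * sqrt (k / 8)) * (Ne / (k * s) * n3 + 2 * NE * n4)"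
        using b unfolding s_def[symmetric] by simp
      also have "Ne / (k * s) * n3 + 2 * NE * n4 \<le> (n3 / k + 2 * n4) * (Ne / s + NE)"
        using k n s H by (simp add: algebra_simps)
      then have "(sqrt (l * s) * sqrt (k / 8)) * (Ne / (k * s) * n3 + 2 * NE * n4) \<le> (sqrt (l * s) * sqrt (k / 8)) * ((n3 / k + 2 * n4) * (Ne / s + NE))"
        using H s k by (intro mult_left_mono) auto
      also have "\<dots> = c1 / 64 * (sqrt (l * s) * (B * (Ne / s + NE)))" using c by (simp add: B_def)
      finally have X: "\<bar>q\<bar> * (l / 8)\<^sup>2 * c1 \<le> c1 / 64 * (sqrt (l * s) * (B * (Ne / s + NE)))" .
      have "\<bar>q\<bar> * (l / 8)\<^sup>2 * c1 = c1 / 64 * (\<bar>q\<bar> * l\<^sup>2)" by (simp add: power_divide)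
      with X have "c1 / 64 * (\<bar>q\<bar> * l\<^sup>2) \<le> c1 / 64 * (sqrt (l * s) * (B * (Ne / s + NE)))" by (simp only:)
      then have "\<bar>q\<bar> * l\<^sup>2 \<le> sqrt (l * s) * (B * (Ne / s + NE))" using c by (subst (asm) mult_le_cancel_left_pos) auto
      then have "(\<bar>q\<bar> * l\<^sup>2)\<^sup>2 \<le> (sqrt (l * s) * (B * (Ne / s + NE)))\<^sup>2" by (intro power_mono) auto
      also have "\<dots> = (l * s) * (B\<^sup>2 * (Ne / s + NE)\<^sup>2)" using H s by (simp add: power_mult_distrib)
      finally have "l * (l ^ 3 * q\<^sup>2) \<le> l * (s * (B\<^sup>2 * (Ne / s + NE)\<^sup>2))"
        by (simp add: power_mult_distrib power2_eq_square power3_eq_cube ac_simps)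
      then have "l ^ 3 * q\<^sup>2 \<le> s * (B\<^sup>2 * (Ne / s + NE)\<^sup>2)" using H(2) by (simp add: mult_le_cancel_left)
      also have "\<dots> \<le> s * (B\<^sup>2 * (2 * (Ne / s)\<^sup>2 + 2 * NE\<^sup>2))" using s by (intro mult_left_mono square_add_le) auto
      finally have "\<epsilon> * (l ^ 3 * q\<^sup>2) \<le> \<epsilon> * (s * (B\<^sup>2 * (2 * (Ne / s)\<^sup>2 + 2 * NE\<^sup>2)))" using H by (intro mult_left_mono) auto
      also have "\<dots> = 2 * B\<^sup>2 * ((\<epsilon> / s) * Ne\<^sup>2 + (\<epsilon> * s) * NE\<^sup>2)" using s by (simp add: power_divide power2_eq_square field_simps)
      also have "\<dots> \<le> 2 * B\<^sup>2 * (\<gamma> / 2 * Ne\<^sup>2 + (\<gamma> / 2 * \<epsilon>\<^sup>2) * NE\<^sup>2)"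
      proof (intro mult_left_mono add_mono mult_right_mono)
        show "\<epsilon> / s \<le> \<gamma> / 2" using \<epsilon>s s by (simp add: divide_le_eq)
        have "\<epsilon> * s \<le> \<epsilon> * \<epsilon>" using s H by (intro mult_left_mono) auto
        also have "\<dots> \<le> \<gamma> / 2 * \<epsilon>\<^sup>2" using \<gamma> mult_right_mono[of 1 "\<gamma> / 2" "\<epsilon>\<^sup>2"] by (simp add: power2_eq_square)
        finally show "\<epsilon> * s \<le> \<gamma> / 2 * \<epsilon>\<^sup>2" .
      qed auto
      also have "\<dots> = \<gamma> * B\<^sup>2 * (\<epsilon>\<^sup>2 * NE\<^sup>2 + Ne\<^sup>2)" by (simp add: algebra_simps)
      also have "\<dots> \<le> (A\<^sup>2 + \<gamma> * B\<^sup>2 + 1) * (\<epsilon>\<^sup>2 * NE\<^sup>2 + Ne\<^sup>2)" using tot by (intro mult_right_mono) auto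
      finally show ?thesis using True H by (simp add: min_def)
    qed
  qed
  moreover have "A\<^sup>2 + \<gamma> * B\<^sup>2 + 1 > 0" using \<gamma> by (simp add: add_nonneg_pos)
  ultimately show ?thesis by (intro exI[of _ "A\<^sup>2 + \<gamma> * B\<^sup>2 + 1"]) blast
qed

text \<open>Up to \<gamma> / 2 the left-hand side is at most (\<kappa> l |g|)^2, and \<kappa>
  absorbs the inverse powers of l: \<kappa> \<epsilon> \<le> h compensates one factor \<epsilon> / l
  of the Hessian term, and \<kappa> l is at most \<gamma> / 2 times the oscillation weight.\<close>

lemma scaling_eta2:
  fixes \<gamma> S k c0 :: real
  assumes \<gamma>: "2 \<le> \<gamma>" and c: "c0 > 0" and k: "k > 0" and S: "S \<ge> 0"
  shows "\<exists>C>0. \<forall>\<epsilon> l h g Nd NE NF. 0 < \<epsilon> \<and> 0 < l \<and> l \<le> h \<and> h \<le> \<gamma> * l / 2 \<and> 0 \<le> Nd \<and> 0 \<le> NE \<and> 0 \<le> NF \<and>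
     \<bar>g\<bar> * (l / 8) * c0 \<le> sqrt (l / 8 * (k * l)) * S * (4 * \<epsilon>\<^sup>2 * NE / (k * l)\<^sup>2 + 2 * Nd / (k * l) + NF)
     \<longrightarrow> h * (min 1 (h / \<epsilon>))\<^sup>2 * (l * g\<^sup>2) \<le> C * (\<epsilon>\<^sup>2 * NE\<^sup>2 + Nd\<^sup>2 + (min l (l\<^sup>2 / \<epsilon>) * NF)\<^sup>2)"
proof -
  define A where "A = 8 / c0 * (sqrt (k / 8) * S)"
  define M where "M = 4 / k\<^sup>2 + 2 / k + 1"
  have A0: "A \<ge> 0" and M0: "M \<ge> 0" using c k S by (auto simp: A_def M_def)
  define C where "C = 3 * (\<gamma> / 2) ^ 3 * A\<^sup>2 * M\<^sup>2 + 1"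
  have "h * (min 1 (h / \<epsilon>))\<^sup>2 * (l * g\<^sup>2) \<le> C * (\<epsilon>\<^sup>2 * NE\<^sup>2 + Nd\<^sup>2 + (min l (l\<^sup>2 / \<epsilon>) * NF)\<^sup>2)"
    if H: "0 < \<epsilon>" "0 < l" "l \<le> h" "h \<le> \<gamma> * l / 2" "0 \<le> Nd" "0 \<le> NE" "0 \<le> NF"
      and b: "\<bar>g\<bar> * (l / 8) * c0 \<le> sqrt (l / 8 * (k * l)) * S * (4 * \<epsilon>\<^sup>2 * NE / (k * l)\<^sup>2 + 2 * Nd / (k * l) + NF)"
    for \<epsilon> l h g Nd NE NF
  proof -
    define \<kappa> where "\<kappa> = min 1 (h / \<epsilon>)"
    define w where "w = min l (l\<^sup>2 / \<epsilon>)"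
    have \<kappa>: "0 < \<kappa>" "\<kappa> \<le> 1" "\<kappa> * \<epsilon> \<le> h" using H by (auto simp: \<kappa>_def min_def field_simps)
    have w0: "w \<ge> 0" using H by (simp add: w_def)
    have \<kappa>l: "\<kappa> * l \<le> \<gamma> / 2 * w"
    proof -
      have "\<kappa> * l \<le> 1 * l" using \<kappa> H by (intro mult_right_mono) auto
      moreover have "1 * l \<le> \<gamma> / 2 * l" using \<gamma> H by (intro mult_right_mono) auto
      moreover have "h / \<epsilon> \<le> \<gamma> * l / 2 / \<epsilon>" using H by (intro divide_right_mono) auto
      then have "\<kappa> \<le> \<gamma> * l / 2 / \<epsilon>" unfolding \<kappa>_def by linarith
      then have "\<kappa> * l \<le> (\<gamma> * l / 2 / \<epsilon>) * l" using H by (intro mult_right_mono) auto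
      then have "\<kappa> * l \<le> \<gamma> / 2 * (l\<^sup>2 / \<epsilon>)" by (simp add: power2_eq_square)
      ultimately show ?thesis by (simp add: w_def min_def)
    qed
    have \<kappa>\<epsilon>: "\<kappa> * \<epsilon> \<le> \<gamma> / 2 * l" using \<kappa> H by simp
    have sq: "sqrt (l / 8 * (k * l)) = l * sqrt (k / 8)"
      using H(2) real_sqrt_mult[of "l\<^sup>2" "k / 8"] by (simp add: power2_eq_square ac_simps)
    have "4 * \<epsilon>\<^sup>2 * NE / (k * l)\<^sup>2 + 2 * Nd / (k * l) + NF = 4 / k\<^sup>2 * (\<epsilon>\<^sup>2 * NE / l\<^sup>2) + 2 / k * (Nd / l) + 1 * NF"
      by (simp add: power_mult_distrib)
    also have "\<dots> \<le> M * (\<epsilon>\<^sup>2 * NE / l\<^sup>2) + M * (Nd / l) + M * NF"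
      using k H by (intro add_mono mult_right_mono) (auto simp: M_def)
    finally have "\<bar>g\<bar> * (l / 8) * c0 \<le> (l * sqrt (k / 8)) * S * (M * (\<epsilon>\<^sup>2 * NE / l\<^sup>2) + M * (Nd / l) + M * NF)"
      using b[unfolded sq] H k S by (elim order_trans) (intro mult_left_mono, auto)
    also have "\<dots> = l / 8 * c0 * (A * M * (\<epsilon>\<^sup>2 * NE / l\<^sup>2 + Nd / l + NF))"
    proof -
      have "sqrt (k / 8) * S = c0 / 8 * A" using c by (simp add: A_def)
      then have e: "l * sqrt (k / 8) * S = l * (c0 / 8 * A)" by (simp only: mult.assoc)
      have "l * (c0 / 8 * A) * (M * x + M * y + M * z) = l / 8 * c0 * (A * M * (x + y + z))" for x y z by (simp add: algebra_simps)
      then show ?thesis unfolding e .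
    qed
    finally have "(l / 8 * c0) * \<bar>g\<bar> \<le> (l / 8 * c0) * (A * M * (\<epsilon>\<^sup>2 * NE / l\<^sup>2 + Nd / l + NF))" by (simp only: ac_simps)
    then have "\<bar>g\<bar> \<le> A * M * (\<epsilon>\<^sup>2 * NE / l\<^sup>2 + Nd / l + NF)" using H c by (subst (asm) mult_le_cancel_left_pos) auto
    then have "(\<kappa> * l) * \<bar>g\<bar> \<le> (\<kappa> * l) * (A * M * (\<epsilon>\<^sup>2 * NE / l\<^sup>2 + Nd / l + NF))" using \<kappa> H by (intro mult_left_mono) auto
    also have "\<dots> = A * M * ((\<kappa> * \<epsilon>) * (\<epsilon> * NE) / l + \<kappa> * Nd + (\<kappa> * l) * NF)"
      using H by (simp add: power2_eq_square field_simps)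
    also have "\<dots> \<le> A * M * (\<gamma> / 2 * (\<epsilon> * NE) + \<gamma> / 2 * Nd + \<gamma> / 2 * w * NF)"
    proof (intro mult_left_mono add_mono)
      have "(\<kappa> * \<epsilon>) * (\<epsilon> * NE) / l \<le> (\<gamma> / 2 * l) * (\<epsilon> * NE) / l" using \<kappa>\<epsilon> H by (intro divide_right_mono mult_right_mono) auto
      then show "(\<kappa> * \<epsilon>) * (\<epsilon> * NE) / l \<le> \<gamma> / 2 * (\<epsilon> * NE)" using H by simp
      show "\<kappa> * Nd \<le> \<gamma> / 2 * Nd" using \<kappa> \<gamma> H by (intro mult_right_mono) auto
      show "(\<kappa> * l) * NF \<le> \<gamma> / 2 * w * NF" using \<kappa>l H by (intro mult_right_mono) auto
    qed (use A0 M0 in auto)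
    also have "\<dots> = \<gamma> / 2 * (A * M) * (\<epsilon> * NE + Nd + w * NF)" by (simp add: algebra_simps)
    finally have "((\<kappa> * l) * \<bar>g\<bar>)\<^sup>2 \<le> (\<gamma> / 2 * (A * M) * (\<epsilon> * NE + Nd + w * NF))\<^sup>2" using \<kappa> H by (intro power_mono) auto
    also have "\<dots> \<le> (\<gamma> / 2 * (A * M))\<^sup>2 * (3 * (\<epsilon> * NE)\<^sup>2 + 3 * Nd\<^sup>2 + 3 * (w * NF)\<^sup>2)"
      unfolding power_mult_distrib[of _ "\<epsilon> * NE + Nd + w * NF"] by (intro mult_left_mono square_add3_le) auto
    finally have m: "((\<kappa> * l) * \<bar>g\<bar>)\<^sup>2 \<le> (\<gamma> / 2 * (A * M))\<^sup>2 * (3 * (\<epsilon> * NE)\<^sup>2 + 3 * Nd\<^sup>2 + 3 * (w * NF)\<^sup>2)" .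
    have "h * \<kappa>\<^sup>2 * (l * g\<^sup>2) \<le> (\<gamma> / 2 * l) * \<kappa>\<^sup>2 * (l * g\<^sup>2)" using H by (intro mult_right_mono) auto
    also have "\<dots> = \<gamma> / 2 * ((\<kappa> * l) * \<bar>g\<bar>)\<^sup>2" by (simp add: power_mult_distrib power2_eq_square)
    also have "\<dots> \<le> \<gamma> / 2 * ((\<gamma> / 2 * (A * M))\<^sup>2 * (3 * (\<epsilon> * NE)\<^sup>2 + 3 * Nd\<^sup>2 + 3 * (w * NF)\<^sup>2))" using m \<gamma> by (intro mult_left_mono) auto
    also have "\<dots> = (C - 1) * (\<epsilon>\<^sup>2 * NE\<^sup>2 + Nd\<^sup>2 + (w * NF)\<^sup>2)"
      by (simp add: C_def power_mult_distrib power3_eq_cube power2_eq_square algebra_simps)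
    also have "\<dots> \<le> C * (\<epsilon>\<^sup>2 * NE\<^sup>2 + Nd\<^sup>2 + (w * NF)\<^sup>2)" by (intro mult_right_mono) auto
    finally show ?thesis by (simp add: \<kappa>_def w_def)
  qed
  moreover have "C > 0" using \<gamma> by (simp add: C_def add_nonneg_pos)
  ultimately show ?thesis by (intro exI[of _ C]) blast
qed

text \<open>With s = min l \<epsilon> the squared bound leaves the factors \<kappa> \<epsilon> / s,
  \<kappa> s / \<epsilon> and \<kappa> s^3 / \<epsilon>, which are at most \<gamma> / 2, \<gamma> /
  2 and \<gamma> w^2 / 2. For \<epsilon> \<le> l a height of order l would leave l / \<epsilon> in
  front of Nd^2.\<close>

lemma scaling_eta1:
  fixes \<gamma> S k c0 :: real
  assumes \<gamma>: "2 \<le> \<gamma>" and c: "c0 > 0" and k: "k > 0" and S: "S \<ge> 0"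
  shows "\<exists>C>0. \<forall>\<epsilon> l h \<mu> Nd NE NF. 0 < \<epsilon> \<and> 0 < l \<and> l \<le> h \<and> h \<le> \<gamma> * l / 2 \<and> 0 \<le> Nd \<and> 0 \<le> NE \<and> 0 \<le> NF \<and>
     \<epsilon>\<^sup>2 * \<bar>\<mu>\<bar> * ((l / 8) / (k * min l \<epsilon>)) * c0 \<le> sqrt (l / 8 * (k * min l \<epsilon>)) * S *
        (4 * \<epsilon>\<^sup>2 * NE / (k * min l \<epsilon>)\<^sup>2 + 2 * Nd / (k * min l \<epsilon>) + NF)
     \<longrightarrow> \<epsilon> ^ 3 * min 1 (h / \<epsilon>) * (l * \<mu>\<^sup>2) \<le> C * (\<epsilon>\<^sup>2 * NE\<^sup>2 + Nd\<^sup>2 + (min l (l\<^sup>2 / \<epsilon>) * NF)\<^sup>2)"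
proof -
  define A where "A = 8 * k / c0 * (sqrt (k / 8) * S)"
  define M where "M = 4 / k\<^sup>2 + 2 / k + 1"
  have A0: "A \<ge> 0" and M0: "M \<ge> 0" using c k S by (auto simp: A_def M_def)
  define C where "C = A\<^sup>2 * M\<^sup>2 * (3 * (\<gamma> / 2)) + 1"
  have "\<epsilon> ^ 3 * min 1 (h / \<epsilon>) * (l * \<mu>\<^sup>2) \<le> C * (\<epsilon>\<^sup>2 * NE\<^sup>2 + Nd\<^sup>2 + (min l (l\<^sup>2 / \<epsilon>) * NF)\<^sup>2)"
    if H: "0 < \<epsilon>" "0 < l" "l \<le> h" "h \<le> \<gamma> * l / 2" "0 \<le> Nd" "0 \<le> NE" "0 \<le> NF"
      and b: "\<epsilon>\<^sup>2 * \<bar>\<mu>\<bar> * ((l / 8) / (k * min l \<epsilon>)) * c0 \<le> sqrt (l / 8 * (k * min l \<epsilon>)) * S *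
        (4 * \<epsilon>\<^sup>2 * NE / (k * min l \<epsilon>)\<^sup>2 + 2 * Nd / (k * min l \<epsilon>) + NF)"
    for \<epsilon> l h \<mu> Nd NE NF
  proof -
    define s where "s = min l \<epsilon>"
    define \<kappa> where "\<kappa> = min 1 (h / \<epsilon>)"
    define w where "w = min l (l\<^sup>2 / \<epsilon>)"
    define X where "X = \<epsilon>\<^sup>2 * NE / s\<^sup>2 + Nd / s + NF"
    have s: "s > 0" "s \<le> \<epsilon>" "s \<le> l" using H by (auto simp: s_def)
    have \<kappa>: "0 < \<kappa>" "\<kappa> \<le> 1" "\<kappa> \<le> h / \<epsilon>" using H by (auto simp: \<kappa>_def)
    \<comment> \<open>The minima in \<open>w\<close> and \<open>s\<close> switch at the same place:
      \<open>w\<close> is l / \<epsilon> times \<open>min \<epsilon> l\<close>.\<close>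
    have w: "w = l * s / \<epsilon>"
    proof (cases "l \<le> \<epsilon>")
      case True
      then have "l\<^sup>2 / \<epsilon> \<le> l" using H by (simp add: power2_eq_square field_simps)
      then show ?thesis using True by (simp add: w_def s_def min_def power2_eq_square)
    next
      case False
      then have "l \<le> l\<^sup>2 / \<epsilon>" using H by (simp add: power2_eq_square field_simps)
      then show ?thesis using False H by (simp add: w_def s_def min_def)
    qed
    have X0: "X \<ge> 0" using H s by (simp add: X_def)
    have sq: "sqrt (l / 8 * (k * s)) = sqrt (l * s) * sqrt (k / 8)"
      by (simp add: real_sqrt_mult[symmetric] ac_simps)
    have "4 * \<epsilon>\<^sup>2 * NE / (k * s)\<^sup>2 + 2 * Nd / (k * s) + NF = 4 / k\<^sup>2 * (\<epsilon>\<^sup>2 * NE / s\<^sup>2) + 2 / k * (Nd / s) + 1 * NF"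
      by (simp add: power_mult_distrib)
    also have "\<dots> \<le> M * (\<epsilon>\<^sup>2 * NE / s\<^sup>2) + M * (Nd / s) + M * NF"
      using k H s by (intro add_mono mult_right_mono) (auto simp: M_def)
    also have "\<dots> = M * X" by (simp add: X_def algebra_simps)
    finally have MX: "4 * \<epsilon>\<^sup>2 * NE / (k * s)\<^sup>2 + 2 * Nd / (k * s) + NF \<le> M * X" .
    have "\<epsilon>\<^sup>2 * \<bar>\<mu>\<bar> * ((l / 8) / (k * s)) * c0 \<le> sqrt (l * s) * sqrt (k / 8) * S * (4 * \<epsilon>\<^sup>2 * NE / (k * s)\<^sup>2 + 2 * Nd / (k * s) + NF)"
      using b unfolding s_def[symmetric] sq .
    also have "\<dots> \<le> sqrt (l * s) * sqrt (k / 8) * S * (M * X)"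
      using MX H s k S by (intro mult_left_mono) auto
    finally have "\<epsilon>\<^sup>2 * \<bar>\<mu>\<bar> * ((l / 8) / (k * s)) * c0 * (8 * k * s / c0) \<le> sqrt (l * s) * sqrt (k / 8) * S * (M * X) * (8 * k * s / c0)"
      using k s c by (intro mult_right_mono) auto
    moreover have "\<epsilon>\<^sup>2 * \<bar>\<mu>\<bar> * ((l / 8) / (k * s)) * c0 * (8 * k * s / c0) = \<epsilon>\<^sup>2 * \<bar>\<mu>\<bar> * l" using k s c by (simp add: field_simps)
    moreover have "sqrt (l * s) * sqrt (k / 8) * S * (M * X) * (8 * k * s / c0) = sqrt (l * s) * (A * M * s * X)" by (simp add: A_def)
    ultimately have m: "\<epsilon>\<^sup>2 * \<bar>\<mu>\<bar> * l \<le> sqrt (l * s) * (A * M * s * X)" by simp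
    have "(\<epsilon>\<^sup>2 * \<bar>\<mu>\<bar> * l)\<^sup>2 \<le> (sqrt (l * s) * (A * M * s * X))\<^sup>2" using m H by (intro power_mono) auto
    also have "\<dots> = (l * s) * (A * M * s * X)\<^sup>2" using H s by (simp add: power_mult_distrib)
    finally have "l * ((\<epsilon>\<^sup>2)\<^sup>2 * (l * \<mu>\<^sup>2)) \<le> l * (s * (A * M * s * X)\<^sup>2)"
      by (simp add: power_mult_distrib power2_eq_square ac_simps)
    then have m2: "(\<epsilon>\<^sup>2)\<^sup>2 * (l * \<mu>\<^sup>2) \<le> s * (A * M * s * X)\<^sup>2" using H(2) by (subst (asm) mult_le_cancel_left_pos) auto
    have "\<epsilon> ^ 3 * \<kappa> * (l * \<mu>\<^sup>2) = \<kappa> / \<epsilon> * ((\<epsilon>\<^sup>2)\<^sup>2 * (l * \<mu>\<^sup>2))" using H by (simp add: power2_eq_square power3_eq_cube)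
    also have "\<dots> \<le> \<kappa> / \<epsilon> * (s * (A * M * s * X)\<^sup>2)" using m2 H \<kappa> by (intro mult_left_mono) auto
    also have "\<dots> = A\<^sup>2 * M\<^sup>2 * (\<kappa> * s ^ 3 / \<epsilon> * X\<^sup>2)" by (simp add: power_mult_distrib power2_eq_square power3_eq_cube)
    also have "\<dots> \<le> A\<^sup>2 * M\<^sup>2 * (3 * (\<gamma> / 2) * (\<epsilon>\<^sup>2 * NE\<^sup>2 + Nd\<^sup>2 + (w * NF)\<^sup>2))"
    proof (rule mult_left_mono)
      have "X\<^sup>2 \<le> 3 * (\<epsilon>\<^sup>2 * NE / s\<^sup>2)\<^sup>2 + 3 * (Nd / s)\<^sup>2 + 3 * NF\<^sup>2" unfolding X_def by (rule square_add3_le)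
      then have "\<kappa> * s ^ 3 / \<epsilon> * X\<^sup>2 \<le> \<kappa> * s ^ 3 / \<epsilon> * (3 * (\<epsilon>\<^sup>2 * NE / s\<^sup>2)\<^sup>2 + 3 * (Nd / s)\<^sup>2 + 3 * NF\<^sup>2)"
        using \<kappa> s H by (intro mult_left_mono) auto
      also have "\<dots> = 3 * ((\<kappa> * \<epsilon> / s) * (\<epsilon>\<^sup>2 * NE\<^sup>2) + (\<kappa> * s / \<epsilon>) * Nd\<^sup>2 + (\<kappa> * s ^ 3 / \<epsilon>) * NF\<^sup>2)"
        using s H by (simp add: power_divide power_mult_distrib power2_eq_square power3_eq_cube field_simps)
      also have "\<dots> \<le> 3 * (\<gamma> / 2 * (\<epsilon>\<^sup>2 * NE\<^sup>2) + \<gamma> / 2 * Nd\<^sup>2 + (\<gamma> / 2 * w\<^sup>2) * NF\<^sup>2)"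
      proof (intro mult_left_mono add_mono mult_right_mono)
        have hl: "h \<le> \<gamma> / 2 * l" using H by simp
        have "\<kappa> * \<epsilon> \<le> h" using \<kappa>(3) H by (simp add: field_simps)
        moreover have "\<kappa> * \<epsilon> \<le> 1 * \<epsilon>" using \<kappa> H by (intro mult_right_mono) auto
        moreover have "1 * \<epsilon> \<le> \<gamma> / 2 * \<epsilon>" using \<gamma> H by (intro mult_right_mono) auto
        ultimately have "\<kappa> * \<epsilon> \<le> \<gamma> / 2 * s" using hl by (simp add: s_def min_def)
        then show "\<kappa> * \<epsilon> / s \<le> \<gamma> / 2" using s by (simp add: divide_le_eq)
        have "\<kappa> * s \<le> 1 * \<epsilon>" using \<kappa> s by (intro mult_mono) auto
        then have "\<kappa> * s / \<epsilon> \<le> 1" using H by (simp add: divide_le_eq)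
        moreover have "1 \<le> \<gamma> / 2" using \<gamma> by simp
        ultimately show "\<kappa> * s / \<epsilon> \<le> \<gamma> / 2" by (rule order_trans)
        have "\<kappa> \<le> \<gamma> / 2 * (l / \<epsilon>)" using \<kappa>(3) divide_right_mono[OF hl, of \<epsilon>] H by simp
        then have "\<kappa> * s ^ 3 / \<epsilon> \<le> \<gamma> / 2 * (l / \<epsilon>) * s ^ 3 / \<epsilon>" using s H by (intro divide_right_mono mult_right_mono) auto
        also have "\<dots> = \<gamma> / 2 * (l / \<epsilon>) * s\<^sup>2 / \<epsilon> * s" by (simp add: power2_eq_square power3_eq_cube)
        also have "\<dots> \<le> \<gamma> / 2 * (l / \<epsilon>) * s\<^sup>2 / \<epsilon> * l" using s H \<gamma> by (intro mult_left_mono) auto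
        also have "\<dots> = \<gamma> / 2 * w\<^sup>2" by (simp add: w power2_eq_square ac_simps)
        finally show "\<kappa> * s ^ 3 / \<epsilon> \<le> \<gamma> / 2 * w\<^sup>2" .
      qed auto
      also have "\<dots> = 3 * (\<gamma> / 2) * (\<epsilon>\<^sup>2 * NE\<^sup>2 + Nd\<^sup>2 + (w * NF)\<^sup>2)" by (simp add: power_mult_distrib algebra_simps)
      finally show "\<kappa> * s ^ 3 / \<epsilon> * X\<^sup>2 \<le> 3 * (\<gamma> / 2) * (\<epsilon>\<^sup>2 * NE\<^sup>2 + Nd\<^sup>2 + (w * NF)\<^sup>2)" .
    qed simp
    also have "\<dots> = (C - 1) * (\<epsilon>\<^sup>2 * NE\<^sup>2 + Nd\<^sup>2 + (w * NF)\<^sup>2)" by (simp add: C_def)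
    also have "\<dots> \<le> C * (\<epsilon>\<^sup>2 * NE\<^sup>2 + Nd\<^sup>2 + (w * NF)\<^sup>2)" by (intro mult_right_mono) auto
    finally show ?thesis by (simp add: \<kappa>_def w_def)
  qed
  moreover have "C > 0" using \<gamma> by (simp add: C_def add_nonneg_pos)
  ultimately show ?thesis by (intro exI[of _ C]) blast
qed

text \<open>Here r is the radius of an inscribed disc and the box is a square of half-width r / 2.
  With W = min h (h^2 / \<epsilon>) the inequalities W \<epsilon> \<le> h^2, W \<le> h and h \<le>
  \<gamma> r absorb the inverse powers of r.\<close>

lemma scaling_f:
  fixes \<gamma> S c2 :: real
  assumes \<gamma>: "2 \<le> \<gamma>" and c: "c2 > 0" and S: "S \<ge> 0"
  shows "\<exists>C>0. \<forall>\<epsilon> r h g Nd NE No. 0 < \<epsilon> \<and> 0 < r \<and> h \<le> \<gamma> * r \<and> 0 < h \<and> 0 \<le> Nd \<and> 0 \<le> NE \<and> 0 \<le> No \<and>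
     \<bar>g\<bar> * (r / 2 * (r / 2)) * c2 \<le> sqrt (r / 2 * (r / 2)) * S * (4 * \<epsilon>\<^sup>2 * NE / (r / 2)\<^sup>2 + 2 * Nd / (r / 2) + No)
     \<longrightarrow> (min h (h\<^sup>2 / \<epsilon>) * h * g)\<^sup>2 \<le> C * (\<epsilon>\<^sup>2 * NE\<^sup>2 + Nd\<^sup>2 + (min h (h\<^sup>2 / \<epsilon>) * No)\<^sup>2)"
proof -
  define A where "A = 32 * S / c2"
  have A0: "A \<ge> 0" using c S by (simp add: A_def)
  define C where "C = 3 * (\<gamma> * A * \<gamma>\<^sup>2)\<^sup>2 + 1"
  have "(min h (h\<^sup>2 / \<epsilon>) * h * g)\<^sup>2 \<le> C * (\<epsilon>\<^sup>2 * NE\<^sup>2 + Nd\<^sup>2 + (min h (h\<^sup>2 / \<epsilon>) * No)\<^sup>2)"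
    if H: "0 < \<epsilon>" "0 < r" "h \<le> \<gamma> * r" "0 < h" "0 \<le> Nd" "0 \<le> NE" "0 \<le> No"
      and b: "\<bar>g\<bar> * (r / 2 * (r / 2)) * c2 \<le> sqrt (r / 2 * (r / 2)) * S * (4 * \<epsilon>\<^sup>2 * NE / (r / 2)\<^sup>2 + 2 * Nd / (r / 2) + No)"
    for \<epsilon> r h g Nd NE No
  proof -
    define W where "W = min h (h\<^sup>2 / \<epsilon>)"
    define X where "X = \<epsilon>\<^sup>2 * NE / r\<^sup>2 + Nd / r + No"
    have W0: "W \<ge> 0" using H by (simp add: W_def)
    have "4 * \<epsilon>\<^sup>2 * NE / (r / 2)\<^sup>2 + 2 * Nd / (r / 2) + No = 16 * (\<epsilon>\<^sup>2 * NE / r\<^sup>2) + 4 * (Nd / r) + 1 * No"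
      by (simp add: power_divide)
    also have "\<dots> \<le> 16 * (\<epsilon>\<^sup>2 * NE / r\<^sup>2) + 16 * (Nd / r) + 16 * No" using H by (intro add_mono mult_right_mono) auto
    also have "\<dots> = 16 * X" by (simp add: X_def)
    finally have X16: "4 * \<epsilon>\<^sup>2 * NE / (r / 2)\<^sup>2 + 2 * Nd / (r / 2) + No \<le> 16 * X" .
    have sq: "sqrt (r / 2 * (r / 2)) = r / 2" unfolding real_sqrt_abs2 using H by simp
    have "\<bar>g\<bar> * (r / 2 * (r / 2)) * c2 \<le> r / 2 * S * (4 * \<epsilon>\<^sup>2 * NE / (r / 2)\<^sup>2 + 2 * Nd / (r / 2) + No)" using b unfolding sq .
    also have "\<dots> \<le> r / 2 * S * (16 * X)" using X16 H S by (intro mult_left_mono) auto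
    finally have "\<bar>g\<bar> * (r / 2 * (r / 2)) * c2 * (4 / (r * c2)) \<le> r / 2 * S * (16 * X) * (4 / (r * c2))"
      using H c by (intro mult_right_mono) auto
    moreover have "\<bar>g\<bar> * (r / 2 * (r / 2)) * c2 * (4 / (r * c2)) = \<bar>g\<bar> * r" using H c by simp
    moreover have "r / 2 * S * (16 * X) * (4 / (r * c2)) = A * X" using H c by (simp add: A_def)
    ultimately have gr: "\<bar>g\<bar> * r \<le> A * X" by simp
    have g1: "1 \<le> \<gamma>\<^sup>2" "\<gamma> \<le> \<gamma>\<^sup>2" using \<gamma> by (auto simp: power2_eq_square intro: mult_left_mono[of 1 \<gamma> \<gamma>, simplified] order_trans[of 1 \<gamma>])
    have WX: "W * X \<le> \<gamma>\<^sup>2 * (\<epsilon> * NE + Nd + W * No)"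
    proof -
      have "W * \<epsilon> \<le> (h\<^sup>2 / \<epsilon>) * \<epsilon>" using H by (intro mult_right_mono) (auto simp: W_def)
      also have "\<dots> \<le> (\<gamma> * r)\<^sup>2" using H by simp
      finally have W\<epsilon>: "W * \<epsilon> \<le> \<gamma>\<^sup>2 * r\<^sup>2" by (simp add: power_mult_distrib)
      have "W * (\<epsilon>\<^sup>2 * NE / r\<^sup>2) = (W * \<epsilon>) * (\<epsilon> * NE / r\<^sup>2)" by (simp add: power2_eq_square)
      also have "\<dots> \<le> (\<gamma>\<^sup>2 * r\<^sup>2) * (\<epsilon> * NE / r\<^sup>2)" using W\<epsilon> H by (intro mult_right_mono) auto
      finally have 1: "W * (\<epsilon>\<^sup>2 * NE / r\<^sup>2) \<le> \<gamma>\<^sup>2 * (\<epsilon> * NE)" using H by simp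
      have "W \<le> h" by (simp add: W_def)
      then have "W \<le> \<gamma> * r" using H by linarith
      then have "W * (Nd / r) \<le> (\<gamma> * r) * (Nd / r)" using H by (intro mult_right_mono) auto
      also have "\<dots> = \<gamma> * Nd" using H by simp
      also have "\<dots> \<le> \<gamma>\<^sup>2 * Nd" using g1 H by (intro mult_right_mono) auto
      finally have 2: "W * (Nd / r) \<le> \<gamma>\<^sup>2 * Nd" .
      have "1 * (W * No) \<le> \<gamma>\<^sup>2 * (W * No)" using g1 W0 H by (intro mult_right_mono) auto
      then show ?thesis using 1 2 by (simp add: X_def algebra_simps)
    qed
    have "W * h * \<bar>g\<bar> \<le> W * (\<gamma> * r) * \<bar>g\<bar>" using W0 H by (intro mult_right_mono mult_left_mono) auto
    also have "\<dots> = (W * \<gamma>) * (\<bar>g\<bar> * r)" by simp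
    also have "\<dots> \<le> (W * \<gamma>) * (A * X)" using gr W0 \<gamma> by (intro mult_left_mono) auto
    also have "\<dots> = \<gamma> * A * (W * X)" by simp
    also have "\<dots> \<le> \<gamma> * A * (\<gamma>\<^sup>2 * (\<epsilon> * NE + Nd + W * No))" using WX A0 \<gamma> by (intro mult_left_mono) auto
    finally have "\<bar>W * h * g\<bar> \<le> \<gamma> * A * \<gamma>\<^sup>2 * (\<epsilon> * NE + Nd + W * No)" using W0 H by (simp add: abs_mult ac_simps)
    then have "\<bar>W * h * g\<bar>\<^sup>2 \<le> (\<gamma> * A * \<gamma>\<^sup>2 * (\<epsilon> * NE + Nd + W * No))\<^sup>2" by (intro power_mono) auto
    also have "\<dots> = (\<gamma> * A * \<gamma>\<^sup>2)\<^sup>2 * (\<epsilon> * NE + Nd + W * No)\<^sup>2" by (rule power_mult_distrib)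
    also have "\<dots> \<le> (\<gamma> * A * \<gamma>\<^sup>2)\<^sup>2 * (3 * (\<epsilon> * NE)\<^sup>2 + 3 * Nd\<^sup>2 + 3 * (W * No)\<^sup>2)" by (intro mult_left_mono square_add3_le) simp
    also have "\<dots> = (C - 1) * (\<epsilon>\<^sup>2 * NE\<^sup>2 + Nd\<^sup>2 + (W * No)\<^sup>2)" by (simp add: C_def power_mult_distrib algebra_simps)
    also have "\<dots> \<le> C * (\<epsilon>\<^sup>2 * NE\<^sup>2 + Nd\<^sup>2 + (W * No)\<^sup>2)" by (intro mult_right_mono) auto
    finally show ?thesis by (simp add: W_def)
  qed
  moreover have "C > 0" by (simp add: C_def add_nonneg_pos)
  ultimately show ?thesis by (intro exI[of _ C]) blast
qed

section \<open>Local identities for the solutions\<close>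

lemma test_integral_indicator:
  fixes c :: "point \<Rightarrow> real"
  assumes "\<psi> \<in> test_functions \<Omega>"
  shows "indicator \<Omega> x * c x * \<psi> x = c x * \<psi> x"
proof -
  obtain K where K: "compact K" "K \<subseteq> \<Omega>" "\<And>y. \<psi> y \<noteq> 0 \<Longrightarrow> y \<in> K" using test_function_support[OF assms] by blast
  have "\<psi> x \<noteq> 0 \<Longrightarrow> x \<in> \<Omega>" using K(2,3) by blast
  then show ?thesis by (cases "\<psi> x = 0") simp_all
qed

lemma sq_int_bounded_continuous:
  fixes p :: "point \<Rightarrow> real"
  assumes A: "A \<in> sets lebesgue" "bounded A" and p: "continuous_on UNIV p"
  shows "sq_int (\<lambda>x. indicator A x * p x)"
proof -
  obtain R where "\<And>x. x \<in> A \<Longrightarrow> norm x \<le> R" using A(2) unfolding bounded_iff by blast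
  then have R: "A \<subseteq> cball 0 R" by auto
  have m: "p \<in> borel_measurable lebesgue" using borel_measurable_continuous_onI[OF p] by (intro measurable_completion) simp
  have "continuous_on UNIV (\<lambda>x. (p x)\<^sup>2)" using p by (rule continuous_on_power)
  then have c: "continuous_on (cball 0 R) (\<lambda>x. (p x)\<^sup>2)" by (rule continuous_on_subset) (rule subset_UNIV)
  have "integrable lborel (\<lambda>x. indicator (cball 0 R) x *\<^sub>R (p x)\<^sup>2)"
    by (rule borel_integrable_compact[OF _ c]) simp
  then have i: "integrable lebesgue (\<lambda>x. indicator (cball 0 R) x * (p x)\<^sup>2)" by (simp add: integrable_completion)
  have "integrable lebesgue (\<lambda>x. (indicator A x * p x)\<^sup>2)"
    by (rule Bochner_Integration.integrable_bound[OF i]) (use m A R in \<open>auto simp: indicator_def intro!: AE_I2\<close>)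
  then show ?thesis using m A by (simp add: sq_int_def)
qed

section \<open>Errors on a triangle and across a face\<close>

locale efficiency = mesh +
  fixes \<epsilon> :: real and f u :: "point \<Rightarrow> real" and u\<^sub>h :: "real pw_fun"
  assumes \<epsilon>_pos: "0 < \<epsilon>" and f_sq: "square_integrable \<Omega> f"
    and solution: "weak_solution \<Omega> \<epsilon> f u" and discrete: "u\<^sub>h \<in> morley0 \<Omega> \<T>"
begin

abbreviation "w \<equiv> nodal_interp \<T> u\<^sub>h"

text \<open>The error is cut off to the open triangle, which lies in \<Omega>; outside \<Omega> the
  representative of the weak derivative is arbitrary.\<close>

definition gerr :: "point set \<Rightarrow> (point \<Rightarrow> real) \<Rightarrow> 2 \<Rightarrow> point \<Rightarrow> real" where
  "gerr K p i x = indicator (interior K) x * (weak_grad \<Omega> u x $ i - pd i p x)"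

definition herr :: "point set \<Rightarrow> (point \<Rightarrow> real) \<Rightarrow> 2 \<Rightarrow> 2 \<Rightarrow> point \<Rightarrow> real" where
  "herr K p i j x = indicator (interior K) x * (weak_hess \<Omega> u x $ i $ j - pd j (pd i p) x)"

lemma u_H2_0: "u \<in> H2_0 \<Omega>" and u_H2: "u \<in> H2 \<Omega>"
  using solution by (auto simp: weak_solution_def H2_0_def)

lemmas Du = H2_weak_derivatives[OF open_\<Omega> u_H2]

lemma f_sq_int: "sq_int (\<lambda>x. indicator \<Omega> x * f x)"
proof -
  have \<Omega>': "\<Omega> \<in> sets lebesgue" using open_\<Omega> by auto
  have "(\<lambda>x. indicator \<Omega> x * f x) \<in> borel_measurable lebesgue"
    using f_sq borel_measurable_restrict_space_iff[of \<Omega> lebesgue f] \<Omega>' by (simp add: square_integrable_def)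
  moreover have "integrable lebesgue (\<lambda>x. indicator \<Omega> x * (norm (f x))\<^sup>2)"
    using f_sq integral_lebesgue_on_indicator(2)[OF \<Omega>'] by (auto simp: square_integrable_def)
  moreover have "(\<lambda>x. indicator \<Omega> x * (norm (f x))\<^sup>2) = (\<lambda>x. (indicator \<Omega> x * f x)\<^sup>2)" by (auto simp: indicator_def fun_eq_iff)
  ultimately show ?thesis by (simp add: sq_int_def)
qed

lemma interior_sets: "interior K \<in> sets lebesgue"
  by (simp add: borel_open)

lemma field_sq_int:
  assumes K: "K \<in> \<T>" and c: "sq_int (\<lambda>x. indicator \<Omega> x * c x)" and p: "continuous_on UNIV p"
  shows "sq_int (\<lambda>x. indicator (interior K) x * (c x - p x))"
proof -
  have b: "bounded (interior K)" using bounded_subset[OF compact_imp_bounded[OF triangle_compact[OF K]] interior_subset] .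
  have "sq_int (\<lambda>x. indicator (interior K) x * (indicator \<Omega> x * c x) - indicator (interior K) x * p x)"
    by (rule sq_int_diff[OF sq_int_indicator[OF c interior_sets] sq_int_bounded_continuous[OF interior_sets b p]])
  moreover have "(\<lambda>x. indicator (interior K) x * (indicator \<Omega> x * c x) - indicator (interior K) x * p x) = (\<lambda>x. indicator (interior K) x * (c x - p x))"
    using triangle_interior_subset[OF K] by (auto simp: indicator_def fun_eq_iff)
  ultimately show ?thesis by simp
qed

lemma gerr_sq_int: "K \<in> \<T> \<Longrightarrow> smooth p \<Longrightarrow> sq_int (gerr K p i)"
  unfolding gerr_def[abs_def] by (intro field_sq_int Du(3) smooth_continuous smooth_pd)

lemma herr_sq_int: "K \<in> \<T> \<Longrightarrow> smooth p \<Longrightarrow> sq_int (herr K p i j)"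
  unfolding herr_def[abs_def] by (intro field_sq_int Du(4) smooth_continuous smooth_pd)

lemma uh_morley: "u\<^sub>h \<in> morley \<Omega> \<T>"
  using discrete unfolding morley0_def mem_Collect_eq by (elim conjE)

lemma uh_poly: "K \<in> \<T> \<Longrightarrow> poly_deg_le 2 (u\<^sub>h K)"
proof -
  have "u\<^sub>h \<in> pw_poly 2 \<T>" using uh_morley unfolding morley_def mem_Collect_eq by (elim conjE)
  then show "K \<in> \<T> \<Longrightarrow> poly_deg_le 2 (u\<^sub>h K)" unfolding pw_poly_def by (simp only: mem_Collect_eq)
qed

lemma w_poly: "K \<in> \<T> \<Longrightarrow> poly_deg_le 1 (w K)"
proof -
  have "w \<in> pw_poly 1 \<T>"
  proof (rule nodal_interp_poly)
    fix z T K assume zTK: "z \<in> nodes \<T>" "T \<in> \<T>" "K \<in> \<T>" "z \<in> T" "z \<in> K"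
    have "\<forall>z\<in>nodes \<T>. \<forall>T\<in>\<T>. \<forall>K\<in>\<T>. z \<in> T \<and> z \<in> K \<longrightarrow> u\<^sub>h T z = u\<^sub>h K z"
      using uh_morley unfolding morley_def mem_Collect_eq by (elim conjE)
    then show "u\<^sub>h T z = u\<^sub>h K z" using zTK by blast
  qed
  then show "K \<in> \<T> \<Longrightarrow> poly_deg_le 1 (w K)" unfolding pw_poly_def by (simp only: mem_Collect_eq)
qed

lemma uh_smooth: "K \<in> \<T> \<Longrightarrow> smooth (u\<^sub>h K)" and w_smooth: "K \<in> \<T> \<Longrightarrow> smooth (w K)"
  using uh_poly w_poly poly_deg_le_elementary elementary_smooth by blast+

lemma split_one:
  assumes K: "K \<in> \<T>" and \<psi>: "\<psi> \<in> test_functions \<Omega>" and supp: "\<And>x. \<psi> x \<noteq> 0 \<Longrightarrow> x \<in> interior K"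
    and c: "sq_int (\<lambda>x. indicator \<Omega> x * c x)" and p: "continuous_on UNIV p"
  shows "(LINT x|lebesgue. indicator (interior K) x * (c x - p x) * \<psi> x) = (LINT x|lebesgue. indicator \<Omega> x * c x * \<psi> x) - (LINT x|lebesgue. p x * \<psi> x)"
proof -
  obtain R where R: "\<And>x. \<psi> x \<noteq> 0 \<Longrightarrow> norm x \<le> R" using test_function_bounded_support[OF \<psi>] by blast
  have i1: "integrable lebesgue (\<lambda>x. indicator \<Omega> x * c x * \<psi> x)" using sq_int_mult[OF c sq_int_test[OF \<psi>]] .
  have i2: "integrable lebesgue (\<lambda>x. p x * \<psi> x)"
    by (rule integrable_compact_support[where R=R])
       (use R p smooth_continuous[OF test_function_smooth[OF \<psi>]] in \<open>auto intro!: continuous_intros\<close>)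
  have "indicator (interior K) x * (c x - p x) * \<psi> x = indicator \<Omega> x * c x * \<psi> x - p x * \<psi> x" for x
    using supp[of x] triangle_interior_subset[OF K] by (cases "\<psi> x = 0") (auto simp: indicator_def algebra_simps)
  then show ?thesis using i1 i2 by simp
qed

end

text \<open>A face with the box around its midpoint in which the test functions live. The half of the
  box with positive normal coordinate lies in \<open>T_plus\<close>.\<close>

locale face_frame = efficiency + 
  fixes F a b \<nu> \<rho> \<delta>
  assumes face: "F \<in> faces \<T>" and Fab: "F = closed_segment a b"
    and side_plus: "side \<gamma> a b (T_plus \<T> F) \<nu>"
    and \<rho>0: "0 < \<rho>" and \<delta>0: "0 < \<delta>" and \<rho>_le: "\<rho> \<le> dist a b / 8" and \<delta>_le: "\<delta> \<le> dist a b / (2 * (\<gamma> * (1 + \<gamma>)))"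
begin

abbreviation "l \<equiv> dist a b"
abbreviation "\<tau> \<equiv> (b - a) /\<^sub>R dist a b"
abbreviation "m \<equiv> midpoint a b"
abbreviation "P \<equiv> T_plus \<T> F"
abbreviation "N \<equiv> T_minus \<T> F"

sublocale fr: frame m \<tau> \<nu> \<rho> \<delta>
  by (rule side_frame[OF side_plus \<rho>0 \<delta>0])

lemma l_pos: "0 < l" and \<gamma>_ge: "2 \<le> \<gamma>"
  using side_plus by (auto simp: side_def)

lemma P_T: "P \<in> \<T>" and P_edge: "F edge_of P"
  using T_plus[OF face] by auto

text \<open>The limits on \<rho> and \<delta> are half of what \<open>side\<close> allows. The
  strict inequalities keep the box inside the open region in which neighbouring triangles are known
  to lie.\<close>

lemma box_strict:
  assumes "x \<in> fr.box"
  shows "\<bar>(x - m) \<bullet> \<tau>\<bar> < l / 4" "\<bar>(x - m) \<bullet> \<nu>\<bar> < l / (\<gamma> * (1 + \<gamma>))"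
proof -
  have r: "\<bar>(x - m) \<bullet> \<tau>\<bar> \<le> \<rho>" "\<bar>(x - m) \<bullet> \<nu>\<bar> \<le> \<delta>" using assms unfolding fr.box_def by blast+
  have d: "l / (2 * (\<gamma> * (1 + \<gamma>))) < l / (\<gamma> * (1 + \<gamma>))"
    using l_pos \<gamma>_ge by (intro divide_strict_left_mono) auto
  show "\<bar>(x - m) \<bullet> \<tau>\<bar> < l / 4" using r(1) \<rho>_le l_pos by linarith
  show "\<bar>(x - m) \<bullet> \<nu>\<bar> < l / (\<gamma> * (1 + \<gamma>))" by (rule le_less_trans[OF order_trans[OF r(2) \<delta>_le] d])
qed

lemma side_interior:
  assumes s: "side \<gamma> a b K \<nu>'" and x: "\<bar>(x - m) \<bullet> \<tau>\<bar> < l / 4" "0 < (x - m) \<bullet> \<nu>'" "(x - m) \<bullet> \<nu>' < l / (\<gamma> * (1 + \<gamma>))"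
  shows "x \<in> interior K"
proof (rule interiorI)
  let ?U = "{x. \<bar>(x - m) \<bullet> \<tau>\<bar> < l / 4 \<and> 0 < (x - m) \<bullet> \<nu>' \<and> (x - m) \<bullet> \<nu>' < l / (\<gamma> * (1 + \<gamma>))}"
  show "open ?U" by (intro open_Collect_conj open_Collect_less continuous_intros)
  show "x \<in> ?U" using x by simp
  show "?U \<subseteq> K" using s unfolding side_def by auto
qed

lemma side_exterior:
  assumes s: "side \<gamma> a b K \<nu>'" and x: "(x - m) \<bullet> \<nu>' < 0"
  shows "x \<notin> interior K"
  using s x interior_subset[of K] unfolding side_def by force

lemma line_null: "AE x in lebesgue. (x - m) \<bullet> \<nu> \<noteq> 0"
proof -
  have "\<nu> \<noteq> 0" using fr.norm_\<nu> by auto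
  then have "negligible {x. \<nu> \<bullet> x = \<nu> \<bullet> m}" by (intro negligible_hyperplane) auto
  then have "AE x in lebesgue. x \<notin> {x. \<nu> \<bullet> x = \<nu> \<bullet> m}"
    by (intro AE_not_in) (simp add: negligible_iff_null_sets)
  moreover have "(x - m) \<bullet> \<nu> = \<nu> \<bullet> x - \<nu> \<bullet> m" for x
    by (simp add: inner_diff_right inner_commute[of "x - m"])
  ultimately show ?thesis by simp
qed

abbreviation "H \<equiv> half_plane m \<nu>"

lemma H_sets: "H \<in> sets lebesgue"
  using open_half_plane[of m \<nu>] by auto

text \<open>Inside the box the open triangle and the half plane differ by a piece of the line
  through the edge only, so a one-sided error integral becomes a half-plane integral.\<close>

lemma split_boundary:
  assumes \<psi>: "sq_int \<psi>" "continuous_on UNIV \<psi>" and supp: "\<And>x. \<psi> x \<noteq> 0 \<Longrightarrow> x \<in> fr.box"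
    and c: "sq_int (\<lambda>x. indicator \<Omega> x * c x)" and p: "continuous_on UNIV p"
  shows "(LINT x|lebesgue. indicator (interior P) x * (c x - p x) * \<psi> x) = (LINT x|lebesgue. indicator H x * (indicator \<Omega> x * c x * \<psi> x)) - (LINT x|lebesgue. indicator H x * (p x * \<psi> x))"
proof -
  have i1: "integrable lebesgue (\<lambda>x. indicator H x * (indicator \<Omega> x * c x * \<psi> x))"
    using integrable_mult_indicator[OF H_sets sq_int_mult[OF c \<psi>(1)]] by simp
  have "integrable lebesgue (\<lambda>x. p x * \<psi> x)"
    by (rule integrable_compact_support[where R="norm m + \<rho> + \<delta>"])
       (use fr.box_norm supp p \<psi>(2) in \<open>auto intro!: continuous_intros\<close>)
  then have i2: "integrable lebesgue (\<lambda>x. indicator H x * (p x * \<psi> x))"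
    using integrable_mult_indicator[OF H_sets, of "\<lambda>x. p x * \<psi> x"] by simp
  have ae: "AE x in lebesgue. indicator H x * (indicator \<Omega> x * c x * \<psi> x) - indicator H x * (p x * \<psi> x) = indicator (interior P) x * (c x - p x) * \<psi> x"
    using line_null
  proof eventually_elim
    case (elim x)
    show ?case
    proof (cases "\<psi> x = 0")
      case False
      note bx = box_strict[OF supp[OF False]]
      show ?thesis
      proof (cases "0 < (x - m) \<bullet> \<nu>")
        case True
        have "x \<in> interior P" using side_interior[OF side_plus bx(1) True] bx(2) by simp
        then have "x \<in> interior P" "x \<in> \<Omega>" "x \<in> H" using triangle_interior_subset[OF P_T] True by auto
        then show ?thesis by (simp add: algebra_simps)
      next
        case F: False
        then have "x \<notin> interior P" using side_exterior[OF side_plus] elim by simp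
        then show ?thesis using F by simp
      qed
    qed simp
  qed
  have m: "(\<lambda>x. indicator H x * (indicator \<Omega> x * c x * \<psi> x) - indicator H x * (p x * \<psi> x)) \<in> borel_measurable lebesgue"
    using borel_measurable_integrable[OF Bochner_Integration.integrable_diff[OF i1 i2]] .
  show ?thesis using integral_lebesgue_AE(1)[OF m ae] i1 i2 by simp
qed

end

locale interior_face_frame = face_frame +
  assumes int_face: "F \<in> interior_faces \<Omega> \<T>"
begin

lemma N_T: "N \<in> \<T>" and N_edge: "F edge_of N" and side_minus: "side \<gamma> a b N (- \<nu>)"
proof -
  show "N \<in> \<T>" "F edge_of N" using T_minus[OF int_face] by auto
  then show "side \<gamma> a b N (- \<nu>)" using opposite_side[OF P_T _ _ side_plus _ Fab] T_minus(3)[OF int_face] by auto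
qed

lemma box_\<Omega>: "fr.box \<subseteq> \<Omega>"
  using side_box_interior[OF side_plus triangle_subset[OF P_T] side_minus triangle_subset[OF N_T]] box_strict by blast

text \<open>On the side of \<open>P\<close> the error is written as (c - p') - (p - p'). The
  derivative of u then appears with p' on the whole box, where a test function can be used, and the
  half plane carries polynomials only.\<close>

lemma split_interior:
  assumes \<psi>: "\<psi> \<in> test_functions \<Omega>" and supp: "\<And>x. \<psi> x \<noteq> 0 \<Longrightarrow> x \<in> fr.box"
    and c: "sq_int (\<lambda>x. indicator \<Omega> x * c x)" and p: "continuous_on UNIV p" "continuous_on UNIV p'"
  shows "(LINT x|lebesgue. (indicator (interior P) x * (c x - p x) + indicator (interior N) x * (c x - p' x)) * \<psi> x) =
    (LINT x|lebesgue. indicator \<Omega> x * c x * \<psi> x) - (LINT x|lebesgue. p' x * \<psi> x) - (LINT x|lebesgue. indicator H x * ((p x - p' x) * \<psi> x))"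
proof -
  have c\<psi>: "continuous_on UNIV \<psi>" using smooth_continuous test_function_smooth \<psi> by blast
  have i1: "integrable lebesgue (\<lambda>x. indicator \<Omega> x * c x * \<psi> x)" using sq_int_mult[OF c sq_int_test[OF \<psi>]] .
  have i2: "integrable lebesgue (\<lambda>x. p' x * \<psi> x)" and "integrable lebesgue (\<lambda>x. (p x - p' x) * \<psi> x)"
    by (rule integrable_compact_support[where R="norm m + \<rho> + \<delta>"];
       use fr.box_norm supp p c\<psi> in \<open>auto intro!: continuous_intros\<close>)+
  then have i3: "integrable lebesgue (\<lambda>x. indicator H x * ((p x - p' x) * \<psi> x))"
    using integrable_mult_indicator[OF H_sets, of "\<lambda>x. (p x - p' x) * \<psi> x"] by simp
  have ae: "AE x in lebesgue. indicator \<Omega> x * c x * \<psi> x - p' x * \<psi> x - indicator H x * ((p x - p' x) * \<psi> x) 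
     = (indicator (interior P) x * (c x - p x) + indicator (interior N) x * (c x - p' x)) * \<psi> x"
    using line_null
  proof eventually_elim
    case (elim x)
    show ?case
    proof (cases "\<psi> x = 0")
      case False
      note bx = box_strict[OF supp[OF False]]
      have x\<Omega>: "x \<in> \<Omega>" using supp[OF False] box_\<Omega> by blast
      show ?thesis
      proof (cases "0 < (x - m) \<bullet> \<nu>")
        case True
        have "x \<in> interior P" using side_interior[OF side_plus bx(1) True] bx(2) by simp
        moreover have "x \<notin> interior N" using side_exterior[OF side_minus] True by simp
        moreover have "x \<in> H" using True by simp
        ultimately show ?thesis using x\<Omega> by (simp add: algebra_simps)
      next
        case F: False
        then have neg: "(x - m) \<bullet> \<nu> < 0" using elim by simp
        then have "x \<notin> interior P" using side_exterior[OF side_plus] by simp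
        moreover have "x \<in> interior N" using side_interior[OF side_minus bx(1)] neg bx(2) by simp
        ultimately show ?thesis using F x\<Omega> by (simp add: algebra_simps)
      qed
    qed simp
  qed
  have m: "(\<lambda>x. indicator \<Omega> x * c x * \<psi> x - p' x * \<psi> x - indicator H x * ((p x - p' x) * \<psi> x)) \<in> borel_measurable lebesgue"
    using borel_measurable_integrable[OF Bochner_Integration.integrable_diff[OF Bochner_Integration.integrable_diff[OF i1 i2] i3]] .
  show ?thesis using integral_lebesgue_AE(1)[OF m ae] i1 i2 i3 by simp
qed

end

context efficiency
begin

lemma uh_mid_interior:
  assumes "F \<in> interior_faces \<Omega> \<T>" "F = closed_segment a b"
  shows "pd i (u\<^sub>h (T_plus \<T> F)) (midpoint a b) = pd i (u\<^sub>h (T_minus \<T> F)) (midpoint a b)"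
proof -
  have "\<forall>F\<in>interior_faces \<Omega> \<T>. jump \<Omega> \<T> (pw_grad u\<^sub>h) F (face_mid F) = 0"
    using uh_morley unfolding morley_def mem_Collect_eq by (elim conjE)
  then have "jump \<Omega> \<T> (pw_grad u\<^sub>h) F (face_mid F) = 0" using assms(1) by blast
  then have "grad (u\<^sub>h (T_plus \<T> F)) (midpoint a b) - grad (u\<^sub>h (T_minus \<T> F)) (midpoint a b) = 0"
    using assms by (simp add: jump_def pw_grad_def face_mid_segment)
  then have "grad (u\<^sub>h (T_plus \<T> F)) (midpoint a b) $ i = grad (u\<^sub>h (T_minus \<T> F)) (midpoint a b) $ i" by simp
  then show ?thesis by (simp add: grad_def)
qed

lemma uh_mid_boundary:
  assumes "F \<in> faces \<T>" "F \<notin> interior_faces \<Omega> \<T>" "F = closed_segment a b"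
  shows "pd i (u\<^sub>h (T_plus \<T> F)) (midpoint a b) = 0"
proof -
  have F: "F \<in> boundary_faces \<Omega> \<T>" using assms by (auto simp: boundary_faces_def interior_faces_def)
  have "\<forall>F\<in>boundary_faces \<Omega> \<T>. \<forall>T\<in>\<T>. F edge_of T \<longrightarrow> pw_grad u\<^sub>h T (face_mid F) = 0"
    using discrete unfolding morley0_def mem_Collect_eq by (elim conjE)
  then have "pw_grad u\<^sub>h (T_plus \<T> F) (face_mid F) = 0" using F T_plus[OF assms(1)] by blast
  then have "grad (u\<^sub>h (T_plus \<T> F)) (midpoint a b) $ i = 0" using assms by (simp add: pw_grad_def face_mid_segment)
  then show ?thesis by (simp add: grad_def)
qed

text \<open>The zero function beyond a boundary face matches the convention for boundary jumps and
  lets both kinds of faces share one identity.\<close>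

definition outer :: "point set \<Rightarrow> point \<Rightarrow> real" where
  "outer F = (if F \<in> interior_faces \<Omega> \<T> then u\<^sub>h (T_minus \<T> F) else (\<lambda>x. 0))"

text \<open>Second derivatives of quadratic pieces are constant; the origin is an arbitrary point of
  evaluation.\<close>

definition Djump :: "point set \<Rightarrow> 2 \<Rightarrow> 2 \<Rightarrow> real" where
  "Djump F i j = pd j (pd i (u\<^sub>h (T_plus \<T> F))) 0 - pd j (pd i (outer F)) 0"

definition face_gerr :: "point set \<Rightarrow> 2 \<Rightarrow> point \<Rightarrow> real" where
  "face_gerr F i x = gerr (T_plus \<T> F) (u\<^sub>h (T_plus \<T> F)) i x +
     (if F \<in> interior_faces \<Omega> \<T> then gerr (T_minus \<T> F) (u\<^sub>h (T_minus \<T> F)) i x else 0)"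

definition face_herr :: "point set \<Rightarrow> 2 \<Rightarrow> 2 \<Rightarrow> point \<Rightarrow> real" where
  "face_herr F i j x = herr (T_plus \<T> F) (u\<^sub>h (T_plus \<T> F)) i j x +
     (if F \<in> interior_faces \<Omega> \<T> then herr (T_minus \<T> F) (u\<^sub>h (T_minus \<T> F)) i j x else 0)"

lemma outer_poly: "F \<in> faces \<T> \<Longrightarrow> poly_deg_le 2 (outer F)"
proof -
  have "poly_deg_le 2 (\<lambda>x. 0)" unfolding poly_deg_le_def by (intro exI[of _ "\<lambda>i j. 0"]) simp
  then show ?thesis using uh_poly T_minus by (auto simp: outer_def)
qed

lemma Djump_const:
  assumes "F \<in> faces \<T>"
  shows "pd j (pd i (u\<^sub>h (T_plus \<T> F))) x - pd j (pd i (outer F)) x = Djump F i j" "Djump F 1 2 = Djump F 2 1"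
proof -
  obtain D where D: "\<And>i j x. pd j (pd i (u\<^sub>h (T_plus \<T> F))) x = D i j" "D 1 2 = D 2 1"
    using poly_deg_le_2_pd[OF uh_poly[OF T_plus(1)[OF assms]]] by blast
  obtain D' where D': "\<And>i j x. pd j (pd i (outer F)) x = D' i j" "D' 1 2 = D' 2 1"
    using poly_deg_le_2_pd[OF outer_poly[OF assms]] by blast
  show "pd j (pd i (u\<^sub>h (T_plus \<T> F))) x - pd j (pd i (outer F)) x = Djump F i j" "Djump F 1 2 = Djump F 2 1"
    by (simp_all add: Djump_def D D')
qed

text \<open>The jump is affine, and the Morley conditions at the midpoint remove its constant term;
  on boundary faces the homogeneous condition does so.\<close>

lemma grad_jump:
  assumes "F \<in> faces \<T>" "F = closed_segment a b"
  shows "pd i (u\<^sub>h (T_plus \<T> F)) x - pd i (outer F) x = Djump F i 1 * (x - midpoint a b)$1 + Djump F i 2 * (x - midpoint a b)$2"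
proof -
  let ?m = "midpoint a b" and ?p = "u\<^sub>h (T_plus \<T> F)" and ?q = "outer F"
  obtain D where D: "\<And>i j x. pd j (pd i ?p) x = D i j" "\<And>i x y. pd i ?p x - pd i ?p y = D i 1 * (x - y)$1 + D i 2 * (x - y)$2"
    using poly_deg_le_2_pd[OF uh_poly[OF T_plus(1)[OF assms(1)]]] by blast
  obtain D' where D': "\<And>i j x. pd j (pd i ?q) x = D' i j" "\<And>i x y. pd i ?q x - pd i ?q y = D' i 1 * (x - y)$1 + D' i 2 * (x - y)$2"
    using poly_deg_le_2_pd[OF outer_poly[OF assms(1)]] by blast
  have "pd i ?p ?m - pd i ?q ?m = 0"
  proof (cases "F \<in> interior_faces \<Omega> \<T>")
    case True then show ?thesis using uh_mid_interior[OF True assms(2)] by (simp add: outer_def)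
  next
    case False
    have "pd i (\<lambda>x. 0) ?m = 0" using pd_affine[of i 0 0 ?m] by simp
    then show ?thesis using uh_mid_boundary[OF assms(1) False assms(2)] False by (simp add: outer_def)
  qed
  then have "pd i ?p x - pd i ?q x = (pd i ?p x - pd i ?p ?m) - (pd i ?q x - pd i ?q ?m)" by simp
  also have "\<dots> = Djump F i 1 * (x - ?m)$1 + Djump F i 2 * (x - ?m)$2"
    unfolding D(2)[of i x ?m] D'(2)[of i x ?m] by (simp add: Djump_def D(1) D'(1) left_diff_distrib)
  finally show ?thesis .
qed

end

section \<open>The jump identity at interior and at boundary faces\<close>

context interior_face_frame
begin

lemma ref_test: "ref g \<Longrightarrow> (\<lambda>x. g (fr.B x)) \<in> test_functions \<Omega>"
  using fr.ref_B_test_function box_\<Omega> by blast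

lemma pd_ref_supp: "ref g \<Longrightarrow> pd i (\<lambda>x. g (fr.B x)) x \<noteq> 0 \<Longrightarrow> x \<in> fr.box"
  and pd_pd_ref_supp: "ref g \<Longrightarrow> pd j (pd i (\<lambda>x. g (fr.B x))) x \<noteq> 0 \<Longrightarrow> x \<in> fr.box"
proof -
  assume g: "ref g"
  have cl: "closed fr.box" using fr.compact_box compact_imp_closed by blast
  have 1: "pd i (\<lambda>x. g (fr.B x)) x \<noteq> 0 \<Longrightarrow> x \<in> fr.box" for i x
    by (rule pd_outside_support[OF fr.ref_B_box[OF g] cl])
  show "pd i (\<lambda>x. g (fr.B x)) x \<noteq> 0 \<Longrightarrow> x \<in> fr.box" by (rule 1)
  show "pd j (pd i (\<lambda>x. g (fr.B x))) x \<noteq> 0 \<Longrightarrow> x \<in> fr.box" by (rule pd_outside_support[OF 1 cl])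
qed

lemma smooth_outer: "smooth (u\<^sub>h P)" "smooth (u\<^sub>h N)"
  using uh_smooth P_T N_T by auto

text \<open>For \<open>weak_grad\<close> of u and for the polynomial of \<open>N\<close>, extended
  across the face, integration by parts over the box leaves nothing. What survives is the difference
  of the two polynomials on the half plane.\<close>

lemma jump_identity_interior:
  assumes g: "ref g"
  shows "(LINT x|lebesgue. face_gerr F i x * pd j (\<lambda>x. g (fr.B x)) x + face_herr F i j x * g (fr.B x)) =
    - (LINT x|lebesgue. indicator H x * ((Djump F i 1 * (x - m)$1 + Djump F i 2 * (x - m)$2) * pd j (\<lambda>x. g (fr.B x)) x + Djump F i j * g (fr.B x)))"
proof -
  let ?\<psi> = "\<lambda>x. g (fr.B x)"
  have o: "outer F = u\<^sub>h N" using int_face by (simp add: outer_def)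
  note t = ref_test[OF g] and tp = test_functions_pd[OF ref_test[OF g], of j]
  have cp: "continuous_on UNIV (pd i (u\<^sub>h P))" "continuous_on UNIV (pd i (u\<^sub>h N))" "continuous_on UNIV (pd j (pd i (u\<^sub>h P)))" "continuous_on UNIV (pd j (pd i (u\<^sub>h N)))"
    by (intro smooth_continuous smooth_pd smooth_outer)+
  have eg: "face_gerr F i x = indicator (interior P) x * (weak_grad \<Omega> u x $ i - pd i (u\<^sub>h P) x) + indicator (interior N) x * (weak_grad \<Omega> u x $ i - pd i (u\<^sub>h N) x)" for x
    using int_face by (simp add: face_gerr_def gerr_def)
  have eh: "face_herr F i j x = indicator (interior P) x * (weak_hess \<Omega> u x $ i $ j - pd j (pd i (u\<^sub>h P)) x) + indicator (interior N) x * (weak_hess \<Omega> u x $ i $ j - pd j (pd i (u\<^sub>h N)) x)" for x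
    using int_face by (simp add: face_herr_def herr_def)
  have sg: "sq_int (face_gerr F i)" "sq_int (face_herr F i j)"
    unfolding face_gerr_def[abs_def] face_herr_def[abs_def] using int_face by (auto intro!: sq_int_add gerr_sq_int herr_sq_int P_T N_T smooth_outer)
  have I: "integrable lebesgue (\<lambda>x. face_gerr F i x * pd j ?\<psi> x)" "integrable lebesgue (\<lambda>x. face_herr F i j x * ?\<psi> x)"
    using sq_int_mult[OF sg(1) sq_int_test[OF tp]] sq_int_mult[OF sg(2) sq_int_test[OF t]] .
  have s1: "(LINT x|lebesgue. face_gerr F i x * pd j ?\<psi> x) = (LINT x|lebesgue. indicator \<Omega> x * weak_grad \<Omega> u x $ i * pd j ?\<psi> x) - (LINT x|lebesgue. pd i (u\<^sub>h N) x * pd j ?\<psi> x)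
      - (LINT x|lebesgue. indicator H x * ((pd i (u\<^sub>h P) x - pd i (u\<^sub>h N) x) * pd j ?\<psi> x))"
    unfolding eg by (rule split_interior[OF tp pd_ref_supp[OF g] Du(3) cp(1,2)])
  have s2: "(LINT x|lebesgue. face_herr F i j x * ?\<psi> x) = (LINT x|lebesgue. indicator \<Omega> x * weak_hess \<Omega> u x $ i $ j * ?\<psi> x) - (LINT x|lebesgue. pd j (pd i (u\<^sub>h N)) x * ?\<psi> x)
      - (LINT x|lebesgue. indicator H x * ((pd j (pd i (u\<^sub>h P)) x - pd j (pd i (u\<^sub>h N)) x) * ?\<psi> x))"
    unfolding eh by (rule split_interior[OF t fr.ref_B_box[OF g] Du(4) cp(3,4)])
  have w1: "(LINT x|lebesgue. indicator \<Omega> x * weak_grad \<Omega> u x $ i * pd j ?\<psi> x) = - (LINT x|lebesgue. indicator \<Omega> x * weak_hess \<Omega> u x $ i $ j * ?\<psi> x)"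
  proof -
    have "(LINT x|lebesgue. weak_grad \<Omega> u x $ i * pd j ?\<psi> x) = - (LINT x|lebesgue. weak_hess \<Omega> u x $ i $ j * ?\<psi> x)"
      using Du(2)[of i j] t unfolding has_weak_pd_lebesgue[OF open_\<Omega>] by blast
    moreover have "(LINT x|lebesgue. indicator \<Omega> x * weak_grad \<Omega> u x $ i * pd j ?\<psi> x) = (LINT x|lebesgue. weak_grad \<Omega> u x $ i * pd j ?\<psi> x)"
      by (intro Bochner_Integration.integral_cong refl test_integral_indicator[OF tp])
    moreover have "(LINT x|lebesgue. indicator \<Omega> x * weak_hess \<Omega> u x $ i $ j * ?\<psi> x) = (LINT x|lebesgue. weak_hess \<Omega> u x $ i $ j * ?\<psi> x)"
      by (intro Bochner_Integration.integral_cong refl test_integral_indicator[OF t])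
    ultimately show ?thesis by (simp only:)
  qed
  have w2: "(LINT x|lebesgue. pd i (u\<^sub>h N) x * pd j ?\<psi> x) = - (LINT x|lebesgue. pd j (pd i (u\<^sub>h N)) x * ?\<psi> x)"
    using has_weak_pd_smooth[OF open_\<Omega> smooth_pd[OF smooth_outer(2)], of i j] t unfolding has_weak_pd_lebesgue[OF open_\<Omega>] by blast
  have ci: "integrable lebesgue (\<lambda>x. indicator H x * (q x * \<psi> x))" if q: "continuous_on UNIV q" and \<psi>: "\<psi> \<in> test_functions \<Omega>" for q \<psi>
  proof -
    obtain R where R: "\<And>x. \<psi> x \<noteq> 0 \<Longrightarrow> norm x \<le> R" using test_function_bounded_support[OF \<psi>] by blast
    have "integrable lebesgue (\<lambda>x. q x * \<psi> x)"
      by (rule integrable_compact_support[where R=R]) (use R q smooth_continuous[OF test_function_smooth[OF \<psi>]] in \<open>auto intro!: continuous_intros\<close>)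
    then show ?thesis using integrable_mult_indicator[OF H_sets, of "\<lambda>x. q x * \<psi> x"] by simp
  qed
  have i3: "integrable lebesgue (\<lambda>x. indicator H x * ((pd i (u\<^sub>h P) x - pd i (u\<^sub>h N) x) * pd j ?\<psi> x))"
    "integrable lebesgue (\<lambda>x. indicator H x * ((pd j (pd i (u\<^sub>h P)) x - pd j (pd i (u\<^sub>h N)) x) * ?\<psi> x))"
    by (intro ci continuous_on_diff cp t tp)+
  have "(LINT x|lebesgue. face_gerr F i x * pd j ?\<psi> x + face_herr F i j x * ?\<psi> x) = 
    - ((LINT x|lebesgue. indicator H x * ((pd i (u\<^sub>h P) x - pd i (u\<^sub>h N) x) * pd j ?\<psi> x)) + (LINT x|lebesgue. indicator H x * ((pd j (pd i (u\<^sub>h P)) x - pd j (pd i (u\<^sub>h N)) x) * ?\<psi> x)))"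
    using I s1 s2 w1 w2 by simp
  also have "\<dots> = - (LINT x|lebesgue. indicator H x * ((pd i (u\<^sub>h P) x - pd i (u\<^sub>h N) x) * pd j ?\<psi> x) + indicator H x * ((pd j (pd i (u\<^sub>h P)) x - pd j (pd i (u\<^sub>h N)) x) * ?\<psi> x))"
    using i3 by simp
  also have "\<dots> = - (LINT x|lebesgue. indicator H x * ((Djump F i 1 * (x - m)$1 + Djump F i 2 * (x - m)$2) * pd j ?\<psi> x + Djump F i j * ?\<psi> x))"
    unfolding grad_jump[OF face Fab, unfolded o] Djump_const(1)[OF face, unfolded o] by (simp only: distrib_left)
  finally show ?thesis .
qed

end

context face_frame
begin

text \<open>The scaled bump need not have its support in \<Omega>, so it cannot be inserted into the
  definition of the weak derivative. For a test function \<phi> in place of u, the product of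
  \<open>pd i \<phi>\<close> and the bump vanishes on the line through the face and its derivatives
  have integral zero over the half plane; \<open>H2_0_limit\<close> transfers this to u.\<close>

lemma jump_identity_boundary:
  assumes g: "ref g" and bd: "F \<notin> interior_faces \<Omega> \<T>"
  shows "(LINT x|lebesgue. face_gerr F i x * pd j (\<lambda>x. g (fr.B x)) x + face_herr F i j x * g (fr.B x)) =
    - (LINT x|lebesgue. indicator H x * ((Djump F i 1 * (x - m)$1 + Djump F i 2 * (x - m)$2) * pd j (\<lambda>x. g (fr.B x)) x + Djump F i j * g (fr.B x)))"
proof -
  let ?\<psi> = "\<lambda>x. g (fr.B x)"
  have fr: "F \<subseteq> frontier \<Omega>" using bd face by (auto simp: interior_faces_def)
  have z0: "pd k (\<lambda>x. 0) x = 0" for k and x :: point using pd_affine[of k 0 0 x] by simp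
  have o: "pd i (outer F) x = 0" "pd j (pd i (outer F)) x = 0" for x using bd by (simp_all add: outer_def z0 z0[abs_def])
  have t: "?\<psi> \<in> test_functions UNIV" using fr.ref_B_test_function[OF g] by simp
  note tp = test_functions_pd[OF t, of j]
  have cl: "closed fr.box" using fr.compact_box compact_imp_closed by blast
  have supp: "\<And>x. ?\<psi> x \<noteq> 0 \<Longrightarrow> x \<in> fr.box" by (rule fr.ref_B_box[OF g])
  have suppd: "\<And>x. pd j ?\<psi> x \<noteq> 0 \<Longrightarrow> x \<in> fr.box" by (rule pd_outside_support[OF supp cl])
  have sm: "smooth ?\<psi>" using t test_function_smooth by blast
  have smP: "smooth (u\<^sub>h P)" using uh_smooth P_T by auto
  have cp: "continuous_on UNIV (pd i (u\<^sub>h P))" "continuous_on UNIV (pd j (pd i (u\<^sub>h P)))" by (intro smooth_continuous smooth_pd smP)+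
  have eg: "face_gerr F i x = indicator (interior P) x * (weak_grad \<Omega> u x $ i - pd i (u\<^sub>h P) x)" for x
    using bd by (simp add: face_gerr_def gerr_def)
  have eh: "face_herr F i j x = indicator (interior P) x * (weak_hess \<Omega> u x $ i $ j - pd j (pd i (u\<^sub>h P)) x)" for x
    using bd by (simp add: face_herr_def herr_def)
  have sg: "sq_int (face_gerr F i)" "sq_int (face_herr F i j)"
    unfolding eg[abs_def] eh[abs_def] by (rule field_sq_int[OF P_T Du(3) cp(1)], rule field_sq_int[OF P_T Du(4) cp(2)])
  have I: "integrable lebesgue (\<lambda>x. face_gerr F i x * pd j ?\<psi> x)" "integrable lebesgue (\<lambda>x. face_herr F i j x * ?\<psi> x)"
    using sq_int_mult[OF sg(1) sq_int_test[OF tp]] sq_int_mult[OF sg(2) sq_int_test[OF t]] .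
  have s1: "(LINT x|lebesgue. face_gerr F i x * pd j ?\<psi> x) = (LINT x|lebesgue. indicator H x * (indicator \<Omega> x * weak_grad \<Omega> u x $ i * pd j ?\<psi> x))
      - (LINT x|lebesgue. indicator H x * (pd i (u\<^sub>h P) x * pd j ?\<psi> x))"
    unfolding eg by (rule split_boundary[OF sq_int_test[OF tp] smooth_continuous[OF smooth_pd[OF sm]] suppd Du(3) cp(1)])
  have s2: "(LINT x|lebesgue. face_herr F i j x * ?\<psi> x) = (LINT x|lebesgue. indicator H x * (indicator \<Omega> x * weak_hess \<Omega> u x $ i $ j * ?\<psi> x))
      - (LINT x|lebesgue. indicator H x * (pd j (pd i (u\<^sub>h P)) x * ?\<psi> x))"
    unfolding eh by (rule split_boundary[OF sq_int_test[OF t] smooth_continuous[OF sm] supp Du(4) cp(2)])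
  have i1: "integrable lebesgue (\<lambda>x. indicator H x * (indicator \<Omega> x * weak_grad \<Omega> u x $ i * pd j ?\<psi> x))" "integrable lebesgue (\<lambda>x. indicator H x * (indicator \<Omega> x * weak_hess \<Omega> u x $ i $ j * ?\<psi> x))"
    using integrable_mult_indicator[OF H_sets sq_int_mult[OF Du(3) sq_int_test[OF tp]]] integrable_mult_indicator[OF H_sets sq_int_mult[OF Du(4) sq_int_test[OF t]]] by simp_all
  \<comment> \<open>Points of the line inside the box lie on the face itself, hence on the boundary
    of \<Omega>; other points of the line could belong to \<Omega>, but there the bump is
    zero.\<close>
  have on_line: "\<phi> x * ?\<psi> x = 0" if \<phi>: "\<phi> \<in> test_functions \<Omega>" and x: "(x - m) \<bullet> \<nu> = 0" for \<phi> x
  proof (rule ccontr)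
    assume nz: "\<phi> x * ?\<psi> x \<noteq> 0"
    then have "x \<in> fr.box" using supp by auto
    then have xb: "\<bar>(x - m) \<bullet> \<tau>\<bar> < l / 4" by (rule box_strict(1))
    define s where "s = (x - m) \<bullet> \<tau> / l"
    have s: "\<bar>s\<bar> \<le> 1/2" using xb l_pos by (simp add: s_def abs_divide divide_le_eq)
    have "x = m + ((x - m) \<bullet> \<tau>) *\<^sub>R \<tau>" using fr.expand[of "x - m"] x by (simp add: algebra_simps)
    also have "\<dots> = m + s *\<^sub>R (b - a)" using l_pos by (simp add: s_def divide_inverse)
    also have "\<dots> = (1 - (s + 1/2)) *\<^sub>R a + (s + 1/2) *\<^sub>R b" by (simp add: midpoint_def vec_eq_iff field_simps)
    finally have "x \<in> closed_segment a b" unfolding in_segment using s by (intro exI[of _ "s + 1/2"]) auto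
    then have "x \<in> frontier \<Omega>" using fr Fab by blast
    then have "x \<notin> \<Omega>" using open_\<Omega> by (simp add: frontier_def interior_open)
    moreover obtain K where "compact K" "K \<subseteq> \<Omega>" "\<And>y. \<phi> y \<noteq> 0 \<Longrightarrow> y \<in> K" using test_function_support[OF \<phi>] by blast
    ultimately show False using nz by auto
  qed
  have zero: "(LINT x|lebesgue. indicator H x * (indicator \<Omega> x * weak_grad \<Omega> u x $ i * pd j ?\<psi> x + indicator \<Omega> x * weak_hess \<Omega> u x $ i $ j * ?\<psi> x)) = 0"
  proof (rule H2_0_limit[OF open_\<Omega> u_H2_0 H_sets sq_int_test[OF tp] sq_int_test[OF t]])
    fix \<phi> assume \<phi>: "\<phi> \<in> test_functions \<Omega>"
    have p\<phi>: "pd i \<phi> \<in> test_functions \<Omega>" using test_functions_pd[OF \<phi>] .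
    have sp: "smooth (pd i \<phi>)" using p\<phi> test_function_smooth by blast
    let ?g = "\<lambda>x. pd i \<phi> x * ?\<psi> x"
    have C1: "C1_fun ?g" by (intro C1_fun_mult smooth_C1_fun sp sm)
    have sb: "norm x \<le> norm m + \<rho> + \<delta>" if "?g x \<noteq> 0" for x using that supp[of x] fr.box_norm by auto
    have "\<nu> \<noteq> 0" using fr.norm_\<nu> by auto
    from integral_half_plane_derivative[OF C1 sb this, of "axis j 1" m] on_line[OF p\<phi>]
    have "(LINT x|lebesgue. indicator H x * (axis j 1 $ 1 * pd 1 ?g x + axis j 1 $ 2 * pd 2 ?g x)) = 0" by blast
    moreover have "axis j 1 $ 1 * pd 1 ?g x + axis j 1 $ 2 * pd 2 ?g x = pd i \<phi> x * pd j ?\<psi> x + pd j (pd i \<phi>) x * ?\<psi> x" for x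
    proof -
      have "axis j 1 $ 1 * pd 1 ?g x + axis j 1 $ 2 * pd 2 ?g x = pd j ?g x" using exhaust_2[of j] by (auto simp: axis_def)
      also have "\<dots> = pd i \<phi> x * pd j ?\<psi> x + pd j (pd i \<phi>) x * ?\<psi> x" by (rule pd_mult[OF smooth_differentiable[OF sp] smooth_differentiable[OF sm]])
      finally show ?thesis .
    qed
    ultimately show "(LINT x|lebesgue. indicator H x * (pd i \<phi> x * pd j ?\<psi> x + pd j (pd i \<phi>) x * ?\<psi> x)) = 0" by simp
  qed
  have z: "(LINT x|lebesgue. indicator H x * (indicator \<Omega> x * weak_grad \<Omega> u x $ i * pd j ?\<psi> x)) + (LINT x|lebesgue. indicator H x * (indicator \<Omega> x * weak_hess \<Omega> u x $ i $ j * ?\<psi> x)) = 0"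
  proof -
    have "(LINT x|lebesgue. indicator H x * (indicator \<Omega> x * weak_grad \<Omega> u x $ i * pd j ?\<psi> x) + indicator H x * (indicator \<Omega> x * weak_hess \<Omega> u x $ i $ j * ?\<psi> x)) = 0"
      using zero by (simp only: distrib_left)
    then show ?thesis using i1 by simp
  qed
  have ci: "integrable lebesgue (\<lambda>x. indicator H x * (q x * \<psi> x))" if "continuous_on UNIV q" "continuous_on UNIV \<psi>" "\<And>x. \<psi> x \<noteq> 0 \<Longrightarrow> x \<in> fr.box" for q \<psi> :: "point \<Rightarrow> real"
  proof -
    have "integrable lebesgue (\<lambda>x. q x * \<psi> x)"
      by (rule integrable_compact_support[where R="norm m + \<rho> + \<delta>"]) (use that fr.box_norm in \<open>auto intro!: continuous_intros\<close>)
    then show ?thesis using integrable_mult_indicator[OF H_sets, of "\<lambda>x. q x * \<psi> x"] by simp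
  qed
  have i3: "integrable lebesgue (\<lambda>x. indicator H x * (pd i (u\<^sub>h P) x * pd j ?\<psi> x))" "integrable lebesgue (\<lambda>x. indicator H x * (pd j (pd i (u\<^sub>h P)) x * ?\<psi> x))"
    by (rule ci[OF cp(1) smooth_continuous[OF smooth_pd[OF sm]]], erule suppd) (rule ci[OF cp(2) smooth_continuous[OF sm]], erule supp)
  have "(LINT x|lebesgue. face_gerr F i x * pd j ?\<psi> x + face_herr F i j x * ?\<psi> x) = 
    - ((LINT x|lebesgue. indicator H x * (pd i (u\<^sub>h P) x * pd j ?\<psi> x)) + (LINT x|lebesgue. indicator H x * (pd j (pd i (u\<^sub>h P)) x * ?\<psi> x)))"
    using I s1 s2 z by simp
  also have "\<dots> = - (LINT x|lebesgue. indicator H x * (pd i (u\<^sub>h P) x * pd j ?\<psi> x) + indicator H x * (pd j (pd i (u\<^sub>h P)) x * ?\<psi> x))"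
    using i3 by simp
  also have "\<dots> = - (LINT x|lebesgue. indicator H x * ((Djump F i 1 * (x - m)$1 + Djump F i 2 * (x - m)$2) * pd j ?\<psi> x + Djump F i j * ?\<psi> x))"
  proof -
    have "pd i (u\<^sub>h P) x = Djump F i 1 * (x - m)$1 + Djump F i 2 * (x - m)$2" for x using grad_jump[OF face Fab, of i x] by (simp add: o)
    moreover have "pd j (pd i (u\<^sub>h P)) x = Djump F i j" for x using Djump_const(1)[OF face, of j i x] by (simp add: o)
    ultimately show ?thesis by (simp only: distrib_left)
  qed
  finally show ?thesis .
qed

lemma jump_identity_face:
  assumes g: "ref g"
  shows "(LINT x|lebesgue. face_gerr F i x * pd j (\<lambda>x. g (fr.B x)) x + face_herr F i j x * g (fr.B x)) =
    - (LINT x|lebesgue. indicator H x * ((Djump F i 1 * (x - m)$1 + Djump F i 2 * (x - m)$2) * pd j (\<lambda>x. g (fr.B x)) x + Djump F i j * g (fr.B x)))"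
proof (cases "F \<in> interior_faces \<Omega> \<T>")
  case True
  then interpret interior_face_frame \<Omega> \<gamma> \<T> \<epsilon> f u u\<^sub>h F a b \<nu> \<rho> \<delta> by unfold_locales
  show ?thesis by (rule jump_identity_interior[OF g])
next
  case False
  then show ?thesis using jump_identity_boundary[OF g] by blast
qed

end

lemma integral_const_pd:
  assumes \<phi>: "\<phi> \<in> test_functions \<Omega>" and c: "\<And>x. p x = (c::real)"
  shows "(LINT x|lebesgue. p x * pd i \<phi> x) = 0"
proof -
  obtain r where "\<And>x. \<phi> x \<noteq> 0 \<Longrightarrow> norm x \<le> r" using test_function_bounded_support[OF \<phi>] by blast
  then have "(LINT x|lebesgue. pd i \<phi> x) = 0"
    using integral_pd_zero[OF smooth_C1_fun[OF test_function_smooth[OF \<phi>]]] by blast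
  then show ?thesis by (simp add: c)
qed

lemma integral_square_add_le:
  assumes "sq_int a" "sq_int b"
  shows "(LINT x|lebesgue. (a x + b x)\<^sup>2) \<le> 2 * (LINT x|lebesgue. (a x)\<^sup>2) + 2 * (LINT x|lebesgue. (b x)\<^sup>2)"
proof -
  have i: "integrable lebesgue (\<lambda>x. (a x + b x)\<^sup>2)" using sq_int_add[OF assms] by (simp add: sq_int_def)
  have j: "integrable lebesgue (\<lambda>x. 2 * (a x)\<^sup>2 + 2 * (b x)\<^sup>2)" using assms by (auto simp: sq_int_def)
  have "(LINT x|lebesgue. (a x + b x)\<^sup>2) \<le> (LINT x|lebesgue. 2 * (a x)\<^sup>2 + 2 * (b x)\<^sup>2)"
    by (rule integral_mono[OF i j]) (rule square_add_le)
  then show ?thesis using assms by (simp add: sq_int_def)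
qed

lemma integral_square_nonneg: "0 \<le> (LINT x|lebesgue. (a x :: real)\<^sup>2)"
  by (rule integral_nonneg_AE) simp

section \<open>Local error quantities and the tangential jump\<close>

context efficiency
begin

text \<open>All these quantities are squared, and \<open>R K\<close> is the share of K in the
  right-hand side of the theorem. \<open>wt K\<close> equals the diameter times \<kappa>;
  \<open>nO\<close> is still unweighted. \<open>fmean\<close> may evaluate at the origin because the
  projection is constant on K.\<close>

definition "nE K = (\<Sum>i\<in>UNIV. \<Sum>j\<in>UNIV. LINT x|lebesgue. (herr K (u\<^sub>h K) i j x)\<^sup>2)"
definition "nG K = (\<Sum>i\<in>UNIV. LINT x|lebesgue. (gerr K (u\<^sub>h K) i x)\<^sup>2)"
definition "nD K = (\<Sum>i\<in>UNIV. LINT x|lebesgue. (gerr K (w K) i x)\<^sup>2)"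
definition "fmean K = L2_proj0 \<T> f K 0"
definition "nO K = (LINT x|lebesgue. (indicator (interior K) x * (f x - fmean K))\<^sup>2)"
definition "nF K = (LINT x|lebesgue. (indicator (interior K) x * f x)\<^sup>2)"
definition "wt K = min (diameter K) ((diameter K)\<^sup>2 / \<epsilon>)"
definition "R K = \<epsilon>\<^sup>2 * nE K + nG K + nD K + (wt K)\<^sup>2 * nO K"

lemma n_nonneg: "0 \<le> nE K" "0 \<le> nG K" "0 \<le> nD K" "0 \<le> nO K" "0 \<le> nF K"
  unfolding nE_def nG_def nD_def nO_def nF_def by (intro sum_nonneg integral_square_nonneg)+

lemma R_nonneg: "0 \<le> R K"
  unfolding R_def using n_nonneg by simp

lemma n_members: "(LINT x|lebesgue. (herr K (u\<^sub>h K) i j x)\<^sup>2) \<le> nE K" "(LINT x|lebesgue. (gerr K (u\<^sub>h K) i x)\<^sup>2) \<le> nG K"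
  "(LINT x|lebesgue. (gerr K (w K) i x)\<^sup>2) \<le> nD K"
proof -
  show "(LINT x|lebesgue. (herr K (u\<^sub>h K) i j x)\<^sup>2) \<le> nE K"
    unfolding nE_def sum_2 using exhaust_2[of i] exhaust_2[of j] integral_square_nonneg[of "herr K (u\<^sub>h K) 1 1"] integral_square_nonneg[of "herr K (u\<^sub>h K) 1 2"]
      integral_square_nonneg[of "herr K (u\<^sub>h K) 2 1"] integral_square_nonneg[of "herr K (u\<^sub>h K) 2 2"] by auto
  show "(LINT x|lebesgue. (gerr K (u\<^sub>h K) i x)\<^sup>2) \<le> nG K"
    unfolding nG_def sum_2 using exhaust_2[of i] integral_square_nonneg[of "gerr K (u\<^sub>h K) 1"] integral_square_nonneg[of "gerr K (u\<^sub>h K) 2"] by auto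
  show "(LINT x|lebesgue. (gerr K (w K) i x)\<^sup>2) \<le> nD K"
    unfolding nD_def sum_2 using exhaust_2[of i] integral_square_nonneg[of "gerr K (w K) 1"] integral_square_nonneg[of "gerr K (w K) 2"] by auto
qed

definition "facesum q F = q (T_plus \<T> F) + (if F \<in> interior_faces \<Omega> \<T> then q (T_minus \<T> F) else (0::real))"

lemma facesum_nonneg: "(\<And>K. 0 \<le> q K) \<Longrightarrow> 0 \<le> facesum q F"
  unfolding facesum_def by (simp add: add_nonneg_nonneg)

lemma face_err_norms:
  assumes "F \<in> faces \<T>"
  shows "sq_int (face_herr F i j)" "sq_int (face_gerr F i)"
    "sqrt (LINT x|lebesgue. (face_herr F i j x)\<^sup>2) \<le> sqrt (2 * facesum nE F)"
    "sqrt (LINT x|lebesgue. (face_gerr F i x)\<^sup>2) \<le> sqrt (2 * facesum nG F)"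
proof -
  note P = T_plus(1)[OF assms]
  have hP: "sq_int (herr (T_plus \<T> F) (u\<^sub>h (T_plus \<T> F)) i j)" "sq_int (gerr (T_plus \<T> F) (u\<^sub>h (T_plus \<T> F)) i)"
    by (intro herr_sq_int gerr_sq_int P uh_smooth)+
  have hN: "sq_int (herr (T_minus \<T> F) (u\<^sub>h (T_minus \<T> F)) i j)" "sq_int (gerr (T_minus \<T> F) (u\<^sub>h (T_minus \<T> F)) i)" if "F \<in> interior_faces \<Omega> \<T>"
    using T_minus(1)[OF that] by (intro herr_sq_int gerr_sq_int uh_smooth; assumption)+
  show "sq_int (face_herr F i j)" unfolding face_herr_def[abs_def] using hP(1) sq_int_add[OF hP(1) hN(1)] by (cases "F \<in> interior_faces \<Omega> \<T>") simp_all
  show "sq_int (face_gerr F i)" unfolding face_gerr_def[abs_def] using hP(2) sq_int_add[OF hP(2) hN(2)] by (cases "F \<in> interior_faces \<Omega> \<T>") simp_all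
  have "(LINT x|lebesgue. (face_herr F i j x)\<^sup>2) \<le> 2 * facesum nE F"
  proof (cases "F \<in> interior_faces \<Omega> \<T>")
    case True
    then show ?thesis using integral_square_add_le[OF hP(1) hN(1)[OF True]] n_members(1)[of "T_plus \<T> F" i j] n_members(1)[of "T_minus \<T> F" i j]
      by (simp add: face_herr_def facesum_def)
  next
    case False
    then show ?thesis using n_members(1)[of "T_plus \<T> F" i j] n_nonneg(1)[of "T_plus \<T> F"] by (simp add: face_herr_def facesum_def)
  qed
  then show "sqrt (LINT x|lebesgue. (face_herr F i j x)\<^sup>2) \<le> sqrt (2 * facesum nE F)" by (rule real_sqrt_le_mono)
  have "(LINT x|lebesgue. (face_gerr F i x)\<^sup>2) \<le> 2 * facesum nG F"
  proof (cases "F \<in> interior_faces \<Omega> \<T>")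
    case True
    then show ?thesis using integral_square_add_le[OF hP(2) hN(2)[OF True]] n_members(2)[of "T_plus \<T> F" i] n_members(2)[of "T_minus \<T> F" i]
      by (simp add: face_gerr_def facesum_def)
  next
    case False
    then show ?thesis using n_members(2)[of "T_plus \<T> F" i] n_nonneg(2)[of "T_plus \<T> F"] by (simp add: face_gerr_def facesum_def)
  qed
  then show "sqrt (LINT x|lebesgue. (face_gerr F i x)\<^sup>2) \<le> sqrt (2 * facesum nG F)" by (rule real_sqrt_le_mono)
qed

lemma facesum_add: "facesum (\<lambda>K. p K + q K) F = facesum p F + facesum q F"
  and facesum_cmult: "facesum (\<lambda>K. c * p K) F = c * facesum p F"
  by (auto simp: facesum_def distrib_left)

lemma facesum_R: "facesum R F = \<epsilon>\<^sup>2 * facesum nE F + facesum nG F + facesum nD F + facesum (\<lambda>K. (wt K)\<^sup>2 * nO K) F"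
  unfolding R_def[abs_def] facesum_add facesum_cmult ..

text \<open>The largest ratio \<delta> / l that \<open>face_frame\<close> admits.\<close>

definition kk :: real where "kk = 1 / (2 * (\<gamma> * (1 + \<gamma>)))"

lemma face_geometry:
  assumes T: "T \<in> \<T>" "F edge_of T" and ab: "F = closed_segment a b"
  shows "2 \<le> \<gamma>" "0 < dist a b" "dist a b \<le> diameter T" "diameter T \<le> \<gamma> * dist a b / 2" "0 < kk"
proof -
  obtain \<nu> where "side \<gamma> a b T \<nu>" using ex_side[OF T ab] by blast
  then show "2 \<le> \<gamma>" "0 < dist a b" "dist a b \<le> diameter T" "diameter T \<le> \<gamma> * dist a b / 2" by (auto simp: side_def)
  then show "0 < kk" by (simp add: kk_def)
qed

lemma face_frame_at:
  assumes F: "F \<in> faces \<T>" "F = closed_segment a b" and s: "side \<gamma> a b (T_plus \<T> F) \<nu>" and \<delta>: "0 < d" "d \<le> dist a b"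
  shows "face_frame \<Omega> \<gamma> \<T> \<epsilon> f u u\<^sub>h F a b \<nu> (dist a b / 8) (kk * d)"
proof -
  note g = face_geometry[OF T_plus[OF F(1)] F(2)]
  have "kk * d \<le> kk * dist a b" using \<delta> g by (intro mult_left_mono) auto
  then have "kk * d \<le> dist a b / (2 * (\<gamma> * (1 + \<gamma>)))" by (simp add: kk_def)
  then show ?thesis using F s \<delta> g by unfold_locales auto
qed

text \<open>The conclusion of \<open>scaling_NC\<close> for the concrete bump constants, as a
  predicate of the constant. It depends on \<gamma> only and quantifies over its own \<epsilon>, so
  that one constant fits all meshes and solutions.\<close>

definition NC_scaling :: "real \<Rightarrow> bool" where
  "NC_scaling C \<longleftrightarrow> (\<forall>\<epsilon> l h q Ne NE. 0 < \<epsilon> \<and> 0 < l \<and> l \<le> h \<and> h \<le> \<gamma> * l / 2 \<and> 0 \<le> Ne \<and> 0 \<le> NE \<and>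
     \<bar>q\<bar> * (l / 8)\<^sup>2 * c0 \<le> 2 * NE * sqrt (l / 8 * (kk * l)) * (frame.nrm (pd 1 bump) + (l / 8) / (kk * l) * frame.nrm (pd 2 bump)) \<and>
     \<bar>q\<bar> * (l / 8)\<^sup>2 * c1 \<le> sqrt (l / 8 * (kk * min l \<epsilon>)) * (Ne / (kk * min l \<epsilon>) * frame.nrm (pd 2 (\<lambda>y. y$1 * bump y)) + 2 * NE * frame.nrm (\<lambda>y. y$1 * bump y))
     \<longrightarrow> \<epsilon> / min 1 (h / \<epsilon>) * (l ^ 3 * q\<^sup>2) \<le> C * (\<epsilon>\<^sup>2 * NE\<^sup>2 + Ne\<^sup>2))"

lemma NC_face:
  assumes C: "NC_scaling C" "0 \<le> C" and T: "T \<in> \<T>" "F edge_of T" and ab: "F = closed_segment a b"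
  shows "\<epsilon> / kappa \<epsilon> T * ((dist a b) ^ 3 * (Djump F i 1 * ((b - a) /\<^sub>R dist a b)$1 + Djump F i 2 * ((b - a) /\<^sub>R dist a b)$2)\<^sup>2) \<le> 2 * C * facesum R F"
proof -
  note F = face_cases(1)[OF T]
  note g = face_geometry[OF T ab]
  let ?l = "dist a b"
  obtain \<nu> where s: "side \<gamma> a b (T_plus \<T> F) \<nu>" using ex_side[OF T_plus[OF F] ab] by blast
  define q where "q = Djump F i 1 * ((b - a) /\<^sub>R dist a b)$1 + Djump F i 2 * ((b - a) /\<^sub>R dist a b)$2"
  have m0: "0 < min ?l \<epsilon>" "min ?l \<epsilon> \<le> ?l" using g \<epsilon>_pos by auto
  note N = face_err_norms[OF F]
  \<comment> \<open>The same edge carries two boxes: this one with a height proportional to l for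
    the bound by the Hessian error, the next one with min l \<epsilon> for the balanced
    bound.\<close>
  interpret A: face_frame \<Omega> \<gamma> \<T> \<epsilon> f u u\<^sub>h F a b \<nu> "?l / 8" "kk * ?l" by (rule face_frame_at[OF F ab s g(2) order_refl])
  have a: "\<bar>q\<bar> * (?l / 8)\<^sup>2 * c0 \<le> 2 * sqrt (2 * facesum nE F) * sqrt (?l / 8 * (kk * ?l)) * (frame.nrm (pd 1 bump) + (?l / 8) / (kk * ?l) * frame.nrm (pd 2 bump))"
    unfolding q_def by (rule A.fr.tangential_jump_bound(1)[OF N(2) N(1) N(3) N(4) A.jump_identity_face])
  interpret B: face_frame \<Omega> \<gamma> \<T> \<epsilon> f u u\<^sub>h F a b \<nu> "?l / 8" "kk * min ?l \<epsilon>" by (rule face_frame_at[OF F ab s m0])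
  have b: "\<bar>q\<bar> * (?l / 8)\<^sup>2 * c1 \<le> sqrt (?l / 8 * (kk * min ?l \<epsilon>)) * (sqrt (2 * facesum nG F) / (kk * min ?l \<epsilon>) * frame.nrm (pd 2 (\<lambda>y. y$1 * bump y)) + 2 * sqrt (2 * facesum nE F) * frame.nrm (\<lambda>y. y$1 * bump y))"
    unfolding q_def by (rule B.fr.tangential_jump_bound(2)[OF N(2) N(1) N(3) N(4) B.jump_identity_face])
  have nn: "0 \<le> 2 * facesum nE F" "0 \<le> 2 * facesum nG F" using facesum_nonneg[of nE] facesum_nonneg[of nG] n_nonneg by auto
  have "\<epsilon> / min 1 (diameter T / \<epsilon>) * (?l ^ 3 * q\<^sup>2) \<le> C * (\<epsilon>\<^sup>2 * (sqrt (2 * facesum nE F))\<^sup>2 + (sqrt (2 * facesum nG F))\<^sup>2)"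
    using C(1)[unfolded NC_scaling_def, rule_format, of \<epsilon> ?l "diameter T" "sqrt (2 * facesum nG F)" "sqrt (2 * facesum nE F)" q] a b g \<epsilon>_pos nn by simp
  also have "\<dots> = C * (2 * (\<epsilon>\<^sup>2 * facesum nE F + facesum nG F))" using nn by simp
  also have "\<dots> \<le> C * (2 * facesum R F)"
    using facesum_nonneg[of nD F] facesum_nonneg[of "\<lambda>K. (wt K)\<^sup>2 * nO K" F] n_nonneg C(2) unfolding facesum_R by (intro mult_left_mono) auto
  finally show ?thesis by (simp add: q_def kappa_def)
qed

definition face_derr :: "point set \<Rightarrow> 2 \<Rightarrow> point \<Rightarrow> real" where
  "face_derr F i x = gerr (T_plus \<T> F) (w (T_plus \<T> F)) i x + gerr (T_minus \<T> F) (w (T_minus \<T> F)) i x"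

text \<open>The terms \<open>f x - 0\<close> have the shape c - p of \<open>split_interior\<close>,
  with zero polynomials on both sides.\<close>

definition face_f :: "point set \<Rightarrow> point \<Rightarrow> real" where
  "face_f F x = indicator (interior (T_plus \<T> F)) x * (f x - 0) + indicator (interior (T_minus \<T> F)) x * (f x - 0)"

definition wjump :: "point set \<Rightarrow> 2 \<Rightarrow> real" where
  "wjump F i = pd i (w (T_plus \<T> F)) 0 - pd i (w (T_minus \<T> F)) 0"

lemma wjump_const:
  assumes "F \<in> interior_faces \<Omega> \<T>"
  shows "pd i (w (T_plus \<T> F)) x - pd i (w (T_minus \<T> F)) x = wjump F i"
proof -
  have F: "F \<in> faces \<T>" using assms by (auto simp: interior_faces_def)
  obtain g where "\<And>i x. pd i (w (T_plus \<T> F)) x = g $ i" using poly_deg_le_1_pd[OF w_poly[OF T_plus(1)[OF F]]] by blast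
  moreover obtain g' where "\<And>i x. pd i (w (T_minus \<T> F)) x = g' $ i" using poly_deg_le_1_pd[OF w_poly[OF T_minus(1)[OF assms]]] by blast
  ultimately show ?thesis by (simp add: wjump_def)
qed

lemma face_res_norms:
  assumes int: "F \<in> interior_faces \<Omega> \<T>"
  shows "sq_int (face_derr F i)" "sq_int (face_f F)"
    "sqrt (LINT x|lebesgue. (face_derr F i x)\<^sup>2) \<le> sqrt (2 * facesum nD F)"
    "sqrt (LINT x|lebesgue. (face_f F x)\<^sup>2) \<le> sqrt (2 * facesum nF F)"
proof -
  have F: "F \<in> faces \<T>" using int by (auto simp: interior_faces_def)
  note P = T_plus(1)[OF F] and N = T_minus(1)[OF int]
  have d: "sq_int (gerr (T_plus \<T> F) (w (T_plus \<T> F)) i)" "sq_int (gerr (T_minus \<T> F) (w (T_minus \<T> F)) i)"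
    by (intro gerr_sq_int P N w_smooth)+
  have ff: "sq_int (\<lambda>x. indicator (interior K) x * (f x - 0))" if "K \<in> \<T>" for K
    by (rule field_sq_int[OF that f_sq_int]) (rule continuous_on_const)
  show "sq_int (face_derr F i)" unfolding face_derr_def[abs_def] by (rule sq_int_add[OF d])
  show "sq_int (face_f F)" unfolding face_f_def[abs_def] by (rule sq_int_add[OF ff[OF P] ff[OF N]])
  have "(LINT x|lebesgue. (face_derr F i x)\<^sup>2) \<le> 2 * facesum nD F"
    using integral_square_add_le[OF d] n_members(3)[of "T_plus \<T> F" i] n_members(3)[of "T_minus \<T> F" i] int
    by (simp add: face_derr_def facesum_def)
  then show "sqrt (LINT x|lebesgue. (face_derr F i x)\<^sup>2) \<le> sqrt (2 * facesum nD F)" by (rule real_sqrt_le_mono)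
  have "(LINT x|lebesgue. (face_f F x)\<^sup>2) \<le> 2 * facesum nF F"
    using integral_square_add_le[OF ff[OF P] ff[OF N]] int by (simp add: face_f_def facesum_def nF_def)
  then show "sqrt (LINT x|lebesgue. (face_f F x)\<^sup>2) \<le> sqrt (2 * facesum nF F)" by (rule real_sqrt_le_mono)
qed

end

section \<open>The residual identity\<close>

context interior_face_frame
begin

text \<open>On a triangle the Hessian of \<open>u\<^sub>h\<close> and the gradient of the
  interpolant are constant. The constants on \<open>N\<close>, extended to the plane, have integral
  zero against derivatives of test functions; the weak equation removes u and f, and the jumps on
  the half plane remain.\<close>

lemma residual_identity:
  assumes g: "ref g"
  shows "\<epsilon>\<^sup>2 * (\<Sum>i\<in>UNIV. \<Sum>j\<in>UNIV. LINT x|lebesgue. face_herr F i j x * pd j (pd i (\<lambda>x. g (fr.B x))) x)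
     + (\<Sum>i\<in>UNIV. LINT x|lebesgue. face_derr F i x * pd i (\<lambda>x. g (fr.B x)) x) - (LINT x|lebesgue. face_f F x * g (fr.B x))
     = - (\<epsilon>\<^sup>2 * (\<Sum>i\<in>UNIV. \<Sum>j\<in>UNIV. Djump F i j * (\<nu>$i * \<nu>$j)) * (\<rho> / \<delta>) * U (pd 2 (pd 2 g)) + (\<Sum>i\<in>UNIV. wjump F i * \<nu>$i) * \<rho> * U (pd 2 g))"
proof -
  let ?\<psi> = "\<lambda>x. g (fr.B x)"
  have o: "outer F = u\<^sub>h N" using int_face by (simp add: outer_def)
  note t = ref_test[OF g] and tp = test_functions_pd[OF ref_test[OF g]] and tpp = test_functions_pd[OF test_functions_pd[OF ref_test[OF g]]]
  have uhc: "\<exists>c. \<forall>x. pd j (pd i (u\<^sub>h N)) x = c" for i j using poly_deg_le_2_pd[OF uh_poly[OF N_T]] by blast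
  have wc: "\<exists>c. \<forall>x. pd i (w N) x = c" for i using poly_deg_le_1_pd[OF w_poly[OF N_T]] by blast
  have cp: "continuous_on UNIV (pd j (pd i (u\<^sub>h P)))" "continuous_on UNIV (pd j (pd i (u\<^sub>h N)))" "continuous_on UNIV (pd i (w P))" "continuous_on UNIV (pd i (w N))" for i j
    by (intro smooth_continuous smooth_pd smooth_outer w_smooth P_T N_T)+
  have eh: "face_herr F i j x = indicator (interior P) x * (weak_hess \<Omega> u x $ i $ j - pd j (pd i (u\<^sub>h P)) x) + indicator (interior N) x * (weak_hess \<Omega> u x $ i $ j - pd j (pd i (u\<^sub>h N)) x)" for i j x
    using int_face by (simp add: face_herr_def herr_def)
  have ed: "face_derr F i x = indicator (interior P) x * (weak_grad \<Omega> u x $ i - pd i (w P) x) + indicator (interior N) x * (weak_grad \<Omega> u x $ i - pd i (w N) x)" for i x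
    by (simp add: face_derr_def gerr_def)
  have h: "(LINT x|lebesgue. face_herr F i j x * pd j (pd i ?\<psi>) x) = (LINT x|lebesgue. indicator \<Omega> x * weak_hess \<Omega> u x $ i $ j * pd j (pd i ?\<psi>) x)
      - Djump F i j * (\<nu>$i * \<nu>$j) * (\<rho> / \<delta>) * U (pd 2 (pd 2 g))" for i j
  proof -
    obtain c where c: "\<And>x. pd j (pd i (u\<^sub>h N)) x = c" using uhc by blast
    have "(LINT x|lebesgue. face_herr F i j x * pd j (pd i ?\<psi>) x) = (LINT x|lebesgue. indicator \<Omega> x * weak_hess \<Omega> u x $ i $ j * pd j (pd i ?\<psi>) x)
      - (LINT x|lebesgue. pd j (pd i (u\<^sub>h N)) x * pd j (pd i ?\<psi>) x) - (LINT x|lebesgue. indicator H x * ((pd j (pd i (u\<^sub>h P)) x - pd j (pd i (u\<^sub>h N)) x) * pd j (pd i ?\<psi>) x))"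
      unfolding eh by (rule split_interior[OF tpp pd_pd_ref_supp[OF g] Du(4) cp(1,2)])
    also have "(LINT x|lebesgue. pd j (pd i (u\<^sub>h N)) x * pd j (pd i ?\<psi>) x) = 0" by (rule integral_const_pd[OF tp c])
    also have "(LINT x|lebesgue. indicator H x * ((pd j (pd i (u\<^sub>h P)) x - pd j (pd i (u\<^sub>h N)) x) * pd j (pd i ?\<psi>) x)) = Djump F i j * (\<nu>$i * \<nu>$j) * (\<rho> / \<delta>) * U (pd 2 (pd 2 g))"
      unfolding Djump_const(1)[OF face, unfolded o] by (rule fr.jump_integral(1)[OF g])
    finally show ?thesis by simp
  qed
  have d: "(LINT x|lebesgue. face_derr F i x * pd i ?\<psi> x) = (LINT x|lebesgue. indicator \<Omega> x * weak_grad \<Omega> u x $ i * pd i ?\<psi> x) - wjump F i * \<nu>$i * \<rho> * U (pd 2 g)" for i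
  proof -
    obtain c where c: "\<And>x. pd i (w N) x = c" using wc by blast
    have "(LINT x|lebesgue. face_derr F i x * pd i ?\<psi> x) = (LINT x|lebesgue. indicator \<Omega> x * weak_grad \<Omega> u x $ i * pd i ?\<psi> x)
      - (LINT x|lebesgue. pd i (w N) x * pd i ?\<psi> x) - (LINT x|lebesgue. indicator H x * ((pd i (w P) x - pd i (w N) x) * pd i ?\<psi> x))"
      unfolding ed by (rule split_interior[OF tp pd_ref_supp[OF g] Du(3) cp(3,4)])
    also have "(LINT x|lebesgue. pd i (w N) x * pd i ?\<psi> x) = 0" by (rule integral_const_pd[OF t c])
    also have "(LINT x|lebesgue. indicator H x * ((pd i (w P) x - pd i (w N) x) * pd i ?\<psi> x)) = wjump F i * \<nu>$i * \<rho> * U (pd 2 g)"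
      unfolding wjump_const[OF int_face] by (rule fr.jump_integral(2)[OF g])
    finally show ?thesis by simp
  qed
  have ff: "(LINT x|lebesgue. face_f F x * ?\<psi> x) = (LINT x|lebesgue. indicator \<Omega> x * f x * ?\<psi> x)"
    unfolding face_f_def using split_interior[OF t fr.ref_B_box[OF g] f_sq_int continuous_on_const continuous_on_const, of 0 0] by simp
  have W: "\<epsilon>\<^sup>2 * (\<Sum>i\<in>UNIV. \<Sum>j\<in>UNIV. LINT x|lebesgue. indicator \<Omega> x * weak_hess \<Omega> u x $ i $ j * pd j (pd i ?\<psi>) x)
    + (\<Sum>i\<in>UNIV. LINT x|lebesgue. indicator \<Omega> x * weak_grad \<Omega> u x $ i * pd i ?\<psi> x) = (LINT x|lebesgue. indicator \<Omega> x * f x * ?\<psi> x)"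
    by (rule weak_solution_test[OF open_\<Omega> solution t])
  show ?thesis unfolding h d ff W[symmetric] sum_2 by (simp add: algebra_simps)
qed

end

lemma measure_le_diameter:
  fixes K :: "point set"
  assumes "compact K" "K \<noteq> {}"
  shows "measure lebesgue (interior K) \<le> 4 * (diameter K)\<^sup>2"
proof -
  obtain z where z: "z \<in> K" using assms(2) by blast
  let ?h = "diameter K" and ?c = "(\<chi> i. diameter K) :: point"
  have h: "0 \<le> ?h" using diameter_ge_0[OF compact_imp_bounded[OF assms(1)]] .
  have sub: "interior K \<subseteq> cbox (z - ?c) (z + ?c)"
  proof
    fix x assume "x \<in> interior K"
    then have "dist z x \<le> ?h" using diameter_bounded_bound[OF compact_imp_bounded[OF assms(1)] z] interior_subset by blast
    then have "\<bar>(x - z) $ i\<bar> \<le> ?h" for i using component_le_norm_cart[of "x - z" i] by (simp add: dist_norm norm_minus_commute)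
    then have "\<bar>x $ i - z $ i\<bar> \<le> ?h" for i by simp
    then show "x \<in> cbox (z - ?c) (z + ?c)" by (simp add: mem_box_cart abs_le_iff algebra_simps)
  qed
  have "measure lebesgue (interior K) \<le> measure lebesgue (cbox (z - ?c) (z + ?c))"
    by (rule measure_mono_fmeasurable[OF sub]) (simp_all add: borel_open)
  also have "\<dots> = prod (\<lambda>i. (z + ?c)$i - (z - ?c)$i) UNIV"
  proof -
    have "cbox (z - ?c) (z + ?c) \<noteq> {}" using h by (simp add: interval_ne_empty_cart)
    from content_cbox_cart[OF this] show ?thesis by simp
  qed
  also have "\<dots> = 4 * ?h\<^sup>2" by (simp add: UNIV_2 power2_eq_square)
  finally show ?thesis .
qed

section \<open>Normal jumps and the mean of the right-hand side\<close>

context efficiency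
begin

text \<open>With \<rho> = l / 8 this makes the box at most as high as wide, the condition \<delta>
  \<le> \<rho> of \<open>residual_bound\<close>.\<close>

lemma kk_le: "2 \<le> \<gamma> \<Longrightarrow> kk \<le> 1/8"
proof -
  assume g: "2 \<le> \<gamma>"
  have "2 * 3 \<le> \<gamma> * (1 + \<gamma>)" using g by (intro mult_mono) auto
  then have "8 \<le> 2 * (\<gamma> * (1 + \<gamma>))" by simp
  then have "1 / (2 * (\<gamma> * (1 + \<gamma>))) \<le> 1 / 8" by (intro divide_left_mono) auto
  then show ?thesis by (simp add: kk_def)
qed

lemma interior_face_frame_at:
  assumes F: "F \<in> interior_faces \<Omega> \<T>" "F = closed_segment a b" and s: "side \<gamma> a b (T_plus \<T> F) \<nu>" and \<delta>: "0 < d" "d \<le> dist a b"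
  shows "interior_face_frame \<Omega> \<gamma> \<T> \<epsilon> f u u\<^sub>h F a b \<nu> (dist a b / 8) (kk * d)"
proof -
  have "F \<in> faces \<T>" using F by (auto simp: interior_faces_def)
  from face_frame_at[OF this F(2) s \<delta>] show ?thesis
    using F(1) by (intro interior_face_frame.intro interior_face_frame_axioms.intro)
qed

definition eta2_scaling :: "real \<Rightarrow> bool" where
  "eta2_scaling C \<longleftrightarrow> (\<forall>\<epsilon> l h g Nd NE NF. 0 < \<epsilon> \<and> 0 < l \<and> l \<le> h \<and> h \<le> \<gamma> * l / 2 \<and> 0 \<le> Nd \<and> 0 \<le> NE \<and> 0 \<le> NF \<and>
     \<bar>g\<bar> * (l / 8) * c0 \<le> sqrt (l / 8 * (kk * l)) * bump_size bump * (4 * \<epsilon>\<^sup>2 * NE / (kk * l)\<^sup>2 + 2 * Nd / (kk * l) + NF)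
     \<longrightarrow> h * (min 1 (h / \<epsilon>))\<^sup>2 * (l * g\<^sup>2) \<le> C * (\<epsilon>\<^sup>2 * NE\<^sup>2 + Nd\<^sup>2 + (min l (l\<^sup>2 / \<epsilon>) * NF)\<^sup>2))"

definition eta1_scaling :: "real \<Rightarrow> bool" where
  "eta1_scaling C \<longleftrightarrow> (\<forall>\<epsilon> l h \<mu> Nd NE NF. 0 < \<epsilon> \<and> 0 < l \<and> l \<le> h \<and> h \<le> \<gamma> * l / 2 \<and> 0 \<le> Nd \<and> 0 \<le> NE \<and> 0 \<le> NF \<and>
     \<epsilon>\<^sup>2 * \<bar>\<mu>\<bar> * ((l / 8) / (kk * min l \<epsilon>)) * c0 \<le> sqrt (l / 8 * (kk * min l \<epsilon>)) * bump_size (\<lambda>y. y$2 * bump y) *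
        (4 * \<epsilon>\<^sup>2 * NE / (kk * min l \<epsilon>)\<^sup>2 + 2 * Nd / (kk * min l \<epsilon>) + NF)
     \<longrightarrow> \<epsilon> ^ 3 * min 1 (h / \<epsilon>) * (l * \<mu>\<^sup>2) \<le> C * (\<epsilon>\<^sup>2 * NE\<^sup>2 + Nd\<^sup>2 + (min l (l\<^sup>2 / \<epsilon>) * NF)\<^sup>2))"

definition f_scaling :: "real \<Rightarrow> bool" where
  "f_scaling C \<longleftrightarrow> (\<forall>\<epsilon> r h g Nd NE No. 0 < \<epsilon> \<and> 0 < r \<and> h \<le> \<gamma> * r \<and> 0 < h \<and> 0 \<le> Nd \<and> 0 \<le> NE \<and> 0 \<le> No \<and>
     \<bar>g\<bar> * (r / 2 * (r / 2)) * c2 \<le> sqrt (r / 2 * (r / 2)) * bump_size bump * (4 * \<epsilon>\<^sup>2 * NE / (r / 2)\<^sup>2 + 2 * Nd / (r / 2) + No)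
     \<longrightarrow> (min h (h\<^sup>2 / \<epsilon>) * h * g)\<^sup>2 \<le> C * (\<epsilon>\<^sup>2 * NE\<^sup>2 + Nd\<^sup>2 + (min h (h\<^sup>2 / \<epsilon>) * No)\<^sup>2))"

lemma facesum_n_nonneg: "0 \<le> 2 * facesum nE F" "0 \<le> 2 * facesum nD F" "0 \<le> 2 * facesum nF F"
  using facesum_nonneg[of nE] facesum_nonneg[of nD] facesum_nonneg[of nF] n_nonneg by simp_all

lemma eta2_face:
  assumes C: "eta2_scaling C" and T: "T \<in> \<T>" "F edge_of T" and int: "F \<in> interior_faces \<Omega> \<T>"
    and ab: "F = closed_segment a b" and s: "side \<gamma> a b (T_plus \<T> F) \<nu>"
  shows "diameter T * (kappa \<epsilon> T)\<^sup>2 * (dist a b * (\<Sum>i\<in>UNIV. wjump F i * \<nu>$i)\<^sup>2)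
     \<le> C * (\<epsilon>\<^sup>2 * (2 * facesum nE F) + 2 * facesum nD F + (min (dist a b) ((dist a b)\<^sup>2 / \<epsilon>))\<^sup>2 * (2 * facesum nF F))"
proof -
  note F = face_cases(1)[OF T]
  note g = face_geometry[OF T ab]
  let ?l = "dist a b"
  define q where "q = (\<Sum>i\<in>UNIV. wjump F i * \<nu>$i)"
  interpret A: interior_face_frame \<Omega> \<gamma> \<T> \<epsilon> f u u\<^sub>h F a b \<nu> "?l / 8" "kk * ?l" by (rule interior_face_frame_at[OF int ab s g(2) order_refl])
  note N = face_err_norms[OF F] and N' = face_res_norms[OF int]
  have "kk * ?l \<le> 1 / 8 * ?l" using kk_le[OF g(1)] g(2) by (intro mult_right_mono) auto
  then have k8: "kk * ?l \<le> ?l / 8" by simp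
  have le: "\<bar>- (\<epsilon>\<^sup>2 * (\<Sum>i\<in>UNIV. \<Sum>j\<in>UNIV. Djump F i j * (\<nu>$i * \<nu>$j)) * ((?l / 8) / (kk * ?l)) * U (pd 2 (pd 2 bump)) + q * (?l / 8) * U (pd 2 bump))\<bar>
     \<le> sqrt (?l / 8 * (kk * ?l)) * bump_size bump * (4 * \<epsilon>\<^sup>2 * sqrt (2 * facesum nE F) / (kk * ?l)\<^sup>2 + 2 * sqrt (2 * facesum nD F) / (kk * ?l) + sqrt (2 * facesum nF F))"
    unfolding q_def A.residual_identity[OF ref_bump, symmetric]
    by (rule A.fr.residual_bound[OF ref_bump N(1) N'(1) N'(2) k8 N(3) N'(3) N'(4)])
  \<comment> \<open>\<open>U_pd2_pd2_bump\<close> annihilates the Hessian jump, so only the gradient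
    jump is left, with the factor \<open>c0\<close>.\<close>
  have eq: "\<bar>- (\<epsilon>\<^sup>2 * (\<Sum>i\<in>UNIV. \<Sum>j\<in>UNIV. Djump F i j * (\<nu>$i * \<nu>$j)) * ((?l / 8) / (kk * ?l)) * U (pd 2 (pd 2 bump)) + q * (?l / 8) * U (pd 2 bump))\<bar> = \<bar>q\<bar> * (?l / 8) * c0"
    unfolding U_pd2_pd2_bump U_bump using c_pos(1) g(2) by (simp add: abs_mult)
  have b: "\<bar>q\<bar> * (?l / 8) * c0 \<le> sqrt (?l / 8 * (kk * ?l)) * bump_size bump * (4 * \<epsilon>\<^sup>2 * sqrt (2 * facesum nE F) / (kk * ?l)\<^sup>2 + 2 * sqrt (2 * facesum nD F) / (kk * ?l) + sqrt (2 * facesum nF F))" using le unfolding eq .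
  have "diameter T * (min 1 (diameter T / \<epsilon>))\<^sup>2 * (?l * q\<^sup>2)
     \<le> C * (\<epsilon>\<^sup>2 * (sqrt (2 * facesum nE F))\<^sup>2 + (sqrt (2 * facesum nD F))\<^sup>2 + (min ?l (?l\<^sup>2 / \<epsilon>) * sqrt (2 * facesum nF F))\<^sup>2)"
    using C[unfolded eta2_scaling_def, rule_format, of \<epsilon> ?l "diameter T" "sqrt (2 * facesum nD F)" "sqrt (2 * facesum nE F)" "sqrt (2 * facesum nF F)" q]
      b g \<epsilon>_pos facesum_n_nonneg[of F] by simp
  then show ?thesis using facesum_n_nonneg[of F] by (simp add: q_def kappa_def power_mult_distrib)
qed

lemma eta1_face:
  assumes C: "eta1_scaling C" and T: "T \<in> \<T>" "F edge_of T" and int: "F \<in> interior_faces \<Omega> \<T>"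
    and ab: "F = closed_segment a b" and s: "side \<gamma> a b (T_plus \<T> F) \<nu>"
  shows "\<epsilon> ^ 3 * kappa \<epsilon> T * (dist a b * (\<Sum>i\<in>UNIV. \<Sum>j\<in>UNIV. Djump F i j * (\<nu>$i * \<nu>$j))\<^sup>2)
     \<le> C * (\<epsilon>\<^sup>2 * (2 * facesum nE F) + 2 * facesum nD F + (min (dist a b) ((dist a b)\<^sup>2 / \<epsilon>))\<^sup>2 * (2 * facesum nF F))"
proof -
  note F = face_cases(1)[OF T]
  note g = face_geometry[OF T ab]
  let ?l = "dist a b" and ?g = "\<lambda>y::point. y$2 * bump y"
  let ?s = "min ?l \<epsilon>"
  define q where "q = (\<Sum>i\<in>UNIV. \<Sum>j\<in>UNIV. Djump F i j * (\<nu>$i * \<nu>$j))"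
  have s0: "0 < ?s" "?s \<le> ?l" using g \<epsilon>_pos by auto
  interpret A: interior_face_frame \<Omega> \<gamma> \<T> \<epsilon> f u u\<^sub>h F a b \<nu> "?l / 8" "kk * ?s" by (rule interior_face_frame_at[OF int ab s s0])
  note N = face_err_norms[OF F] and N' = face_res_norms[OF int]
  have "kk * ?s \<le> 1 / 8 * ?l" using kk_le[OF g(1)] g(2,5) s0 by (intro mult_mono) auto
  then have k8: "kk * ?s \<le> ?l / 8" by simp
  have le: "\<bar>- (\<epsilon>\<^sup>2 * q * ((?l / 8) / (kk * ?s)) * U (pd 2 (pd 2 ?g)) + (\<Sum>i\<in>UNIV. wjump F i * \<nu>$i) * (?l / 8) * U (pd 2 ?g))\<bar>
     \<le> sqrt (?l / 8 * (kk * ?s)) * bump_size ?g * (4 * \<epsilon>\<^sup>2 * sqrt (2 * facesum nE F) / (kk * ?s)\<^sup>2 + 2 * sqrt (2 * facesum nD F) / (kk * ?s) + sqrt (2 * facesum nF F))"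
    unfolding q_def A.residual_identity[OF ref_y2_bump, symmetric]
    by (rule A.fr.residual_bound[OF ref_y2_bump N(1) N'(1) N'(2) k8 N(3) N'(3) N'(4)])
  \<comment> \<open>The roles are exchanged: \<open>U_y2_bump\<close> annihilates the gradient jump
    and leaves the Hessian jump.\<close>
  have eq: "\<bar>- (\<epsilon>\<^sup>2 * q * ((?l / 8) / (kk * ?s)) * U (pd 2 (pd 2 ?g)) + (\<Sum>i\<in>UNIV. wjump F i * \<nu>$i) * (?l / 8) * U (pd 2 ?g))\<bar> = \<epsilon>\<^sup>2 * \<bar>q\<bar> * ((?l / 8) / (kk * ?s)) * c0"
  proof -
    have "0 < (?l / 8) / (kk * ?s)" using g s0 by simp
    then show ?thesis unfolding U_y2_bump using c_pos(1) by (simp only: mult_zero_right add_0_right mult_minus_right minus_minus abs_mult abs_of_pos abs_power2)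
  qed
  have b: "\<epsilon>\<^sup>2 * \<bar>q\<bar> * ((?l / 8) / (kk * ?s)) * c0 \<le> sqrt (?l / 8 * (kk * ?s)) * bump_size ?g * (4 * \<epsilon>\<^sup>2 * sqrt (2 * facesum nE F) / (kk * ?s)\<^sup>2 + 2 * sqrt (2 * facesum nD F) / (kk * ?s) + sqrt (2 * facesum nF F))" using le unfolding eq .
  have "\<epsilon> ^ 3 * min 1 (diameter T / \<epsilon>) * (?l * q\<^sup>2)
     \<le> C * (\<epsilon>\<^sup>2 * (sqrt (2 * facesum nE F))\<^sup>2 + (sqrt (2 * facesum nD F))\<^sup>2 + (min ?l (?l\<^sup>2 / \<epsilon>) * sqrt (2 * facesum nF F))\<^sup>2)"
    by (rule C[unfolded eta1_scaling_def, rule_format], intro conjI \<epsilon>_pos g(2,3,4) real_sqrt_ge_zero facesum_n_nonneg b)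
  then show ?thesis using facesum_n_nonneg[of F] by (simp add: q_def kappa_def power_mult_distrib)
qed

lemma diameter_pos:
  assumes "K \<in> \<T>" shows "0 < diameter K"
proof -
  obtain z r where r: "0 < r" "cball z r \<subseteq> K" using shape[OF assms] by blast
  have "diameter (cball z r) \<le> diameter K" using diameter_subset[OF r(2) compact_imp_bounded[OF triangle_compact[OF assms]]] .
  then show ?thesis using r(1) by simp
qed

text \<open>A test function inside one triangle meets no jump. The weak equation then equates the
  mean of f times the integral of the bump with local errors and the oscillation.\<close>

lemma fmean_bound:
  assumes C: "f_scaling C" and K: "K \<in> \<T>"
  shows "(wt K * diameter K * fmean K)\<^sup>2 \<le> C * (\<epsilon>\<^sup>2 * nE K + nD K + (wt K)\<^sup>2 * nO K)"
proof -
  obtain z r where r: "0 < r" "cball z r \<subseteq> K" "diameter K \<le> \<gamma> * r" using shape[OF K] by blast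
  \<comment> \<open>In a square of half-width r / 2 the distance to the centre is at most r / sqrt
    2, which is below the radius of the inscribed disc.\<close>
  interpret A: frame z "axis 1 1" "axis 2 1" "r/2" "r/2"
    by unfold_locales (use r in \<open>simp_all add: inner_axis_axis\<close>)
  have box: "A.box \<subseteq> interior K"
  proof
    fix x assume "x \<in> A.box"
    then have "\<bar>(x - z)$1\<bar> \<le> r/2" "\<bar>(x - z)$2\<bar> \<le> r/2" by (simp_all add: A.box_def inner_axis)
    then have "((x - z)$1)\<^sup>2 \<le> (r/2)\<^sup>2" "((x - z)$2)\<^sup>2 \<le> (r/2)\<^sup>2" by (metis abs_le_square_iff abs_of_nonneg order_trans abs_ge_zero)+
    then have "(norm (x - z))\<^sup>2 \<le> (r/2)\<^sup>2 + (r/2)\<^sup>2" unfolding norm_vec2 by simp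
    also have "\<dots> < r\<^sup>2" using r(1) by (simp add: power_divide)
    finally have "norm (x - z) < r" using r(1) by (simp add: power2_less_imp_less)
    then have "x \<in> ball z r" by (simp add: dist_norm norm_minus_commute)
    moreover have "ball z r \<subseteq> interior K" using r(2) by (intro interior_maximal order_trans[OF ball_subset_cball]) auto
    ultimately show "x \<in> interior K" by blast
  qed
  let ?\<psi> = "\<lambda>x. bump (A.B x)"
  have t: "?\<psi> \<in> test_functions \<Omega>" using A.ref_B_test_function[OF ref_bump] box triangle_interior_subset[OF K] by blast
  note tp = test_functions_pd[OF t] and tpp = test_functions_pd[OF test_functions_pd[OF t]]
  have cl: "closed A.box" using A.compact_box compact_imp_closed by blast
  have supp: "?\<psi> x \<noteq> 0 \<Longrightarrow> x \<in> A.box" for x by (rule A.ref_B_box[OF ref_bump])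
  have supp1: "pd i ?\<psi> x \<noteq> 0 \<Longrightarrow> x \<in> A.box" for i x by (rule pd_outside_support[OF supp cl])
  have supp2: "pd j (pd i ?\<psi>) x \<noteq> 0 \<Longrightarrow> x \<in> A.box" for i j x by (rule pd_outside_support[OF supp1 cl])
  have s: "?\<psi> x \<noteq> 0 \<Longrightarrow> x \<in> interior K" "pd i ?\<psi> x \<noteq> 0 \<Longrightarrow> x \<in> interior K" "pd j (pd i ?\<psi>) x \<noteq> 0 \<Longrightarrow> x \<in> interior K" for i j x
    using supp supp1 supp2 box by blast+
  have h: "(LINT x|lebesgue. herr K (u\<^sub>h K) i j x * pd j (pd i ?\<psi>) x) = (LINT x|lebesgue. indicator \<Omega> x * weak_hess \<Omega> u x $ i $ j * pd j (pd i ?\<psi>) x)" for i j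
  proof -
    obtain c where c: "\<And>x. pd j (pd i (u\<^sub>h K)) x = c" using poly_deg_le_2_pd[OF uh_poly[OF K]] by blast
    have "(LINT x|lebesgue. herr K (u\<^sub>h K) i j x * pd j (pd i ?\<psi>) x) = (LINT x|lebesgue. indicator \<Omega> x * weak_hess \<Omega> u x $ i $ j * pd j (pd i ?\<psi>) x)
        - (LINT x|lebesgue. pd j (pd i (u\<^sub>h K)) x * pd j (pd i ?\<psi>) x)"
      unfolding herr_def by (rule split_one[OF K tpp s(3) Du(4) smooth_continuous[OF smooth_pd[OF smooth_pd[OF uh_smooth[OF K]]]]])
    also have "(LINT x|lebesgue. pd j (pd i (u\<^sub>h K)) x * pd j (pd i ?\<psi>) x) = 0" by (rule integral_const_pd[OF tp c])
    finally show ?thesis by simp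
  qed
  have d: "(LINT x|lebesgue. gerr K (w K) i x * pd i ?\<psi> x) = (LINT x|lebesgue. indicator \<Omega> x * weak_grad \<Omega> u x $ i * pd i ?\<psi> x)" for i
  proof -
    obtain c where c: "\<And>x. pd i (w K) x = c" using poly_deg_le_1_pd[OF w_poly[OF K]] by blast
    have "(LINT x|lebesgue. gerr K (w K) i x * pd i ?\<psi> x) = (LINT x|lebesgue. indicator \<Omega> x * weak_grad \<Omega> u x $ i * pd i ?\<psi> x)
        - (LINT x|lebesgue. pd i (w K) x * pd i ?\<psi> x)"
      unfolding gerr_def by (rule split_one[OF K tp s(2) Du(3) smooth_continuous[OF smooth_pd[OF w_smooth[OF K]]]])
    also have "(LINT x|lebesgue. pd i (w K) x * pd i ?\<psi> x) = 0" by (rule integral_const_pd[OF t c])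
    finally show ?thesis by simp
  qed
  let ?F = "\<lambda>x. indicator (interior K) x * (f x - fmean K)"
  have "(LINT x|lebesgue. ?F x * ?\<psi> x) = (LINT x|lebesgue. indicator \<Omega> x * f x * ?\<psi> x) - (LINT x|lebesgue. fmean K * ?\<psi> x)"
    by (rule split_one[OF K t s(1) f_sq_int continuous_on_const])
  also have "(LINT x|lebesgue. fmean K * ?\<psi> x) = fmean K * (r / 2 * (r / 2) * c2)"
    using A.integral_B(2)[OF ref_integrable[OF ref_bump]] by (simp add: c2_def)
  finally have ff: "(LINT x|lebesgue. ?F x * ?\<psi> x) = (LINT x|lebesgue. indicator \<Omega> x * f x * ?\<psi> x) - fmean K * (r / 2 * (r / 2) * c2)" .
  note W = weak_solution_test[OF open_\<Omega> solution t]
  have sE: "sq_int (herr K (u\<^sub>h K) i j)" for i j by (intro herr_sq_int K uh_smooth)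
  have sD: "sq_int (gerr K (w K) i)" for i by (intro gerr_sq_int K w_smooth)
  have sF: "sq_int ?F" by (rule field_sq_int[OF K f_sq_int continuous_on_const])
  have "\<bar>\<epsilon>\<^sup>2 * (\<Sum>i\<in>UNIV. \<Sum>j\<in>UNIV. LINT x|lebesgue. herr K (u\<^sub>h K) i j x * pd j (pd i ?\<psi>) x)
     + (\<Sum>i\<in>UNIV. LINT x|lebesgue. gerr K (w K) i x * pd i ?\<psi> x) - (LINT x|lebesgue. ?F x * ?\<psi> x)\<bar>
     \<le> sqrt (r / 2 * (r / 2)) * bump_size bump * (4 * \<epsilon>\<^sup>2 * sqrt (nE K) / (r / 2)\<^sup>2 + 2 * sqrt (nD K) / (r / 2) + sqrt (nO K))"
    by (rule A.residual_bound[OF ref_bump sE sD sF order_refl real_sqrt_le_mono[OF n_members(1)] real_sqrt_le_mono[OF n_members(3)]])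
       (simp only: nO_def order_refl)
  then have b: "\<bar>fmean K\<bar> * (r / 2 * (r / 2)) * c2 \<le> sqrt (r / 2 * (r / 2)) * bump_size bump * (4 * \<epsilon>\<^sup>2 * sqrt (nE K) / (r / 2)\<^sup>2 + 2 * sqrt (nD K) / (r / 2) + sqrt (nO K))"
    unfolding h d ff W using c_pos(3) r(1) by (simp add: abs_mult)
  have "(min (diameter K) ((diameter K)\<^sup>2 / \<epsilon>) * diameter K * fmean K)\<^sup>2
     \<le> C * (\<epsilon>\<^sup>2 * (sqrt (nE K))\<^sup>2 + (sqrt (nD K))\<^sup>2 + (min (diameter K) ((diameter K)\<^sup>2 / \<epsilon>) * sqrt (nO K))\<^sup>2)"
    by (rule C[unfolded f_scaling_def, rule_format, of _ r], intro conjI \<epsilon>_pos r(1,3) diameter_pos[OF K] real_sqrt_ge_zero n_nonneg b)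
  then show ?thesis using n_nonneg by (simp add: wt_def power_mult_distrib)
qed

text \<open>f is split into its mean and the oscillation; the area bound 4 h^2 turns the bound for
  the mean into one for its L2 norm, which accounts for the factor 8 = 2 * 4.\<close>

lemma nF_bound:
  assumes C: "f_scaling C" "0 \<le> C" and K: "K \<in> \<T>"
  shows "(wt K)\<^sup>2 * nF K \<le> (2 + 8 * C) * R K"
proof -
  let ?I = "indicator (interior K) :: point \<Rightarrow> real"
  have ne: "K \<noteq> {}" using diameter_pos[OF K] by auto
  have bd: "bounded (interior K)" using bounded_subset[OF compact_imp_bounded[OF triangle_compact[OF K]] interior_subset] .
  have s1: "sq_int (\<lambda>x. ?I x * (f x - fmean K))" by (rule field_sq_int[OF K f_sq_int continuous_on_const])
  have s2: "sq_int (\<lambda>x. ?I x * fmean K)" by (rule sq_int_bounded_continuous[OF interior_sets bd continuous_on_const])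
  have "(LINT x|lebesgue. (?I x * fmean K)\<^sup>2) = (LINT x|lebesgue. ?I x * (fmean K)\<^sup>2)"
    by (intro Bochner_Integration.integral_cong refl) (simp add: indicator_def)
  also have "\<dots> = measure lebesgue (interior K) * (fmean K)\<^sup>2" by simp
  also have "\<dots> \<le> 4 * (diameter K)\<^sup>2 * (fmean K)\<^sup>2" by (intro mult_right_mono measure_le_diameter triangle_compact K ne) simp
  finally have m: "(LINT x|lebesgue. (?I x * fmean K)\<^sup>2) \<le> 4 * (diameter K)\<^sup>2 * (fmean K)\<^sup>2" .
  have "nF K = (LINT x|lebesgue. (?I x * (f x - fmean K) + ?I x * fmean K)\<^sup>2)" unfolding nF_def by (simp add: right_diff_distrib)
  also have "\<dots> \<le> 2 * nO K + 2 * (4 * (diameter K)\<^sup>2 * (fmean K)\<^sup>2)"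
    using integral_square_add_le[OF s1 s2] m unfolding nO_def by linarith
  finally have "(wt K)\<^sup>2 * nF K \<le> (wt K)\<^sup>2 * (2 * nO K + 2 * (4 * (diameter K)\<^sup>2 * (fmean K)\<^sup>2))" by (intro mult_left_mono) auto
  also have "\<dots> = 2 * ((wt K)\<^sup>2 * nO K) + 8 * (wt K * diameter K * fmean K)\<^sup>2" by (simp add: power_mult_distrib algebra_simps)
  also have "\<dots> \<le> 2 * R K + 8 * (C * R K)"
  proof -
    have "(wt K)\<^sup>2 * nO K \<le> R K" "\<epsilon>\<^sup>2 * nE K + nD K + (wt K)\<^sup>2 * nO K \<le> R K" using n_nonneg[of K] by (simp_all add: R_def)
    then show ?thesis using order_trans[OF fmean_bound[OF C(1) K] mult_left_mono[OF _ C(2)]] by (intro add_mono mult_left_mono) auto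
  qed
  finally show ?thesis by (simp add: algebra_simps)
qed

text \<open>An edge is not longer than the diameter of an adjacent triangle, so the weight with l is
  below \<open>wt\<close> on both sides of the face and \<open>nF_bound\<close> applies to
  each.\<close>

lemma face_residual_R:
  assumes C: "f_scaling C" "0 \<le> C" and T: "T \<in> \<T>" "F edge_of T" and int: "F \<in> interior_faces \<Omega> \<T>" and ab: "F = closed_segment a b"
  shows "\<epsilon>\<^sup>2 * (2 * facesum nE F) + 2 * facesum nD F + (min (dist a b) ((dist a b)\<^sup>2 / \<epsilon>))\<^sup>2 * (2 * facesum nF F) \<le> (6 + 16 * C) * facesum R F"
proof -
  note F = face_cases(1)[OF T]
  let ?l = "dist a b" and ?q = "\<lambda>K. (min (dist a b) ((dist a b)\<^sup>2 / \<epsilon>))\<^sup>2 * nF K"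
  have w: "?q K \<le> (2 + 8 * C) * R K" if K: "K \<in> \<T>" "F edge_of K" for K
  proof -
    note g = face_geometry[OF K ab]
    have "?l\<^sup>2 / \<epsilon> \<le> (diameter K)\<^sup>2 / \<epsilon>" using g \<epsilon>_pos by (intro divide_right_mono power_mono) auto
    then have "(min ?l (?l\<^sup>2 / \<epsilon>))\<^sup>2 \<le> (wt K)\<^sup>2" unfolding wt_def using g \<epsilon>_pos by (intro power_mono) auto
    then have "?q K \<le> (wt K)\<^sup>2 * nF K" using n_nonneg by (intro mult_right_mono) auto
    also have "\<dots> \<le> (2 + 8 * C) * R K" by (rule nF_bound[OF C K(1)])
    finally show ?thesis .
  qed
  have "facesum ?q F \<le> (2 + 8 * C) * facesum R F"
    using w[OF T_plus[OF F]] w[OF T_minus(1,2)[OF int]] int by (simp add: facesum_def distrib_left)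
  then have "2 * facesum ?q F \<le> (4 + 16 * C) * facesum R F" by (simp add: algebra_simps)
  moreover have "\<epsilon>\<^sup>2 * facesum nE F + facesum nD F \<le> facesum R F"
    unfolding facesum_R using facesum_nonneg[of nG F] facesum_nonneg[of "\<lambda>K. (wt K)\<^sup>2 * nO K" F] n_nonneg by simp
  moreover have "facesum ?q F = (min ?l (?l\<^sup>2 / \<epsilon>))\<^sup>2 * facesum nF F" by (rule facesum_cmult)
  ultimately show ?thesis by (simp add: algebra_simps)
qed

end

section \<open>The estimator\<close>

lemma segment_minus_midpoint:
  fixes a b :: point
  assumes "x \<in> closed_segment a b" "a \<noteq> b"
  obtains s where "\<bar>s\<bar> \<le> dist a b / 2" "x - midpoint a b = s *\<^sub>R ((b - a) /\<^sub>R dist a b)"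
proof -
  obtain t where t: "0 \<le> t" "t \<le> 1" "x = (1 - t) *\<^sub>R a + t *\<^sub>R b" using assms(1) by (auto simp: in_segment)
  have l: "0 < dist a b" using assms(2) by simp
  have "\<bar>t - 1/2\<bar> \<le> 1/2" using t(1,2) by linarith
  then have 1: "\<bar>(t - 1/2) * dist a b\<bar> \<le> dist a b / 2" using mult_right_mono[of "\<bar>t - 1/2\<bar>" "1/2" "dist a b"] by (simp add: abs_mult)
  have "((t - 1/2) * dist a b) *\<^sub>R ((b - a) /\<^sub>R dist a b) = (t - 1/2) *\<^sub>R (b - a)" using l by simp
  also have "\<dots> = x - midpoint a b" by (simp add: t(3) midpoint_def vec_eq_iff field_simps)
  finally have 2: "x - midpoint a b = ((t - 1/2) * dist a b) *\<^sub>R ((b - a) /\<^sub>R dist a b)" by (rule sym)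
  show ?thesis by (rule that[OF 1 2])
qed

text \<open>Every edge is the hull of a subset of the three vertices. Counting all eight subsets is
  crude but independent of the triangle.\<close>

lemma triangle_edges:
  fixes T :: "point set"
  assumes "2 simplex T"
  shows "finite (faces_of T)" "card (faces_of T) \<le> 8" "faces_of T \<noteq> {}"
proof -
  obtain S where S: "\<not> affine_dependent S" "int (card S) = 2 + 1" "T = convex hull S"
    using assms unfolding simplex_def by blast
  have c: "card S = 3" using S(2) by simp
  then have fS: "finite S" by (metis card.infinite zero_neq_numeral)
  have sub: "faces_of T \<subseteq> (\<lambda>c. convex hull c) ` Pow S"
    using face_of_convex_hull_affine_independent[OF S(1)] by (auto simp: faces_of_def edge_of_def S(3))
  have fin: "finite ((\<lambda>c. convex hull c) ` Pow S)" using fS by simp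
  show "finite (faces_of T)" by (rule finite_subset[OF sub fin])
  have "card (faces_of T) \<le> card ((\<lambda>c. convex hull c) ` Pow S)" by (rule card_mono[OF fin sub])
  also have "\<dots> \<le> card (Pow S)" by (rule card_image_le) (simp add: fS)
  also have "\<dots> = 8" by (simp add: card_Pow fS c)
  finally show "card (faces_of T) \<le> 8" .
  obtain a b where ab: "a \<in> S" "b \<in> S" "a \<noteq> b"
    using c card_le_Suc0_iff_eq[OF fS] by auto
  have "convex hull {a, b} face_of T" unfolding S(3) face_of_convex_hull_affine_independent[OF S(1)] using ab by (intro exI[of _ "{a, b}"]) simp
  moreover have "aff_dim (convex hull {a, b}) = 1" using ab by (simp add: aff_dim_convex_hull aff_dim_2)
  ultimately show "faces_of T \<noteq> {}" by (auto simp: faces_of_def edge_of_def)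
qed

lemma integral_norm_sq_interior:
  fixes W :: "point \<Rightarrow> 'b::euclidean_space"
  assumes K: "compact K" "convex K" and s: "\<And>i. i \<in> I \<Longrightarrow> sq_int (e i)"
    and eq: "AE x in lebesgue. (\<Sum>i\<in>I. (e i x)\<^sup>2) = indicator (interior K) x * (norm (W x))\<^sup>2"
  shows "(LINT x|lebesgue_on K. (norm (W x))\<^sup>2) = (\<Sum>i\<in>I. LINT x|lebesgue. (e i x)\<^sup>2)"
proof -
  have i: "integrable lebesgue (\<lambda>x. (e i x)\<^sup>2)" if "i \<in> I" for i using s[OF that] by (simp add: sq_int_def)
  have m: "(\<lambda>x. \<Sum>i\<in>I. (e i x)\<^sup>2) \<in> borel_measurable lebesgue" by (intro borel_measurable_sum borel_measurable_integrable i)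
  have "(LINT x|lebesgue_on K. (norm (W x))\<^sup>2) = (LINT x|lebesgue. indicator (interior K) x * (norm (W x))\<^sup>2)"
    by (rule integral_convex_interior(1)[OF K borel_measurable_lebesgue_AE[OF m eq]])
  also have "\<dots> = (LINT x|lebesgue. (\<Sum>i\<in>I. (e i x)\<^sup>2))" by (rule integral_lebesgue_AE(1)[OF m eq, symmetric])
  also have "\<dots> = (\<Sum>i\<in>I. LINT x|lebesgue. (e i x)\<^sup>2)" by (rule Bochner_Integration.integral_sum[OF i])
  finally show ?thesis .
qed

lemma orthonormal_norm_sq:
  fixes v :: point
  assumes "norm \<tau> = 1" "norm \<nu> = 1" "\<tau> \<bullet> \<nu> = 0"
  shows "(norm v)\<^sup>2 = (v \<bullet> \<tau>)\<^sup>2 + (v \<bullet> \<nu>)\<^sup>2"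
proof -
  interpret frame 0 \<tau> \<nu> 1 1 using assms by unfold_locales auto
  have "(norm v)\<^sup>2 = v \<bullet> ((v \<bullet> \<tau>) *\<^sub>R \<tau> + (v \<bullet> \<nu>) *\<^sub>R \<nu>)" using expand[of v] by (simp add: power2_norm_eq_inner)
  then show ?thesis by (simp add: inner_add_right power2_eq_square)
qed

lemma unit_combination_sq_le:
  assumes "norm (v :: point) = 1"
  shows "(v$1 * p + v$2 * q)\<^sup>2 \<le> p\<^sup>2 + q\<^sup>2"
proof -
  have "(v$1)\<^sup>2 + (v$2)\<^sup>2 = 1" using norm_vec2[of v] assms by simp
  then have "p\<^sup>2 + q\<^sup>2 - (v$1 * p + v$2 * q)\<^sup>2 = (v$1 * q - v$2 * p)\<^sup>2"
    by algebra
  moreover have "0 \<le> (v$1 * q - v$2 * p)\<^sup>2" by simp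
  ultimately show ?thesis by linarith
qed

context mesh
begin

text \<open>The vector of \<open>side\<close> points into \<open>T_plus\<close>, the face normal out
  of it. Orthogonality to the edge leaves two unit vectors, and the point of \<open>T_plus\<close>
  above the midpoint excludes the inner one.\<close>

lemma face_normal:
  assumes F: "F \<in> faces \<T>" "F = closed_segment a b" and s: "side \<gamma> a b (T_plus \<T> F) \<nu>"
  shows "face_normal \<T> F = - \<nu>"
  unfolding face_normal_def
proof (rule the_equality)
  let ?P = "T_plus \<T> F" and ?m = "midpoint a b"
  have n: "norm \<nu> = 1" "(b - a) \<bullet> \<nu> = 0" "a \<noteq> b" "2 \<le> \<gamma>" and pos: "\<And>x. x \<in> ?P \<Longrightarrow> 0 \<le> (x - ?m) \<bullet> \<nu>" using s by (auto simp: side_def)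
  have on: "(x - ?m) \<bullet> \<nu> = 0" if x: "x \<in> F" for x
  proof -
    obtain s where "x - ?m = s *\<^sub>R ((b - a) /\<^sub>R dist a b)" using segment_minus_midpoint[OF x[unfolded F(2)] n(3)] by blast
    then show ?thesis using n(2) by simp
  qed
  have d: "- \<nu> \<bullet> (y - x) = (x - ?m) \<bullet> \<nu> - (y - ?m) \<bullet> \<nu>" for x y by (simp add: inner_diff_left inner_diff_right inner_commute)
  show "norm (- \<nu>) = 1 \<and> (\<forall>x\<in>F. \<forall>y\<in>F. - \<nu> \<bullet> (y - x) = 0) \<and> (\<forall>x\<in>F. \<forall>y\<in>?P. - \<nu> \<bullet> (y - x) \<le> 0)"
    unfolding d using n(1) on pos by simp
  fix \<mu> assume \<mu>: "norm \<mu> = 1 \<and> (\<forall>x\<in>F. \<forall>y\<in>F. \<mu> \<bullet> (y - x) = 0) \<and> (\<forall>x\<in>F. \<forall>y\<in>?P. \<mu> \<bullet> (y - x) \<le> 0)"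
  then have "\<mu> \<bullet> (b - a) = 0" using F(2) by auto
  then have "((b - a) /\<^sub>R dist a b) \<bullet> \<mu> = 0" by (simp add: inner_commute)
  then have "\<mu> = \<nu> \<or> \<mu> = - \<nu>" using unit_orthogonal_cases[OF side_tau(1)[OF s] n(1) side_tau(2)[OF s], of \<mu>] \<mu> by blast
  moreover have "\<mu> \<noteq> \<nu>"
  proof
    assume e: "\<mu> = \<nu>"
    define h where "h = dist a b / (\<gamma> * (1 + \<gamma>))"
    have h: "0 < h" using n by (simp add: h_def)
    have \<nu>\<nu>: "\<nu> \<bullet> \<nu> = 1" using n(1) by (simp add: dot_square_norm)
    have \<nu>b: "\<nu> \<bullet> (b - a) = 0" using n(2) by (simp add: inner_commute)
    have "\<bar>(?m + h *\<^sub>R \<nu> - ?m) \<bullet> ((b - a) /\<^sub>R dist a b)\<bar> \<le> dist a b / 4" "0 \<le> (?m + h *\<^sub>R \<nu> - ?m) \<bullet> \<nu>"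
      "(?m + h *\<^sub>R \<nu> - ?m) \<bullet> \<nu> \<le> dist a b / (\<gamma> * (1 + \<gamma>))"
      using h by (simp_all add: \<nu>b \<nu>\<nu> flip: h_def)
    then have "?m + h *\<^sub>R \<nu> \<in> ?P" using s unfolding side_def by blast
    moreover have mF: "?m \<in> F" using F(2) by simp
    ultimately have "\<mu> \<bullet> (?m + h *\<^sub>R \<nu> - ?m) \<le> 0" using \<mu> by blast
    then show False using h by (simp add: e \<nu>\<nu>)
  qed
  ultimately show "\<mu> = - \<nu>" by blast
qed

end

section \<open>Assembly of the local estimator\<close>

context efficiency
begin

lemma facesum_le:
  assumes "T \<in> \<T>" "F \<in> faces_of T"
  shows "facesum R F \<le> 2 * (\<Sum>K\<in>submesh \<T> (patch \<Omega> \<T> T). R K)"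
proof -
  let ?S = "submesh \<T> (patch \<Omega> \<T> T)"
  have fin: "finite ?S" using finite_\<T> by (simp add: submesh_def)
  have m: "R K \<le> (\<Sum>K\<in>?S. R K)" if "K \<in> ?S" for K by (rule member_le_sum[OF that R_nonneg fin])
  have "0 \<le> (\<Sum>K\<in>?S. R K)" by (intro sum_nonneg R_nonneg)
  then show ?thesis using m[OF patch_subset(1)[OF assms]] m[OF patch_subset(2)[OF assms]] unfolding facesum_def by (cases "F \<in> interior_faces \<Omega> \<T>") auto
qed

lemma kappa_pos: "T \<in> \<T> \<Longrightarrow> 0 < kappa \<epsilon> T"
  using diameter_pos \<epsilon>_pos by (simp add: kappa_def)

lemma jump_pw_grad: "jump \<Omega> \<T> (pw_grad u\<^sub>h) F x $ i = pd i (u\<^sub>h (T_plus \<T> F)) x - pd i (outer F) x"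
proof -
  have "pd i (\<lambda>x. 0) x = 0" using pd_affine[of i 0 0 x] by simp
  then show ?thesis by (simp add: jump_def pw_grad_def grad_def outer_def)
qed

lemma mu_NC_face:
  assumes C: "NC_scaling C" "0 \<le> C" and T: "T \<in> \<T>" "F edge_of T"
  shows "\<epsilon> / kappa \<epsilon> T * (face_L2_norm F (jump \<Omega> \<T> (pw_grad u\<^sub>h) F))\<^sup>2 \<le> C * facesum R F"
proof -
  obtain a b where ab: "F = closed_segment a b" using edge_segment[OF T] by blast
  note F = face_cases(1)[OF T] and g = face_geometry[OF T ab]
  let ?l = "dist a b" and ?\<tau> = "(b - a) /\<^sub>R dist a b"
  define q where "q i = Djump F i 1 * ?\<tau>$1 + Djump F i 2 * ?\<tau>$2" for i
  have ne: "a \<noteq> b" using g(2) by simp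
  \<comment> \<open>At signed distance s from the midpoint the i-th component of the jump is s times
    the slope \<open>q i\<close>, and |s| is at most l / 2.\<close>
  have "(norm (jump \<Omega> \<T> (pw_grad u\<^sub>h) F x))\<^sup>2 \<le> (?l / 2)\<^sup>2 * ((q 1)\<^sup>2 + (q 2)\<^sup>2)" if x: "x \<in> closed_segment a b" for x
  proof -
    obtain s where s: "\<bar>s\<bar> \<le> ?l / 2" "x - midpoint a b = s *\<^sub>R ?\<tau>" using segment_minus_midpoint[OF x ne] by blast
    have j: "jump \<Omega> \<T> (pw_grad u\<^sub>h) F x $ i = s * q i" for i
      unfolding jump_pw_grad grad_jump[OF F ab] s(2) by (simp only: q_def vector_scaleR_component real_scaleR_def distrib_left mult.left_commute mult.assoc)
    have "s\<^sup>2 \<le> (?l / 2)\<^sup>2" using s(1) abs_le_square_iff[of s "?l/2"] by simp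
    then show ?thesis unfolding norm_vec2 j using mult_right_mono[of "s\<^sup>2" "(?l/2)\<^sup>2" "(q 1)\<^sup>2 + (q 2)\<^sup>2"]
      by (simp add: power_mult_distrib distrib_left)
  qed
  then have "(face_L2_norm F (jump \<Omega> \<T> (pw_grad u\<^sub>h) F))\<^sup>2 \<le> ?l * ((?l / 2)\<^sup>2 * ((q 1)\<^sup>2 + (q 2)\<^sup>2))"
    using face_L2_norm_le[of a b "jump \<Omega> \<T> (pw_grad u\<^sub>h) F"] ab by blast
  also have "\<dots> = (?l ^ 3 * (q 1)\<^sup>2 + ?l ^ 3 * (q 2)\<^sup>2) / 4" by (simp add: power2_eq_square power3_eq_cube field_simps)
  finally have "\<epsilon> / kappa \<epsilon> T * (face_L2_norm F (jump \<Omega> \<T> (pw_grad u\<^sub>h) F))\<^sup>2 \<le> \<epsilon> / kappa \<epsilon> T * ((?l ^ 3 * (q 1)\<^sup>2 + ?l ^ 3 * (q 2)\<^sup>2) / 4)"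
    using kappa_pos[OF T(1)] \<epsilon>_pos by (intro mult_left_mono) auto
  also have "\<dots> = (\<epsilon> / kappa \<epsilon> T * (?l ^ 3 * (q 1)\<^sup>2) + \<epsilon> / kappa \<epsilon> T * (?l ^ 3 * (q 2)\<^sup>2)) / 4" by (simp only: distrib_left times_divide_eq_right)
  also have "\<dots> \<le> (2 * C * facesum R F + 2 * C * facesum R F) / 4"
    unfolding q_def by (intro divide_right_mono add_mono NC_face[OF C T ab]) simp
  finally show ?thesis by simp
qed

text \<open>The jump of the Hessian applied to the normal is split along \<tau> and \<nu>. By
  symmetry of the Hessian jump its tangential part is a combination of the slopes
  \<open>q i\<close>, covered by \<open>NC_face\<close>; its normal part is the quantity bounded
  through the residual.\<close>

lemma eta1_jump_face:
  assumes C1: "NC_scaling C1" "0 \<le> C1" and C3: "eta1_scaling C3" "0 \<le> C3" and C4: "f_scaling C4" "0 \<le> C4"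
    and T: "T \<in> \<T>" "F edge_of T" and int: "F \<in> interior_faces \<Omega> \<T>"
  shows "\<epsilon> ^ 3 * kappa \<epsilon> T * (face_L2_norm F (jump \<Omega> \<T> (\<lambda>K x. pw_hess u\<^sub>h K x *v face_normal \<T> F) F))\<^sup>2
    \<le> (C3 * (6 + 16 * C4) + \<gamma>\<^sup>2 * C1) * facesum R F"
proof -
  obtain a b where ab: "F = closed_segment a b" using edge_segment[OF T] by blast
  note F = face_cases(1)[OF T] and g = face_geometry[OF T ab]
  obtain \<nu> where s: "side \<gamma> a b (T_plus \<T> F) \<nu>" using ex_side[OF T_plus[OF F] ab] by blast
  let ?l = "dist a b" and ?\<tau> = "(b - a) /\<^sub>R dist a b" and ?k = "kappa \<epsilon> T"
  define q where "q i = Djump F i 1 * ?\<tau>$1 + Djump F i 2 * ?\<tau>$2" for i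
  define \<mu> where "\<mu> = (\<Sum>i\<in>UNIV. \<Sum>j\<in>UNIV. Djump F i j * (\<nu>$i * \<nu>$j))"
  define v :: point where "v = (\<chi> i. Djump F i 1 * \<nu>$1 + Djump F i 2 * \<nu>$2)"
  have o: "outer F = u\<^sub>h (T_minus \<T> F)" using int by (simp add: outer_def)
  have j: "jump \<Omega> \<T> (\<lambda>K x. pw_hess u\<^sub>h K x *v face_normal \<T> F) F x = - v" for x
  proof -
    have "pd k (pd i (u\<^sub>h (T_plus \<T> F))) x = Djump F i k + pd k (pd i (u\<^sub>h (T_minus \<T> F))) x" for i k
      using Djump_const(1)[OF F, of k i x] by (simp add: o)
    then have "jump \<Omega> \<T> (\<lambda>K x. pw_hess u\<^sub>h K x *v face_normal \<T> F) F x $ i = - v $ i" for i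
      using int by (simp add: jump_def pw_hess_def hess_def face_normal[OF F ab s] matrix_vector_mult_def sum_2 v_def algebra_simps)
    then show ?thesis by (simp add: vec_eq_iff)
  qed
  have v\<nu>: "v \<bullet> \<nu> = \<mu>" by (simp add: inner_vec_def sum_2 v_def \<mu>_def algebra_simps)
  have v\<tau>: "v \<bullet> ?\<tau> = \<nu>$1 * q 1 + \<nu>$2 * q 2"
    using Djump_const(2)[OF F] by (simp add: inner_vec_def sum_2 v_def q_def algebra_simps)
  have "(norm v)\<^sup>2 = (\<nu>$1 * q 1 + \<nu>$2 * q 2)\<^sup>2 + \<mu>\<^sup>2"
    using orthonormal_norm_sq[OF side_tau(1)[OF s] side_tau(3)[OF s] side_tau(2)[OF s], of v] unfolding v\<nu> v\<tau> .
  also have "\<dots> \<le> (q 1)\<^sup>2 + (q 2)\<^sup>2 + \<mu>\<^sup>2" using unit_combination_sq_le[OF side_tau(3)[OF s], of "q 1" "q 2"] by simp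
  finally have "(face_L2_norm F (jump \<Omega> \<T> (\<lambda>K x. pw_hess u\<^sub>h K x *v face_normal \<T> F) F))\<^sup>2 \<le> ?l * ((q 1)\<^sup>2 + (q 2)\<^sup>2 + \<mu>\<^sup>2)"
    using face_L2_norm_le[of a b "jump \<Omega> \<T> (\<lambda>K x. pw_hess u\<^sub>h K x *v face_normal \<T> F) F" "(q 1)\<^sup>2 + (q 2)\<^sup>2 + \<mu>\<^sup>2"] unfolding j ab[symmetric] by simp
  then have "\<epsilon> ^ 3 * ?k * (face_L2_norm F (jump \<Omega> \<T> (\<lambda>K x. pw_hess u\<^sub>h K x *v face_normal \<T> F) F))\<^sup>2 \<le> \<epsilon> ^ 3 * ?k * (?l * ((q 1)\<^sup>2 + (q 2)\<^sup>2 + \<mu>\<^sup>2))"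
    using kappa_pos[OF T(1)] \<epsilon>_pos by (intro mult_left_mono) auto
  also have "\<dots> = \<epsilon> ^ 3 * ?k * (?l * (q 1)\<^sup>2) + \<epsilon> ^ 3 * ?k * (?l * (q 2)\<^sup>2) + \<epsilon> ^ 3 * ?k * (?l * \<mu>\<^sup>2)" by (simp add: algebra_simps)
  also have "\<dots> \<le> \<gamma>\<^sup>2 / 4 * (2 * C1 * facesum R F) + \<gamma>\<^sup>2 / 4 * (2 * C1 * facesum R F) + C3 * ((6 + 16 * C4) * facesum R F)"
  proof -
    have q: "\<epsilon> ^ 3 * ?k * (?l * (q i)\<^sup>2) \<le> \<gamma>\<^sup>2 / 4 * (2 * C1 * facesum R F)" for i
    proof -
      \<comment> \<open>The weights are related by \<epsilon>^3 \<kappa> = (\<epsilon> \<kappa>)^2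
        \<epsilon> / \<kappa>, and \<epsilon> \<kappa> \<le> h \<le> \<gamma> l / 2 trades the first
        factor for \<gamma>^2 l^2 / 4.\<close>
      have "?k \<le> diameter T / \<epsilon>" by (simp add: kappa_def)
      then have "\<epsilon> * ?k \<le> diameter T" using \<epsilon>_pos by (simp add: field_simps)
      then have "\<epsilon> * ?k \<le> \<gamma> * ?l / 2" using g(4) by simp
      then have "(\<epsilon> * ?k)\<^sup>2 \<le> (\<gamma> * ?l / 2)\<^sup>2" using \<epsilon>_pos kappa_pos[OF T(1)] by (intro power_mono) auto
      then have "(\<epsilon> * ?k)\<^sup>2 * (\<epsilon> / ?k * (?l * (q i)\<^sup>2)) \<le> (\<gamma> * ?l / 2)\<^sup>2 * (\<epsilon> / ?k * (?l * (q i)\<^sup>2))"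
        using \<epsilon>_pos kappa_pos[OF T(1)] by (intro mult_right_mono) auto
      moreover have "(\<epsilon> * ?k)\<^sup>2 * (\<epsilon> / ?k * (?l * (q i)\<^sup>2)) = \<epsilon> ^ 3 * ?k * (?l * (q i)\<^sup>2)"
        using kappa_pos[OF T(1)] by (simp add: power2_eq_square power3_eq_cube)
      moreover have "(\<gamma> * ?l / 2)\<^sup>2 * (\<epsilon> / ?k * (?l * (q i)\<^sup>2)) = \<gamma>\<^sup>2 / 4 * (\<epsilon> / ?k * (?l ^ 3 * (q i)\<^sup>2))"
        by (simp add: power2_eq_square power3_eq_cube)
      ultimately have "\<epsilon> ^ 3 * ?k * (?l * (q i)\<^sup>2) \<le> \<gamma>\<^sup>2 / 4 * (\<epsilon> / ?k * (?l ^ 3 * (q i)\<^sup>2))" by linarith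
      also have "\<dots> \<le> \<gamma>\<^sup>2 / 4 * (2 * C1 * facesum R F)" unfolding q_def by (intro mult_left_mono NC_face[OF C1 T ab]) simp
      finally show ?thesis .
    qed
    show ?thesis unfolding \<mu>_def
      by (intro add_mono q order_trans[OF eta1_face[OF C3(1) T int ab s] mult_left_mono[OF face_residual_R[OF C4 T int ab] C3(2)]])
  qed
  finally show ?thesis by (simp add: algebra_simps)
qed

lemma eta2_jump_face:
  assumes C2: "eta2_scaling C2" "0 \<le> C2" and C4: "f_scaling C4" "0 \<le> C4"
    and T: "T \<in> \<T>" "F edge_of T" and int: "F \<in> interior_faces \<Omega> \<T>"
  shows "diameter T * (kappa \<epsilon> T)\<^sup>2 * (face_L2_norm F (jump \<Omega> \<T> (\<lambda>K x. pw_grad w K x \<bullet> face_normal \<T> F) F))\<^sup>2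
    \<le> C2 * (6 + 16 * C4) * facesum R F"
proof -
  obtain a b where ab: "F = closed_segment a b" using edge_segment[OF T] by blast
  note F = face_cases(1)[OF T] and g = face_geometry[OF T ab]
  obtain \<nu> where s: "side \<gamma> a b (T_plus \<T> F) \<nu>" using ex_side[OF T_plus[OF F] ab] by blast
  let ?l = "dist a b"
  define q where "q = (\<Sum>i\<in>UNIV. wjump F i * \<nu>$i)"
  have j: "jump \<Omega> \<T> (\<lambda>K x. pw_grad w K x \<bullet> face_normal \<T> F) F x = - q" for x
  proof -
    have "pd i (w (T_plus \<T> F)) x = wjump F i + pd i (w (T_minus \<T> F)) x" for i using wjump_const[OF int, of i x] by simp
    then show ?thesis using int by (simp add: jump_def pw_grad_def grad_def face_normal[OF F ab s] inner_vec_def sum_2 q_def algebra_simps)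
  qed
  have "(face_L2_norm F (jump \<Omega> \<T> (\<lambda>K x. pw_grad w K x \<bullet> face_normal \<T> F) F))\<^sup>2 \<le> ?l * q\<^sup>2"
    using face_L2_norm_le[of a b "jump \<Omega> \<T> (\<lambda>K x. pw_grad w K x \<bullet> face_normal \<T> F) F" "q\<^sup>2"] unfolding j ab[symmetric] by simp
  then have "diameter T * (kappa \<epsilon> T)\<^sup>2 * (face_L2_norm F (jump \<Omega> \<T> (\<lambda>K x. pw_grad w K x \<bullet> face_normal \<T> F) F))\<^sup>2 \<le> diameter T * (kappa \<epsilon> T)\<^sup>2 * (?l * q\<^sup>2)"
    using diameter_pos[OF T(1)] by (intro mult_left_mono) auto
  also have "\<dots> \<le> C2 * ((6 + 16 * C4) * facesum R F)" unfolding q_def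
    by (rule order_trans[OF eta2_face[OF C2(1) T int ab s] mult_left_mono[OF face_residual_R[OF C4 T int ab] C2(2)]])
  finally show ?thesis by (simp add: algebra_simps)
qed

text \<open>The triangle inequality through u: the difference of the two discrete gradients is the
  difference of their errors.\<close>

lemma mu_interp_le:
  assumes T: "T \<in> \<T>"
  shows "(mu_interp \<T> u\<^sub>h T)\<^sup>2 \<le> 2 * R T"
proof -
  let ?e = "\<lambda>i x. gerr T (w T) i x + (- 1) * gerr T (u\<^sub>h T) i x"
  have s: "sq_int (gerr T (w T) i)" "sq_int (\<lambda>x. (- 1) * gerr T (u\<^sub>h T) i x)" for i
    by (intro sq_int_cmult gerr_sq_int T uh_smooth w_smooth)+
  have d: "pd i (\<lambda>x. u\<^sub>h T x - w T x) x = pd i (u\<^sub>h T) x - pd i (w T) x" for i x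
    by (rule pd_diff[OF smooth_differentiable[OF uh_smooth[OF T]] smooth_differentiable[OF w_smooth[OF T]]])
  have "(mu_interp \<T> u\<^sub>h T)\<^sup>2 = (LINT x|lebesgue_on T. (norm (grad (\<lambda>x. u\<^sub>h T x - w T x) x))\<^sup>2)"
    by (simp add: mu_interp_def L2_norm_sq pw_grad_def)
  also have "\<dots> = (\<Sum>i\<in>UNIV. LINT x|lebesgue. (?e i x)\<^sup>2)"
    by (rule integral_norm_sq_interior[OF triangle_compact[OF T] triangle_convex[OF T] sq_int_add[OF s]])
       (rule AE_I2, simp add: sum_2 norm_vec2 grad_def d gerr_def indicator_def)
  also have "\<dots> \<le> (\<Sum>i\<in>UNIV. 2 * (LINT x|lebesgue. (gerr T (w T) i x)\<^sup>2) + 2 * (LINT x|lebesgue. (gerr T (u\<^sub>h T) i x)\<^sup>2))"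
    using integral_square_add_le[OF s] by (intro sum_mono) simp
  also have "\<dots> = 2 * (nD T + nG T)" by (simp add: nD_def nG_def sum.distrib sum_distrib_left distrib_left)
  also have "\<dots> \<le> 2 * R T" using n_nonneg[of T] by (simp add: R_def)
  finally show ?thesis .
qed

lemma eta_f_le:
  assumes C: "f_scaling C" "0 \<le> C" and T: "T \<in> \<T>"
  shows "(eta_f \<epsilon> f T)\<^sup>2 \<le> (2 + 8 * C) * R T"
proof -
  let ?e = "\<lambda>x. wt T * (indicator (interior T) x * (f x - 0))"
  have s: "sq_int ?e" by (intro sq_int_cmult field_sq_int[OF T f_sq_int continuous_on_const])
  have k: "diameter T * kappa \<epsilon> T = wt T"
  proof -
    have "wt T = min (diameter T * 1) (diameter T * (diameter T / \<epsilon>))" by (simp add: wt_def power2_eq_square)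
    then show ?thesis using diameter_pos[OF T] by (simp add: kappa_def min_mult_distrib_left)
  qed
  have "(eta_f \<epsilon> f T)\<^sup>2 = (LINT x|lebesgue_on T. (norm (wt T * f x))\<^sup>2)" by (simp only: eta_f_def L2_norm_sq k)
  also have "\<dots> = (\<Sum>i\<in>{()}. LINT x|lebesgue. (?e x)\<^sup>2)"
    by (rule integral_norm_sq_interior[OF triangle_compact[OF T] triangle_convex[OF T] s])
       (rule AE_I2, simp add: indicator_def)
  also have "\<dots> = (wt T)\<^sup>2 * nF T" by (simp add: power_mult_distrib nF_def)
  also have "\<dots> \<le> (2 + 8 * C) * R T" by (rule nF_bound[OF C T])
  finally show ?thesis .
qed

lemma integral_weak_grad_error:
  assumes K: "K \<in> \<T>" and p: "smooth p"
  shows "(LINT x|lebesgue_on K. (norm (weak_grad (interior K) (\<lambda>x. u x - p x) x))\<^sup>2) = (\<Sum>i\<in>UNIV. LINT x|lebesgue. (gerr K p i x)\<^sup>2)"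
proof (rule integral_norm_sq_interior[OF triangle_compact[OF K] triangle_convex[OF K] gerr_sq_int[OF K p]])
  show "AE x in lebesgue. (\<Sum>i\<in>UNIV. (gerr K p i x)\<^sup>2) = indicator (interior K) x * (norm (weak_grad (interior K) (\<lambda>x. u x - p x) x))\<^sup>2"
    using weak_derivatives_minus_smooth(1)[OF open_\<Omega> open_interior triangle_interior_subset[OF K] u_H2 p]
  proof eventually_elim
    case (elim x)
    then show ?case by (cases "x \<in> interior K") (simp_all add: sum_2 gerr_def norm_vec2 grad_def)
  qed
qed

lemma integral_weak_hess_error:
  assumes K: "K \<in> \<T>" and p: "smooth p"
  shows "(LINT x|lebesgue_on K. (norm (weak_hess (interior K) (\<lambda>x. u x - p x) x))\<^sup>2) = (\<Sum>i\<in>UNIV. \<Sum>j\<in>UNIV. LINT x|lebesgue. (herr K p i j x)\<^sup>2)"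
proof -
  have "(LINT x|lebesgue_on K. (norm (weak_hess (interior K) (\<lambda>x. u x - p x) x))\<^sup>2) = (\<Sum>k\<in>UNIV\<times>UNIV. LINT x|lebesgue. (herr K p (fst k) (snd k) x)\<^sup>2)"
  proof (rule integral_norm_sq_interior[OF triangle_compact[OF K] triangle_convex[OF K] herr_sq_int[OF K p]])
    have c: "(\<Sum>k\<in>UNIV\<times>UNIV. (herr K p (fst k) (snd k) x)\<^sup>2) = (\<Sum>i\<in>UNIV. \<Sum>j\<in>UNIV. (herr K p i j x)\<^sup>2)" for x
      by (simp only: sum.cartesian_product case_prod_unfold)
    show "AE x in lebesgue. (\<Sum>k\<in>UNIV\<times>UNIV. (herr K p (fst k) (snd k) x)\<^sup>2) = indicator (interior K) x * (norm (weak_hess (interior K) (\<lambda>x. u x - p x) x))\<^sup>2"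
      unfolding c using weak_derivatives_minus_smooth(2)[OF open_\<Omega> open_interior triangle_interior_subset[OF K] u_H2 p]
    proof eventually_elim
      case (elim x)
      then show ?case by (cases "x \<in> interior K") (simp_all add: sum_2 herr_def norm_mat2 hess_def)
    qed
  qed
  also have "\<dots> = (\<Sum>i\<in>UNIV. \<Sum>j\<in>UNIV. LINT x|lebesgue. (herr K p i j x)\<^sup>2)" by (simp only: sum.cartesian_product case_prod_unfold)
  finally show ?thesis .
qed

lemma integral_oscillation:
  assumes K: "K \<in> \<T>"
  shows "(LINT x|lebesgue_on K. (norm (min (diameter K) ((diameter K)\<^sup>2 / \<epsilon>) * (f x - L2_proj0 \<T> f K x)))\<^sup>2) = (wt K)\<^sup>2 * nO K"
proof -
  obtain c where c: "L2_proj0 \<T> f K = (\<lambda>x. c)" using L2_proj0_const[OF f_sq K] by blast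
  let ?e = "\<lambda>x. wt K * (indicator (interior K) x * (f x - fmean K))"
  have s: "sq_int ?e" by (intro sq_int_cmult field_sq_int[OF K f_sq_int continuous_on_const])
  have "(LINT x|lebesgue_on K. (norm (wt K * (f x - L2_proj0 \<T> f K x)))\<^sup>2) = (\<Sum>i\<in>{()}. LINT x|lebesgue. (?e x)\<^sup>2)"
    by (rule integral_norm_sq_interior[OF triangle_compact[OF K] triangle_convex[OF K] s])
       (rule AE_I2, simp add: indicator_def fmean_def c)
  also have "\<dots> = (wt K)\<^sup>2 * nO K" by (simp add: power_mult_distrib nO_def)
  finally show ?thesis by (simp add: wt_def)
qed

lemma pw_L2_norm_sq: "(pw_L2_norm S g)\<^sup>2 = (\<Sum>K\<in>S. LINT x|lebesgue_on K. (norm (g K x))\<^sup>2)"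
  unfolding pw_L2_norm_def pw_integral_def by (intro real_sqrt_pow2 sum_nonneg integral_nonneg_AE) simp

text \<open>The pieces of \<open>R\<close> were defined with cut-off components and smooth
  polynomial derivatives; this identifies their sum exactly with the norms of the theorem, which use
  weak derivatives on each triangle.\<close>

lemma error_sum:
  assumes S: "S = submesh \<T> \<omega>"
  shows "(energy_norm \<epsilon> \<T> \<omega> (\<lambda>K x. u x - u\<^sub>h K x))\<^sup>2 + (pw_L2_norm S (pw_weak_grad (\<lambda>K x. u x - w K x)))\<^sup>2 + (osc \<epsilon> \<T> \<omega> f)\<^sup>2 = (\<Sum>K\<in>S. R K)"
proof -
  have ST: "K \<in> \<T>" if "K \<in> S" for K using that S by (simp add: submesh_def)
  have h: "(pw_L2_norm S (pw_weak_hess (\<lambda>K x. u x - u\<^sub>h K x)))\<^sup>2 = (\<Sum>K\<in>S. nE K)"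
    unfolding pw_L2_norm_sq pw_weak_hess_def nE_def by (intro sum.cong refl integral_weak_hess_error ST uh_smooth)
  have g: "(pw_L2_norm S (pw_weak_grad (\<lambda>K x. u x - u\<^sub>h K x)))\<^sup>2 = (\<Sum>K\<in>S. nG K)"
    unfolding pw_L2_norm_sq pw_weak_grad_def nG_def by (intro sum.cong refl integral_weak_grad_error ST uh_smooth)
  have d: "(pw_L2_norm S (pw_weak_grad (\<lambda>K x. u x - w K x)))\<^sup>2 = (\<Sum>K\<in>S. nD K)"
    unfolding pw_L2_norm_sq pw_weak_grad_def nD_def by (intro sum.cong refl integral_weak_grad_error ST w_smooth)
  have o: "(osc \<epsilon> \<T> \<omega> f)\<^sup>2 = (\<Sum>K\<in>S. (wt K)\<^sup>2 * nO K)"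
    unfolding osc_def S[symmetric] pw_L2_norm_sq by (intro sum.cong refl integral_oscillation ST)
  have "(energy_norm \<epsilon> \<T> \<omega> (\<lambda>K x. u x - u\<^sub>h K x))\<^sup>2 = \<epsilon>\<^sup>2 * (\<Sum>K\<in>S. nE K) + (\<Sum>K\<in>S. nG K)"
    unfolding energy_norm_def S[symmetric] h g by (intro real_sqrt_pow2 add_nonneg_nonneg mult_nonneg_nonneg sum_nonneg n_nonneg) simp
  then show ?thesis unfolding d o by (simp add: R_def sum.distrib sum_distrib_left)
qed

theorem estimator_le:
  assumes C1: "NC_scaling C1" "0 \<le> C1" and C2: "eta2_scaling C2" "0 \<le> C2" and C3: "eta1_scaling C3" "0 \<le> C3" and C4: "f_scaling C4" "0 \<le> C4"
    and T: "T \<in> \<T>"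
  shows "eta_sq \<Omega> \<T> \<epsilon> f u\<^sub>h T \<le> (16 * (C1 + (C3 * (6 + 16 * C4) + \<gamma>\<^sup>2 * C1) + C2 * (6 + 16 * C4)) + (4 + 8 * C4)) *
    ((energy_norm \<epsilon> \<T> (patch \<Omega> \<T> T) (\<lambda>K x. u x - u\<^sub>h K x))\<^sup>2
      + (pw_L2_norm (submesh \<T> (patch \<Omega> \<T> T)) (pw_weak_grad (\<lambda>K x. u x - nodal_interp \<T> u\<^sub>h K x)))\<^sup>2
      + (osc \<epsilon> \<T> (patch \<Omega> \<T> T) f)\<^sup>2)"
proof -
  let ?S = "submesh \<T> (patch \<Omega> \<T> T)"
  let ?D3 = "C3 * (6 + 16 * C4) + \<gamma>\<^sup>2 * C1" and ?D2 = "C2 * (6 + 16 * C4)"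
  define Q where "Q = (\<Sum>K\<in>?S. R K)"
  have Q0: "0 \<le> Q" unfolding Q_def by (intro sum_nonneg R_nonneg)
  note edges = triangle_edges[OF simplex[OF T]]
  \<comment> \<open>16 is the bound 8 for the number of edges times the factor 2 of
    \<open>facesum_le\<close>.\<close>
  have faces: "(\<Sum>F\<in>A. q F) \<le> 16 * (D * Q)" if A: "A \<subseteq> faces_of T" and D: "0 \<le> D" and q: "\<And>F. F \<in> A \<Longrightarrow> q F \<le> D * facesum R F" for A D and q :: "point set \<Rightarrow> real"
  proof -
    have "q F \<le> D * (2 * Q)" if "F \<in> A" for F
      using order_trans[OF q[OF that] mult_left_mono[OF facesum_le[OF T] D]] A that unfolding Q_def by blast
    then have "(\<Sum>F\<in>A. q F) \<le> of_nat (card A) * (D * (2 * Q))" by (rule sum_bounded_above)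
    also have "\<dots> \<le> 8 * (D * (2 * Q))"
      using card_mono[OF edges(1) A] edges(2) D Q0 by (intro mult_right_mono) auto
    finally show ?thesis by simp
  qed
  have D: "0 \<le> ?D3" "0 \<le> ?D2" using C1 C2 C3 C4 by auto
  have 1: "mu_NC_sq \<Omega> \<T> \<epsilon> u\<^sub>h T \<le> 16 * (C1 * Q)"
    unfolding mu_NC_sq_def by (rule faces[OF subset_refl C1(2)]) (rule mu_NC_face[OF C1 T], simp add: faces_of_def)
  have 3: "eta1_sq \<Omega> \<T> \<epsilon> u\<^sub>h T \<le> 16 * (?D3 * Q)"
    unfolding eta1_sq_def by (rule faces[OF Int_lower1 D(1)]) (rule eta1_jump_face[OF C1 C3 C4 T], simp_all add: faces_of_def)
  have 2: "eta2_sq \<Omega> \<T> \<epsilon> u\<^sub>h T \<le> 16 * (?D2 * Q)"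
    unfolding eta2_sq_def by (rule faces[OF Int_lower1 D(2)]) (rule eta2_jump_face[OF C2 C4 T], simp_all add: faces_of_def)
  obtain F where F: "F \<in> faces_of T" using edges(3) by blast
  have fin: "finite ?S" using finite_\<T> by (simp add: submesh_def)
  have RT: "R T \<le> Q" unfolding Q_def by (rule member_le_sum[OF patch_subset(3)[OF T F] R_nonneg fin])
  have 4: "(mu_interp \<T> u\<^sub>h T)\<^sup>2 \<le> 2 * Q" using mu_interp_le[OF T] RT by simp
  have 5: "(eta_f \<epsilon> f T)\<^sup>2 \<le> (2 + 8 * C4) * Q" using order_trans[OF eta_f_le[OF C4 T] mult_left_mono[OF RT]] C4 by simp
  have "eta_sq \<Omega> \<T> \<epsilon> f u\<^sub>h T \<le> 16 * (C1 * Q) + 2 * Q + (2 + 8 * C4) * Q + 16 * (?D3 * Q) + 16 * (?D2 * Q)"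
    unfolding eta_sq_def by (intro add_mono 1 2 3 4 5)
  also have "\<dots> = (16 * (C1 + ?D3 + ?D2) + (4 + 8 * C4)) * Q" by (simp add: algebra_simps)
  also have "Q = (energy_norm \<epsilon> \<T> (patch \<Omega> \<T> T) (\<lambda>K x. u x - u\<^sub>h K x))\<^sup>2
      + (pw_L2_norm ?S (pw_weak_grad (\<lambda>K x. u x - w K x)))\<^sup>2 + (osc \<epsilon> \<T> (patch \<Omega> \<T> T) f)\<^sup>2"
    unfolding Q_def by (rule error_sum[OF refl, symmetric])
  finally show ?thesis .
qed

end

section \<open>Choice of the constant\<close>

lemma efficiency_intro:
  assumes "polygonal_lipschitz_domain \<Omega>" "shape_regular_family \<gamma> \<Omega> \<FF>" "\<T> \<in> \<FF>"
    and "0 < \<epsilon>" "square_integrable \<Omega> f" "weak_solution \<Omega> \<epsilon> f u" "morley_solution \<Omega> \<T> \<epsilon> f u\<^sub>h"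
  shows "efficiency \<Omega> \<gamma> \<T> \<epsilon> f u u\<^sub>h"
proof (intro efficiency.intro mesh.intro efficiency_axioms.intro)
  have "regular_triangulation \<Omega> \<T> \<and> (\<forall>T\<in>\<T>. \<exists>x r. r > 0 \<and> cball x r \<subseteq> T \<and> diameter T \<le> \<gamma> * r)"
    using assms(2,3) unfolding shape_regular_family_def by blast
  then show "regular_triangulation \<Omega> \<T>" "\<And>T. T \<in> \<T> \<Longrightarrow> \<exists>x r. r > 0 \<and> cball x r \<subseteq> T \<and> diameter T \<le> \<gamma> * r" by simp_all
  show "u\<^sub>h \<in> morley0 \<Omega> \<T>" using assms(7) unfolding morley_solution_def by (rule conjunct1)
qed (rule assms)+

theorem theorem3p5:
  fixes \<Omega> :: "(real^2) set" and \<gamma> :: real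
  assumes "polygonal_lipschitz_domain \<Omega>"
  shows "\<exists>C>0. \<forall>\<FF>. shape_regular_family \<gamma> \<Omega> \<FF> \<longrightarrow>
    (\<forall>\<T>\<in>\<FF>. \<forall>\<epsilon> f u u\<^sub>h.
      0 < \<epsilon> \<and> \<epsilon> \<le> 1 \<and> square_integrable \<Omega> f \<and>
      weak_solution \<Omega> \<epsilon> f u \<and> morley_solution \<Omega> \<T> \<epsilon> f u\<^sub>h \<longrightarrow>
      (\<forall>T\<in>\<T>. eta_sq \<Omega> \<T> \<epsilon> f u\<^sub>h T
        \<le> C * ((energy_norm \<epsilon> \<T> (patch \<Omega> \<T> T) (\<lambda>K x. u x - u\<^sub>h K x))\<^sup>2
              + (pw_L2_norm (submesh \<T> (patch \<Omega> \<T> T))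
                  (pw_weak_grad (\<lambda>K x. u x - nodal_interp \<T> u\<^sub>h K x)))\<^sup>2
              + (osc \<epsilon> \<T> (patch \<Omega> \<T> T) f)\<^sup>2)))"
proof (cases "2 \<le> \<gamma>")
  case True
  \<comment> \<open>This is \<open>kk\<close> outside its locale. The four scaling constants are
    obtained here, before the mesh, \<epsilon> and the data are introduced.\<close>
  define k where "k = 1 / (2 * (\<gamma> * (1 + \<gamma>)))"
  have k: "0 < k" using True by (simp add: k_def)
  interpret fr: frame 0 "axis 1 1" "axis 2 1" 1 1 by unfold_locales (simp_all add: inner_axis_axis)
  note n = fr.nrm_nonneg
  have S: "0 \<le> bump_size g" for g unfolding bump_size_def using n by (intro add_nonneg_nonneg mult_nonneg_nonneg) simp_all
  obtain C1 where C1: "C1 > 0" and NC: "efficiency \<Omega> \<gamma> \<T> \<epsilon> f u u\<^sub>h \<Longrightarrow> efficiency.NC_scaling \<gamma> C1" for \<T> \<epsilon> f u u\<^sub>h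
    using scaling_NC[OF True c_pos(1,2) k n[of "pd 1 bump"] n[of "pd 2 bump"] n[of "pd 2 (\<lambda>y. y$1 * bump y)"] n[of "\<lambda>y. y$1 * bump y"]]
    by (elim exE conjE) (simp only: efficiency.NC_scaling_def efficiency.kk_def flip: k_def)
  obtain C2 where C2: "C2 > 0" and eta2: "efficiency \<Omega> \<gamma> \<T> \<epsilon> f u u\<^sub>h \<Longrightarrow> efficiency.eta2_scaling \<gamma> C2" for \<T> \<epsilon> f u u\<^sub>h
    using scaling_eta2[OF True c_pos(1) k S[of bump]]
    by (elim exE conjE) (simp only: efficiency.eta2_scaling_def efficiency.kk_def flip: k_def)
  obtain C3 where C3: "C3 > 0" and eta1: "efficiency \<Omega> \<gamma> \<T> \<epsilon> f u u\<^sub>h \<Longrightarrow> efficiency.eta1_scaling \<gamma> C3" for \<T> \<epsilon> f u u\<^sub>h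
    using scaling_eta1[OF True c_pos(1) k S[of "\<lambda>y. y$2 * bump y"]]
    by (elim exE conjE) (simp only: efficiency.eta1_scaling_def efficiency.kk_def flip: k_def)
  obtain C4 where C4: "C4 > 0" and f: "efficiency \<Omega> \<gamma> \<T> \<epsilon> f u u\<^sub>h \<Longrightarrow> efficiency.f_scaling \<gamma> C4" for \<T> \<epsilon> f u u\<^sub>h
    using scaling_f[OF True c_pos(3) S[of bump]]
    by (elim exE conjE) (simp only: efficiency.f_scaling_def)
  let ?C = "16 * (C1 + (C3 * (6 + 16 * C4) + \<gamma>\<^sup>2 * C1) + C2 * (6 + 16 * C4)) + (4 + 8 * C4)"
  have "0 \<le> 16 * (C1 + (C3 * (6 + 16 * C4) + \<gamma>\<^sup>2 * C1) + C2 * (6 + 16 * C4))" using C1 C2 C3 C4 by simp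
  then have C: "0 < ?C" using C4 by linarith
  show ?thesis
  proof (intro exI[of _ ?C] conjI allI impI ballI C)
    fix \<FF> \<T> \<epsilon> f u u\<^sub>h T
    assume family: "shape_regular_family \<gamma> \<Omega> \<FF>" "\<T> \<in> \<FF>" and T: "T \<in> \<T>"
      and "0 < \<epsilon> \<and> \<epsilon> \<le> 1 \<and> square_integrable \<Omega> f \<and> weak_solution \<Omega> \<epsilon> f u \<and> morley_solution \<Omega> \<T> \<epsilon> f u\<^sub>h"
    then have E: "efficiency \<Omega> \<gamma> \<T> \<epsilon> f u u\<^sub>h" by (intro efficiency_intro[OF assms family]) simp_all
    show "eta_sq \<Omega> \<T> \<epsilon> f u\<^sub>h T \<le> ?C * ((energy_norm \<epsilon> \<T> (patch \<Omega> \<T> T) (\<lambda>K x. u x - u\<^sub>h K x))\<^sup>2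
      + (pw_L2_norm (submesh \<T> (patch \<Omega> \<T> T)) (pw_weak_grad (\<lambda>K x. u x - nodal_interp \<T> u\<^sub>h K x)))\<^sup>2
      + (osc \<epsilon> \<T> (patch \<Omega> \<T> T) f)\<^sup>2)"
      by (rule efficiency.estimator_le[OF E NC[OF E] less_imp_le[OF C1] eta2[OF E] less_imp_le[OF C2] eta1[OF E] less_imp_le[OF C3] f[OF E] less_imp_le[OF C4] T])
  qed
next
  case False
  \<comment> \<open>A triangle with an inscribed disc of radius r has diameter at least 2 r. For
    \<gamma> < 2 the mesh therefore has no triangle, and any constant serves.\<close>
  have empty: "T \<notin> \<T>" if "efficiency \<Omega> \<gamma> \<T> \<epsilon> f u u\<^sub>h" for \<T> \<epsilon> f u u\<^sub>h T
  proof
    interpret efficiency \<Omega> \<gamma> \<T> \<epsilon> f u u\<^sub>h by (rule that)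
    assume T: "T \<in> \<T>"
    obtain F where F: "F edge_of T" using triangle_edges(3)[OF simplex[OF T]] by (auto simp: faces_of_def)
    obtain a b where "F = closed_segment a b" using edge_segment[OF T F] by blast
    then show False using face_geometry(1)[OF T F] False by blast
  qed
  show ?thesis
  proof (intro exI[of _ 1] conjI allI impI ballI zero_less_one)
    fix \<FF> \<T> \<epsilon> f u u\<^sub>h T
    assume family: "shape_regular_family \<gamma> \<Omega> \<FF>" "\<T> \<in> \<FF>" and T: "T \<in> \<T>"
      and "0 < \<epsilon> \<and> \<epsilon> \<le> 1 \<and> square_integrable \<Omega> f \<and> weak_solution \<Omega> \<epsilon> f u \<and> morley_solution \<Omega> \<T> \<epsilon> f u\<^sub>h"
    then have "efficiency \<Omega> \<gamma> \<T> \<epsilon> f u u\<^sub>h" by (intro efficiency_intro[OF assms family]) simp_all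
    then show "eta_sq \<Omega> \<T> \<epsilon> f u\<^sub>h T \<le> 1 * ((energy_norm \<epsilon> \<T> (patch \<Omega> \<T> T) (\<lambda>K x. u x - u\<^sub>h K x))\<^sup>2
      + (pw_L2_norm (submesh \<T> (patch \<Omega> \<T> T)) (pw_weak_grad (\<lambda>K x. u x - nodal_interp \<T> u\<^sub>h K x)))\<^sup>2
      + (osc \<epsilon> \<T> (patch \<Omega> \<T> T) f)\<^sup>2)" using empty T by blast
  qed
qed

end
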